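(* Let $\widehat{\mathbb{G}}$ be a discrete quantum group, dual to the compact quantum group $\mathbb{G}$. Then $\widehat{\mathbb{G}}$ has property $(\mathrm{T})$ if and only if the $C^*$-algebra $\mathrm{C}(\mathbb{G}_{\max})$ has property $(\mathrm{T})$ in the sense of Bekka.
   Context: Conventions: $C^*$-algebras (other than multiplier algebras) and Hilbert spaces are separable, tensor products of $C^*$-algebras are spatial, representations are $*$-representations. $\mathbb{G}$ is a compact quantum group; $\mathrm{Pol}(\mathbb{G})$ is the Hopf $*$-algebra spanned by matrix elements of finite-dimensional corepresentations of $\mathbb{G}$, with comultiplication $\Delta$ and counit $\varepsilon$; $\mathrm{Irr}(\mathbb{G})$ is the set of classes of irreducible corepresentations and $u^\alpha=(u^\alpha_{i,j})\in M_{n_\alpha}(\mathbb{C})\otimes\mathrm{Pol}(\mathbb{G})$ is a fixed unitary representative of $\alpha$. $\mathrm{C}(\mathbb{G}_{\max})$ is the universal enveloping $C^*$-algebra of $\mathrm{Pol}(\mathbb{G})$; $\varepsilon$ extends to a character of it (in particular a tracial state). $L^2(\mathbb{G})$ is the GNS space of the Haar state. The dual discrete quantum group $\widehat{\mathbb{G}}$ is given by $\mathrm{c}_0(\widehat{\mathbb{G}})=\bigoplus_\alpha M_{n_\alpha}(\mathbb{C})$, which acts on $L^2(\mathbb{G})=\bigoplus_\alpha H^\alpha$, $H^\alpha=\mathrm{span}\{u^\alpha_{i,j}\}$, by $e^\alpha_{i,j}u^\alpha_{r,l}=\delta_{j,l}u^\alpha_{r,i}$ (matrix units $e^\alpha_{i,j}$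 act as $0$ on $H^\beta$, $\beta\ne\alpha$). Its comultiplication $\widehat\Delta$ is determined by $(\widehat\Delta\otimes\mathrm{id})w=w_{23}w_{13}$, where $w=\bigoplus_\alpha u^\alpha\in\mathrm{M}(\mathrm{c}_0(\widehat{\mathbb{G}})\otimes\mathrm{C}(\mathbb{G}_{\max}))$. A (unitary) corepresentation of $\widehat{\mathbb{G}}$ on $H_V$ is a unitary $V\in\mathrm{M}(\mathrm{c}_0(\widehat{\mathbb{G}})\otimes\mathcal{K}(H_V))$ with $(\widehat\Delta\otimes\mathrm{id})V=V_{23}V_{13}$; these are exactly $V=(\mathrm{id}\otimes\pi_V)w$ for (unique) representations $\pi_V$ of $\mathrm{C}(\mathbb{G}_{\max})$ on $H_V$. Put $V^\alpha=(\mathrm{id}\otimes\pi_V)u^\alpha$. Property $(\mathrm{T})$ of $\widehat{\mathbb{G}}$ (Fima): for finite $E\subset\mathrm{Irr}(\mathbb{G})$ and $\delta>0$, a vector $\xi\in H_V$ is $(E,\delta)$-invariant if $\|V^\alpha(\eta\otimes\xi)-\eta\otimes\xi\|<\delta\|\eta\|\|\xi\|$ for all $\alpha\in E$ and all non-zero $\eta\in H^\alpha$. $V$ has almost invariant vectors if such $\xi$ exists for all $E,\delta$. A vector $\xi$ is invariant if $V^\alpha(\eta\otimes\xi)=\eta\otimes\xi$ for all $\alpha$, $\eta\in H^\alpha$. $\widehat{\mathbb{G}}$ has property $(\mathrm{T})$ if every corepresentation with almost invariant vectors has a non-zero invariant vector. Equivalently (a known fact): every representation $\pi:\mathrm{C}(\mathbb{G}_{\max})\to\mathrm{B}(H)$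 admitting unit vectors $\xi_n$ with $\|\pi(a)\xi_n-\varepsilon(a)\xi_n\|\to0$ for all $a$ admits a unit vector $\xi$ with $\pi(a)\xi=\varepsilon(a)\xi$ for all $a$. Bekka's property $(\mathrm{T})$: a unital $C^*$-algebra $A$ admitting a tracial state has property $(\mathrm{T})$ if there exist a finite $F\subset A$ and a constant $c>0$ such that whenever a Hilbert $A$-bimodule $H$ (a Hilbert space with commuting unital $*$-representations of $A$ and of $A^{\mathrm{op}}$, written $\xi\mapsto a\xi$ and $\xi\mapsto\xi a$) has a unit vector $\xi$ with $\|a\xi-\xi a\|<c$ for all $a\in F$, there exists a non-zero $\xi'\in H$ with $a\xi'=\xi'a$ for all $a\in A$. *)

theory Defs
  imports "HOL-Analysis.Analysis"
begin

section \<open>The Hilbert space of square-summable sequences and its closed subspaces\<close>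

text \<open>Every separable complex Hilbert space is unitarily equivalent to a closed subspace of
  \<open>\<ell>\<^sup>2(\<nat>)\<close>. Quantification over all (separable) Hilbert spaces is therefore expressed as
  quantification over all closed complex subspaces of the type \<open>ell2\<close>. All dimensions
  \<open>0, 1, 2, \<dots>, \<infinity>\<close> occur.\<close>

typedef ell2 = "{f :: nat \<Rightarrow> complex. summable (\<lambda>n. (cmod (f n))\<^sup>2)}"
  morphisms coord Abs_ell2
  by (rule exI[of _ "\<lambda>_. 0"]) simp

setup_lifting type_definition_ell2

lemma ell2_summable_prod:
  fixes f g :: "nat \<Rightarrow> complex"
  assumes "summable (\<lambda>n. (cmod (f n))\<^sup>2)" "summable (\<lambda>n. (cmod (g n))\<^sup>2)"
  shows "summable (\<lambda>n. cnj (f n) * g n)"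
proof (rule summable_comparison_test')
  show "summable (\<lambda>n. (cmod (f n))\<^sup>2 + (cmod (g n))\<^sup>2)"
    using assms by (rule summable_add)
  fix n
  have "0 \<le> (cmod (f n) - cmod (g n))\<^sup>2" by simp
  then have "2 * (cmod (f n) * cmod (g n)) \<le> (cmod (f n))\<^sup>2 + (cmod (g n))\<^sup>2"
    by (simp add: power2_diff)
  moreover have "0 \<le> cmod (f n) * cmod (g n)" by simp
  ultimately have "cmod (f n) * cmod (g n) \<le> (cmod (f n))\<^sup>2 + (cmod (g n))\<^sup>2" by linarith
  then show "norm (cnj (f n) * g n) \<le> (cmod (f n))\<^sup>2 + (cmod (g n))\<^sup>2"
    by (simp add: norm_mult)
qed

lemma ell2_summable_add:
  fixes f g :: "nat \<Rightarrow> complex"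
  assumes "summable (\<lambda>n. (cmod (f n))\<^sup>2)" "summable (\<lambda>n. (cmod (g n))\<^sup>2)"
  shows "summable (\<lambda>n. (cmod (f n + g n))\<^sup>2)"
proof (rule summable_comparison_test')
  show "summable (\<lambda>n. 2 * (cmod (f n))\<^sup>2 + 2 * (cmod (g n))\<^sup>2)"
    using assms by (intro summable_add summable_mult)
  fix n
  have "(cmod (f n + g n))\<^sup>2 \<le> (cmod (f n) + cmod (g n))\<^sup>2"
    by (simp add: norm_triangle_ineq power_mono)
  also have "\<dots> \<le> 2 * (cmod (f n))\<^sup>2 + 2 * (cmod (g n))\<^sup>2"
    using zero_le_power2[of "cmod (f n) - cmod (g n)"]
    by (simp add: power2_diff power2_sum)
  finally show "norm ((cmod (f n + g n))\<^sup>2) \<le> 2 * (cmod (f n))\<^sup>2 + 2 * (cmod (g n))\<^sup>2"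
    by simp
qed

lift_definition scaleC :: "complex \<Rightarrow> ell2 \<Rightarrow> ell2" (infixr "*\<^sub>C" 75)
  is "\<lambda>c f n. c * f n"
  by (simp add: norm_mult power_mult_distrib summable_mult)

text \<open>The inner product is conjugate-linear in the first variable.\<close>

definition cinner :: "ell2 \<Rightarrow> ell2 \<Rightarrow> complex"
  where "cinner x y = (\<Sum>n. cnj (coord x n) * coord y n)"

instantiation ell2 :: real_vector
begin

lift_definition zero_ell2 :: ell2 is "\<lambda>_. 0" by simp
lift_definition plus_ell2 :: "ell2 \<Rightarrow> ell2 \<Rightarrow> ell2" is "\<lambda>f g n. f n + g n"
  by (rule ell2_summable_add)
lift_definition uminus_ell2 :: "ell2 \<Rightarrow> ell2" is "\<lambda>f n. - f n" by simp
lift_definition minus_ell2 :: "ell2 \<Rightarrow> ell2 \<Rightarrow> ell2" is "\<lambda>f g n. f n - g n"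
proof -
  fix f g :: "nat \<Rightarrow> complex"
  assume "summable (\<lambda>n. (cmod (f n))\<^sup>2)" "summable (\<lambda>n. (cmod (g n))\<^sup>2)"
  then show "summable (\<lambda>n. (cmod (f n - g n))\<^sup>2)"
    using ell2_summable_add[of f "\<lambda>n. - g n"] by simp
qed
definition scaleR_ell2 :: "real \<Rightarrow> ell2 \<Rightarrow> ell2"
  where "scaleR_ell2 r x = complex_of_real r *\<^sub>C x"

instance
  by standard ((unfold scaleR_ell2_def)?, transfer, simp add: fun_eq_iff algebra_simps)+

end

lemma coord_simps [simp]:
  "coord 0 n = 0"
  "coord (x + y) n = coord x n + coord y n"
  "coord (x - y) n = coord x n - coord y n"
  "coord (- x) n = - coord x n"
  "coord (c *\<^sub>C x) n = c * coord x n"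
  "coord (r *\<^sub>R x) n = complex_of_real r * coord x n"
  unfolding scaleR_ell2_def by (transfer; simp)+

lemma ell2_eqI: "(\<And>n. coord x n = coord y n) \<Longrightarrow> x = y"
  by (metis coord_inject ext)

lemma summable_coord: "summable (\<lambda>n. (cmod (coord x n))\<^sup>2)"
  using coord[of x] by simp

lemma summable_cinner: "summable (\<lambda>n. cnj (coord x n) * coord y n)"
  by (intro ell2_summable_prod summable_coord)

lemma cinner_add_left: "cinner (x + y) z = cinner x z + cinner y z"
  unfolding cinner_def
  by (subst suminf_add[OF summable_cinner summable_cinner]) (simp add: algebra_simps)

lemma cinner_scaleC_left: "cinner (c *\<^sub>C x) z = cnj c * cinner x z"
  unfolding cinner_def
  by (subst suminf_mult[OF summable_cinner, symmetric]) (simp add: algebra_simps)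

lemma cinner_commute: "cinner x y = cnj (cinner y x)"
proof -
  have "(\<lambda>n. cnj (cnj (coord y n) * coord x n)) sums cnj (cinner y x)"
    unfolding cinner_def by (intro sums_cnj[THEN iffD2] summable_sums summable_cinner)
  then show ?thesis
    unfolding cinner_def by (simp add: sums_iff mult.commute)
qed

lemma cinner_self: "cinner x x = complex_of_real (\<Sum>n. (cmod (coord x n))\<^sup>2)"
proof -
  have "(\<lambda>n. complex_of_real ((cmod (coord x n))\<^sup>2)) sums
      complex_of_real (\<Sum>n. (cmod (coord x n))\<^sup>2)"
    by (intro sums_of_real summable_sums summable_coord)
  moreover have "complex_of_real ((cmod (coord x n))\<^sup>2) = cnj (coord x n) * coord x n" for n
    by (simp add: complex_norm_square[symmetric] mult.commute[of "cnj _"])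
  ultimately show ?thesis
    unfolding cinner_def by (simp add: sums_iff)
qed

instantiation ell2 :: real_inner
begin

definition inner_ell2 :: "ell2 \<Rightarrow> ell2 \<Rightarrow> real"
  where "inner_ell2 x y = Re (cinner x y)"
definition norm_ell2 :: "ell2 \<Rightarrow> real"
  where "norm_ell2 x = sqrt (inner x x)"
definition dist_ell2 :: "ell2 \<Rightarrow> ell2 \<Rightarrow> real"
  where "dist_ell2 x y = norm (x - y)"
definition sgn_ell2 :: "ell2 \<Rightarrow> ell2"
  where "sgn_ell2 x = x /\<^sub>R norm x"
definition uniformity_ell2 :: "(ell2 \<times> ell2) filter"
  where "uniformity_ell2 = (INF e\<in>{0 <..}. principal {(x, y). dist x y < e})"
definition open_ell2 :: "ell2 set \<Rightarrow> bool"
  where "open_ell2 U = (\<forall>x\<in>U. eventually (\<lambda>(x', y). x' = x \<longrightarrow> y \<in> U) uniformity)"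

instance
proof
  fix x y z :: ell2 and r :: real and U :: "ell2 set"
  show "dist x y = norm (x - y)" by (rule dist_ell2_def)
  show "sgn x = x /\<^sub>R norm x" by (rule sgn_ell2_def)
  show "(uniformity :: (ell2 \<times> ell2) filter) = (INF e\<in>{0<..}. principal {(x, y). dist x y < e})"
    by (rule uniformity_ell2_def)
  show "open U = (\<forall>x\<in>U. eventually (\<lambda>(x', y). x' = x \<longrightarrow> y \<in> U) uniformity)"
    by (rule open_ell2_def)
  show "norm x = sqrt (inner x x)" by (rule norm_ell2_def)
  show "inner x y = inner y x"
    unfolding inner_ell2_def by (subst cinner_commute) simp
  show "inner (x + y) z = inner x z + inner y z"
    unfolding inner_ell2_def by (simp add: cinner_add_left)
  show "inner (r *\<^sub>R x) y = r * inner x y"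
    unfolding inner_ell2_def scaleR_ell2_def by (simp add: cinner_scaleC_left)
  show "0 \<le> inner x x"
    unfolding inner_ell2_def by (simp add: cinner_self suminf_nonneg summable_coord)
  show "inner x x = 0 \<longleftrightarrow> x = 0"
  proof -
    have "inner x x = 0 \<longleftrightarrow> (\<forall>n. (cmod (coord x n))\<^sup>2 = 0)"
      unfolding inner_ell2_def by (simp add: cinner_self suminf_eq_zero_iff summable_coord)
    also have "\<dots> \<longleftrightarrow> x = 0" by (auto intro: ell2_eqI)
    finally show ?thesis .
  qed
qed

end

lemma norm_ell2_square: "(norm x)\<^sup>2 = (\<Sum>n. (cmod (coord x n))\<^sup>2)"
  by (simp add: power2_norm_eq_inner inner_ell2_def cinner_self)

lemma ell2_partial_sum_le: "(\<Sum>n<N. (cmod (coord x n))\<^sup>2) \<le> (norm x)\<^sup>2"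
  unfolding norm_ell2_square by (intro sum_le_suminf summable_coord) auto

lemma cmod_coord_le: "cmod (coord x n) \<le> norm x"
proof -
  have "(cmod (coord x n))\<^sup>2 \<le> (\<Sum>k<Suc n. (cmod (coord x k))\<^sup>2)"
    by (rule member_le_sum) auto
  also have "\<dots> \<le> (norm x)\<^sup>2" by (rule ell2_partial_sum_le)
  finally show ?thesis by (simp add: power2_le_iff_abs_le)
qed

instance ell2 :: banach
proof
  fix X :: "nat \<Rightarrow> ell2"
  assume X: "Cauchy X"
  have "Cauchy (\<lambda>m. coord (X m) k)" for k
  proof (rule CauchyI)
    fix e :: real assume "e > 0"
    then obtain M where "\<forall>m\<ge>M. \<forall>n\<ge>M. norm (X m - X n) < e"
      using CauchyD[OF X] by blast
    moreover have "cmod (coord (X m) k - coord (X n) k) \<le> norm (X m - X n)" for m n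
      using cmod_coord_le[of "X m - X n" k] by simp
    ultimately show "\<exists>M. \<forall>m\<ge>M. \<forall>n\<ge>M. norm (coord (X m) k - coord (X n) k) < e"
      by (meson le_less_trans)
  qed
  then have "\<exists>l. (\<lambda>m. coord (X m) k) \<longlonglongrightarrow> l" for k
    using Cauchy_convergent_iff convergent_def by blast
  then obtain f where f: "\<And>k. (\<lambda>m. coord (X m) k) \<longlonglongrightarrow> f k" by metis
  have tail: "\<exists>M. \<forall>m\<ge>M. \<forall>N. (\<Sum>k<N. (cmod (coord (X m) k - f k))\<^sup>2) \<le> e\<^sup>2" if "e > 0" for e :: real
  proof -
    obtain M where M: "\<forall>m\<ge>M. \<forall>n\<ge>M. norm (X m - X n) < e"
      using CauchyD[OF X] \<open>e > 0\<close> by blast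
    have "(\<Sum>k<N. (cmod (coord (X m) k - f k))\<^sup>2) \<le> e\<^sup>2" if "m \<ge> M" for m N
    proof (rule LIMSEQ_le_const2)
      show "(\<lambda>n. \<Sum>k<N. (cmod (coord (X m) k - coord (X n) k))\<^sup>2)
          \<longlonglongrightarrow> (\<Sum>k<N. (cmod (coord (X m) k - f k))\<^sup>2)"
        by (intro tendsto_intros f)
      have "(\<Sum>k<N. (cmod (coord (X m) k - coord (X n) k))\<^sup>2) \<le> e\<^sup>2" if "n \<ge> M" for n
      proof -
        have "(\<Sum>k<N. (cmod (coord (X m) k - coord (X n) k))\<^sup>2) \<le> (norm (X m - X n))\<^sup>2"
          using ell2_partial_sum_le[of "X m - X n" N] by simp
        also have "\<dots> \<le> e\<^sup>2"
          using M \<open>m \<ge> M\<close> that by (intro power_mono) (auto intro: less_imp_le)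
        finally show ?thesis .
      qed
      then show "\<exists>K. \<forall>n\<ge>K. (\<Sum>k<N. (cmod (coord (X m) k - coord (X n) k))\<^sup>2) \<le> e\<^sup>2" by blast
    qed
    then show ?thesis by blast
  qed
  have diff: "summable (\<lambda>k. (cmod (coord (X m) k - f k))\<^sup>2)"
    if "\<forall>N. (\<Sum>k<N. (cmod (coord (X m) k - f k))\<^sup>2) \<le> e\<^sup>2" for m e
    using that by (intro summableI_nonneg_bounded[of _ "e\<^sup>2"]) auto
  obtain m0 where "\<forall>N. (\<Sum>k<N. (cmod (coord (X m0) k - f k))\<^sup>2) \<le> 1\<^sup>2"
    using tail[of 1] by auto
  then have "summable (\<lambda>k. (cmod (coord (X m0) k - f k))\<^sup>2)"
    by (rule diff)
  then have "summable (\<lambda>k. (cmod (f k - coord (X m0) k))\<^sup>2)"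
    by (simp add: norm_minus_commute)
  then have "summable (\<lambda>k. (cmod (f k))\<^sup>2)"
    by (drule_tac ell2_summable_add[OF _ summable_coord[of "X m0"]]) simp
  then have coord_l: "coord (Abs_ell2 f) = f"
    by (simp add: Abs_ell2_inverse)
  have "X \<longlonglongrightarrow> Abs_ell2 f"
  proof (rule LIMSEQ_I)
    fix e :: real assume "e > 0"
    then obtain M where M: "\<And>m N. m \<ge> M \<Longrightarrow> (\<Sum>k<N. (cmod (coord (X m) k - f k))\<^sup>2) \<le> (e / 2)\<^sup>2"
      using tail[of "e / 2"] by auto
    have "norm (X m - Abs_ell2 f) < e" if "m \<ge> M" for m
    proof -
      have "(norm (X m - Abs_ell2 f))\<^sup>2 = (\<Sum>k. (cmod (coord (X m) k - f k))\<^sup>2)"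
        by (simp add: norm_ell2_square coord_l)
      also have "\<dots> \<le> (e / 2)\<^sup>2"
        using M[OF that] diff[of m "e / 2"] by (intro suminf_le_const) blast+
      finally have "norm (X m - Abs_ell2 f) \<le> e / 2"
        using \<open>e > 0\<close> by (simp add: power2_le_iff_abs_le)
      then show ?thesis using \<open>e > 0\<close> by simp
    qed
    then show "\<exists>M. \<forall>m\<ge>M. norm (X m - Abs_ell2 f) < e" by blast
  qed
  then show "convergent X" by (auto simp: convergent_def)
qed

global_interpretation ell2: vector_space scaleC
  by unfold_locales (auto intro!: ell2_eqI simp: algebra_simps)

definition hilbert_subspace :: "ell2 set \<Rightarrow> bool"
  where "hilbert_subspace K \<longleftrightarrow> module.subspace (*\<^sub>C) K \<and> closed K"

text \<open>Elements of \<open>B(K)\<close> are functions on \<open>ell2\<close> of which only the restriction to \<open>K\<close> is relevant.\<close>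

definition bounded_op :: "ell2 set \<Rightarrow> (ell2 \<Rightarrow> ell2) \<Rightarrow> bool"
  where "bounded_op K T \<longleftrightarrow>
    (\<forall>x\<in>K. T x \<in> K) \<and>
    (\<forall>x\<in>K. \<forall>y\<in>K. T (x + y) = T x + T y) \<and>
    (\<forall>c. \<forall>x\<in>K. T (c *\<^sub>C x) = c *\<^sub>C T x) \<and>
    (\<exists>B. \<forall>x\<in>K. norm (T x) \<le> B * norm x)"


section \<open>Unital *-algebras, C*-algebras\<close>

record 'a star_alg =
  scl :: "complex \<Rightarrow> 'a \<Rightarrow> 'a"
  star :: "'a \<Rightarrow> 'a"

abbreviation (input) functional :: "('a::ring_1, 'm) star_alg_scheme \<Rightarrow> ('a \<Rightarrow> complex) \<Rightarrow> bool"
  where "functional A f \<equiv> Vector_Spaces.linear (scl A) (*) f"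

locale star_algebra = vector_space "scl A"
  for A :: "('a::ring_1, 'm) star_alg_scheme" +
  assumes scl_mult_left: "scl A c (a * b) = scl A c a * b"
    and scl_mult_right: "scl A c (a * b) = a * scl A c b"
    and star_star: "star A (star A a) = a"
    and star_add: "star A (a + b) = star A a + star A b"
    and star_scl: "star A (scl A c a) = scl A (cnj c) (star A a)"
    and star_mult: "star A (a * b) = star A b * star A a"

text \<open>The type class provides completeness, submultiplicativity and \<open>\<parallel>1\<parallel> = 1\<close>.\<close>

locale cstar_algebra = star_algebra A
  for A :: "('c::{real_normed_algebra_1, banach}, 'm) star_alg_scheme" +
  assumes scl_of_real: "scl A (complex_of_real r) a = r *\<^sub>R a"
    and norm_scl: "norm (scl A c a) = cmod c * norm a"
    and cstar_identity: "norm (star A a * a) = (norm a)\<^sup>2"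

definition tracial_state :: "('a::ring_1, 'm) star_alg_scheme \<Rightarrow> ('a \<Rightarrow> complex) \<Rightarrow> bool"
  where "tracial_state A \<tau> \<longleftrightarrow>
    functional A \<tau> \<and> \<tau> 1 = 1 \<and>
    (\<forall>a. \<tau> (star A a * a) \<in> \<real>\<^sub>\<ge>\<^sub>0) \<and>
    (\<forall>a b. \<tau> (a * b) = \<tau> (b * a))"

text \<open>A map into \<open>B(K)\<close> that is linear, unital and compatible with the involutions;
  it is a representation of the algebra or of the opposite algebra according to how it
  treats products.\<close>

definition star_linear_map ::
    "('a::ring_1, 'm) star_alg_scheme \<Rightarrow> ell2 set \<Rightarrow> ('a \<Rightarrow> ell2 \<Rightarrow> ell2) \<Rightarrow> bool"
  where "star_linear_map A K \<pi> \<longleftrightarrow>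
    (\<forall>a. bounded_op K (\<pi> a)) \<and>
    (\<forall>a b. \<forall>x\<in>K. \<pi> (a + b) x = \<pi> a x + \<pi> b x) \<and>
    (\<forall>c a. \<forall>x\<in>K. \<pi> (scl A c a) x = c *\<^sub>C \<pi> a x) \<and>
    (\<forall>x\<in>K. \<pi> 1 x = x) \<and>
    (\<forall>a. \<forall>x\<in>K. \<forall>y\<in>K. cinner (\<pi> a x) y = cinner x (\<pi> (star A a) y))"

definition star_rep ::
    "('a::ring_1, 'm) star_alg_scheme \<Rightarrow> ell2 set \<Rightarrow> ('a \<Rightarrow> ell2 \<Rightarrow> ell2) \<Rightarrow> bool"
  where "star_rep A K \<pi> \<longleftrightarrow>
    star_linear_map A K \<pi> \<and> (\<forall>a b. \<forall>x\<in>K. \<pi> (a * b) x = \<pi> a (\<pi> b x))"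

definition op_star_rep ::
    "('a::ring_1, 'm) star_alg_scheme \<Rightarrow> ell2 set \<Rightarrow> ('a \<Rightarrow> ell2 \<Rightarrow> ell2) \<Rightarrow> bool"
  where "op_star_rep A K \<rho> \<longleftrightarrow>
    star_linear_map A K \<rho> \<and> (\<forall>a b. \<forall>x\<in>K. \<rho> (a * b) x = \<rho> b (\<rho> a x))"

text \<open>\<open>L a \<xi>\<close> is \<open>a\<xi>\<close> and \<open>R a \<xi>\<close> is \<open>\<xi>a\<close>.\<close>

definition hilbert_bimodule ::
    "('a::ring_1, 'm) star_alg_scheme \<Rightarrow> ell2 set \<Rightarrow>
      ('a \<Rightarrow> ell2 \<Rightarrow> ell2) \<Rightarrow> ('a \<Rightarrow> ell2 \<Rightarrow> ell2) \<Rightarrow> bool"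
  where "hilbert_bimodule A K L R \<longleftrightarrow>
    hilbert_subspace K \<and> star_rep A K L \<and> op_star_rep A K R \<and>
    (\<forall>a b. \<forall>x\<in>K. L a (R b x) = R b (L a x))"

text \<open>Bekka's property (T). The existence of a tracial state, under which the notion is
  considered, is made part of it.\<close>

definition bekka_property_T :: "('c::{real_normed_algebra_1, banach}, 'm) star_alg_scheme \<Rightarrow> bool"
  where "bekka_property_T A \<longleftrightarrow>
    cstar_algebra A \<and> (\<exists>\<tau>. tracial_state A \<tau>) \<and>
    (\<exists>F c. finite F \<and> c > 0 \<and>
      (\<forall>K L R. hilbert_bimodule A K L R \<longrightarrow>
        (\<exists>\<xi>\<in>K. norm \<xi> = 1 \<and> (\<forall>a\<in>F. norm (L a \<xi> - R a \<xi>) < c)) \<longrightarrow>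
        (\<exists>\<xi>'\<in>K. \<xi>' \<noteq> 0 \<and> (\<forall>a. L a \<xi>' = R a \<xi>'))))"


section \<open>Compact quantum groups\<close>

text \<open>Elements of algebraic tensor products are represented by finite lists of simple tensors.
  Two lists represent the same element of the tensor product iff all bilinear (trilinear)
  forms agree on them.\<close>

definition tensor2_eq ::
    "('a::ring_1, 'm) star_alg_scheme \<Rightarrow> ('a \<times> 'a) list \<Rightarrow> ('a \<times> 'a) list \<Rightarrow> bool"
  where "tensor2_eq A s t \<longleftrightarrow>
    (\<forall>B :: 'a \<Rightarrow> 'a \<Rightarrow> complex.
      (\<forall>a. functional A (\<lambda>x. B x a)) \<and> (\<forall>a. functional A (\<lambda>x. B a x)) \<longrightarrow>
      (\<Sum>(x, y)\<leftarrow>s. B x y) = (\<Sum>(x, y)\<leftarrow>t. B x y))"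

definition tensor3_eq ::
    "('a::ring_1, 'm) star_alg_scheme \<Rightarrow> ('a \<times> 'a \<times> 'a) list \<Rightarrow> ('a \<times> 'a \<times> 'a) list \<Rightarrow> bool"
  where "tensor3_eq A s t \<longleftrightarrow>
    (\<forall>B :: 'a \<Rightarrow> 'a \<Rightarrow> 'a \<Rightarrow> complex.
      (\<forall>a b. functional A (\<lambda>x. B x a b)) \<and> (\<forall>a b. functional A (\<lambda>x. B a x b)) \<and>
      (\<forall>a b. functional A (\<lambda>x. B a b x)) \<longrightarrow>
      (\<Sum>(x, y, z)\<leftarrow>s. B x y z) = (\<Sum>(x, y, z)\<leftarrow>t. B x y z))"

text \<open>A compact quantum group \<open>G\<close> is given by its Hopf *-algebra \<open>Pol(G)\<close>, the type \<open>'a\<close>, together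
  with a set \<open>Irr G\<close> indexing the classes of irreducible corepresentations and fixed unitary
  representatives: \<open>fund G \<alpha> i j\<close> with \<open>i, j < dim_irr G \<alpha>\<close> is \<open>u\<^sup>\<alpha>\<^sub>i\<^sub>j\<close> (indices start at 0).
  The list \<open>comult G a\<close> represents \<open>\<Delta>(a)\<close>; only its tensor class matters.\<close>

record ('a, 'i) cqg = "'a star_alg" +
  comult :: "'a \<Rightarrow> ('a \<times> 'a) list"
  counit :: "'a \<Rightarrow> complex"
  antipode :: "'a \<Rightarrow> 'a"
  Irr :: "'i set"
  dim_irr :: "'i \<Rightarrow> nat"
  fund :: "'i \<Rightarrow> nat \<Rightarrow> nat \<Rightarrow> 'a"

locale hopf_star_algebra = star_algebra G
  for G :: "('a::ring_1, 'i, 'm) cqg_scheme" +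
  assumes comult_add: "tensor2_eq G (comult G (a + b)) (comult G a @ comult G b)"
    and comult_scl: "tensor2_eq G (comult G (scl G c a)) [(scl G c x, y). (x, y) \<leftarrow> comult G a]"
    and comult_one: "tensor2_eq G (comult G 1) [(1, 1)]"
    and comult_mult: "tensor2_eq G (comult G (a * b))
          [(x * x', y * y'). (x, y) \<leftarrow> comult G a, (x', y') \<leftarrow> comult G b]"
    and comult_star: "tensor2_eq G (comult G (star G a)) [(star G x, star G y). (x, y) \<leftarrow> comult G a]"
    and coassoc: "tensor3_eq G
          [(x1, x2, y). (x, y) \<leftarrow> comult G a, (x1, x2) \<leftarrow> comult G x]
          [(x, y1, y2). (x, y) \<leftarrow> comult G a, (y1, y2) \<leftarrow> comult G y]"
    and counit_linear: "functional G (counit G)"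
    and counit_one: "counit G 1 = 1"
    and counit_mult: "counit G (a * b) = counit G a * counit G b"
    and counit_star: "counit G (star G a) = cnj (counit G a)"
    and counit_left: "(\<Sum>(x, y)\<leftarrow>comult G a. scl G (counit G x) y) = a"
    and counit_right: "(\<Sum>(x, y)\<leftarrow>comult G a. scl G (counit G y) x) = a"
    and antipode_linear: "Vector_Spaces.linear (scl G) (scl G) (antipode G)"
    and antipode_left: "(\<Sum>(x, y)\<leftarrow>comult G a. antipode G x * y) = scl G (counit G a) 1"
    and antipode_right: "(\<Sum>(x, y)\<leftarrow>comult G a. x * antipode G y) = scl G (counit G a) 1"

text \<open>\<open>n\<close>-dimensional corepresentations of \<open>G\<close>, in matrix form.\<close>

definition fd_corep :: "('a::ring_1, 'i, 'm) cqg_scheme \<Rightarrow> nat \<Rightarrow> (nat \<Rightarrow> nat \<Rightarrow> 'a) \<Rightarrow> bool"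
  where "fd_corep G n u \<longleftrightarrow>
    (\<forall>i<n. \<forall>j<n.
      tensor2_eq G (comult G (u i j)) [(u i k, u k j). k \<leftarrow> [0..<n]] \<and>
      counit G (u i j) = of_bool (i = j))"

definition unitary_matrix :: "('a::ring_1, 'm) star_alg_scheme \<Rightarrow> nat \<Rightarrow> (nat \<Rightarrow> nat \<Rightarrow> 'a) \<Rightarrow> bool"
  where "unitary_matrix A n u \<longleftrightarrow>
    (\<forall>i<n. \<forall>j<n.
      (\<Sum>k<n. star A (u k i) * u k j) = of_bool (i = j) \<and>
      (\<Sum>k<n. u i k * star A (u j k)) = of_bool (i = j))"

text \<open>Linear subspaces \<open>W\<close> of \<open>\<complex>\<^sup>n\<close> (tuples extended by 0) with \<open>u(W) \<subseteq> W \<otimes> Pol(G)\<close>; the latter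
  inclusion is tested by applying linear functionals to the second leg.\<close>

definition invariant_subspace ::
    "('a::ring_1, 'i, 'm) cqg_scheme \<Rightarrow> nat \<Rightarrow> (nat \<Rightarrow> nat \<Rightarrow> 'a) \<Rightarrow> (nat \<Rightarrow> complex) set \<Rightarrow> bool"
  where "invariant_subspace G n u W \<longleftrightarrow>
    W \<subseteq> {w. \<forall>i\<ge>n. w i = 0} \<and>
    (\<lambda>_. 0) \<in> W \<and>
    (\<forall>v\<in>W. \<forall>w\<in>W. (\<lambda>i. v i + w i) \<in> W) \<and>
    (\<forall>c. \<forall>w\<in>W. (\<lambda>i. c * w i) \<in> W) \<and>
    (\<forall>f. functional G f \<longrightarrow>
      (\<forall>w\<in>W. (\<lambda>i. if i < n then \<Sum>j<n. f (u i j) * w j else 0) \<in> W))"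

definition irreducible_corep ::
    "('a::ring_1, 'i, 'm) cqg_scheme \<Rightarrow> nat \<Rightarrow> (nat \<Rightarrow> nat \<Rightarrow> 'a) \<Rightarrow> bool"
  where "irreducible_corep G n u \<longleftrightarrow>
    fd_corep G n u \<and> n > 0 \<and>
    (\<forall>W. invariant_subspace G n u W \<longrightarrow> W = {\<lambda>_. 0} \<or> W = {w. \<forall>i\<ge>n. w i = 0})"

definition equivalent_coreps ::
    "('a::ring_1, 'i, 'm) cqg_scheme \<Rightarrow> nat \<Rightarrow> (nat \<Rightarrow> nat \<Rightarrow> 'a) \<Rightarrow> nat \<Rightarrow> (nat \<Rightarrow> nat \<Rightarrow> 'a) \<Rightarrow> bool"
  where "equivalent_coreps G m u n v \<longleftrightarrow> m = n \<and>
    (\<exists>T S :: nat \<Rightarrow> nat \<Rightarrow> complex.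
      (\<forall>i<n. \<forall>j<n.
        (\<Sum>k<n. T i k * S k j) = of_bool (i = j) \<and>
        (\<Sum>k<n. S i k * T k j) = of_bool (i = j) \<and>
        (\<Sum>k<n. scl G (T i k) (u k j)) = (\<Sum>k<n. scl G (T k j) (v i k))))"

text \<open>Compact quantum groups through their polynomial algebras (Dijkhuizen--Koornwinder): Hopf
  *-algebras spanned by the matrix elements of their finite-dimensional unitary
  corepresentations.\<close>

locale compact_quantum_group = hopf_star_algebra G
  for G :: "('a::ring_1, 'i, 'm) cqg_scheme" +
  assumes spanned: "module.span (scl G)
        {u i j | n u i j. fd_corep G n u \<and> unitary_matrix G n u \<and> i < n \<and> j < n} = UNIV"
    and fund_irreducible: "\<alpha> \<in> Irr G \<Longrightarrow> irreducible_corep G (dim_irr G \<alpha>) (fund G \<alpha>)"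
    and fund_unitary: "\<alpha> \<in> Irr G \<Longrightarrow> unitary_matrix G (dim_irr G \<alpha>) (fund G \<alpha>)"
    and fund_inequivalent: "\<lbrakk>\<alpha> \<in> Irr G; \<beta> \<in> Irr G;
        equivalent_coreps G (dim_irr G \<alpha>) (fund G \<alpha>) (dim_irr G \<beta>) (fund G \<beta>)\<rbrakk> \<Longrightarrow> \<alpha> = \<beta>"
    and fund_exhaust: "irreducible_corep G n v \<Longrightarrow>
        \<exists>\<alpha>\<in>Irr G. equivalent_coreps G n v (dim_irr G \<alpha>) (fund G \<alpha>)"

definition haar_state :: "('a::ring_1, 'i, 'm) cqg_scheme \<Rightarrow> ('a \<Rightarrow> complex) \<Rightarrow> bool"
  where "haar_state G h \<longleftrightarrow>
    functional G h \<and> h 1 = 1 \<and> (\<forall>a. h (star G a * a) \<in> \<real>\<^sub>\<ge>\<^sub>0) \<and>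
    (\<forall>a. (\<Sum>(x, y)\<leftarrow>comult G a. scl G (h x) y) = scl G (h a) 1 \<and>
         (\<Sum>(x, y)\<leftarrow>comult G a. scl G (h y) x) = scl G (h a) 1)"

definition haar :: "('a::ring_1, 'i, 'm) cqg_scheme \<Rightarrow> 'a \<Rightarrow> complex"
  where "haar G = (THE h. haar_state G h)"

definition cstar_seminorm :: "('a::ring_1, 'm) star_alg_scheme \<Rightarrow> ('a \<Rightarrow> real) \<Rightarrow> bool"
  where "cstar_seminorm A p \<longleftrightarrow>
    (\<forall>a b. p (a + b) \<le> p a + p b) \<and> (\<forall>c a. p (scl A c a) = cmod c * p a) \<and>
    (\<forall>a b. p (a * b) \<le> p a * p b) \<and> (\<forall>a. p (star A a * a) = (p a)\<^sup>2)"

text \<open>\<open>A\<close> with \<open>\<iota> : Pol(G) \<rightarrow> A\<close> is (a model of) \<open>C(G\<^sub>m\<^sub>a\<^sub>x)\<close>: the completion of \<open>Pol(G)\<close> in its largest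
  C*-seminorm.\<close>

locale universal_envelope = pol: star_algebra G + env: cstar_algebra A
  for G :: "('a::ring_1, 'm) star_alg_scheme"
    and A :: "('c::{real_normed_algebra_1, banach}, 'l) star_alg_scheme"
    and \<iota> :: "'a \<Rightarrow> 'c" +
  assumes embed_linear: "Vector_Spaces.linear (scl G) (scl A) \<iota>"
    and embed_one: "\<iota> 1 = 1"
    and embed_mult: "\<iota> (a * b) = \<iota> a * \<iota> b"
    and embed_star: "\<iota> (star G a) = star A (\<iota> a)"
    and embed_dense: "closure (range \<iota>) = UNIV"
    and embed_norm_greatest: "cstar_seminorm G p \<Longrightarrow> p a \<le> norm (\<iota> a)"


section \<open>The dual discrete quantum group\<close>

text \<open>Write \<open>G'\<close> for the dual of \<open>G\<close> and \<open>\<Delta>'\<close> for its comultiplication. An element \<open>x\<close> of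
  \<open>M(c\<^sub>0(G'))\<close>, a bounded family of matrices \<open>x\<^sup>\<gamma>\<close> of size \<open>n\<^sub>\<gamma>\<close>, has entries \<open>x \<gamma> p q\<close>. Comparing the
  coefficients of \<open>e\<^sup>\<alpha>\<^sub>i\<^sub>k \<otimes> e\<^sup>\<beta>\<^sub>j\<^sub>l\<close> in \<open>(\<Delta>' \<otimes> id)w = w\<^sub>2\<^sub>3w\<^sub>1\<^sub>3\<close>, where \<open>w = \<Sum> e\<^sup>\<gamma>\<^sub>p\<^sub>q \<otimes> u\<^sup>\<gamma>\<^sub>p\<^sub>q\<close>, gives
  \<open>\<Sum> \<Delta>'(e\<^sup>\<gamma>\<^sub>p\<^sub>q)[\<alpha> i k, \<beta> j l] u\<^sup>\<gamma>\<^sub>p\<^sub>q = u\<^sup>\<beta>\<^sub>j\<^sub>l u\<^sup>\<alpha>\<^sub>i\<^sub>k\<close>. So the entries of \<open>\<Delta>'(e\<^sup>\<gamma>\<^sub>p\<^sub>q)\<close> are the coordinates of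
  \<open>u\<^sup>\<beta>\<^sub>j\<^sub>l u\<^sup>\<alpha>\<^sub>i\<^sub>k\<close> in the basis of matrix elements.\<close>

definition irr_indices :: "('a::ring_1, 'i, 'm) cqg_scheme \<Rightarrow> ('i \<times> nat \<times> nat) set"
  where "irr_indices G = {(\<gamma>, p, q). \<gamma> \<in> Irr G \<and> p < dim_irr G \<gamma> \<and> q < dim_irr G \<gamma>}"

definition dual_comult_unit ::
    "('a::ring_1, 'i, 'm) cqg_scheme \<Rightarrow> 'i \<times> nat \<times> nat \<Rightarrow> 'i \<times> nat \<times> nat \<Rightarrow> 'i \<times> nat \<times> nat \<Rightarrow> complex"
  where "dual_comult_unit G = (\<lambda>(\<gamma>, p, q) (\<alpha>, i, k) (\<beta>, j, l).
    module.representation (scl G) ((\<lambda>(\<gamma>, p, q). fund G \<gamma> p q) ` irr_indices G)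
      (fund G \<beta> j l * fund G \<alpha> i k) (fund G \<gamma> p q))"

text \<open>The entry of \<open>(\<Delta>' \<otimes> id)V\<close> at \<open>(\<alpha>, i, k), (\<beta>, j, l)\<close>, applied to \<open>\<xi>\<close>. The sum is finite.\<close>

definition dual_comult ::
    "('a::ring_1, 'i, 'm) cqg_scheme \<Rightarrow> ('i \<Rightarrow> nat \<Rightarrow> nat \<Rightarrow> ell2 \<Rightarrow> ell2) \<Rightarrow>
      'i \<times> nat \<times> nat \<Rightarrow> 'i \<times> nat \<times> nat \<Rightarrow> ell2 \<Rightarrow> ell2"
  where "dual_comult G V s t \<xi> =
    (\<Sum>(\<gamma>, p, q) \<in> {r \<in> irr_indices G. dual_comult_unit G r s t \<noteq> 0}.
      dual_comult_unit G (\<gamma>, p, q) s t *\<^sub>C V \<gamma> p q \<xi>)"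

text \<open>Corepresentations \<open>V \<in> M(c\<^sub>0(G') \<otimes> \<K>(K))\<close> of \<open>G'\<close> on \<open>K\<close>. This multiplier algebra consists of the bounded
  families \<open>(V\<^sup>\<alpha>)\<close> with \<open>V\<^sup>\<alpha> \<in> M\<^bsub>n\<^sub>\<alpha>\<^esub>(\<complex>) \<otimes> B(K) = B(K\<^sup>n)\<close>, \<open>n = n\<^sub>\<alpha>\<close>; such a family is unitary iff every \<open>V\<^sup>\<alpha>\<close> is a
  surjective isometry of \<open>K\<^sup>n\<close>. The last clause is \<open>(\<Delta>' \<otimes> id)V = V\<^sub>2\<^sub>3V\<^sub>1\<^sub>3\<close>.\<close>

definition dual_corep ::
    "('a::ring_1, 'i, 'm) cqg_scheme \<Rightarrow> ell2 set \<Rightarrow> ('i \<Rightarrow> nat \<Rightarrow> nat \<Rightarrow> ell2 \<Rightarrow> ell2) \<Rightarrow> bool"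
  where "dual_corep G K V \<longleftrightarrow>
    hilbert_subspace K \<and>
    (\<forall>\<alpha>\<in>Irr G. \<forall>i<dim_irr G \<alpha>. \<forall>j<dim_irr G \<alpha>. bounded_op K (V \<alpha> i j)) \<and>
    (\<forall>\<alpha>\<in>Irr G. \<forall>x. (\<forall>j<dim_irr G \<alpha>. x j \<in> K) \<longrightarrow>
      (\<Sum>i<dim_irr G \<alpha>. (norm (\<Sum>j<dim_irr G \<alpha>. V \<alpha> i j (x j)))\<^sup>2) =
      (\<Sum>j<dim_irr G \<alpha>. (norm (x j))\<^sup>2)) \<and>
    (\<forall>\<alpha>\<in>Irr G. \<forall>y. (\<forall>i<dim_irr G \<alpha>. y i \<in> K) \<longrightarrow>
      (\<exists>x. (\<forall>j<dim_irr G \<alpha>. x j \<in> K) \<and>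
        (\<forall>i<dim_irr G \<alpha>. (\<Sum>j<dim_irr G \<alpha>. V \<alpha> i j (x j)) = y i))) \<and>
    (\<forall>\<alpha>\<in>Irr G. \<forall>\<beta>\<in>Irr G. \<forall>i<dim_irr G \<alpha>. \<forall>k<dim_irr G \<alpha>. \<forall>j<dim_irr G \<beta>. \<forall>l<dim_irr G \<beta>. \<forall>\<xi>\<in>K.
      dual_comult G V (\<alpha>, i, k) (\<beta>, j, l) \<xi> = V \<beta> j l (V \<alpha> i k \<xi>))"

text \<open>\<open>H\<^sup>\<alpha> = span {u\<^sup>\<alpha>\<^sub>r\<^sub>l}\<close> with the norm of \<open>L\<^sup>2(G)\<close>. Elements \<open>\<eta> = \<Sum> c\<^sub>r\<^sub>l u\<^sup>\<alpha>\<^sub>r\<^sub>l\<close> are given by their coefficients,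
  elements \<open>\<Sum> u\<^sup>\<alpha>\<^sub>r\<^sub>l \<otimes> \<zeta>\<^sub>r\<^sub>l\<close> of \<open>H\<^sup>\<alpha> \<otimes> K\<close> by the family \<open>\<zeta>\<close>.\<close>

definition H_elem :: "('a::ring_1, 'i, 'm) cqg_scheme \<Rightarrow> 'i \<Rightarrow> (nat \<Rightarrow> nat \<Rightarrow> complex) \<Rightarrow> 'a"
  where "H_elem G \<alpha> c = (\<Sum>r<dim_irr G \<alpha>. \<Sum>l<dim_irr G \<alpha>. scl G (c r l) (fund G \<alpha> r l))"

definition L2_norm :: "('a::ring_1, 'i, 'm) cqg_scheme \<Rightarrow> 'a \<Rightarrow> real"
  where "L2_norm G a = sqrt (Re (haar G (star G a * a)))"

definition H_tensor_norm :: "('a::ring_1, 'i, 'm) cqg_scheme \<Rightarrow> 'i \<Rightarrow> (nat \<Rightarrow> nat \<Rightarrow> ell2) \<Rightarrow> real"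
  where "H_tensor_norm G \<alpha> \<zeta> = sqrt (Re
    (\<Sum>r<dim_irr G \<alpha>. \<Sum>l<dim_irr G \<alpha>. \<Sum>r'<dim_irr G \<alpha>. \<Sum>l'<dim_irr G \<alpha>.
      haar G (star G (fund G \<alpha> r l) * fund G \<alpha> r' l') * cinner (\<zeta> r l) (\<zeta> r' l')))"

text \<open>\<open>V\<^sup>\<alpha>(\<eta> \<otimes> \<xi>) - \<eta> \<otimes> \<xi>\<close>, using \<open>e\<^sup>\<alpha>\<^sub>i\<^sub>j u\<^sup>\<alpha>\<^sub>r\<^sub>l = \<delta>\<^sub>j\<^sub>l u\<^sup>\<alpha>\<^sub>r\<^sub>i\<close>: as \<open>V\<^sup>\<alpha> = \<Sum> e\<^sup>\<alpha>\<^sub>i\<^sub>j \<otimes> V\<^sup>\<alpha>\<^sub>i\<^sub>j\<close>, the component of \<open>V\<^sup>\<alpha>(\<eta> \<otimes> \<xi>)\<close>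
  at \<open>u\<^sup>\<alpha>\<^sub>r\<^sub>l\<close> is \<open>\<Sum>\<^sub>j c\<^sub>r\<^sub>j V\<^sup>\<alpha>\<^sub>l\<^sub>j \<xi>\<close>.\<close>

definition displacement ::
    "('a::ring_1, 'i, 'm) cqg_scheme \<Rightarrow> ('i \<Rightarrow> nat \<Rightarrow> nat \<Rightarrow> ell2 \<Rightarrow> ell2) \<Rightarrow> 'i \<Rightarrow>
      (nat \<Rightarrow> nat \<Rightarrow> complex) \<Rightarrow> ell2 \<Rightarrow> nat \<Rightarrow> nat \<Rightarrow> ell2"
  where "displacement G V \<alpha> c \<xi> r l =
    (\<Sum>j<dim_irr G \<alpha>. c r j *\<^sub>C V \<alpha> l j \<xi>) - c r l *\<^sub>C \<xi>"

definition almost_invariant ::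
    "('a::ring_1, 'i, 'm) cqg_scheme \<Rightarrow> ('i \<Rightarrow> nat \<Rightarrow> nat \<Rightarrow> ell2 \<Rightarrow> ell2) \<Rightarrow> 'i set \<Rightarrow> real \<Rightarrow> ell2 \<Rightarrow> bool"
  where "almost_invariant G V E \<delta> \<xi> \<longleftrightarrow>
    (\<forall>\<alpha>\<in>E. \<forall>c. H_elem G \<alpha> c \<noteq> 0 \<longrightarrow>
      H_tensor_norm G \<alpha> (displacement G V \<alpha> c \<xi>) < \<delta> * L2_norm G (H_elem G \<alpha> c) * norm \<xi>)"

definition has_almost_invariant_vectors ::
    "('a::ring_1, 'i, 'm) cqg_scheme \<Rightarrow> ell2 set \<Rightarrow> ('i \<Rightarrow> nat \<Rightarrow> nat \<Rightarrow> ell2 \<Rightarrow> ell2) \<Rightarrow> bool"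
  where "has_almost_invariant_vectors G K V \<longleftrightarrow>
    (\<forall>E \<delta>. finite E \<and> E \<subseteq> Irr G \<and> \<delta> > 0 \<longrightarrow> (\<exists>\<xi>\<in>K. almost_invariant G V E \<delta> \<xi>))"

definition invariant_vector ::
    "('a::ring_1, 'i, 'm) cqg_scheme \<Rightarrow> ('i \<Rightarrow> nat \<Rightarrow> nat \<Rightarrow> ell2 \<Rightarrow> ell2) \<Rightarrow> ell2 \<Rightarrow> bool"
  where "invariant_vector G V \<xi> \<longleftrightarrow>
    (\<forall>\<alpha>\<in>Irr G. \<forall>c. \<forall>r<dim_irr G \<alpha>. \<forall>l<dim_irr G \<alpha>. displacement G V \<alpha> c \<xi> r l = 0)"

definition dual_property_T :: "('a::ring_1, 'i, 'm) cqg_scheme \<Rightarrow> bool"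
  where "dual_property_T G \<longleftrightarrow>
    (\<forall>K V. dual_corep G K V \<longrightarrow> has_almost_invariant_vectors G K V \<longrightarrow>
      (\<exists>\<xi>\<in>K. \<xi> \<noteq> 0 \<and> invariant_vector G V \<xi>))"

end

theory Submission
  imports Defs "HOL-Library.Function_Algebras"
    "HOL-Computational_Algebra.Fundamental_Theorem_Algebra"
    "HOL-Computational_Algebra.Formal_Power_Series"
begin

text \<open>
  Both properties produce invariant vectors from almost invariant ones, so each direction turns the
  objects of one property into those of the other.

  Bekka's property implies property (T): a corepresentation of the dual is a representation of the
  polynomial algebra, which extends to the envelope. Let the envelope act from the right through the
  counit. The central vectors of this bimodule are the invariant vectors of the corepresentation, and
  almost invariant vectors are almost central, since representations are contractive and the
  polynomial algebra is dense (\<open>bekka_imp_property_T\<close>).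

  Conversely, a bimodule carries the adjoint action \<open>\<xi> \<mapsto> a\<^sub>1 \<xi> S(a\<^sub>2)\<close> of the polynomial algebra. Its
  invariant vectors are central, and almost central vectors are almost invariant. It respects the
  involution if the antipode does, which is the case when the dual is unimodular, and property (T)
  forces unimodularity: otherwise the modular automorphism of the Haar state, composed with the
  counit, is a non-trivial positive character; its imaginary powers are characters that respect the
  involution and converge to the counit at exponent 0. Along exponents chosen for a modular
  eigenvalue different from 1 they never equal the counit. As one-dimensional representations they add
  up to a representation with almost invariant vectors, and an invariant vector would exhibit one of
  them as the counit (\<open>kac_criterion\<close>, \<open>property_T_kac\<close>).
  Given unimodularity, a failure of Bekka's property yields, by separability, a sequence of bimodules
  without central vectors whose unit vectors become central asymptotically. The Hilbert sum of their
  adjoint representations has almost invariant vectors, hence by property (T) an invariant vector; a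
  non-zero component of it is a central vector of one of the bimodules (\<open>property_T_imp_bekka\<close>).

  The modular theory rests on the fact that the matrix elements of the irreducible representatives
  form a linear basis of the polynomial algebra. The Haar state and its modular automorphism are
  prescribed on this basis; Schur's lemma yields the orthogonality relations, from which positivity,
  nondegeneracy and the KMS property follow.
\<close>

section \<open>Finite-dimensional complex linear algebra\<close>

lemma (in vector_space) separating_functional:
  assumes S: "subspace S" and v: "v \<notin> S"
  shows "\<exists>f. Vector_Spaces.linear scale (*) f \<and> f v = 1 \<and> (\<forall>x\<in>S. f x = 0)"
proof -
  interpret dual: vector_space_pair scale "(*)"
    by unfold_locales (simp_all add: algebra_simps)
  obtain B where B: "B \<subseteq> S" "independent B" "S \<subseteq> span B"
    using basis_exists[of S] by metis
  have "span B \<subseteq> S"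
    using B(1) S by (simp add: span_minimal)
  then have "independent (insert v B)"
    using B(2) v by (intro independent_insertI) auto
  then obtain f where f: "Vector_Spaces.linear scale (*) f"
      "\<forall>x\<in>insert v B. f x = of_bool (x = v)"
    using dual.linear_independent_extend[of "insert v B" "\<lambda>x. of_bool (x = v)"] by auto
  have "f x = 0" if "x \<in> S" for x
  proof -
    have "x \<in> span B" using B(3) that by auto
    moreover have "\<forall>b\<in>B. f b = 0"
      using f(2) B(1) v by auto
    ultimately show ?thesis
      using dual.linear_eq_0_on_span[OF f(1), of B] by blast
  qed
  with f show ?thesis by auto
qed

definition tuple_scale :: "complex \<Rightarrow> (nat \<Rightarrow> complex) \<Rightarrow> nat \<Rightarrow> complex"
  where "tuple_scale c w = (\<lambda>i. c * w i)"

global_interpretation tuple: vector_space tuple_scale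
  by unfold_locales (auto simp: tuple_scale_def algebra_simps fun_eq_iff)

text \<open>Vectors of all dimensions are functions on the naturals, because dimensions of corepresentations
  vary within a proof; vectors of dimension \<open>n\<close> vanish from \<open>n\<close> on.\<close>
definition tuples :: "nat \<Rightarrow> (nat \<Rightarrow> complex) set"
  where "tuples n = {w. \<forall>i\<ge>n. w i = 0}"

definition unit_tuple :: "nat \<Rightarrow> nat \<Rightarrow> complex"
  where "unit_tuple j = (\<lambda>i. of_bool (i = j))"

definition mat_apply :: "nat \<Rightarrow> (nat \<Rightarrow> nat \<Rightarrow> complex) \<Rightarrow> (nat \<Rightarrow> complex) \<Rightarrow> nat \<Rightarrow> complex"
  where "mat_apply n t w = (\<lambda>i. if i < n then \<Sum>j<n. t i j * w j else 0)"

definition tuple_inner :: "nat \<Rightarrow> (nat \<Rightarrow> complex) \<Rightarrow> (nat \<Rightarrow> complex) \<Rightarrow> complex"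
  where "tuple_inner n v w = (\<Sum>j<n. cnj (v j) * w j)"

lemma subspace_tuples: "tuple.subspace (tuples n)"
  by (auto simp: tuple.subspace_def tuples_def tuple_scale_def)

lemma unit_tuple_in [simp]: "j < n \<Longrightarrow> unit_tuple j \<in> tuples n"
  by (auto simp: unit_tuple_def tuples_def)

lemma sum_of_bool_mult [simp]:
  fixes f :: "nat \<Rightarrow> 'a::semiring_1"
  shows "(\<Sum>j<n. of_bool (i = j) * f j) = (if i < n then f i else 0)"
    "(\<Sum>j<n. of_bool (j = i) * f j) = (if i < n then f i else 0)"
    "(\<Sum>j<n. f j * of_bool (i = j)) = (if i < n then f i else 0)"
    "(\<Sum>j<n. f j * of_bool (j = i)) = (if i < n then f i else 0)"
proof -
  have "(\<Sum>j<n. of_bool (i = j) * f j) = (\<Sum>j<n. if i = j then f j else 0)"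
    "(\<Sum>j<n. of_bool (j = i) * f j) = (\<Sum>j<n. if i = j then f j else 0)"
    "(\<Sum>j<n. f j * of_bool (i = j)) = (\<Sum>j<n. if i = j then f j else 0)"
    "(\<Sum>j<n. f j * of_bool (j = i)) = (\<Sum>j<n. if i = j then f j else 0)"
    by (rule sum.cong; auto)+
  then show "(\<Sum>j<n. of_bool (i = j) * f j) = (if i < n then f i else 0)"
    "(\<Sum>j<n. of_bool (j = i) * f j) = (if i < n then f i else 0)"
    "(\<Sum>j<n. f j * of_bool (i = j)) = (if i < n then f i else 0)"
    "(\<Sum>j<n. f j * of_bool (j = i)) = (if i < n then f i else 0)"
    by simp_all
qed

lemma tuple_sum_apply: "(\<Sum>x\<in>S. f x) (i::nat) = (\<Sum>x\<in>S. f x i)" for f :: "_ \<Rightarrow> nat \<Rightarrow> complex"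
  by (induction S rule: infinite_finite_induct) auto

lemma tuple_expansion:
  assumes "w \<in> tuples n"
  shows "w = (\<Sum>j<n. tuple_scale (w j) (unit_tuple j))"
proof
  fix i
  show "w i = (\<Sum>j<n. tuple_scale (w j) (unit_tuple j)) i"
    using assms by (auto simp: tuple_sum_apply tuple_scale_def unit_tuple_def tuples_def)
qed

lemma tuples_subset_span_units: "tuples n \<subseteq> tuple.span (unit_tuple ` {..<n})"
proof
  fix w assume "w \<in> tuples n"
  then show "w \<in> tuple.span (unit_tuple ` {..<n})"
    by (subst tuple_expansion) (auto intro!: tuple.span_sum tuple.span_scale intro: tuple.span_base)
qed

lemma independent_tuples_card:
  assumes "tuple.independent B" "B \<subseteq> tuples n"
  shows "finite B" "card B \<le> n"
proof -
  have "finite B \<and> card B \<le> card (unit_tuple ` {..<n})"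
    using assms tuples_subset_span_units[of n]
    by (intro tuple.independent_span_bound) auto
  moreover have "card (unit_tuple ` {..<n}) \<le> n"
    using card_image_le[of "{..<n}" unit_tuple] by simp
  ultimately show "finite B" "card B \<le> n" by auto
qed

lemma mat_apply_in [simp]: "mat_apply n t w \<in> tuples n"
  by (auto simp: mat_apply_def tuples_def)

lemma mat_apply_add: "mat_apply n t (v + w) = mat_apply n t v + mat_apply n t w"
  by (auto simp: mat_apply_def fun_eq_iff algebra_simps sum.distrib)

lemma mat_apply_scale: "mat_apply n t (tuple_scale c w) = tuple_scale c (mat_apply n t w)"
  by (auto simp: mat_apply_def tuple_scale_def fun_eq_iff algebra_simps sum_distrib_left)

lemma mat_apply_zero: "mat_apply n t 0 = 0"
  by (auto simp: mat_apply_def fun_eq_iff)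

lemma mat_apply_sum: "mat_apply n t (\<Sum>x\<in>S. f x) = (\<Sum>x\<in>S. mat_apply n t (f x))"
  by (induction S rule: infinite_finite_induct) (simp_all add: mat_apply_add mat_apply_zero del: plus_fun_apply zero_fun_apply)

lemma mat_apply_unit: "j < n \<Longrightarrow> mat_apply n t (unit_tuple j) = (\<lambda>i. if i < n then t i j else 0)"
  by (auto simp: mat_apply_def unit_tuple_def fun_eq_iff)

lemma tuple_inner_add: "tuple_inner n v (w + w') = tuple_inner n v w + tuple_inner n v w'"
  by (simp add: tuple_inner_def algebra_simps sum.distrib)

lemma tuple_inner_scale: "tuple_inner n v (tuple_scale c w) = c * tuple_inner n v w"
  by (simp add: tuple_inner_def tuple_scale_def algebra_simps sum_distrib_left)

lemma tuple_inner_zero [simp]: "tuple_inner n v 0 = 0"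
  by (simp add: tuple_inner_def)

lemma tuple_inner_sum: "tuple_inner n v (\<Sum>x\<in>S. f x) = (\<Sum>x\<in>S. tuple_inner n v (f x))"
  by (induction S rule: infinite_finite_induct) (simp_all add: tuple_inner_add del: plus_fun_apply zero_fun_apply)

lemma tuple_inner_commute: "tuple_inner n w v = cnj (tuple_inner n v w)"
  by (simp add: tuple_inner_def mult.commute)

lemma tuple_inner_self: "tuple_inner n w w = complex_of_real (\<Sum>j<n. (cmod (w j))\<^sup>2)"
  by (simp add: tuple_inner_def complex_norm_square mult.commute del: of_real_power)

lemma tuple_inner_self_pos:
  assumes "w \<in> tuples n" "w \<noteq> 0"
  shows "(\<Sum>j<n. (cmod (w j))\<^sup>2) > 0"
proof -
  obtain j where j: "w j \<noteq> 0" using assms(2) by (auto simp: fun_eq_iff)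
  with assms(1) have "j < n" by (auto simp: tuples_def not_le[symmetric])
  with j show ?thesis by (intro sum_pos2[of _ j]) auto
qed

text \<open>A linear functional that vanishes on \<open>W\<close> but not everywhere is an inner product with a
  vector; this vector is orthogonal to \<open>W\<close>.\<close>

lemma orthogonal_vector_exists:
  assumes W: "tuple.subspace W" and v: "v \<in> tuples n" "v \<notin> W"
  shows "\<exists>y\<in>tuples n. y \<noteq> 0 \<and> (\<forall>w\<in>W \<inter> tuples n. tuple_inner n y w = 0)"
proof -
  obtain f where f: "Vector_Spaces.linear tuple_scale (*) f" "f v = 1" "\<forall>x\<in>W. f x = 0"
    using tuple.separating_functional[OF W v(2)] by auto
  interpret f: Vector_Spaces.linear tuple_scale "(*)" f by fact
  define y where "y = (\<lambda>j. if j < n then cnj (f (unit_tuple j)) else 0)"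
  have inner: "tuple_inner n y w = f w" if "w \<in> tuples n" for w
  proof -
    have "f w = (\<Sum>j<n. w j * f (unit_tuple j))"
      by (subst tuple_expansion[OF that]) (simp add: f.sum f.scale)
    then show ?thesis by (simp add: tuple_inner_def y_def mult.commute)
  qed
  have "y \<noteq> 0"
    using inner[OF v(1)] f(2) by (auto simp: tuple_inner_def)
  moreover have "y \<in> tuples n" by (simp add: y_def tuples_def)
  ultimately show ?thesis using inner f(3) by auto
qed

text \<open>The usual argument over \<open>\<complex>\<close>: a polynomial of least degree that annihilates a vector has a root,
  and dividing out that root leaves an eigenvector.\<close>

lemma eigenvector_exists:
  assumes W: "tuple.subspace W" "W \<subseteq> tuples n" and w: "w \<in> W" "w \<noteq> 0"
    and inv: "\<And>x. x \<in> W \<Longrightarrow> mat_apply n t x \<in> W"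
  shows "\<exists>v\<in>W. v \<noteq> 0 \<and> (\<exists>c. mat_apply n t v = tuple_scale c v)"
proof -
  define T where "T = mat_apply n t"
  define ev where "ev p = (\<Sum>i\<le>degree p. tuple_scale (coeff p i) ((T ^^ i) w))" for p :: "complex poly"
  have ev_ge: "ev p = (\<Sum>i\<le>N. tuple_scale (coeff p i) ((T ^^ i) w))" if "degree p \<le> N" for p N
    unfolding ev_def using that
    by (intro sum.mono_neutral_left) (auto simp: coeff_eq_0 tuple_scale_def zero_fun_def)
  have T_W: "(T ^^ i) w \<in> W" for i
    by (induction i) (auto simp: w T_def inv)
  have ev_W: "ev p \<in> W" for p
    unfolding ev_def by (intro tuple.subspace_sum W tuple.subspace_scale T_W)
  have ev_root: "ev ([:- c, 1:] * q) = T (ev q) - tuple_scale c (ev q)" for c q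
  proof -
    define N where "N = Suc (degree q)"
    have deg: "degree ([:- c, 1:] * q) \<le> N" "degree q \<le> N"
      using degree_mult_le[of "[:- c, 1:]" q] by (auto simp: N_def)
    have "ev ([:- c, 1:] * q) = (\<Sum>i\<le>N. tuple_scale (coeff (pCons 0 q) i) ((T ^^ i) w))
        - (\<Sum>i\<le>N. tuple_scale (c * coeff q i) ((T ^^ i) w))"
      unfolding ev_ge[OF deg(1)] sum_subtractf[symmetric]
      by (intro sum.cong) (auto simp: tuple.scale_left_diff_distrib[symmetric])
    also have "(\<Sum>i\<le>N. tuple_scale (coeff (pCons 0 q) i) ((T ^^ i) w))
        = (\<Sum>i\<le>degree q. tuple_scale (coeff q i) ((T ^^ Suc i) w))"
      by (simp add: N_def sum.atMost_Suc_shift del: sum.atMost_Suc funpow.simps)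
    also have "\<dots> = T (ev q)"
      by (simp add: ev_def T_def mat_apply_sum mat_apply_scale)
    also have "(\<Sum>i\<le>N. tuple_scale (c * coeff q i) ((T ^^ i) w)) = tuple_scale c (ev q)"
      by (simp add: ev_ge[OF deg(2)] tuple.scale_sum_right)
    finally show ?thesis .
  qed
  have "\<exists>p. p \<noteq> 0 \<and> ev p = 0"
  proof (cases "inj_on (\<lambda>i. (T ^^ i) w) {..n}")
    case True
    let ?B = "(\<lambda>i. (T ^^ i) w) ` {..n}"
    have "card ?B = Suc n" using True by (simp add: card_image)
    then have "tuple.dependent ?B"
      using independent_tuples_card(2)[of ?B n] T_W W(2) by force
    from iffD1[OF tuple.dependent_finite[OF finite_imageI[OF finite_atMost]] this]
    obtain u v where u: "(\<Sum>x\<in>?B. tuple_scale (u x) x) = 0" "v \<in> ?B" "u v \<noteq> 0"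
      by blast
    define p where "p = (\<Sum>i\<le>n. monom (u ((T ^^ i) w)) i)"
    have coeff_p: "coeff p i = (if i \<le> n then u ((T ^^ i) w) else 0)" for i
      by (simp add: p_def coeff_sum)
    have "degree p \<le> n" by (rule degree_le) (simp add: coeff_p)
    then have "ev p = (\<Sum>x\<in>?B. tuple_scale (u x) x)"
      by (simp add: ev_ge coeff_p sum.reindex[OF True])
    moreover have "p \<noteq> 0" using u(2,3) by (auto simp: poly_eq_iff coeff_p)
    ultimately show ?thesis using u(1) by auto
  next
    case False
    then obtain i j where ij: "i < j" "(T ^^ i) w = (T ^^ j) w"
      by (auto simp: inj_on_def) (metis nat_neq_iff)
    define p :: "complex poly" where "p = monom 1 i - monom 1 j"
    have "degree p \<le> j" unfolding p_def
      using ij(1) by (intro degree_diff_le) (auto simp: degree_monom_eq)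
    then have "ev p = (\<Sum>k\<le>j. tuple_scale (of_bool (k = i)) ((T ^^ k) w) - tuple_scale (of_bool (k = j)) ((T ^^ k) w))"
      unfolding ev_ge[OF \<open>degree p \<le> j\<close>]
      by (intro sum.cong) (auto simp: p_def tuple.scale_left_diff_distrib[symmetric])
    also have "\<dots> = (\<Sum>k\<le>j. if k = i then (T ^^ k) w else 0) - (\<Sum>k\<le>j. if k = j then (T ^^ k) w else 0)"
      unfolding sum_subtractf[symmetric]
      by (intro sum.cong) (auto simp: tuple_scale_def fun_eq_iff)
    also have "\<dots> = 0" using ij by simp
    finally have "ev p = 0" .
    moreover have "coeff p i \<noteq> 0" using ij(1) by (simp add: p_def)
    then have "p \<noteq> 0" by auto
    ultimately show ?thesis by auto
  qed
  then obtain p where p: "p \<noteq> 0" "ev p = 0"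
    and least: "\<And>q. q \<noteq> 0 \<Longrightarrow> ev q = 0 \<Longrightarrow> degree p \<le> degree q"
    using ex_has_least_nat[of "\<lambda>p. p \<noteq> 0 \<and> ev p = 0" _ degree] by blast
  have "degree p \<noteq> 0"
  proof
    assume "degree p = 0"
    then obtain a where a: "p = [:a:]" by (rule degree_eq_zeroE)
    then have "tuple_scale a w = 0" using p(2) by (simp add: ev_def)
    with w(2) p(1) a show False by simp
  qed
  then obtain c where "poly p c = 0"
    using fundamental_theorem_of_algebra[of p] constant_degree[of p] by auto
  then obtain q where q: "p = [:- c, 1:] * q" by (auto simp: poly_eq_0_iff_dvd)
  with p(1) have "q \<noteq> 0" by auto
  have "degree p = Suc (degree q)" unfolding q using \<open>q \<noteq> 0\<close>
    by (subst degree_mult_eq) auto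
  with least[of q] \<open>q \<noteq> 0\<close> have "ev q \<noteq> 0" by auto
  moreover have "T (ev q) = tuple_scale c (ev q)"
    using p(2) ev_root[of c q] q by simp
  ultimately show ?thesis
    using ev_W[of q] by (auto simp: T_def)
qed

definition orthonormal :: "nat \<Rightarrow> nat \<Rightarrow> (nat \<Rightarrow> nat \<Rightarrow> complex) \<Rightarrow> bool"
  where "orthonormal n k v \<longleftrightarrow> (\<forall>m<k. v m \<in> tuples n) \<and>
    (\<forall>m<k. \<forall>l<k. tuple_inner n (v m) (v l) = of_bool (m = l))"

lemma orthonormal_independent:
  assumes "orthonormal n k v"
  shows "inj_on v {..<k}" "tuple.independent (v ` {..<k})"
proof -
  show inj: "inj_on v {..<k}"
  proof (rule inj_onI)
    fix m l assume ml: "m \<in> {..<k}" "l \<in> {..<k}" "v m = v l"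
    then have ml': "m < k" "l < k" by auto
    then have "tuple_inner n (v m) (v m) = of_bool (m = m)" "tuple_inner n (v m) (v l) = of_bool (m = l)"
      using assms unfolding orthonormal_def by blast+
    then show "m = l" using ml(3) by (cases "m = l") simp_all
  qed
  show "tuple.independent (v ` {..<k})"
  proof (rule tuple.independent_if_scalars_zero)
    fix f x assume *: "(\<Sum>x\<in>v ` {..<k}. tuple_scale (f x) x) = 0" "x \<in> v ` {..<k}"
    then obtain m where m: "m < k" "x = v m" by auto
    have "0 = tuple_inner n (v m) (\<Sum>l<k. tuple_scale (f (v l)) (v l))"
      using * by (simp add: sum.reindex[OF inj])
    also have "\<dots> = (\<Sum>l<k. f (v l) * of_bool (m = l))"
      using assms m by (auto simp: tuple_inner_sum tuple_inner_scale orthonormal_def intro!: sum.cong)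
    also have "\<dots> = f (v m)" using m by simp
    finally show "f x = 0" using m by simp
  qed simp
qed

lemma orthonormal_le:
  assumes "orthonormal n k v"
  shows "k \<le> n"
  using independent_tuples_card(2)[of "v ` {..<k}" n] orthonormal_independent[OF assms] assms
  by (auto simp: orthonormal_def card_image)

lemma normalize_tuple:
  assumes "w \<in> tuples n" "w \<noteq> 0"
  shows "\<exists>c. c \<noteq> 0 \<and> tuple_inner n (tuple_scale c w) (tuple_scale c w) = 1"
proof -
  define r where "r = (\<Sum>j<n. (cmod (w j))\<^sup>2)"
  have r: "r > 0" using tuple_inner_self_pos[OF assms] by (simp add: r_def)
  define c where "c = complex_of_real (1 / sqrt r)"
  have "tuple_inner n (tuple_scale c w) w = cnj c * of_real r"
    unfolding tuple_inner_commute[of n "tuple_scale c w"] tuple_inner_scale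
    by (simp add: tuple_inner_self r_def)
  then have "tuple_inner n (tuple_scale c w) (tuple_scale c w) = c * cnj c * of_real r"
    by (simp add: tuple_inner_scale)
  also have "\<dots> = of_real (1 / sqrt r * (1 / sqrt r) * r)"
    unfolding c_def complex_cnj_complex_of_real of_real_mult by (rule refl)
  also have "1 / sqrt r * (1 / sqrt r) * r = 1" using r by (simp add: field_simps)
  finally show ?thesis using r by (intro exI[of _ c]) (simp add: c_def)
qed

lemma orthonormal_extend:
  assumes v: "orthonormal n k v" and w: "w \<in> tuples n" "w \<noteq> 0"
    and orth: "\<And>m. m < k \<Longrightarrow> tuple_inner n (v m) w = 0"
  shows "\<exists>c. c \<noteq> 0 \<and> orthonormal n (Suc k) (v(k := tuple_scale c w))"
proof -
  obtain c where c: "c \<noteq> 0" "tuple_inner n (tuple_scale c w) (tuple_scale c w) = 1"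
    using normalize_tuple[OF w] by auto
  have "orthonormal n (Suc k) (v(k := tuple_scale c w))"
    unfolding orthonormal_def
    using v w orth c subspace_tuples[of n]
    by (auto simp: orthonormal_def less_Suc_eq tuple_inner_scale tuple.subspace_scale
        tuple_inner_commute[of n "tuple_scale c w"])
  with c show ?thesis by auto
qed

lemma hermitian_inner:
  assumes "\<forall>i<n. \<forall>j<n. q j i = cnj (q i j)"
  shows "tuple_inner n v (mat_apply n q w) = tuple_inner n (mat_apply n q v) w"
proof -
  have "tuple_inner n v (mat_apply n q w) = (\<Sum>i<n. \<Sum>j<n. cnj (v i) * (q i j * w j))"
    by (simp add: tuple_inner_def mat_apply_def sum_distrib_left)
  also have "\<dots> = (\<Sum>j<n. \<Sum>i<n. cnj (v i) * (q i j * w j))"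
    by (rule sum.swap)
  also have "\<dots> = (\<Sum>j<n. \<Sum>i<n. cnj (q j i) * cnj (v i) * w j)"
  proof (intro sum.cong refl)
    fix i j assume "j \<in> {..<n}" "i \<in> {..<n}"
    then have "q i j = cnj (q j i)" using assms by blast
    then show "cnj (v i) * (q i j * w j) = cnj (q j i) * cnj (v i) * w j" by simp
  qed
  also have "\<dots> = tuple_inner n (mat_apply n q v) w"
    by (simp add: tuple_inner_def mat_apply_def sum_distrib_right)
  finally show ?thesis .
qed

text \<open>The orthogonal complement of the eigenvectors found so far is invariant under a hermitian matrix
  and hence contains a further eigenvector, until there are \<open>n\<close> of them.\<close>
lemma spectral_theorem:
  assumes herm: "\<forall>i<n. \<forall>j<n. q j i = cnj (q i j)"
  obtains v d where "orthonormal n n v"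
    "\<And>m. m < n \<Longrightarrow> mat_apply n q (v m) = tuple_scale (d m) (v m)"
    "\<And>i j. i < n \<Longrightarrow> j < n \<Longrightarrow> (\<Sum>m<n. v m i * cnj (v m j)) = of_bool (i = j)"
    "\<And>i j. i < n \<Longrightarrow> j < n \<Longrightarrow> q i j = (\<Sum>m<n. v m i * d m * cnj (v m j))"
proof -
  have "\<exists>v d. orthonormal n k v \<and> (\<forall>m<k. mat_apply n q (v m) = tuple_scale (d m) (v m))" if "k \<le> n" for k
    using that
  proof (induction k)
    case 0
    then show ?case by (auto simp: orthonormal_def)
  next
    case (Suc k)
    then obtain v d where v: "orthonormal n k v" "\<forall>m<k. mat_apply n q (v m) = tuple_scale (d m) (v m)"
      by auto
    define W where "W = {w \<in> tuples n. \<forall>m<k. tuple_inner n (v m) w = 0}"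
    have W: "tuple.subspace W" "W \<subseteq> tuples n"
      using subspace_tuples[of n]
      by (auto simp: W_def tuple.subspace_def tuple_inner_add tuple_inner_scale)
    have inv: "mat_apply n q x \<in> W" if "x \<in> W" for x
    proof -
      have "tuple_inner n (v m) (mat_apply n q x) = 0" if m: "m < k" for m
      proof -
        have "tuple_inner n (v m) (mat_apply n q x) = tuple_inner n (mat_apply n q (v m)) x"
          by (rule hermitian_inner[OF herm])
        also have "\<dots> = cnj (d m) * tuple_inner n (v m) x"
          using v(2) m by (simp add: tuple_inner_commute[of n "tuple_scale _ _"] tuple_inner_scale
              tuple_inner_commute[of n "v m"])
        finally show ?thesis using \<open>x \<in> W\<close> m by (simp add: W_def)
      qed
      then show ?thesis by (simp add: W_def)
    qed
    have "\<not> tuples n \<subseteq> tuple.span (v ` {..<k})"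
    proof
      assume *: "tuples n \<subseteq> tuple.span (v ` {..<k})"
      have unit: "orthonormal n n unit_tuple"
        by (auto simp: orthonormal_def tuple_inner_def unit_tuple_def tuples_def)
      note unit_independent = orthonormal_independent[OF unit]
      have "card (unit_tuple ` {..<n}) \<le> card (v ` {..<k})"
        using * unit_independent(2) by (intro conjunct2[OF tuple.independent_span_bound]) auto
      also have "\<dots> \<le> k" using card_image_le[of "{..<k}" v] by simp
      finally show False using Suc.prems unit_independent(1) by (simp add: card_image)
    qed
    then obtain z where "z \<in> tuples n" "z \<notin> tuple.span (v ` {..<k})" by auto
    from orthogonal_vector_exists[OF tuple.subspace_span this]
    obtain y where y: "y \<in> tuples n" "y \<noteq> 0"
      "\<forall>w\<in>tuple.span (v ` {..<k}) \<inter> tuples n. tuple_inner n y w = 0" by auto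
    have "tuple_inner n (v m) y = 0" if "m < k" for m
    proof -
      have "v m \<in> tuple.span (v ` {..<k}) \<inter> tuples n"
        using that v(1) by (auto simp: orthonormal_def intro: tuple.span_base)
      then show ?thesis using y(3) by (simp add: tuple_inner_commute[of n "v m"])
    qed
    then have "y \<in> W" using y by (simp add: W_def)
    from eigenvector_exists[OF W this y(2) inv]
    obtain w e where w: "w \<in> W" "w \<noteq> 0" "mat_apply n q w = tuple_scale e w" by auto
    then obtain c where c: "orthonormal n (Suc k) (v(k := tuple_scale c w))"
      using orthonormal_extend[OF v(1), of w] by (auto simp: W_def)
    have "mat_apply n q (tuple_scale c w) = tuple_scale e (tuple_scale c w)"
      by (simp add: mat_apply_scale w mult.commute)
    then have "\<forall>m<Suc k. mat_apply n q ((v(k := tuple_scale c w)) m)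
        = tuple_scale ((d(k := e)) m) ((v(k := tuple_scale c w)) m)"
      using v(2) by (simp add: less_Suc_eq)
    with c show ?case by blast
  qed
  from this[OF order_refl] obtain v d where v: "orthonormal n n v"
    and d: "\<forall>m<n. mat_apply n q (v m) = tuple_scale (d m) (v m)" by blast
  have expand: "(\<Sum>m<n. tuple_scale (cnj (v m j)) (v m)) = unit_tuple j" if j: "j < n" for j
  proof (rule ccontr)
    define z where "z = unit_tuple j - (\<Sum>m<n. tuple_scale (cnj (v m j)) (v m))"
    assume "(\<Sum>m<n. tuple_scale (cnj (v m j)) (v m)) \<noteq> unit_tuple j"
    then have "z \<noteq> 0" by (simp add: z_def)
    moreover have "z \<in> tuples n" unfolding z_def
      using j v by (intro tuple.subspace_diff subspace_tuples tuple.subspace_sum tuple.subspace_scale)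
        (auto simp: orthonormal_def)
    moreover have "tuple_inner n (v m) z = 0" if m: "m < n" for m
    proof -
      have "tuple_inner n (v m) (\<Sum>m<n. tuple_scale (cnj (v m j)) (v m)) = (\<Sum>l<n. cnj (v l j) * of_bool (m = l))"
        using v m by (auto simp: tuple_inner_sum tuple_inner_scale orthonormal_def intro!: sum.cong)
      also have "\<dots> = tuple_inner n (v m) (unit_tuple j)"
        using m j by (simp add: tuple_inner_def unit_tuple_def)
      finally show ?thesis
        using tuple_inner_add[of n "v m" z "\<Sum>m<n. tuple_scale (cnj (v m j)) (v m)"] by (simp add: z_def)
    qed
    ultimately obtain c where "orthonormal n (Suc n) (v(n := tuple_scale c z))"
      using orthonormal_extend[OF v] by metis
    then show False using orthonormal_le by fastforce
  qed
  show ?thesis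
  proof
    show "orthonormal n n v" by fact
    show "mat_apply n q (v m) = tuple_scale (d m) (v m)" if "m < n" for m using d that by simp
    fix i j assume ij: "i < n" "j < n"
    have "(\<Sum>m<n. tuple_scale (cnj (v m j)) (v m)) i = unit_tuple j i"
      by (simp add: expand ij)
    then show "(\<Sum>m<n. v m i * cnj (v m j)) = of_bool (i = j)"
      by (simp add: tuple_sum_apply tuple_scale_def unit_tuple_def mult.commute)
    have "q i j = mat_apply n q (unit_tuple j) i"
      using ij by (simp add: mat_apply_unit)
    also have "\<dots> = (\<Sum>m<n. tuple_scale (cnj (v m j)) (mat_apply n q (v m))) i"
      by (simp add: expand[OF ij(2), symmetric] mat_apply_sum mat_apply_scale)
    also have "\<dots> = (\<Sum>m<n. v m i * d m * cnj (v m j))"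
      using d by (auto simp: tuple_sum_apply tuple_scale_def mult_ac intro!: sum.cong)
    finally show "q i j = (\<Sum>m<n. v m i * d m * cnj (v m j))" .
  qed
qed

section \<open>Bilinear maps on the coproduct\<close>

context star_algebra
begin

lemma functionalI:
  assumes "\<And>a b. f (a + b) = f a + f b" "\<And>c a. f (scl A c a) = c * f a"
  shows "functional A f"
  by (unfold_locales) (use assms in \<open>simp_all add: algebra_simps\<close>)

lemma functional_eqI:
  assumes "\<And>f. functional A f \<Longrightarrow> f a = f b"
  shows "a = b"
proof (rule ccontr)
  assume "a \<noteq> b"
  then obtain f where f: "functional A f" "f (a - b) = 1"
    using separating_functional[of "{0}" "a - b"] subspace_single_0 by auto
  interpret f: Vector_Spaces.linear "scl A" "(*)" f by fact
  show False using f assms[OF f(1)] by (simp add: f.diff)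
qed

lemma linear_intro:
  assumes "vector_space s2" "\<And>a b. f (a + b) = f a + f b" "\<And>c a. f (scl A c a) = s2 c (f a)"
  shows "Vector_Spaces.linear (scl A) s2 f"
  using assms vector_space_axioms
  by (simp add: Vector_Spaces.linear_def module_hom_def module_hom_axioms_def module_iff_vector_space)

lemmas self_vector_space = vector_space_axioms

lemma star_sum: "star A (\<Sum>x\<in>S. f x) = (\<Sum>x\<in>S. star A (f x))"
proof (induction S rule: infinite_finite_induct)
  have "star A 0 = 0"
    using star_scl[of 0 0] by simp
  {
    case (infinite S)
    then show ?case using \<open>star A 0 = 0\<close> by simp
  next
    case empty
    then show ?case using \<open>star A 0 = 0\<close> by simp
  }
qed (simp add: star_add)

lemma star_one: "star A 1 = 1"
  by (metis mult_1 mult_1_right star_mult star_star)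

lemma star_of_bool: "star A (of_bool b) = of_bool b"
proof -
  have "star A 0 = 0" using star_scl[of 0 0] by simp
  then show ?thesis by (simp add: star_one)
qed

end

lemma complex_vector_space: "vector_space ((*) :: complex \<Rightarrow> complex \<Rightarrow> complex)"
  by unfold_locales (simp_all add: algebra_simps)

definition bilinear_map :: "('a::ring_1, 'm) star_alg_scheme \<Rightarrow> (complex \<Rightarrow> 'b::ab_group_add \<Rightarrow> 'b) \<Rightarrow> ('a \<Rightarrow> 'a \<Rightarrow> 'b) \<Rightarrow> bool"
  where "bilinear_map A s B \<longleftrightarrow> (\<forall>a. Vector_Spaces.linear (scl A) s (\<lambda>x. B x a)) \<and>
    (\<forall>a. Vector_Spaces.linear (scl A) s (B a))"

text \<open>Equality of tensors is defined by complex-valued bilinear forms; composing with functionals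
  extends it to bilinear maps into any complex vector space.\<close>

lemma (in star_algebra) tensor2_eq_bilinear:
  fixes s :: "complex \<Rightarrow> 'b::ab_group_add \<Rightarrow> 'b"
  assumes eq: "tensor2_eq A xs ys" and B: "bilinear_map A s B"
  shows "(\<Sum>(x, y)\<leftarrow>xs. B x y) = (\<Sum>(x, y)\<leftarrow>ys. B x y)"
proof -
  interpret target: vector_space s
    using B by (simp add: bilinear_map_def Vector_Spaces.linear_def)
  show ?thesis
  proof (rule ccontr)
    assume neq: "\<not> ?thesis"
    define d where "d = (\<Sum>(x, y)\<leftarrow>xs. B x y) - (\<Sum>(x, y)\<leftarrow>ys. B x y)"
    have "d \<notin> {0}" using neq by (simp add: d_def)
    then obtain f where f: "Vector_Spaces.linear s (*) f" "f d = 1"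
      using target.separating_functional[of "{0}" d] target.subspace_single_0 by auto
    interpret f: Vector_Spaces.linear s "(*)" f by fact
    have sum: "f (\<Sum>(x, y)\<leftarrow>zs. B x y) = (\<Sum>(x, y)\<leftarrow>zs. f (B x y))" for zs
      by (induction zs) (auto simp: f.add f.zero)
    have "functional A (\<lambda>x. f (B x a))" "functional A (\<lambda>x. f (B a x))" for a
    proof -
      interpret l: Vector_Spaces.linear "scl A" s "\<lambda>x. B x a" using B by (simp add: bilinear_map_def)
      interpret r: Vector_Spaces.linear "scl A" s "B a" using B by (simp add: bilinear_map_def)
      show "functional A (\<lambda>x. f (B x a))" "functional A (\<lambda>x. f (B a x))"
        by (intro functionalI; simp add: l.add l.scale r.add r.scale f.add f.scale)+
    qed
    then have "(\<Sum>(x, y)\<leftarrow>xs. f (B x y)) = (\<Sum>(x, y)\<leftarrow>ys. f (B x y))"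
      using eq unfolding tensor2_eq_def by (elim allE[of _ "\<lambda>x y. f (B x y)"]) auto
    then have "f d = 0" by (simp add: d_def f.diff sum)
    with f(2) show False by simp
  qed
qed

text \<open>The Sweedler sum of \<open>B a\<^sub>1 a\<^sub>2\<close>, computed from the list that represents the coproduct. It is
  independent of the representing list when \<open>B\<close> is bilinear.\<close>
definition comult_map :: "('a::ring_1, 'i, 'm) cqg_scheme \<Rightarrow> ('a \<Rightarrow> 'a \<Rightarrow> 'b::monoid_add) \<Rightarrow> 'a \<Rightarrow> 'b"
  where "comult_map G B a = (\<Sum>(x, y)\<leftarrow>comult G a. B x y)"

lemma sum_list_products:
  "(\<Sum>(x, y)\<leftarrow>[(x * x', y * y'). (x, y) \<leftarrow> xs, (x', y') \<leftarrow> ys]. B x y) =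
    (\<Sum>(x, y)\<leftarrow>xs. \<Sum>(x', y')\<leftarrow>ys. B (x * x') (y * y'))"
  for B :: "_ \<Rightarrow> _ \<Rightarrow> 'b::monoid_add"
  by (induction xs) (auto simp: case_prod_unfold comp_def)

context hopf_star_algebra
begin

lemma comult_map_linear:
  fixes s :: "complex \<Rightarrow> 'b::ab_group_add \<Rightarrow> 'b"
  assumes B: "bilinear_map G s B"
  shows "Vector_Spaces.linear (scl G) s (comult_map G B)"
proof -
  have vs: "vector_space s"
    using B by (simp add: bilinear_map_def Vector_Spaces.linear_def)
  interpret target: vector_space s by fact
  show ?thesis
  proof (rule linear_intro[OF vs])
    show "comult_map G B (a + b) = comult_map G B a + comult_map G B b" for a b
      using tensor2_eq_bilinear[OF comult_add B] by (simp add: comult_map_def)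
    fix c a
    have "s c (\<Sum>(x, y)\<leftarrow>xs. B x y) = (\<Sum>(x, y)\<leftarrow>[(scl G c x, y). (x, y) \<leftarrow> xs]. B x y)" for xs
    proof (induction xs)
      case (Cons p xs)
      obtain x y where p: "p = (x, y)" by force
      interpret l: Vector_Spaces.linear "scl G" s "\<lambda>x. B x y" using B by (simp add: bilinear_map_def)
      show ?case using Cons p by (simp add: target.scale_right_distrib l.scale)
    qed simp
    then show "comult_map G B (scl G c a) = s c (comult_map G B a)"
      using tensor2_eq_bilinear[OF comult_scl B] by (simp add: comult_map_def)
  qed
qed

lemma comult_map_one: "bilinear_map G s B \<Longrightarrow> comult_map G B 1 = B 1 1"
  using tensor2_eq_bilinear[OF comult_one, of s B] by (simp add: comult_map_def)

lemma comult_map_mult: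
  "bilinear_map G s B \<Longrightarrow> comult_map G B (a * b) =
    (\<Sum>(x, y)\<leftarrow>comult G a. \<Sum>(x', y')\<leftarrow>comult G b. B (x * x') (y * y'))"
  using tensor2_eq_bilinear[OF comult_mult, of s B]
  by (simp add: comult_map_def sum_list_products)

lemma comult_map_star:
  "bilinear_map G s B \<Longrightarrow> comult_map G B (star G a) = (\<Sum>(x, y)\<leftarrow>comult G a. B (star G x) (star G y))"
  using tensor2_eq_bilinear[OF comult_star, of s B]
  by (simp add: comult_map_def case_prod_unfold comp_def)

lemma comult_map_corep:
  assumes "bilinear_map G s B" "fd_corep G n u" "i < n" "j < n"
  shows "comult_map G B (u i j) = (\<Sum>k<n. B (u i k) (u k j))"
proof -
  have "tensor2_eq G (comult G (u i j)) [(u i k, u k j). k \<leftarrow> [0..<n]]"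
    using assms by (simp add: fd_corep_def)
  from tensor2_eq_bilinear[OF this assms(1)]
  have "comult_map G B (u i j) = (\<Sum>(x, y)\<leftarrow>[(u i k, u k j). k \<leftarrow> [0..<n]]. B x y)"
    by (simp add: comult_map_def)
  also have "\<dots> = (\<Sum>k\<leftarrow>[0..<n]. B (u i k) (u k j))"
    by (simp add: comp_def)
  finally show ?thesis by (simp add: interv_sum_list_conv_sum_set_nat atLeast0LessThan)
qed

lemma counit_corep: "fd_corep G n u \<Longrightarrow> i < n \<Longrightarrow> j < n \<Longrightarrow> counit G (u i j) = of_bool (i = j)"
  by (simp add: fd_corep_def)

lemma bilinear_mapI:
  assumes "vector_space s"
    "\<And>x x' y. B (x + x') y = B x y + B x' y" "\<And>c x y. B (scl G c x) y = s c (B x y)"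
    "\<And>x y y'. B x (y + y') = B x y + B x y'" "\<And>c x y. B x (scl G c y) = s c (B x y)"
  shows "bilinear_map G s B"
  unfolding bilinear_map_def using assms by (auto intro!: linear_intro)

text \<open>The antipode axiom provides a left inverse of the matrix \<open>z\<close>, which coincides with any right
  inverse. The index set is arbitrary in order to cover products of corepresentations, which are
  indexed by pairs.\<close>
lemma antipode_inverse:
  assumes comult: "\<And>B :: 'a \<Rightarrow> 'a \<Rightarrow> 'a. \<And>i j. bilinear_map G (scl G) B \<Longrightarrow> i \<in> I \<Longrightarrow> j \<in> I \<Longrightarrow>
      comult_map G B (z i j) = (\<Sum>k\<in>I. B (z i k) (z k j))"
    and counit: "\<And>i j. i \<in> I \<Longrightarrow> j \<in> I \<Longrightarrow> counit G (z i j) = of_bool (i = j)"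
    and inverse: "\<And>i j. i \<in> I \<Longrightarrow> j \<in> I \<Longrightarrow> (\<Sum>k\<in>I. z i k * y k j) = of_bool (i = j)"
    and I: "finite I" "i \<in> I" "j \<in> I"
  shows "antipode G (z i j) = y i j"
proof -
  interpret S: Vector_Spaces.linear "scl G" "scl G" "antipode G" by (rule antipode_linear)
  have bil: "bilinear_map G (scl G) (\<lambda>x y. antipode G x * y)"
    by (rule bilinear_mapI[OF self_vector_space])
      (simp_all add: S.add S.scale algebra_simps flip: scl_mult_left scl_mult_right)
  have left: "(\<Sum>k\<in>I. antipode G (z i k) * z k l) = scl G (of_bool (i = l)) 1" if "l \<in> I" for l
    using comult[OF bil I(2) that] antipode_left[of "z i l"] counit[OF I(2) that]
    by (simp add: comult_map_def)
  have "antipode G (z i j) = (\<Sum>k\<in>I. antipode G (z i k) * of_bool (k = j))"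
    using I by (simp add: if_distrib[of "\<lambda>x. _ * x"] of_bool_def cong: if_cong)
  also have "\<dots> = (\<Sum>k\<in>I. \<Sum>l\<in>I. antipode G (z i k) * z k l * y l j)"
    using inverse I(3) by (simp add: sum_distrib_left[symmetric] mult.assoc)
  also have "\<dots> = (\<Sum>l\<in>I. (\<Sum>k\<in>I. antipode G (z i k) * z k l) * y l j)"
    unfolding sum_distrib_right by (rule sum.swap)
  also have "\<dots> = (\<Sum>l\<in>I. if i = l then y l j else 0)"
    using left by (intro sum.cong) (auto simp: scl_mult_left[symmetric])
  also have "\<dots> = y i j" using I by simp
  finally show ?thesis .
qed

lemma antipode_unitary:
  assumes "fd_corep G n u" "unitary_matrix G n u" "i < n" "j < n"
  shows "antipode G (u i j) = star G (u j i)"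
proof (rule antipode_inverse[where I = "{..<n}" and z = u and y = "\<lambda>i j. star G (u j i)"])
  show "comult_map G B (u i j) = (\<Sum>k\<in>{..<n}. B (u i k) (u k j))"
    if "bilinear_map G (scl G) B" "i \<in> {..<n}" "j \<in> {..<n}" for B i j
    using comult_map_corep[OF that(1) assms(1)] that by simp
qed (use assms in \<open>auto simp: unitary_matrix_def counit_corep\<close>)

lemma conv_bilinear:
  assumes "functional G f"
  shows "bilinear_map G (scl G) (\<lambda>x y. scl G (f y) x)" "bilinear_map G (scl G) (\<lambda>x y. scl G (f x) y)"
proof -
  interpret f: Vector_Spaces.linear "scl G" "(*)" f by fact
  show "bilinear_map G (scl G) (\<lambda>x y. scl G (f y) x)" "bilinear_map G (scl G) (\<lambda>x y. scl G (f x) y)"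
    by (intro bilinear_mapI[OF self_vector_space];
        simp add: f.add f.scale scale_left_distrib scale_right_distrib mult.commute)+
qed

lemma form_bilinear:
  assumes "functional G f" "functional G g"
  shows "bilinear_map G (*) (\<lambda>x y. f x * g y)"
proof -
  interpret f: Vector_Spaces.linear "scl G" "(*)" f by fact
  interpret g: Vector_Spaces.linear "scl G" "(*)" g by fact
  show ?thesis
    by (intro bilinear_mapI[OF complex_vector_space];
        simp add: f.add f.scale g.add g.scale algebra_simps)
qed

end

section \<open>Irreducible corepresentations: Schur's lemma\<close>

lemma invariant_subspace_iff:
  "invariant_subspace G n u W \<longleftrightarrow> tuple.subspace W \<and> W \<subseteq> tuples n \<and>
    (\<forall>f. functional G f \<longrightarrow> (\<forall>w\<in>W. mat_apply n (\<lambda>i j. f (u i j)) w \<in> W))"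
  unfolding invariant_subspace_def tuple.subspace_def tuples_def mat_apply_def tuple_scale_def
    plus_fun_def zero_fun_def by auto

lemma irreducible_corep_iff:
  "irreducible_corep G n u \<longleftrightarrow> fd_corep G n u \<and> n > 0 \<and>
    (\<forall>W. invariant_subspace G n u W \<longrightarrow> W = {0} \<or> W = tuples n)"
  unfolding irreducible_corep_def tuples_def zero_fun_def by auto

definition rect_apply :: "nat \<Rightarrow> nat \<Rightarrow> (nat \<Rightarrow> nat \<Rightarrow> complex) \<Rightarrow> (nat \<Rightarrow> complex) \<Rightarrow> nat \<Rightarrow> complex"
  where "rect_apply m n t w = (\<lambda>i. if i < m then \<Sum>j<n. t i j * w j else 0)"

lemma rect_apply_in [simp]: "rect_apply m n t w \<in> tuples m"
  by (auto simp: rect_apply_def tuples_def)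

lemma rect_apply_add: "rect_apply m n t (v + w) = rect_apply m n t v + rect_apply m n t w"
  by (auto simp: rect_apply_def fun_eq_iff algebra_simps sum.distrib)

lemma rect_apply_scale: "rect_apply m n t (tuple_scale c w) = tuple_scale c (rect_apply m n t w)"
  by (auto simp: rect_apply_def tuple_scale_def fun_eq_iff algebra_simps sum_distrib_left)

lemma rect_apply_zero: "rect_apply m n t 0 = 0"
  by (auto simp: rect_apply_def fun_eq_iff)

lemma rect_apply_unit: "j < n \<Longrightarrow> i < m \<Longrightarrow> rect_apply m n t (unit_tuple j) i = t i j"
  by (simp add: rect_apply_def unit_tuple_def)

lemma rect_apply_mat_apply:
  assumes "\<And>i j. i < m \<Longrightarrow> j < n \<Longrightarrow> (\<Sum>k<n. t i k * x k j) = (\<Sum>k<m. y i k * t k j)"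
  shows "rect_apply m n t (mat_apply n x w) = mat_apply m y (rect_apply m n t w)"
proof
  fix i
  have "(\<Sum>k<n. t i k * (\<Sum>j<n. x k j * w j)) = (\<Sum>k<m. y i k * (\<Sum>j<n. t k j * w j))" if "i < m"
  proof -
    have "(\<Sum>k<n. t i k * (\<Sum>j<n. x k j * w j)) = (\<Sum>j<n. (\<Sum>k<n. t i k * x k j) * w j)"
      unfolding sum_distrib_left sum_distrib_right by (subst sum.swap) (simp add: mult.assoc)
    also have "\<dots> = (\<Sum>j<n. (\<Sum>k<m. y i k * t k j) * w j)"
      using assms that by simp
    also have "\<dots> = (\<Sum>k<m. y i k * (\<Sum>j<n. t k j * w j))"
      unfolding sum_distrib_left sum_distrib_right by (subst sum.swap) (simp add: mult.assoc)
    finally show ?thesis .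
  qed
  then show "rect_apply m n t (mat_apply n x w) i = mat_apply m y (rect_apply m n t w) i"
    by (simp add: rect_apply_def mat_apply_def)
qed

definition intertwiner ::
    "('a::ring_1, 'm) star_alg_scheme \<Rightarrow> nat \<Rightarrow> (nat \<Rightarrow> nat \<Rightarrow> 'a) \<Rightarrow> nat \<Rightarrow> (nat \<Rightarrow> nat \<Rightarrow> 'a) \<Rightarrow> (nat \<Rightarrow> nat \<Rightarrow> complex) \<Rightarrow> bool"
  where "intertwiner A n u m v t \<longleftrightarrow> (\<forall>i<m. \<forall>j<n.
    (\<Sum>k<n. scl A (t i k) (u k j)) = (\<Sum>k<m. scl A (t k j) (v i k)))"

context star_algebra
begin

lemma intertwinerI:
  assumes "\<And>f i j. functional A f \<Longrightarrow> i < m \<Longrightarrow> j < n \<Longrightarrow>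
    (\<Sum>k<n. t i k * f (u k j)) = (\<Sum>k<m. t k j * f (v i k))"
  shows "intertwiner A n u m v t"
  unfolding intertwiner_def
proof (intro allI impI functional_eqI)
  fix i j f assume *: "i < m" "j < n" "functional A f"
  then interpret f: Vector_Spaces.linear "scl A" "(*)" f by simp
  show "f (\<Sum>k<n. scl A (t i k) (u k j)) = f (\<Sum>k<m. scl A (t k j) (v i k))"
    using assms * by (simp add: f.sum f.scale)
qed

lemma intertwinerD:
  assumes "intertwiner A n u m v t" "functional A f" "i < m" "j < n"
  shows "(\<Sum>k<n. t i k * f (u k j)) = (\<Sum>k<m. f (v i k) * t k j)"
proof -
  interpret f: Vector_Spaces.linear "scl A" "(*)" f by fact
  have "(\<Sum>k<n. scl A (t i k) (u k j)) = (\<Sum>k<m. scl A (t k j) (v i k))"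
    using assms by (simp add: intertwiner_def)
  from arg_cong[OF this, of f] show ?thesis by (simp add: f.sum f.scale mult.commute)
qed

end

lemma kernel_subspace: "tuple.subspace {w \<in> tuples n. rect_apply m n t w = 0}"
  using subspace_tuples[of n]
  by (auto simp: tuple.subspace_def rect_apply_add rect_apply_scale rect_apply_zero)

lemma image_subspace: "tuple.subspace (rect_apply m n t ` tuples n)"
  unfolding tuple.subspace_def
proof (intro conjI allI ballI)
  show "0 \<in> rect_apply m n t ` tuples n"
    using subspace_tuples[of n] by (auto simp: tuple.subspace_def intro!: image_eqI[of _ _ 0] rect_apply_zero[symmetric])
  show "x + y \<in> rect_apply m n t ` tuples n"
    if "x \<in> rect_apply m n t ` tuples n" "y \<in> rect_apply m n t ` tuples n" for x y
    using that subspace_tuples[of n] by (auto simp: tuple.subspace_def rect_apply_add[symmetric])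
  show "tuple_scale c x \<in> rect_apply m n t ` tuples n" if "x \<in> rect_apply m n t ` tuples n" for c x
    using that subspace_tuples[of n] by (auto simp: tuple.subspace_def rect_apply_scale[symmetric])
qed

context compact_quantum_group
begin

lemma kernel_invariant:
  assumes "intertwiner G n u m v t"
  shows "invariant_subspace G n u {w \<in> tuples n. rect_apply m n t w = 0}"
proof -
  have "rect_apply m n t (mat_apply n (\<lambda>i j. f (u i j)) w) = 0"
    if "functional G f" "rect_apply m n t w = 0" for f w
    using rect_apply_mat_apply[of m n t "\<lambda>i j. f (u i j)" "\<lambda>i j. f (v i j)" w]
      intertwinerD[OF assms that(1)] that(2) by (simp add: mat_apply_zero)
  then show ?thesis by (auto simp: invariant_subspace_iff kernel_subspace)
qed

lemma image_invariant:
  assumes "intertwiner G n u m v t"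
  shows "invariant_subspace G m v (rect_apply m n t ` tuples n)"
proof -
  have "mat_apply m (\<lambda>i j. f (v i j)) (rect_apply m n t w) \<in> rect_apply m n t ` tuples n"
    if "functional G f" for f w
    by (rule image_eqI, rule rect_apply_mat_apply[symmetric])
      (use intertwinerD[OF assms that] in simp_all)
  then show ?thesis by (auto simp: invariant_subspace_iff image_subspace)
qed

text \<open>Kernel and image of an intertwiner are invariant, so that a non-zero intertwiner between
  irreducible corepresentations is bijective.\<close>
theorem schur:
  assumes u: "irreducible_corep G n u" and v: "irreducible_corep G m v"
    and t: "intertwiner G n u m v t" and nz: "i < m" "j < n" "t i j \<noteq> 0"
  shows "equivalent_coreps G n u m v"
proof -
  have unit: "rect_apply m n t (unit_tuple j) \<noteq> 0"
    using rect_apply_unit[OF nz(2,1), of t] nz(3) by auto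
  have ker: "{w \<in> tuples n. rect_apply m n t w = 0} = {0}"
  proof -
    have "unit_tuple j \<notin> {w \<in> tuples n. rect_apply m n t w = 0}" "unit_tuple j \<in> tuples n"
      using unit nz by auto
    then show ?thesis
      using u kernel_invariant[OF t] unfolding irreducible_corep_iff by blast
  qed
  have im: "rect_apply m n t ` tuples n = tuples m"
  proof -
    have "rect_apply m n t (unit_tuple j) \<in> rect_apply m n t ` tuples n" using nz by auto
    then have "rect_apply m n t ` tuples n \<noteq> {0}" using unit by blast
    then show ?thesis
      using v image_invariant[OF t] unfolding irreducible_corep_iff by blast
  qed
  have "\<forall>l. \<exists>w. l < m \<longrightarrow> w \<in> tuples n \<and> rect_apply m n t w = unit_tuple l"
    using im by (metis imageE unit_tuple_in)
  then obtain w where w: "\<And>l. l < m \<Longrightarrow> w l \<in> tuples n" "\<And>l. l < m \<Longrightarrow> rect_apply m n t (w l) = unit_tuple l"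
    by metis
  define s where "s = (\<lambda>k l. w l k)"
  have ts: "(\<Sum>k<n. t i k * s k l) = of_bool (i = l)" if "i < m" "l < m" for i l
    using fun_cong[OF w(2)[OF that(2)], of i] that by (simp add: rect_apply_def s_def unit_tuple_def)
  have st: "(\<Sum>l<m. s k l * t l j) = of_bool (k = j)" if kj: "k < n" "j < n" for k j
  proof -
    define x where "x = (\<lambda>k. (if k < n then \<Sum>l<m. s k l * t l j else 0) - unit_tuple j k)"
    have "x \<in> tuples n" using kj by (auto simp: x_def tuples_def unit_tuple_def)
    moreover have "rect_apply m n t x = 0"
    proof
      fix i
      have "(\<Sum>k<n. t i k * (\<Sum>l<m. s k l * t l j)) = t i j" if "i < m"
      proof -
        have "(\<Sum>k<n. t i k * (\<Sum>l<m. s k l * t l j)) = (\<Sum>l<m. (\<Sum>k<n. t i k * s k l) * t l j)"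
          unfolding sum_distrib_left sum_distrib_right by (subst sum.swap) (simp add: mult.assoc)
        also have "\<dots> = t i j" using ts that by simp
        finally show ?thesis .
      qed
      then show "rect_apply m n t x i = 0 i"
        using kj by (simp add: rect_apply_def x_def algebra_simps sum_subtractf unit_tuple_def)
    qed
    ultimately have "x = 0" using ker by auto
    then have "x k = 0" by simp
    then show ?thesis using kj by (simp add: x_def unit_tuple_def)
  qed
  have "complex_of_nat m = (\<Sum>i<m. \<Sum>k<n. t i k * s k i)" using ts by simp
  also have "\<dots> = (\<Sum>k<n. \<Sum>i<m. s k i * t i k)" by (subst sum.swap) (simp add: mult.commute)
  also have "\<dots> = complex_of_nat n" using st by simp
  finally have mn: "m = n" by simp
  show ?thesis unfolding equivalent_coreps_def
  proof (rule conjI[OF mn[symmetric]], rule exI[of _ t], rule exI[of _ s], intro allI impI conjI)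
    fix i j assume ij: "i < m" "j < m"
    show "(\<Sum>k<m. t i k * s k j) = of_bool (i = j)" using ts ij mn by simp
    show "(\<Sum>k<m. s i k * t k j) = of_bool (i = j)" using st ij mn by simp
    show "(\<Sum>k<m. scl G (t i k) (u k j)) = (\<Sum>k<m. scl G (t k j) (v i k))"
      using t ij mn by (simp add: intertwiner_def)
  qed
qed

text \<open>An eigenvalue is subtracted; what remains is an intertwiner with non-trivial kernel.\<close>
theorem schur_scalar:
  assumes u: "irreducible_corep G n u" and t: "intertwiner G n u n u t"
  obtains c where "\<And>i j. i < n \<Longrightarrow> j < n \<Longrightarrow> t i j = c * of_bool (i = j)"
proof -
  have n: "n > 0" using u by (simp add: irreducible_corep_iff)
  have "unit_tuple 0 \<noteq> 0"
    by (auto simp: unit_tuple_def fun_eq_iff)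
  then obtain v c where v: "v \<in> tuples n" "v \<noteq> 0" "mat_apply n t v = tuple_scale c v"
    using eigenvector_exists[OF subspace_tuples order_refl, of "unit_tuple 0" n t] n by auto
  define t' where "t' = (\<lambda>i j. t i j - c * of_bool (i = j))"
  have "intertwiner G n u n u t'"
  proof (rule intertwinerI)
    fix f i j assume *: "functional G f" "i < n" "j < n"
    have "(\<Sum>k<n. t i k * f (u k j)) = (\<Sum>k<n. t k j * f (u i k))"
      using intertwinerD[OF t *] by (simp add: mult.commute)
    then show "(\<Sum>k<n. t' i k * f (u k j)) = (\<Sum>k<n. t' k j * f (u i k))"
      using * by (simp add: t'_def algebra_simps sum_subtractf sum_distrib_left[symmetric])
  qed
  from kernel_invariant[OF this]
  have "{w \<in> tuples n. rect_apply n n t' w = 0} = {0} \<or> {w \<in> tuples n. rect_apply n n t' w = 0} = tuples n"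
    using u unfolding irreducible_corep_iff by blast
  moreover have "rect_apply n n t' v = 0"
  proof
    fix i
    have "(\<Sum>j<n. t i j * v j) = c * v i" if "i < n"
      using fun_cong[OF v(3), of i] that by (simp add: mat_apply_def tuple_scale_def)
    then show "rect_apply n n t' v i = 0 i"
      by (simp add: rect_apply_def t'_def algebra_simps sum_subtractf sum_distrib_left[symmetric])
  qed
  ultimately have "tuples n \<subseteq> {w \<in> tuples n. rect_apply n n t' w = 0}" using v by blast
  then have "t' i j = 0" if "i < n" "j < n" for i j
    using rect_apply_unit[OF that(2,1), of t'] unit_tuple_in[OF that(2)] by auto
  then show ?thesis using that[of c] by (simp add: t'_def)
qed

end

section \<open>The matrix elements of irreducible corepresentations form a basis\<close>

definition row_indices :: "('a::ring_1, 'i, 'm) cqg_scheme \<Rightarrow> ('i \<times> nat) set"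
  where "row_indices G = {(\<alpha>, i). \<alpha> \<in> Irr G \<and> i < dim_irr G \<alpha>}"

text \<open>A linear relation between matrix elements of the representatives, with the coefficients grouped
  into one vector for each row. The set of relations is then stable under the matrices obtained by
  applying functionals to the entries of the representatives.\<close>
definition row_relation ::
    "('a::ring_1, 'i, 'm) cqg_scheme \<Rightarrow> ('i \<times> nat) set \<Rightarrow> ('i \<times> nat \<Rightarrow> nat \<Rightarrow> complex) \<Rightarrow> bool"
  where "row_relation G J c \<longleftrightarrow> (\<forall>b. c b \<in> tuples (dim_irr G (fst b))) \<and> (\<forall>b. b \<notin> J \<longrightarrow> c b = 0) \<and>
    (\<Sum>b\<in>J. \<Sum>j<dim_irr G (fst b). scl G (c b j) (fund G (fst b) (snd b) j)) = 0"

definition fund_entry :: "('a::ring_1, 'i, 'm) cqg_scheme \<Rightarrow> 'i \<times> nat \<times> nat \<Rightarrow> 'a"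
  where "fund_entry G = (\<lambda>(\<gamma>, p, q). fund G \<gamma> p q)"

context compact_quantum_group
begin

lemma fund_corep: "\<alpha> \<in> Irr G \<Longrightarrow> fd_corep G (dim_irr G \<alpha>) (fund G \<alpha>)"
  using fund_irreducible by (simp add: irreducible_corep_iff)

lemma dim_irr_pos: "\<alpha> \<in> Irr G \<Longrightarrow> dim_irr G \<alpha> > 0"
  using fund_irreducible by (simp add: irreducible_corep_iff)

lemma row_relation_tuples: "row_relation G J c \<Longrightarrow> c b \<in> tuples (dim_irr G (fst b))"
  unfolding row_relation_def by blast

lemma row_relation_add:
  "row_relation G J c \<Longrightarrow> row_relation G J c' \<Longrightarrow> row_relation G J (\<lambda>b. c b + c' b)"
  using subspace_tuples
  by (simp add: row_relation_def tuple.subspace_add scale_left_distrib sum.distrib)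

lemma row_relation_scale:
  "row_relation G J c \<Longrightarrow> row_relation G J (\<lambda>b. tuple_scale z (c b))"
proof -
  assume c: "row_relation G J c"
  have "(\<Sum>b\<in>J. \<Sum>j<dim_irr G (fst b). scl G (tuple_scale z (c b) j) (fund G (fst b) (snd b) j))
      = scl G z (\<Sum>b\<in>J. \<Sum>j<dim_irr G (fst b). scl G (c b j) (fund G (fst b) (snd b) j))"
    by (simp add: tuple_scale_def scale_sum_right)
  with c subspace_tuples show ?thesis
    by (simp add: row_relation_def tuple.subspace_scale)
qed

lemma row_relation_zero: "row_relation G J (\<lambda>b. 0)"
  using subspace_tuples by (simp add: row_relation_def tuple.subspace_0)

lemma row_relation_sum:
  "(\<And>k. k \<in> S \<Longrightarrow> row_relation G J (c k)) \<Longrightarrow> row_relation G J (\<lambda>b. \<Sum>k\<in>S. c k b)"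
  by (induction S rule: infinite_finite_induct)
    (auto simp: row_relation_zero intro!: row_relation_add simp del: plus_fun_apply zero_fun_apply)

text \<open>Slicing the coproduct of a linear relation by functionals in the second leg lets the matrices
  of functionals act on each row of coefficients.\<close>

lemma row_relation_act:
  assumes J: "J \<subseteq> row_indices G" and c: "row_relation G J c" and f: "functional G f"
  shows "row_relation G J (\<lambda>b. mat_apply (dim_irr G (fst b)) (\<lambda>k j. f (fund G (fst b) k j)) (c b))"
proof -
  let ?D = "comult_map G (\<lambda>x y. scl G (f y) x)"
  interpret D: Vector_Spaces.linear "scl G" "scl G" ?D
    by (rule comult_map_linear[OF conv_bilinear(1)[OF f]])
  have row: "?D (\<Sum>j<dim_irr G (fst b). scl G (c b j) (fund G (fst b) (snd b) j)) =
      (\<Sum>k<dim_irr G (fst b). scl G (mat_apply (dim_irr G (fst b)) (\<lambda>k j. f (fund G (fst b) k j)) (c b) k)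
        (fund G (fst b) (snd b) k))" if "b \<in> J" for b
  proof -
    have b: "fst b \<in> Irr G" "snd b < dim_irr G (fst b)"
      using that J by (auto simp: row_indices_def)
    have "?D (\<Sum>j<dim_irr G (fst b). scl G (c b j) (fund G (fst b) (snd b) j)) =
        (\<Sum>j<dim_irr G (fst b). \<Sum>k<dim_irr G (fst b).
          scl G (f (fund G (fst b) k j) * c b j) (fund G (fst b) (snd b) k))"
      using b by (simp add: D.sum D.scale comult_map_corep[OF conv_bilinear(1)[OF f] fund_corep]
          scale_sum_right mult.commute)
    also have "\<dots> = (\<Sum>k<dim_irr G (fst b). \<Sum>j<dim_irr G (fst b).
          scl G (f (fund G (fst b) k j) * c b j) (fund G (fst b) (snd b) k))"
      by (rule sum.swap)
    finally show ?thesis by (simp add: mat_apply_def scale_sum_left)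
  qed
  have "0 = ?D (\<Sum>b\<in>J. \<Sum>j<dim_irr G (fst b). scl G (c b j) (fund G (fst b) (snd b) j))"
    using c by (simp add: row_relation_def D.zero)
  also have "\<dots> = (\<Sum>b\<in>J. \<Sum>k<dim_irr G (fst b). scl G (mat_apply (dim_irr G (fst b)) (\<lambda>k j. f (fund G (fst b) k j)) (c b) k)
        (fund G (fst b) (snd b) k))"
    using row by (simp add: D.sum)
  finally show ?thesis
    using c by (simp add: row_relation_def mat_apply_zero)
qed

text \<open>Consider a relation supported on a minimal set \<open>J\<close> of rows. By irreducibility the coefficient
  vectors at a row \<open>a\<close> of \<open>J\<close> exhaust the whole space, and by minimality a relation is determined by its
  vector at \<open>a\<close>. The vectors at another row therefore depend on those at \<open>a\<close> through an intertwiner,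
  which by Schur's lemma is a scalar matrix between rows of the same representative and zero
  otherwise. Applying the counit to the relation whose vector at \<open>a\<close> is the unit vector of the
  diagonal position picks out precisely this coefficient and gives \<open>0 = 1\<close>.\<close>
lemma row_relation_trivial:
  assumes "finite J" "J \<subseteq> row_indices G" "row_relation G J c"
  shows "c b = 0"
  using assms
proof (induction J arbitrary: c b rule: finite_psubset_induct)
  case (psubset J)
  have drop_row: "c' b = 0" if "row_relation G J c'" "a \<in> J" "c' a = 0" for c' a b
  proof -
    have "row_relation G (J - {a}) c'"
      using that psubset.hyps unfolding row_relation_def
      by (auto simp: sum.remove[of J a])
    moreover have "J - {a} \<subset> J" "J - {a} \<subseteq> row_indices G"
      using that(2) psubset.prems(1) by auto
    ultimately show ?thesis by (intro psubset.IH)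
  qed
  show ?case
  proof (rule ccontr)
    assume nz: "c b \<noteq> 0"
    define a where "a = b"
    have a: "a \<in> J" using nz psubset.prems(2) unfolding row_relation_def a_def by blast
    define \<alpha> i n where "\<alpha> = fst a" "i = snd a" "n = dim_irr G \<alpha>"
    note \<alpha>_def = this(1) and i_def = this(2) and n_def = this(3)
    have \<alpha>: "\<alpha> \<in> Irr G" "i < n"
      using a psubset.prems(1) by (auto simp: \<alpha>_def i_def n_def row_indices_def)
    define W where "W = (\<lambda>c. c a) ` Collect (row_relation G J)"
    have W: "tuple.subspace W" unfolding tuple.subspace_def
    proof (intro conjI allI ballI)
      show "0 \<in> W" unfolding W_def using row_relation_zero[of J] by (intro image_eqI[where x = "\<lambda>b. 0"]) (rule refl, blast)
      show "x + y \<in> W" if xy: "x \<in> W" "y \<in> W" for x y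
      proof -
        obtain c1 c2 where "row_relation G J c1" "x = c1 a" "row_relation G J c2" "y = c2 a"
          using xy by (auto simp: W_def)
        then show ?thesis unfolding W_def using row_relation_add[of J c1 c2]
          by (intro image_eqI[where x = "\<lambda>b. c1 b + c2 b"]) auto
      qed
      show "tuple_scale z x \<in> W" if x: "x \<in> W" for z x
      proof -
        obtain c1 where "row_relation G J c1" "x = c1 a"
          using x by (auto simp: W_def)
        then show ?thesis unfolding W_def using row_relation_scale[of J c1 z]
          by (intro image_eqI[where x = "\<lambda>b. tuple_scale z (c1 b)"]) auto
      qed
    qed
    have "invariant_subspace G n (fund G \<alpha>) W"
      unfolding invariant_subspace_iff
    proof (intro conjI allI impI ballI W)
      show "W \<subseteq> tuples n" using row_relation_tuples[of J _ a] by (auto simp: W_def n_def \<alpha>_def)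
      fix f w assume "functional G f" "w \<in> W"
      then obtain c1 where "row_relation G J c1" "w = c1 a" by (auto simp: W_def)
      then show "mat_apply n (\<lambda>i j. f (fund G \<alpha> i j)) w \<in> W" unfolding W_def
        using row_relation_act[OF psubset.prems(1) _ \<open>functional G f\<close>, of c1]
        by (intro image_eqI[where x = "\<lambda>b. mat_apply (dim_irr G (fst b)) (\<lambda>k j. f (fund G (fst b) k j)) (c1 b)"])
          (auto simp: n_def \<alpha>_def)
    qed
    moreover have "c a \<in> W" "c a \<noteq> 0" using nz psubset.prems(2) by (auto simp: W_def a_def)
    ultimately have W_eq: "W = tuples n"
      using fund_irreducible[OF \<alpha>(1)] unfolding irreducible_corep_iff n_def by blast
    have "\<exists>e. row_relation G J e \<and> e a = unit_tuple k" if "k < n" for k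
    proof -
      have "unit_tuple k \<in> W" using W_eq that by simp
      then show ?thesis by (auto simp: W_def)
    qed
    then obtain e where e: "\<And>k. k < n \<Longrightarrow> row_relation G J (e k)" "\<And>k. k < n \<Longrightarrow> e k a = unit_tuple k"
      by metis
    have expand: "c' b' = (\<Sum>k<n. tuple_scale (c' a k) (e k b'))" if c': "row_relation G J c'" for c' b'
    proof -
      define c'' where "c'' = (\<lambda>b. c' b + tuple_scale (-1) (\<Sum>k<n. tuple_scale (c' a k) (e k b)))"
      have "row_relation G J c''" unfolding c''_def
        using e c' by (intro row_relation_add row_relation_scale row_relation_sum) auto
      moreover have "c' a \<in> tuples n" using row_relation_tuples[OF c', of a] by (simp add: n_def \<alpha>_def)
      then have "(\<Sum>k<n. tuple_scale (c' a k) (e k a)) = c' a"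
        using tuple_expansion[of "c' a" n] e(2) by simp
      then have "c'' a = 0" by (simp add: c''_def)
      ultimately have "c'' b' = 0" using drop_row a by blast
      then show ?thesis by (simp add: c''_def)
    qed
    have intertw: "intertwiner G n (fund G \<alpha>) (dim_irr G (fst b')) (fund G (fst b')) (\<lambda>l k. e k b' l)"
      if b': "b' \<in> J" for b'
    proof (rule intertwinerI)
      fix f l k assume *: "functional G f" "l < dim_irr G (fst b')" "k < n"
      let ?c = "\<lambda>b. mat_apply (dim_irr G (fst b)) (\<lambda>k j. f (fund G (fst b) k j)) (e k b)"
      have "row_relation G J ?c"
        using row_relation_act[OF psubset.prems(1) e(1)[OF *(3)] *(1)] .
      from expand[OF this, of b']
      have "?c b' l = (\<Sum>p<n. ?c a p * e p b' l)"
        by (simp add: tuple_sum_apply tuple_scale_def)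
      moreover have "?c a p = f (fund G \<alpha> p k)" if "p < n" for p
        using e(2)[OF *(3)] *(3) that by (simp add: mat_apply_unit n_def \<alpha>_def)
      moreover have "?c b' l = (\<Sum>q<dim_irr G (fst b'). e k b' q * f (fund G (fst b') l q))"
        using * by (simp add: mat_apply_def mult.commute)
      ultimately show "(\<Sum>p<n. e p b' l * f (fund G \<alpha> p k)) =
          (\<Sum>q<dim_irr G (fst b'). e k b' q * f (fund G (fst b') l q))"
        by (simp add: mult.commute)
    qed
    have "\<exists>z. \<forall>k<n. \<forall>l<dim_irr G (fst b'). e k b' l = (if fst b' = \<alpha> then z * of_bool (l = k) else 0)"
      if b': "b' \<in> J" for b'
    proof (cases "fst b' = \<alpha>")
      case True
      with intertw[OF b'] have "intertwiner G n (fund G \<alpha>) n (fund G \<alpha>) (\<lambda>l k. e k b' l)"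
        by (simp add: n_def)
      then obtain z where "\<And>l k. l < n \<Longrightarrow> k < n \<Longrightarrow> e k b' l = z * of_bool (l = k)"
        using schur_scalar fund_irreducible[OF \<alpha>(1)] unfolding n_def by metis
      then show ?thesis using True by (auto simp: n_def)
    next
      case False
      have "fst b' \<in> Irr G" using b' psubset.prems(1) by (auto simp: row_indices_def)
      then have "e k b' l = 0" if "k < n" "l < dim_irr G (fst b')" for k l
        using schur[OF fund_irreducible[OF \<alpha>(1)] fund_irreducible intertw[OF b', unfolded n_def]]
          fund_inequivalent[of \<alpha> "fst b'"] False that \<alpha>(1) unfolding n_def by metis
      then show ?thesis using False by simp
    qed
    then obtain z where z: "\<And>b' k l. b' \<in> J \<Longrightarrow> k < n \<Longrightarrow> l < dim_irr G (fst b') \<Longrightarrow>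
        e k b' l = (if fst b' = \<alpha> then z b' * of_bool (l = k) else 0)"
      by metis
    interpret \<epsilon>: Vector_Spaces.linear "scl G" "(*)" "counit G" by (rule counit_linear)
    have "z a = 1"
      using z[OF a \<alpha>(2), of i] e(2)[OF \<alpha>(2)] \<alpha> by (simp add: unit_tuple_def \<alpha>_def n_def)
    have "0 = counit G (\<Sum>b\<in>J. \<Sum>j<dim_irr G (fst b). scl G (e i b j) (fund G (fst b) (snd b) j))"
      using e(1)[OF \<alpha>(2)] by (simp add: row_relation_def \<epsilon>.zero)
    also have "\<dots> = (\<Sum>b\<in>J. \<Sum>j<dim_irr G (fst b). e i b j * of_bool (snd b = j))"
      using psubset.prems(1)
      by (auto simp: \<epsilon>.sum \<epsilon>.scale row_indices_def counit_corep[OF fund_corep] intro!: sum.cong)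
    also have "\<dots> = (\<Sum>b\<in>J. e i b (snd b))"
      using psubset.prems(1) by (auto simp: row_indices_def intro!: sum.cong)
    also have "\<dots> = (\<Sum>b\<in>J. if b = a then 1 else 0)"
    proof (rule sum.cong[OF refl])
      fix b' assume b': "b' \<in> J"
      then have "snd b' < dim_irr G (fst b')" using psubset.prems(1) by (auto simp: row_indices_def)
      moreover have "b' = a" if "fst b' = \<alpha>" "snd b' = i"
        using that by (intro prod_eqI) (auto simp: \<alpha>_def i_def)
      moreover have "fst b' = \<alpha>" "snd b' = i" if "b' = a"
        using that by (auto simp: \<alpha>_def i_def)
      ultimately show "e i b' (snd b') = (if b' = a then 1 else 0)"
        using z[OF b' \<alpha>(2), of "snd b'"] \<open>z a = 1\<close> by (cases "b' = a") auto
    qed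
    also have "\<dots> = 1" using a psubset.hyps by simp
    finally show False by simp
  qed
qed

lemma fund_entries_independent:
  assumes I: "finite I" "I \<subseteq> irr_indices G"
    and sum: "(\<Sum>r\<in>I. scl G (c r) (fund_entry G r)) = 0" and r: "r \<in> I"
  shows "c r = 0"
proof -
  define J where "J = {(\<alpha>, i). \<exists>j. (\<alpha>, i, j) \<in> I}"
  define c' where "c' = (\<lambda>b j. if (fst b, snd b, j) \<in> I then c (fst b, snd b, j) else 0)"
  have J: "finite J" "J \<subseteq> row_indices G"
    using I finite_subset[of J "(\<lambda>(\<alpha>, i, j). (\<alpha>, i)) ` I"]
    by (force simp: J_def row_indices_def irr_indices_def)+
  have J_iff: "b \<in> J \<longleftrightarrow> (\<exists>j. (fst b, snd b, j) \<in> I)" for b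
    by (auto simp: J_def)
  have "row_relation G J c'"
    unfolding row_relation_def
  proof (intro conjI allI impI)
    show "c' b \<in> tuples (dim_irr G (fst b))" for b
      using I(2) by (auto simp: c'_def tuples_def irr_indices_def)
    show "c' b = 0" if "b \<notin> J" for b
    proof -
      have "(fst b, snd b, j) \<notin> I" for j
        using that by (simp add: J_iff)
      then show ?thesis by (auto simp: c'_def fun_eq_iff)
    qed
    have "(\<Sum>b\<in>J. \<Sum>j<dim_irr G (fst b). scl G (c' b j) (fund G (fst b) (snd b) j)) =
        (\<Sum>(b, j)\<in>(SIGMA b:J. {..<dim_irr G (fst b)}). scl G (c' b j) (fund G (fst b) (snd b) j))"
      using J(1) by (subst sum.Sigma) auto
    also have "\<dots> = (\<Sum>(b, j)\<in>(\<lambda>(\<alpha>, i, j). ((\<alpha>, i), j)) ` I. scl G (c' b j) (fund G (fst b) (snd b) j))"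
      using I J(1)
      by (intro sum.mono_neutral_right) (force simp: J_def irr_indices_def c'_def image_iff split: if_splits)+
    also have "\<dots> = (\<Sum>r\<in>I. scl G (c r) (fund_entry G r))"
      by (subst sum.reindex) (auto simp: inj_on_def c'_def fund_entry_def intro!: sum.cong)
    finally show "(\<Sum>b\<in>J. \<Sum>j<dim_irr G (fst b). scl G (c' b j) (fund G (fst b) (snd b) j)) = 0"
      using sum by simp
  qed
  from row_relation_trivial[OF J this]
  have "c' (fst r, fst (snd r)) (snd (snd r)) = 0" by simp
  then show ?thesis using r by (simp add: c'_def)
qed

lemma inj_fund_entry: "inj_on (fund_entry G) (irr_indices G)"
proof (rule inj_onI, rule ccontr)
  fix r s assume *: "r \<in> irr_indices G" "s \<in> irr_indices G" "fund_entry G r = fund_entry G s" "r \<noteq> s"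
  have "(\<Sum>t\<in>{r, s}. scl G (if t = r then 1 else -1) (fund_entry G t)) = 0"
    using * by simp
  from fund_entries_independent[OF _ _ this, of r] * show False by simp
qed

lemma independent_fund_entries: "independent (fund_entry G ` irr_indices G)"
  unfolding independent_explicit_finite_subsets
proof (intro allI impI ballI)
  fix S u v assume *: "S \<subseteq> fund_entry G ` irr_indices G" "finite S" "(\<Sum>v\<in>S. scl G (u v) v) = 0" "v \<in> S"
  then obtain I where I: "I \<subseteq> irr_indices G" "finite I" "S = fund_entry G ` I"
    using finite_subset_image[OF *(2,1)] by blast
  have inj: "inj_on (fund_entry G) I" using inj_fund_entry I(1) by (rule inj_on_subset)
  obtain r where r: "r \<in> I" "v = fund_entry G r" using *(4) I(3) by blast
  have "(\<Sum>r\<in>I. scl G (u (fund_entry G r)) (fund_entry G r)) = 0"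
    using *(3) I(3) by (simp add: sum.reindex[OF inj])
  from fund_entries_independent[OF I(2,1) this r(1)] show "u v = 0" using r(2) by simp
qed

abbreviation fund_span :: "'a set"
  where "fund_span \<equiv> span (fund_entry G ` irr_indices G)"

lemma fund_in_span: "\<alpha> \<in> Irr G \<Longrightarrow> i < dim_irr G \<alpha> \<Longrightarrow> j < dim_irr G \<alpha> \<Longrightarrow> fund G \<alpha> i j \<in> fund_span"
  by (rule span_base) (auto simp: fund_entry_def irr_indices_def image_iff)

lemma fund_span_conv:
  assumes f: "functional G f" and a: "a \<in> fund_span"
  shows "comult_map G (\<lambda>x y. scl G (f y) x) a \<in> fund_span"
  using a
proof (induction rule: span_induct)
  interpret D: Vector_Spaces.linear "scl G" "scl G" "comult_map G (\<lambda>x y. scl G (f y) x)"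
    by (rule comult_map_linear[OF conv_bilinear(1)[OF f]])
  {
    case base
    then show ?case
      by (auto simp: subspace_def D.zero D.add D.scale span_zero span_add span_scale)
  next
    case (step x)
    then obtain \<gamma> p q where x: "x = fund G \<gamma> p q" "\<gamma> \<in> Irr G" "p < dim_irr G \<gamma>" "q < dim_irr G \<gamma>"
      by (auto simp: fund_entry_def irr_indices_def)
    then show ?case
      by (auto simp: comult_map_corep[OF conv_bilinear(1)[OF f] fund_corep]
          intro!: span_sum span_scale fund_in_span)
  }
qed

lemma irreducible_in_fund_span:
  assumes v: "irreducible_corep G n v" and ij: "i < n" "j < n"
  shows "v i j \<in> fund_span"
proof -
  obtain \<alpha> where \<alpha>: "\<alpha> \<in> Irr G" and eq: "equivalent_coreps G n v (dim_irr G \<alpha>) (fund G \<alpha>)"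
    using fund_exhaust[OF v] by auto
  from eq have n: "n = dim_irr G \<alpha>" by (simp add: equivalent_coreps_def)
  from eq[unfolded equivalent_coreps_def, folded n] obtain t s where
    st: "\<And>i j. i < n \<Longrightarrow> j < n \<Longrightarrow> (\<Sum>k<n. s i k * t k j) = of_bool (i = j)" and
    eq': "\<And>i j. i < n \<Longrightarrow> j < n \<Longrightarrow> (\<Sum>k<n. scl G (t i k) (v k j)) = (\<Sum>k<n. scl G (t k j) (fund G \<alpha> i k))"
    by auto
  have "v i j = (\<Sum>k<n. scl G (of_bool (i = k)) (v k j))"
    using ij by (simp add: of_bool_def if_distrib[of "\<lambda>x. scl G x _"] cong: if_cong)
  also have "\<dots> = (\<Sum>k<n. \<Sum>p<n. scl G (s i p * t p k) (v k j))"
    using st ij by (simp add: scale_sum_left[symmetric])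
  also have "\<dots> = (\<Sum>p<n. scl G (s i p) (\<Sum>k<n. scl G (t p k) (v k j)))"
    by (subst sum.swap) (simp add: scale_sum_right)
  also have "\<dots> = (\<Sum>p<n. scl G (s i p) (\<Sum>k<n. scl G (t k j) (fund G \<alpha> p k)))"
    using eq' ij by simp
  also have "\<dots> \<in> fund_span"
    using \<alpha> n by (intro span_sum span_scale fund_in_span) auto
  finally show ?thesis .
qed

text \<open>Choose a non-zero invariant subspace of least dimension.\<close>
lemma minimal_invariant_subspace:
  assumes W1: "invariant_subspace G n u W1" "W1 \<noteq> {0}"
  obtains W where "W \<subseteq> W1" "invariant_subspace G n u W" "W \<noteq> {0}"
    "\<And>W'. W' \<subseteq> W \<Longrightarrow> invariant_subspace G n u W' \<Longrightarrow> W' = {0} \<or> W' = W"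
proof -
  define P where "P W \<longleftrightarrow> W \<subseteq> W1 \<and> invariant_subspace G n u W \<and> W \<noteq> {0}" for W
  obtain W where W: "P W" and least: "\<And>W'. P W' \<Longrightarrow> tuple.dim W \<le> tuple.dim W'"
    using ex_has_least_nat[of P W1 tuple.dim] W1 unfolding P_def by blast
  show ?thesis
  proof
    fix W' assume W': "W' \<subseteq> W" "invariant_subspace G n u W'"
    show "W' = {0} \<or> W' = W"
    proof (rule ccontr)
      assume neg: "\<not> (W' = {0} \<or> W' = W)"
      then obtain v where v: "v \<in> W" "v \<notin> W'" using W'(1) by auto
      have "P W'" using W' W neg by (auto simp: P_def)
      obtain B B' where B: "B \<subseteq> W" "tuple.independent B" "W \<subseteq> tuple.span B" "card B = tuple.dim W"
        and B': "B' \<subseteq> W'" "tuple.independent B'" "W' \<subseteq> tuple.span B'" "card B' = tuple.dim W'"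
        using tuple.basis_exists[of W] tuple.basis_exists[of W'] by metis
      have sub: "W \<subseteq> tuples n" "tuple.subspace W'" using W W' by (auto simp: P_def invariant_subspace_iff)
      have fin: "finite B" "finite B'"
        using independent_tuples_card(1)[OF B(2), of n] independent_tuples_card(1)[OF B'(2), of n] B(1) B'(1) W'(1) sub(1)
        by auto
      have "tuple.span B' \<subseteq> W'" by (rule tuple.span_minimal[OF B'(1) sub(2)])
      then have "tuple.independent (insert v B')"
        using v(2) B'(2) by (intro tuple.independent_insertI) auto
      moreover have "insert v B' \<subseteq> tuple.span B" using v(1) B(3) B'(1) W'(1) by auto
      ultimately have "card (insert v B') \<le> card B"
        using fin by (intro conjunct2[OF tuple.independent_span_bound])
      moreover have "v \<notin> B'" using v(2) B'(1) by auto
      ultimately have "Suc (tuple.dim W') \<le> tuple.dim W" using fin B(4) B'(4) by simp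
      with least[OF \<open>P W'\<close>] show False by simp
    qed
  qed (use W in \<open>auto simp: P_def\<close>)
qed

text \<open>In an arbitrary basis of \<open>W\<close> the restriction of \<open>u\<close> to \<open>W\<close> becomes an irreducible corepresentation
  matrix. It may fail to be unitary, but is still equivalent to one of the fixed representatives.\<close>

lemma minimal_invariant_in_fund_span:
  assumes u: "fd_corep G n u" and W: "invariant_subspace G n u W" "W \<noteq> {0}"
    and minimal: "\<And>W'. W' \<subseteq> W \<Longrightarrow> invariant_subspace G n u W' \<Longrightarrow> W' = {0} \<or> W' = W"
    and w: "w \<in> W" and i: "i < n"
  shows "(\<Sum>j<n. scl G (w j) (u i j)) \<in> fund_span"
proof -
  interpret tf: vector_space_pair tuple_scale "(*)" by unfold_locales (simp_all add: algebra_simps)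
  have W_sub: "tuple.subspace W" "W \<subseteq> tuples n" using W by (auto simp: invariant_subspace_iff)
  have W_inv: "mat_apply n (\<lambda>i j. f (u i j)) x \<in> W" if "functional G f" "x \<in> W" for f x
    using W(1) that by (auto simp: invariant_subspace_iff)
  obtain B where B: "B \<subseteq> W" "tuple.independent B" "W \<subseteq> tuple.span B"
    using tuple.basis_exists[of W] by metis
  have "finite B" using independent_tuples_card(1)[OF B(2)] B(1) W_sub(2) by auto
  define m where "m = card B"
  obtain b where b: "bij_betw b {..<m} B"
    using ex_bij_betw_nat_finite[OF \<open>finite B\<close>] by (auto simp: m_def atLeast0LessThan)
  have b_W: "b k \<in> W" if "k < m" for k
    using b B(1) that by (auto simp: bij_betw_def)
  have "\<exists>y. Vector_Spaces.linear tuple_scale (*) y \<and> (\<forall>k<m. y (b k) = of_bool (l = k))" if l: "l < m" for l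
  proof -
    obtain y where y: "Vector_Spaces.linear tuple_scale (*) y" "\<forall>x\<in>B. y x = of_bool (b l = x)"
      using tf.linear_independent_extend[OF B(2), of "\<lambda>x. of_bool (b l = x)"] by auto
    have "y (b k) = of_bool (l = k)" if "k < m" for k
      using y(2) b l that by (auto simp: bij_betw_def inj_on_def)
    with y(1) show ?thesis by auto
  qed
  then obtain y where y: "\<And>l. l < m \<Longrightarrow> Vector_Spaces.linear tuple_scale (*) (y l)"
    and yb: "\<And>l k. l < m \<Longrightarrow> k < m \<Longrightarrow> y l (b k) = of_bool (l = k)" by metis
  have y_sum: "y l (\<Sum>k\<in>S. tuple_scale (c k) (x k)) = (\<Sum>k\<in>S. c k * y l (x k))" if "l < m" for l S x and c :: "'x \<Rightarrow> complex"
  proof -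
    interpret y: Vector_Spaces.linear tuple_scale "(*)" "y l" by (rule y[OF that])
    show ?thesis by (simp add: y.sum y.scale)
  qed
  have expand: "x = (\<Sum>l<m. tuple_scale (y l x) (b l))" if "x \<in> W" for x
  proof -
    have "x \<in> tuple.span B" using that B(3) by auto
    then show ?thesis
    proof (induction rule: tuple.span_induct)
      case base
      have lin: "y l 0 = 0" "y l (v + v') = y l v + y l v'" "y l (tuple_scale c v) = c * y l v" if "l < m" for l v v' c
      proof -
        interpret y: Vector_Spaces.linear tuple_scale "(*)" "y l" by (rule y[OF that])
        show "y l 0 = 0" "y l (v + v') = y l v + y l v'" "y l (tuple_scale c v) = c * y l v"
          by (simp_all add: y.zero y.add y.scale)
      qed
      have "(\<Sum>l<m. tuple_scale (y l (v + v')) (b l)) = (\<Sum>l<m. tuple_scale (y l v) (b l)) + (\<Sum>l<m. tuple_scale (y l v') (b l))"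
          "(\<Sum>l<m. tuple_scale (y l (tuple_scale c v)) (b l)) = tuple_scale c (\<Sum>l<m. tuple_scale (y l v) (b l))" 
          "(\<Sum>l<m. tuple_scale (y l 0) (b l)) = 0" for v v' c
        by (simp_all add: lin tuple.scale_left_distrib sum.distrib tuple.scale_sum_right)
      then show ?case unfolding tuple.subspace_def by (simp del: plus_fun_apply zero_fun_apply)
    next
      case (step x)
      then obtain k where k: "k < m" "x = b k" using b by (auto simp: bij_betw_def)
      have "(\<Sum>l<m. tuple_scale (y l x) (b l)) = (\<Sum>l<m. if l = k then b l else 0)"
        using k yb by (intro sum.cong) (auto simp del: zero_fun_apply)
      then show ?case using k by simp
    qed
  qed
  define a where "a = (\<lambda>l k. \<Sum>i<n. \<Sum>j<n. scl G (y l (unit_tuple i) * b k j) (u i j))"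
  have f_a: "f (a l k) = y l (mat_apply n (\<lambda>i j. f (u i j)) (b k))"
    if f: "functional G f" and "l < m" for f l k
  proof -
    interpret f: Vector_Spaces.linear "scl G" "(*)" f by fact
    let ?x = "mat_apply n (\<lambda>i j. f (u i j)) (b k)"
    have "?x = (\<Sum>i<n. tuple_scale (?x i) (unit_tuple i))" by (rule tuple_expansion) simp
    then have "y l ?x = (\<Sum>i<n. ?x i * y l (unit_tuple i))" using y_sum[OF \<open>l < m\<close>] by metis
    also have "\<dots> = f (a l k)"
      by (simp add: a_def f.sum f.scale mat_apply_def sum_distrib_right sum_distrib_left mult_ac)
    finally show ?thesis by simp
  qed
  have restrict: "(\<Sum>j<n. scl G (b k j) (u i j)) = (\<Sum>l<m. scl G (b l i) (a l k))"
    if "k < m" "i < n" for k i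
  proof (rule functional_eqI)
    fix f assume f: "functional G f"
    then interpret f: Vector_Spaces.linear "scl G" "(*)" f by simp
    have "f (\<Sum>j<n. scl G (b k j) (u i j)) = mat_apply n (\<lambda>i j. f (u i j)) (b k) i"
      using that by (simp add: f.sum f.scale mat_apply_def mult.commute)
    also have "\<dots> = (\<Sum>l<m. tuple_scale (y l (mat_apply n (\<lambda>i j. f (u i j)) (b k))) (b l)) i"
      using expand[OF W_inv[OF f b_W[OF that(1)]]] by simp
    also have "\<dots> = f (\<Sum>l<m. scl G (b l i) (a l k))"
      using f_a[OF f] by (simp add: tuple_sum_apply tuple_scale_def f.sum f.scale mult.commute)
    finally show "f (\<Sum>j<n. scl G (b k j) (u i j)) = f (\<Sum>l<m. scl G (b l i) (a l k))" .
  qed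
  have corep: "fd_corep G m a"
    unfolding fd_corep_def
  proof (intro allI impI conjI)
    fix l k assume lk: "l < m" "k < m"
    show "counit G (a l k) = of_bool (l = k)"
    proof -
      have "mat_apply n (\<lambda>i j. counit G (u i j)) (b k) = b k"
        using b_W[OF lk(2)] W_sub(2) by (auto simp: mat_apply_def fun_eq_iff counit_corep[OF u] tuples_def)
      then show ?thesis using f_a[OF counit_linear lk(1), of k] yb[OF lk] by simp
    qed
    show "tensor2_eq G (comult G (a l k)) [(a l q, a q k). q \<leftarrow> [0..<m]]"
      unfolding tensor2_eq_def
    proof (intro allI impI)
      fix \<Phi> :: "'a \<Rightarrow> 'a \<Rightarrow> complex"
      assume "(\<forall>a. functional G (\<lambda>x. \<Phi> x a)) \<and> (\<forall>a. functional G (\<lambda>x. \<Phi> a x))"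
      then have \<Phi>: "bilinear_map G (*) \<Phi>" by (simp add: bilinear_map_def)
      interpret C: Vector_Spaces.linear "scl G" "(*)" "comult_map G \<Phi>" by (rule comult_map_linear[OF \<Phi>])
      have \<Phi>r: "\<Phi> x (\<Sum>k\<in>S. scl G (c k) (z k)) = (\<Sum>k\<in>S. c k * \<Phi> x (z k))" for x c z and S :: "nat set"
      proof -
        interpret r: Vector_Spaces.linear "scl G" "(*)" "\<Phi> x" using \<Phi> by (simp add: bilinear_map_def)
        show ?thesis by (simp add: r.sum r.scale)
      qed
      have \<Phi>l: "\<Phi> (\<Sum>k\<in>S. \<Sum>j\<in>T. scl G (c k j) (z k j)) x = (\<Sum>k\<in>S. \<Sum>j\<in>T. c k j * \<Phi> (z k j) x)" for x c z and S T :: "nat set"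
      proof -
        interpret r: Vector_Spaces.linear "scl G" "(*)" "\<lambda>z. \<Phi> z x" using \<Phi> by (simp add: bilinear_map_def)
        show ?thesis by (simp add: r.sum r.scale)
      qed
      have "comult_map G \<Phi> (a l k) = (\<Sum>i<n. \<Sum>j<n. (y l (unit_tuple i) * b k j) * (\<Sum>p<n. \<Phi> (u i p) (u p j)))"
        by (simp add: a_def C.sum C.scale comult_map_corep[OF \<Phi> u])
      also have "\<dots> = (\<Sum>i<n. \<Sum>p<n. y l (unit_tuple i) * \<Phi> (u i p) (\<Sum>j<n. scl G (b k j) (u p j)))"
      proof (rule sum.cong[OF refl])
        fix i
        have "(\<Sum>j<n. (y l (unit_tuple i) * b k j) * (\<Sum>p<n. \<Phi> (u i p) (u p j))) =
            (\<Sum>j<n. \<Sum>p<n. y l (unit_tuple i) * (b k j * \<Phi> (u i p) (u p j)))"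
          by (simp add: sum_distrib_left mult.assoc)
        also have "\<dots> = (\<Sum>p<n. \<Sum>j<n. y l (unit_tuple i) * (b k j * \<Phi> (u i p) (u p j)))"
          by (rule sum.swap)
        finally show "(\<Sum>j<n. (y l (unit_tuple i) * b k j) * (\<Sum>p<n. \<Phi> (u i p) (u p j))) =
            (\<Sum>p<n. y l (unit_tuple i) * \<Phi> (u i p) (\<Sum>j<n. scl G (b k j) (u p j)))"
          by (simp add: \<Phi>r sum_distrib_left)
      qed
      also have "\<dots> = (\<Sum>i<n. \<Sum>p<n. \<Sum>q<m. y l (unit_tuple i) * b q p * \<Phi> (u i p) (a q k))"
        using restrict[OF lk(2)] by (simp add: \<Phi>r sum_distrib_left mult.assoc)
      also have "\<dots> = (\<Sum>i<n. \<Sum>q<m. \<Sum>p<n. y l (unit_tuple i) * b q p * \<Phi> (u i p) (a q k))"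
        by (intro sum.cong refl sum.swap)
      also have "\<dots> = (\<Sum>q<m. \<Sum>i<n. \<Sum>p<n. y l (unit_tuple i) * b q p * \<Phi> (u i p) (a q k))"
        by (rule sum.swap)
      also have "\<dots> = (\<Sum>q<m. \<Phi> (a l q) (a q k))"
        by (subst (2) a_def) (simp add: \<Phi>l)
      finally show "(\<Sum>(x, y)\<leftarrow>comult G (a l k). \<Phi> x y) = (\<Sum>(x, y)\<leftarrow>[(a l q, a q k). q \<leftarrow> [0..<m]]. \<Phi> x y)"
        by (simp add: comult_map_def comp_def interv_sum_list_conv_sum_set_nat atLeast0LessThan)
    qed
  qed
  have "irreducible_corep G m a"
    unfolding irreducible_corep_iff
  proof (intro conjI allI impI corep)
    have "B \<noteq> {}"
    proof
      assume "B = {}"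
      then have "W \<subseteq> {0}" using B(3) by simp
      then show False using W(2) W_sub(1) tuple.subspace_0[of W] by auto
    qed
    then show "m > 0" using \<open>finite B\<close> by (simp add: m_def card_gt_0_iff)
    fix W' assume W': "invariant_subspace G m a W'"
    define L where "L = (\<lambda>c. \<Sum>k<m. tuple_scale (c k) (b k))"
    have W'_sub: "tuple.subspace W'" "W' \<subseteq> tuples m" using W' by (auto simp: invariant_subspace_iff)
    have L_apply: "L c = (\<Sum>k<m. tuple_scale (c k) (b k))" for c
      by (simp add: L_def)
    have L_W: "L c \<in> W" for c
      unfolding L_def using b_W W_sub(1) by (intro tuple.subspace_sum tuple.subspace_scale) auto
    have y_L: "y l (L c) = c l" if "l < m" for l c
      unfolding L_def using yb that by (simp add: y_sum)
    have L_inj: "c = c'" if "c \<in> tuples m" "c' \<in> tuples m" "L c = L c'" for c c'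
    proof
      fix l show "c l = c' l"
        using y_L[of l c] y_L[of l c'] that by (cases "l < m") (auto simp: tuples_def)
    qed
    have L_add: "L (c + c') = L c + L c'" and L_scale: "L (tuple_scale z c) = tuple_scale z (L c)"
      and L_0: "L 0 = 0" for c c' z
      by (simp_all add: L_def tuple.scale_left_distrib sum.distrib tuple.scale_sum_right
          tuple_scale_def[of z c] del: plus_fun_apply zero_fun_apply)
        (simp_all add: tuple.scale_left_distrib sum.distrib)
    have "invariant_subspace G n u (L ` W')"
      unfolding invariant_subspace_iff
    proof (intro conjI allI impI ballI)
      show "tuple.subspace (L ` W')"
        unfolding tuple.subspace_def
      proof (intro conjI allI ballI)
        show "0 \<in> L ` W'" using W'_sub(1) L_0 by (metis image_eqI tuple.subspace_0)
        show "x + x' \<in> L ` W'" if x: "x \<in> L ` W'" "x' \<in> L ` W'" for x x'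
        proof -
          obtain c c' where "c \<in> W'" "c' \<in> W'" "x = L c" "x' = L c'" using x by blast
          then show ?thesis
            using imageI[OF tuple.subspace_add[OF W'_sub(1), of c c'], of L] by (simp only: L_add)
        qed
        show "tuple_scale z x \<in> L ` W'" if x: "x \<in> L ` W'" for x z
        proof -
          obtain c where "c \<in> W'" "x = L c" using x by blast
          then show ?thesis
            using imageI[OF tuple.subspace_scale[OF W'_sub(1), of c z], of L] by (simp only: L_scale)
        qed
      qed
      show "L ` W' \<subseteq> tuples n" using L_W W_sub(2) by auto
      fix f x assume f: "functional G f" and "x \<in> L ` W'"
      then obtain c where c: "c \<in> W'" "x = L c" by auto
      have "mat_apply n (\<lambda>i j. f (u i j)) (L c) = L (mat_apply m (\<lambda>i j. f (a i j)) c)"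
      proof -
        let ?T = "mat_apply n (\<lambda>i j. f (u i j))"
        have "?T (L c) = (\<Sum>l<m. tuple_scale (y l (?T (L c))) (b l))"
          by (rule expand[OF W_inv[OF f L_W]])
        also have "\<dots> = L (mat_apply m (\<lambda>i j. f (a i j)) c)"
          unfolding L_apply[of "mat_apply m (\<lambda>i j. f (a i j)) c"]
        proof (rule sum.cong[OF refl])
          fix l assume "l \<in> {..<m}"
          then have l: "l < m" by simp
          have "y l (?T (L c)) = (\<Sum>k<m. c k * y l (?T (b k)))"
            by (simp add: L_def mat_apply_sum mat_apply_scale y_sum[OF l])
          also have "\<dots> = mat_apply m (\<lambda>i j. f (a i j)) c l"
            using l f_a[OF f l] by (simp add: mat_apply_def mult.commute)
          finally show "tuple_scale (y l (?T (L c))) (b l) = tuple_scale (mat_apply m (\<lambda>i j. f (a i j)) c l) (b l)"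
            by simp
        qed
        finally show ?thesis .
      qed
      then show "mat_apply n (\<lambda>i j. f (u i j)) x \<in> L ` W'"
        using W' c f by (auto simp: invariant_subspace_iff)
    qed
    moreover have "L ` W' \<subseteq> W" using L_W by auto
    ultimately consider "L ` W' = {0}" | "L ` W' = W" using minimal by blast
    then show "W' = {0} \<or> W' = tuples m"
    proof cases
      case 1
      have "c = 0" if "c \<in> W'" for c
      proof (rule L_inj)
        show "c \<in> tuples m" "0 \<in> tuples m" using that W'_sub(2) tuple.subspace_0[OF subspace_tuples] by auto
        show "L c = L 0" using 1 that L_0 by auto
      qed
      then show ?thesis using tuple.subspace_0[OF W'_sub(1)] by auto
    next
      case 2
      have "c \<in> W'" if c: "c \<in> tuples m" for c
      proof -
        have "L c \<in> L ` W'" using 2 L_W by simp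
        then obtain c' where "c' \<in> W'" "L c = L c'" by auto
        then show ?thesis using L_inj[OF c, of c'] W'_sub(2) by auto
      qed
      then show ?thesis using W'_sub(2) by auto
    qed
  qed
  then have a_span: "a l k \<in> fund_span" if "l < m" "k < m" for l k
    using irreducible_in_fund_span that by blast
  have "(\<Sum>j<n. scl G (w j) (u i j)) = (\<Sum>j<n. scl G ((\<Sum>l<m. tuple_scale (y l w) (b l)) j) (u i j))"
    using expand[OF w] by simp
  also have "\<dots> = (\<Sum>j<n. \<Sum>l<m. scl G (y l w) (scl G (b l j) (u i j)))"
    by (simp add: tuple_sum_apply tuple_scale_def scale_sum_left)
  also have "\<dots> = (\<Sum>l<m. scl G (y l w) (\<Sum>j<n. scl G (b l j) (u i j)))"
    by (subst sum.swap) (simp add: scale_sum_right)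
  also have "\<dots> = (\<Sum>l<m. scl G (y l w) (\<Sum>q<m. scl G (b q i) (a q l)))"
    using restrict i by simp
  also have "\<dots> \<in> fund_span"
    using a_span by (intro span_sum span_scale) auto
  finally show ?thesis .
qed

text \<open>The vectors on which \<open>u\<close> has matrix elements in the span of the representatives form an
  invariant subspace. Unitarity makes its orthogonal complement invariant; a minimal invariant
  subspace of the complement would again consist of such vectors, so the complement vanishes.\<close>

lemma unitary_in_fund_span:
  assumes u: "fd_corep G n u" "unitary_matrix G n u" and ij: "i < n" "j < n"
  shows "u i j \<in> fund_span"
proof -
  define W0 where "W0 = {w \<in> tuples n. \<forall>i<n. (\<Sum>j<n. scl G (w j) (u i j)) \<in> fund_span}"
  have sub0: "tuple.subspace W0"
    using subspace_tuples[of n] unfolding tuple.subspace_def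
    by (auto simp: W0_def span_zero scale_left_distrib sum.distrib span_add tuple_scale_def
        scale_sum_right[symmetric] span_scale simp flip: scale_scale)
  have inv0: "mat_apply n (\<lambda>i j. f (u i j)) w \<in> W0" if f: "functional G f" and w: "w \<in> W0" for f w
  proof -
    interpret D: Vector_Spaces.linear "scl G" "scl G" "comult_map G (\<lambda>x y. scl G (f y) x)"
      by (rule comult_map_linear[OF conv_bilinear(1)[OF f]])
    have "(\<Sum>j<n. scl G (mat_apply n (\<lambda>i j. f (u i j)) w j) (u i j)) \<in> fund_span" if i: "i < n" for i
    proof -
      have "comult_map G (\<lambda>x y. scl G (f y) x) (\<Sum>k<n. scl G (w k) (u i k)) \<in> fund_span"
        using w i by (intro fund_span_conv f) (auto simp: W0_def)
      also have "comult_map G (\<lambda>x y. scl G (f y) x) (\<Sum>k<n. scl G (w k) (u i k))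
          = (\<Sum>k<n. \<Sum>j<n. scl G (f (u j k) * w k) (u i j))"
        using i by (simp add: D.sum D.scale comult_map_corep[OF conv_bilinear(1)[OF f] u(1)]
            scale_sum_right mult.commute)
      also have "\<dots> = (\<Sum>j<n. \<Sum>k<n. scl G (f (u j k) * w k) (u i j))"
        by (rule sum.swap)
      finally show ?thesis by (simp add: mat_apply_def scale_sum_left)
    qed
    then show ?thesis by (simp add: W0_def)
  qed
  have "W0 = tuples n"
  proof (rule ccontr)
    assume "W0 \<noteq> tuples n"
    then obtain v where v: "v \<in> tuples n" "v \<notin> W0" by (auto simp: W0_def)
    define W1 where "W1 = {y \<in> tuples n. \<forall>w\<in>W0. tuple_inner n w y = 0}"
    obtain y where y: "y \<in> tuples n" "y \<noteq> 0" "\<forall>w\<in>W0 \<inter> tuples n. tuple_inner n y w = 0"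
      using orthogonal_vector_exists[OF sub0 v] by auto
    then have "y \<in> W1"
      by (auto simp: W1_def W0_def tuple_inner_commute[of n _ y])
    have "invariant_subspace G n u W1"
      unfolding invariant_subspace_iff
    proof (intro conjI allI impI ballI)
      show "tuple.subspace W1" using subspace_tuples[of n]
        by (auto simp: W1_def tuple.subspace_def tuple_inner_add tuple_inner_scale)
      show "W1 \<subseteq> tuples n" by (auto simp: W1_def)
      fix f x assume f: "functional G f" and x: "x \<in> W1"
      interpret f: Vector_Spaces.linear "scl G" "(*)" f by fact
      interpret S: Vector_Spaces.linear "scl G" "scl G" "antipode G" by (rule antipode_linear)
      define g where "g = (\<lambda>a. cnj (f (star G (antipode G a))))"
      have g: "functional G g"
        by (rule functionalI) (simp_all add: g_def S.add S.scale star_add star_scl f.add f.scale)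
      have gu: "g (u j i) = cnj (f (u i j))" if "i < n" "j < n" for i j
        using that by (simp add: g_def antipode_unitary[OF u] star_star)
      have "tuple_inner n w (mat_apply n (\<lambda>i j. f (u i j)) x) = 0" if w: "w \<in> W0" for w
      proof -
        have "tuple_inner n w (mat_apply n (\<lambda>i j. f (u i j)) x) =
            (\<Sum>i<n. \<Sum>j<n. cnj (w i) * (f (u i j) * x j))"
          by (simp add: tuple_inner_def mat_apply_def sum_distrib_left)
        also have "\<dots> = (\<Sum>j<n. \<Sum>i<n. cnj (g (u j i) * w i) * x j)"
          using gu by (subst sum.swap) (simp add: mult_ac)
        also have "\<dots> = tuple_inner n (mat_apply n (\<lambda>i j. g (u i j)) w) x"
          by (simp add: tuple_inner_def mat_apply_def sum_distrib_right)
        also have "\<dots> = 0" using x inv0[OF g w] by (simp add: W1_def)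
        finally show ?thesis .
      qed
      then show "mat_apply n (\<lambda>i j. f (u i j)) x \<in> W1" by (simp add: W1_def)
    qed
    moreover have "W1 \<noteq> {0}" using \<open>y \<in> W1\<close> y(2) by auto
    ultimately obtain W where W: "W \<subseteq> W1" "invariant_subspace G n u W" "W \<noteq> {0}"
      and minimal: "\<And>W'. W' \<subseteq> W \<Longrightarrow> invariant_subspace G n u W' \<Longrightarrow> W' = {0} \<or> W' = W"
      using minimal_invariant_subspace by metis
    obtain w where w: "w \<in> W" "w \<noteq> 0"
      using W(2,3) tuple.subspace_0[of W] by (auto simp: invariant_subspace_iff)
    have "w \<in> W0"
      using minimal_invariant_in_fund_span[OF u(1) W(2,3) minimal w(1)] w(1) W(2)
      by (auto simp: W0_def invariant_subspace_iff)
    then have "tuple_inner n w w = 0" "w \<in> tuples n" using w(1) W(1) by (auto simp: W1_def)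
    then have "complex_of_real (\<Sum>j<n. (cmod (w j))\<^sup>2) = 0" using tuple_inner_self[of n w] by metis
    then have "(\<Sum>j<n. (cmod (w j))\<^sup>2) = 0" by (simp only: of_real_eq_0_iff)
    then show False using tuple_inner_self_pos[OF \<open>w \<in> tuples n\<close> w(2)] by linarith
  qed
  then have "unit_tuple j \<in> W0" using ij by simp
  then have "(\<Sum>k<n. scl G (unit_tuple j k) (u i k)) \<in> fund_span" using ij by (auto simp: W0_def)
  also have "(\<Sum>k<n. scl G (unit_tuple j k) (u i k)) = (\<Sum>k<n. if k = j then u i k else 0)"
    by (intro sum.cong) (auto simp: unit_tuple_def)
  also have "\<dots> = u i j" using ij by simp
  finally show ?thesis .
qed

theorem fund_span_UNIV: "fund_span = UNIV"
proof -
  have "span {u i j | n u i j. fd_corep G n u \<and> unitary_matrix G n u \<and> i < n \<and> j < n} \<subseteq> fund_span"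
    by (rule span_minimal) (auto simp: unitary_in_fund_span subspace_span)
  then show ?thesis using spanned by auto
qed

end

section \<open>Matrices over the algebra\<close>

definition mat_mult :: "nat \<Rightarrow> (nat \<Rightarrow> nat \<Rightarrow> 'a) \<Rightarrow> (nat \<Rightarrow> nat \<Rightarrow> 'a) \<Rightarrow> nat \<Rightarrow> nat \<Rightarrow> 'a::ring_1"
  where "mat_mult n x y = (\<lambda>i j. if i < n \<and> j < n then \<Sum>k<n. x i k * y k j else 0)"

text \<open>Entries outside the \<open>n\<times>n\<close> block are set to zero, so that matrix identities become equalities of
  functions.\<close>
definition mat_cut :: "nat \<Rightarrow> (nat \<Rightarrow> nat \<Rightarrow> 'a) \<Rightarrow> nat \<Rightarrow> nat \<Rightarrow> 'a::ring_1"
  where "mat_cut n x = (\<lambda>i j. if i < n \<and> j < n then x i j else 0)"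

definition mat_one :: "nat \<Rightarrow> nat \<Rightarrow> nat \<Rightarrow> 'a::ring_1"
  where "mat_one n = mat_cut n (\<lambda>i j. of_bool (i = j))"

definition mat_adj :: "('a::ring_1, 'm) star_alg_scheme \<Rightarrow> nat \<Rightarrow> (nat \<Rightarrow> nat \<Rightarrow> 'a) \<Rightarrow> nat \<Rightarrow> nat \<Rightarrow> 'a"
  where "mat_adj A n x = mat_cut n (\<lambda>i j. star A (x j i))"

definition const_mat :: "('a::ring_1, 'm) star_alg_scheme \<Rightarrow> nat \<Rightarrow> (nat \<Rightarrow> nat \<Rightarrow> complex) \<Rightarrow> nat \<Rightarrow> nat \<Rightarrow> 'a"
  where "const_mat A n x = mat_cut n (\<lambda>i j. scl A (x i j) 1)"

lemma mat_eqI: "(\<And>i j. i < n \<Longrightarrow> j < n \<Longrightarrow> x i j = y i j) \<Longrightarrow> mat_cut n x = mat_cut n y"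
  by (auto simp: mat_cut_def fun_eq_iff)

lemma mat_cut_mult [simp]: "mat_cut n (mat_mult n x y) = mat_mult n x y"
  by (auto simp: mat_cut_def mat_mult_def fun_eq_iff)

lemma mat_mult_cut [simp]: "mat_mult n (mat_cut n x) y = mat_mult n x y" "mat_mult n x (mat_cut n y) = mat_mult n x y"
  by (auto simp: mat_cut_def mat_mult_def fun_eq_iff intro!: sum.cong)

lemma mat_mult_assoc: "mat_mult n (mat_mult n x y) z = mat_mult n x (mat_mult n y z)"
proof (intro ext)
  fix i j
  have "(\<Sum>k<n. (\<Sum>l<n. x i l * y l k) * z k j) = (\<Sum>l<n. x i l * (\<Sum>k<n. y l k * z k j))"
    unfolding sum_distrib_left sum_distrib_right by (subst sum.swap) (simp add: mult.assoc)
  then show "mat_mult n (mat_mult n x y) z i j = mat_mult n x (mat_mult n y z) i j"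
    by (simp add: mat_mult_def cong: if_cong)
qed

lemma mat_mult_one [simp]: "mat_mult n (mat_one n) x = mat_cut n x" "mat_mult n x (mat_one n) = mat_cut n x"
  by (auto simp: mat_mult_def mat_one_def mat_cut_def fun_eq_iff cong: if_cong)

lemma mat_cut_cut [simp]: "mat_cut n (mat_cut n x) = mat_cut n x"
  "mat_cut n (mat_adj A n x) = mat_adj A n x" "mat_cut n (const_mat A n z) = const_mat A n z"
  "mat_cut n (mat_one n) = mat_one n"
  by (auto simp: mat_cut_def mat_adj_def const_mat_def mat_one_def fun_eq_iff)

context star_algebra
begin

lemma star_zero: "star A 0 = 0"
  using star_scl[of 0 0] by simp

lemma mat_adj_mult: "mat_adj A n (mat_mult n x y) = mat_mult n (mat_adj A n y) (mat_adj A n x)"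
  by (auto simp: mat_adj_def mat_mult_def mat_cut_def fun_eq_iff star_sum star_mult intro!: sum.cong)

lemma mat_adj_one: "mat_adj A n (mat_one n) = mat_one n"
  by (auto simp: mat_adj_def mat_one_def mat_cut_def fun_eq_iff star_of_bool)

lemma mat_adj_cut: "mat_adj A n (mat_cut n x) = mat_adj A n x"
  by (auto simp: mat_adj_def mat_cut_def fun_eq_iff)

lemma const_mat_mult:
  "mat_mult n (const_mat A n x) (const_mat A n y) = const_mat A n (\<lambda>i j. \<Sum>k<n. x i k * y k j)"
  by (auto simp: const_mat_def mat_mult_def mat_cut_def fun_eq_iff scale_sum_left scl_mult_left[symmetric] intro!: sum.cong)

lemma const_mat_one: "(\<And>i j. i < n \<Longrightarrow> j < n \<Longrightarrow> x i j = of_bool (i = j)) \<Longrightarrow> const_mat A n x = mat_one n"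
  unfolding const_mat_def mat_one_def by (rule mat_eqI) auto

lemma const_mat_adj: "mat_adj A n (const_mat A n x) = const_mat A n (\<lambda>i j. cnj (x j i))"
  by (auto simp: const_mat_def mat_adj_def mat_cut_def fun_eq_iff star_scl star_one)

lemma const_mult_entry: "i < n \<Longrightarrow> j < n \<Longrightarrow> mat_mult n (const_mat A n x) y i j = (\<Sum>k<n. scl A (x i k) (y k j))"
  by (simp add: mat_mult_def const_mat_def mat_cut_def scl_mult_left[symmetric])

lemma mult_const_entry: "i < n \<Longrightarrow> j < n \<Longrightarrow> mat_mult n y (const_mat A n x) i j = (\<Sum>k<n. scl A (x k j) (y i k))"
  by (simp add: mat_mult_def const_mat_def mat_cut_def scl_mult_right[symmetric])

lemma intertwiner_iff_commute:
  "intertwiner A n u n v t \<longleftrightarrow> mat_mult n (const_mat A n t) u = mat_mult n v (const_mat A n t)"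
proof
  assume "intertwiner A n u n v t"
  then have "mat_cut n (mat_mult n (const_mat A n t) u) = mat_cut n (mat_mult n v (const_mat A n t))"
    by (intro mat_eqI) (simp add: intertwiner_def const_mult_entry mult_const_entry)
  then show "mat_mult n (const_mat A n t) u = mat_mult n v (const_mat A n t)" by simp
next
  assume "mat_mult n (const_mat A n t) u = mat_mult n v (const_mat A n t)"
  then show "intertwiner A n u n v t"
    unfolding intertwiner_def by (metis const_mult_entry mult_const_entry)
qed

lemma unitary_matrix_iff:
  "unitary_matrix A n u \<longleftrightarrow> mat_mult n (mat_adj A n u) u = mat_one n \<and> mat_mult n u (mat_adj A n u) = mat_one n"
proof -
  have "mat_mult n (mat_adj A n u) u i j = (if i < n \<and> j < n then \<Sum>k<n. star A (u k i) * u k j else 0)"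
    "mat_mult n u (mat_adj A n u) i j = (if i < n \<and> j < n then \<Sum>k<n. u i k * star A (u j k) else 0)" for i j
    by (auto simp: mat_mult_def mat_adj_def mat_cut_def)
  then show ?thesis
    by (auto simp: unitary_matrix_def mat_one_def mat_cut_def fun_eq_iff)
qed

end

section \<open>The Haar state\<close>

definition trivial_irr :: "('a::ring_1, 'i, 'm) cqg_scheme \<Rightarrow> 'i"
  where "trivial_irr G = (SOME \<alpha>. \<alpha> \<in> Irr G \<and> dim_irr G \<alpha> = 1 \<and> fund G \<alpha> 0 0 = 1)"

text \<open>The coefficient of the unit in the basis of matrix elements. It is the Haar state, but this rests
  on the orthogonality relations derived from its invariance.\<close>
definition haar_functional :: "('a::ring_1, 'i, 'm) cqg_scheme \<Rightarrow> 'a \<Rightarrow> complex"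
  where "haar_functional G = (SOME h. functional G h \<and> (\<forall>\<alpha>\<in>Irr G. \<forall>i<dim_irr G \<alpha>. \<forall>j<dim_irr G \<alpha>.
    h (fund G \<alpha> i j) = of_bool (\<alpha> = trivial_irr G)))"

context compact_quantum_group
begin

lemma fund_induct:
  assumes "subspace {a. P a}"
    and "\<And>\<alpha> i j. \<alpha> \<in> Irr G \<Longrightarrow> i < dim_irr G \<alpha> \<Longrightarrow> j < dim_irr G \<alpha> \<Longrightarrow> P (fund G \<alpha> i j)"
  shows "P a"
proof -
  have "fund_entry G ` irr_indices G \<subseteq> {a. P a}"
    using assms(2) by (auto simp: fund_entry_def irr_indices_def)
  then have "fund_span \<subseteq> {a. P a}" using assms(1) by (rule span_minimal)
  then show ?thesis using fund_span_UNIV by auto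
qed

lemma linear_eq_on_fund:
  assumes f: "Vector_Spaces.linear (scl G) s f" and g: "Vector_Spaces.linear (scl G) s g"
    and "\<And>\<alpha> i j. \<alpha> \<in> Irr G \<Longrightarrow> i < dim_irr G \<alpha> \<Longrightarrow> j < dim_irr G \<alpha> \<Longrightarrow> f (fund G \<alpha> i j) = g (fund G \<alpha> i j)"
  shows "f a = g a"
proof -
  interpret f: Vector_Spaces.linear "scl G" s f by fact
  interpret g: Vector_Spaces.linear "scl G" s g by fact
  show ?thesis
    by (rule fund_induct[of "\<lambda>a. f a = g a"])
      (use assms(3) in \<open>auto simp: subspace_def f.zero g.zero f.add g.add f.scale g.scale\<close>)
qed

text \<open>The matrix elements of the representatives form a basis, on which values can be prescribed.\<close>
lemma linear_extension:
  assumes "vector_space s"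
  shows "\<exists>f. Vector_Spaces.linear (scl G) s f \<and> (\<forall>\<alpha>\<in>Irr G. \<forall>i<dim_irr G \<alpha>. \<forall>j<dim_irr G \<alpha>.
    f (fund G \<alpha> i j) = x \<alpha> i j)"
proof -
  interpret vector_space_pair "scl G" s
    using assms vector_space_axioms by (simp add: vector_space_pair_def)
  obtain f where f: "Vector_Spaces.linear (scl G) s f"
    "\<forall>v\<in>fund_entry G ` irr_indices G. f v = (case inv_into (irr_indices G) (fund_entry G) v of (\<alpha>, i, j) \<Rightarrow> x \<alpha> i j)"
    using linear_independent_extend[OF independent_fund_entries, of "\<lambda>v. case inv_into (irr_indices G) (fund_entry G) v of (\<alpha>, i, j) \<Rightarrow> x \<alpha> i j"]
    by blast
  have "f (fund G \<alpha> i j) = x \<alpha> i j" if "\<alpha> \<in> Irr G" "i < dim_irr G \<alpha>" "j < dim_irr G \<alpha>" for \<alpha> i j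
  proof -
    have r: "(\<alpha>, i, j) \<in> irr_indices G" using that by (simp add: irr_indices_def)
    have "f (fund_entry G (\<alpha>, i, j)) = x \<alpha> i j"
      using f(2) r by (simp add: inv_into_f_f[OF inj_fund_entry r])
    then show ?thesis by (simp add: fund_entry_def)
  qed
  with f(1) show ?thesis by blast
qed

lemma fund_expansion:
  obtains I c where "finite I" "I \<subseteq> irr_indices G" "a = (\<Sum>r\<in>I. scl G (c r) (fund_entry G r))"
proof -
  have "a \<in> fund_span" using fund_span_UNIV by simp
  then obtain T u where T: "finite T" "T \<subseteq> fund_entry G ` irr_indices G" "a = (\<Sum>v\<in>T. scl G (u v) v)"
    unfolding span_explicit by blast
  obtain I where I: "I \<subseteq> irr_indices G" "finite I" "T = fund_entry G ` I"
    using finite_subset_image[OF T(1,2)] by blast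
  have "inj_on (fund_entry G) I" using inj_fund_entry I(1) by (rule inj_on_subset)
  then have "a = (\<Sum>r\<in>I. scl G (u (fund_entry G r)) (fund_entry G r))"
    using T(3) I(3) by (simp add: sum.reindex)
  then show ?thesis by (rule that[OF I(2,1)])
qed

lemma trivial_exists: "\<exists>\<alpha>. \<alpha> \<in> Irr G \<and> dim_irr G \<alpha> = 1 \<and> fund G \<alpha> 0 0 = 1"
proof -
  have "irreducible_corep G 1 (\<lambda>_ _. 1)"
    unfolding irreducible_corep_iff
  proof (intro conjI allI impI)
    show "fd_corep G 1 (\<lambda>_ _. 1)"
      using comult_one by (simp add: fd_corep_def counit_one)
    fix W assume "invariant_subspace G 1 (\<lambda>_ _. 1) W"
    then have W: "tuple.subspace W" "W \<subseteq> tuples 1" by (auto simp: invariant_subspace_iff)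
    show "W = {0} \<or> W = tuples 1"
    proof (cases "W = {0}")
      case False
      then obtain w where w: "w \<in> W" "w \<noteq> 0" using tuple.subspace_0[OF W(1)] by blast
      have "w 0 \<noteq> 0"
      proof
        assume "w 0 = 0"
        then have "w i = 0" for i using w(1) W(2) by (cases i) (auto simp: tuples_def)
        then have "w = 0" by (auto simp: fun_eq_iff)
        with w(2) show False by simp
      qed
      have "x \<in> W" if x: "x \<in> tuples 1" for x
      proof -
        have "x i = tuple_scale (x 0 / w 0) w i" for i
          using x w(1) W(2) \<open>w 0 \<noteq> 0\<close> by (cases i) (auto simp: tuples_def tuple_scale_def)
        then have "x = tuple_scale (x 0 / w 0) w" by blast
        then show ?thesis using tuple.subspace_scale[OF W(1) w(1)] by metis
      qed
      then show ?thesis using W(2) by blast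
    qed simp
  qed simp
  from fund_exhaust[OF this] obtain \<alpha> where \<alpha>: "\<alpha> \<in> Irr G"
    and eq: "equivalent_coreps G 1 (\<lambda>_ _. 1) (dim_irr G \<alpha>) (fund G \<alpha>)" by blast
  from eq have dim: "dim_irr G \<alpha> = 1" by (simp add: equivalent_coreps_def)
  from eq[unfolded equivalent_coreps_def dim]
  obtain t s where "t 0 0 * s 0 0 = (1::complex)" and ts: "scl G (t 0 0) 1 = scl G (t 0 0) (fund G \<alpha> 0 0)"
    by auto
  then have "t 0 0 \<noteq> 0" by auto
  with ts have "fund G \<alpha> 0 0 = 1" by (simp add: scale_left_imp_eq)
  with \<alpha> dim show ?thesis by blast
qed

lemma trivial_irr: "trivial_irr G \<in> Irr G" "dim_irr G (trivial_irr G) = 1" "fund G (trivial_irr G) 0 0 = 1"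
  using someI_ex[OF trivial_exists] by (simp_all add: trivial_irr_def)

lemma haar_functional:
  "functional G (haar_functional G)"
  "\<alpha> \<in> Irr G \<Longrightarrow> i < dim_irr G \<alpha> \<Longrightarrow> j < dim_irr G \<alpha> \<Longrightarrow> haar_functional G (fund G \<alpha> i j) = of_bool (\<alpha> = trivial_irr G)"
  using someI_ex[OF linear_extension[OF complex_vector_space, of "\<lambda>\<alpha> i j. of_bool (\<alpha> = trivial_irr G)"]]
  by (simp_all add: haar_functional_def)

lemma haar_functional_one: "haar_functional G 1 = 1"
  using haar_functional(2)[OF trivial_irr(1), of 0 0] trivial_irr by simp

lemma haar_functional_invariant:
  "comult_map G (\<lambda>x y. scl G (haar_functional G x) y) a = scl G (haar_functional G a) 1"
  "comult_map G (\<lambda>x y. scl G (haar_functional G y) x) a = scl G (haar_functional G a) 1"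
proof -
  interpret h: Vector_Spaces.linear "scl G" "(*)" "haar_functional G" by (rule haar_functional(1))
  have lin: "Vector_Spaces.linear (scl G) (scl G) (\<lambda>a. scl G (haar_functional G a) 1)"
    by (rule linear_intro[OF self_vector_space]) (simp_all add: h.add h.scale scale_left_distrib)
  note bil = conv_bilinear[OF haar_functional(1)]
  show "comult_map G (\<lambda>x y. scl G (haar_functional G x) y) a = scl G (haar_functional G a) 1"
  proof (rule linear_eq_on_fund[OF comult_map_linear[OF bil(2)] lin])
    fix \<alpha> i j assume *: "\<alpha> \<in> Irr G" "i < dim_irr G \<alpha>" "j < dim_irr G \<alpha>"
    show "comult_map G (\<lambda>x y. scl G (haar_functional G x) y) (fund G \<alpha> i j) = scl G (haar_functional G (fund G \<alpha> i j)) 1"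
      using * trivial_irr by (cases "\<alpha> = trivial_irr G")
        (simp_all add: comult_map_corep[OF bil(2) fund_corep] comult_map_one[OF bil(2)] haar_functional_one haar_functional(2))
  qed
  show "comult_map G (\<lambda>x y. scl G (haar_functional G y) x) a = scl G (haar_functional G a) 1"
  proof (rule linear_eq_on_fund[OF comult_map_linear[OF bil(1)] lin])
    fix \<alpha> i j assume *: "\<alpha> \<in> Irr G" "i < dim_irr G \<alpha>" "j < dim_irr G \<alpha>"
    show "comult_map G (\<lambda>x y. scl G (haar_functional G y) x) (fund G \<alpha> i j) = scl G (haar_functional G (fund G \<alpha> i j)) 1"
      using * trivial_irr by (cases "\<alpha> = trivial_irr G")
        (simp_all add: comult_map_corep[OF bil(1) fund_corep] comult_map_one[OF bil(1)] haar_functional_one haar_functional(2))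
  qed
qed

lemma conjugate_corep:
  assumes u: "fd_corep G n u"
  shows "fd_corep G n (\<lambda>i j. star G (u i j))"
  unfolding fd_corep_def
proof (intro allI impI conjI)
  fix i j assume ij: "i < n" "j < n"
  show "counit G (star G (u i j)) = of_bool (i = j)"
    using ij by (simp add: counit_star counit_corep[OF u])
  show "tensor2_eq G (comult G (star G (u i j))) [(star G (u i k), star G (u k j)). k \<leftarrow> [0..<n]]"
    unfolding tensor2_eq_def
  proof (intro allI impI)
    fix B :: "'a \<Rightarrow> 'a \<Rightarrow> complex"
    assume "(\<forall>a. functional G (\<lambda>x. B x a)) \<and> (\<forall>a. functional G (\<lambda>x. B a x))"
    then have B: "bilinear_map G (*) B" by (simp add: bilinear_map_def)
    have lin: "B (x + x') y = B x y + B x' y" "B x (y + y') = B x y + B x y'"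
      "B (scl G c x) y = c * B x y" "B x (scl G c y) = c * B x y" for x x' y y' c
    proof -
      interpret l: Vector_Spaces.linear "scl G" "(*)" "\<lambda>x. B x y" using B by (simp add: bilinear_map_def)
      interpret r: Vector_Spaces.linear "scl G" "(*)" "B x" using B by (simp add: bilinear_map_def)
      show "B (x + x') y = B x y + B x' y" "B x (y + y') = B x y + B x y'"
        "B (scl G c x) y = c * B x y" "B x (scl G c y) = c * B x y"
        by (simp_all add: l.add r.add l.scale r.scale)
    qed
    have B': "bilinear_map G (*) (\<lambda>x y. cnj (B (star G x) (star G y)))"
      by (rule bilinear_mapI[OF complex_vector_space]) (simp_all add: star_add star_scl lin)
    have cnj_sum_list: "cnj (sum_list zs) = sum_list (map cnj zs)" for zs
      by (induction zs) auto
    have "(\<Sum>(x, y)\<leftarrow>comult G (star G (u i j)). B x y) = cnj (comult_map G (\<lambda>x y. cnj (B (star G x) (star G y))) (u i j))"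
      using comult_map_star[OF B, of "u i j"]
      by (simp add: comult_map_def cnj_sum_list comp_def case_prod_unfold)
    also have "\<dots> = (\<Sum>k<n. B (star G (u i k)) (star G (u k j)))"
      by (simp add: comult_map_corep[OF B' u ij])
    finally show "(\<Sum>(x, y)\<leftarrow>comult G (star G (u i j)). B x y) =
        (\<Sum>(x, y)\<leftarrow>[(star G (u i k), star G (u k j)). k \<leftarrow> [0..<n]]. B x y)"
      by (simp add: comp_def interv_sum_list_conv_sum_set_nat atLeast0LessThan)
  qed
qed

text \<open>Entrywise complex conjugation of vectors exchanges the invariant subspaces of \<open>u\<close> with those of its
  conjugate.\<close>
lemma conjugate_irreducible:
  assumes u: "irreducible_corep G n u"
  shows "irreducible_corep G n (\<lambda>i j. star G (u i j))"
  unfolding irreducible_corep_iff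
proof (intro conjI allI impI)
  show "fd_corep G n (\<lambda>i j. star G (u i j))" "n > 0"
    using u conjugate_corep by (auto simp: irreducible_corep_iff)
  fix W assume "invariant_subspace G n (\<lambda>i j. star G (u i j)) W"
  then have W: "tuple.subspace W" "W \<subseteq> tuples n" and
    inv: "\<And>f w. functional G f \<Longrightarrow> w \<in> W \<Longrightarrow> mat_apply n (\<lambda>i j. f (star G (u i j))) w \<in> W"
    by (auto simp: invariant_subspace_iff)
  define C where "C = (\<lambda>(w::nat \<Rightarrow> complex) i. cnj (w i))"
  have CC: "C (C w) = w" for w by (simp add: C_def)
  have mem: "w \<in> C ` S \<longleftrightarrow> C w \<in> S" for w S
  proof
    show "C w \<in> S" if "w \<in> C ` S" using that CC by auto
    show "w \<in> C ` S" if "C w \<in> S" using imageI[OF that, of C] CC by simp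
  qed
  have C_tuples: "C w \<in> tuples n \<longleftrightarrow> w \<in> tuples n" for w by (simp add: C_def tuples_def)
  have C_add: "C (v + w) = C v + C w" and C_scale: "C (tuple_scale z w) = tuple_scale (cnj z) (C w)"
    and C0: "C 0 = 0" for v w z
    by (auto simp: C_def tuple_scale_def fun_eq_iff)
  have "tuple.subspace (C ` W)"
    unfolding tuple.subspace_def
  proof (intro conjI allI ballI)
    show "0 \<in> C ` W" using tuple.subspace_0[OF W(1)] unfolding mem C0 .
    show "x + y \<in> C ` W" if "x \<in> C ` W" "y \<in> C ` W" for x y
      using tuple.subspace_add[OF W(1), of "C x" "C y"] that unfolding mem C_add .
    show "tuple_scale z x \<in> C ` W" if "x \<in> C ` W" for x z
      using tuple.subspace_scale[OF W(1), of "C x"] that unfolding mem C_scale .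
  qed
  moreover have "C ` W \<subseteq> tuples n" using W(2) C_tuples by auto
  moreover have "mat_apply n (\<lambda>i j. f (u i j)) w \<in> C ` W" if f: "functional G f" and w: "w \<in> C ` W" for f w
  proof -
    interpret f: Vector_Spaces.linear "scl G" "(*)" f by fact
    define g where "g = (\<lambda>a. cnj (f (star G a)))"
    have g: "functional G g"
      by (rule functionalI) (simp_all add: g_def star_add star_scl f.add f.scale)
    have "C (mat_apply n (\<lambda>i j. f (u i j)) w) = mat_apply n (\<lambda>i j. g (star G (u i j))) (C w)"
      by (auto simp: C_def mat_apply_def g_def star_star fun_eq_iff)
    then show ?thesis using inv[OF g] w by (simp add: mem)
  qed
  ultimately have "invariant_subspace G n u (C ` W)" by (auto simp: invariant_subspace_iff)
  then have "C ` W = {0} \<or> C ` W = tuples n" using u by (auto simp: irreducible_corep_iff)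
  then have "C ` C ` W = C ` {0} \<or> C ` C ` W = C ` tuples n" by metis
  moreover have "C ` C ` W = W" using CC by (simp add: image_image)
  moreover have "C ` tuples n = tuples n" by (rule set_eqI) (simp only: mem C_tuples)
  ultimately show "W = {0} \<or> W = tuples n" using C0 by auto
qed

lemma comult_map_product:
  assumes B: "bilinear_map G s B" and u: "fd_corep G n u" "i < n" "j < n" and v: "fd_corep G m v" "k < m" "l < m"
  shows "comult_map G B (u i j * v k l) = (\<Sum>p<n. \<Sum>q<m. B (u i p * v k q) (u p j * v q l))"
proof -
  have vs: "vector_space s" using B by (simp add: bilinear_map_def Vector_Spaces.linear_def)
  have lin: "B (x + x') y = B x y + B x' y" "B x (y + y') = B x y + B x y'"
    "B (scl G c x) y = s c (B x y)" "B x (scl G c y) = s c (B x y)" for x x' y y' c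
  proof -
    interpret l: Vector_Spaces.linear "scl G" s "\<lambda>x. B x y" using B by (simp add: bilinear_map_def)
    interpret r: Vector_Spaces.linear "scl G" s "B x" using B by (simp add: bilinear_map_def)
    show "B (x + x') y = B x y + B x' y" "B x (y + y') = B x y + B x y'"
      "B (scl G c x) y = s c (B x y)" "B x (scl G c y) = s c (B x y)"
      by (simp_all add: l.add r.add l.scale r.scale)
  qed
  interpret target: vector_space s by (rule vs)
  have inner: "bilinear_map G s (\<lambda>x' y'. B (x * x') (y * y'))" for x y
    by (rule bilinear_mapI[OF vs]) (simp_all add: distrib_left lin scl_mult_right[symmetric])
  have outer: "bilinear_map G s (\<lambda>x y. \<Sum>q<m. B (x * v k q) (y * v q l))"
    by (rule bilinear_mapI[OF vs])
      (simp_all add: distrib_right lin scl_mult_left[symmetric] sum.distrib target.scale_sum_right)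
  have "comult_map G B (u i j * v k l) = comult_map G (\<lambda>x y. comult_map G (\<lambda>x' y'. B (x * x') (y * y')) (v k l)) (u i j)"
    unfolding comult_map_mult[OF B] by (simp add: comult_map_def)
  also have "\<dots> = comult_map G (\<lambda>x y. \<Sum>q<m. B (x * v k q) (y * v q l)) (u i j)"
    by (simp add: comult_map_corep[OF inner v])
  also have "\<dots> = (\<Sum>p<n. \<Sum>q<m. B (u i p * v k q) (u p j * v q l))"
    by (rule comult_map_corep[OF outer u])
  finally show ?thesis .
qed

text \<open>Averaging over the Haar state produces intertwiners; Schur's lemma evaluates them.\<close>

lemma haar_orthogonality_left:
  assumes \<alpha>: "\<alpha> \<in> Irr G" and \<beta>: "\<beta> \<in> Irr G" and ik: "i < dim_irr G \<alpha>" "k < dim_irr G \<beta>"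
  shows "intertwiner G (dim_irr G \<beta>) (fund G \<beta>) (dim_irr G \<alpha>) (fund G \<alpha>)
    (\<lambda>j l. haar_functional G (star G (fund G \<alpha> i j) * fund G \<beta> k l))"
  unfolding intertwiner_def
proof (intro allI impI)
  let ?n = "dim_irr G \<alpha>" and ?m = "dim_irr G \<beta>" and ?u = "fund G \<alpha>" and ?v = "fund G \<beta>"
  let ?E = "\<lambda>j l. haar_functional G (star G (?u i j) * ?v k l)"
  fix r l assume rl: "r < ?n" "l < ?m"
  have inv: "(\<Sum>p<?n. \<Sum>q<?m. scl G (?E p q) (star G (?u p j) * ?v q l)) = scl G (?E j l) 1" if "j < ?n" for j
    using haar_functional_invariant(1)[of "star G (?u i j) * ?v k l"]
      comult_map_product[OF conv_bilinear(2)[OF haar_functional(1)] conjugate_corep[OF fund_corep[OF \<alpha>]] _ _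
        fund_corep[OF \<beta>], of i j k l] ik rl that by simp
  have "(\<Sum>j<?n. scl G (?E j l) (?u r j)) = (\<Sum>j<?n. ?u r j * scl G (?E j l) 1)"
    by (simp add: scl_mult_right[symmetric])
  also have "\<dots> = (\<Sum>j<?n. ?u r j * (\<Sum>p<?n. \<Sum>q<?m. scl G (?E p q) (star G (?u p j) * ?v q l)))"
    using inv by simp
  also have "\<dots> = (\<Sum>j<?n. \<Sum>p<?n. (?u r j * star G (?u p j)) * (\<Sum>q<?m. scl G (?E p q) (?v q l)))"
    by (simp add: sum_distrib_left scl_mult_right[symmetric] mult.assoc)
  also have "\<dots> = (\<Sum>p<?n. (\<Sum>j<?n. ?u r j * star G (?u p j)) * (\<Sum>q<?m. scl G (?E p q) (?v q l)))"
    by (subst sum.swap) (simp add: sum_distrib_right)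
  also have "\<dots> = (\<Sum>p<?n. of_bool (r = p) * (\<Sum>q<?m. scl G (?E p q) (?v q l)))"
    using fund_unitary[OF \<alpha>] rl by (simp add: unitary_matrix_def)
  also have "\<dots> = (\<Sum>q<?m. scl G (?E r q) (?v q l))" using rl by simp
  finally show "(\<Sum>q<?m. scl G (?E r q) (?v q l)) = (\<Sum>j<?n. scl G (?E j l) (?u r j))" by simp
qed

lemma haar_orthogonality_right:
  assumes \<alpha>: "\<alpha> \<in> Irr G" and \<beta>: "\<beta> \<in> Irr G" and jl: "j < dim_irr G \<alpha>" "l < dim_irr G \<beta>"
  shows "intertwiner G (dim_irr G \<beta>) (fund G \<beta>) (dim_irr G \<alpha>) (fund G \<alpha>)
    (\<lambda>i k. haar_functional G (fund G \<alpha> i j * star G (fund G \<beta> k l)))"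
  unfolding intertwiner_def
proof (intro allI impI)
  let ?n = "dim_irr G \<alpha>" and ?m = "dim_irr G \<beta>" and ?u = "fund G \<alpha>" and ?v = "fund G \<beta>"
  let ?D = "\<lambda>i k. haar_functional G (?u i j * star G (?v k l))"
  fix i r assume ir: "i < ?n" "r < ?m"
  have inv: "(\<Sum>p<?n. \<Sum>q<?m. scl G (?D p q) (?u i p * star G (?v k q))) = scl G (?D i k) 1" if "k < ?m" for k
    using haar_functional_invariant(2)[of "?u i j * star G (?v k l)"]
      comult_map_product[OF conv_bilinear(1)[OF haar_functional(1)] fund_corep[OF \<alpha>] _ _
        conjugate_corep[OF fund_corep[OF \<beta>]], of i j k l] jl ir that by simp
  have "(\<Sum>k<?m. scl G (?D i k) (?v k r)) = (\<Sum>k<?m. scl G (?D i k) 1 * ?v k r)"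
    by (simp add: scl_mult_left[symmetric])
  also have "\<dots> = (\<Sum>k<?m. (\<Sum>p<?n. \<Sum>q<?m. scl G (?D p q) (?u i p * star G (?v k q))) * ?v k r)"
    using inv by simp
  also have "\<dots> = (\<Sum>k<?m. \<Sum>p<?n. \<Sum>q<?m. scl G (?D p q) (?u i p) * (star G (?v k q) * ?v k r))"
    by (simp add: sum_distrib_right scl_mult_left[symmetric] mult.assoc)
  also have "\<dots> = (\<Sum>p<?n. \<Sum>k<?m. \<Sum>q<?m. scl G (?D p q) (?u i p) * (star G (?v k q) * ?v k r))"
    by (rule sum.swap)
  also have "\<dots> = (\<Sum>p<?n. \<Sum>q<?m. \<Sum>k<?m. scl G (?D p q) (?u i p) * (star G (?v k q) * ?v k r))"
    by (intro sum.cong refl sum.swap)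
  also have "\<dots> = (\<Sum>p<?n. \<Sum>q<?m. scl G (?D p q) (?u i p) * (\<Sum>k<?m. star G (?v k q) * ?v k r))"
    by (simp add: sum_distrib_left)
  also have "\<dots> = (\<Sum>p<?n. \<Sum>q<?m. scl G (?D p q) (?u i p) * of_bool (q = r))"
    using fund_unitary[OF \<beta>] ir by (simp add: unitary_matrix_def)
  also have "\<dots> = (\<Sum>p<?n. scl G (?D p r) (?u i p))" using ir by simp
  finally show "(\<Sum>k<?m. scl G (?D i k) (?v k r)) = (\<Sum>p<?n. scl G (?D p r) (?u i p))" .
qed

lemma haar_orthogonal:
  assumes "\<alpha> \<in> Irr G" "\<beta> \<in> Irr G" "\<alpha> \<noteq> \<beta>" "i < dim_irr G \<alpha>" "j < dim_irr G \<alpha>" "k < dim_irr G \<beta>" "l < dim_irr G \<beta>"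
  shows "haar_functional G (star G (fund G \<alpha> i j) * fund G \<beta> k l) = 0"
    "haar_functional G (fund G \<alpha> i j * star G (fund G \<beta> k l)) = 0"
proof -
  note schur' = schur[OF fund_irreducible[OF assms(2)] fund_irreducible[OF assms(1)]]
  have neq: "\<not> equivalent_coreps G (dim_irr G \<beta>) (fund G \<beta>) (dim_irr G \<alpha>) (fund G \<alpha>)"
    using fund_inequivalent[OF assms(2,1)] assms(3) by blast
  show "haar_functional G (star G (fund G \<alpha> i j) * fund G \<beta> k l) = 0"
    using schur'[OF haar_orthogonality_left[OF assms(1,2,4,6)] assms(5,7)] neq by blast
  show "haar_functional G (fund G \<alpha> i j * star G (fund G \<beta> k l)) = 0"
    using schur'[OF haar_orthogonality_right[OF assms(1,2,5,7)] assms(4,6)] neq by blast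
qed

end

section \<open>The modular matrices\<close>

definition gram :: "nat \<Rightarrow> (nat \<Rightarrow> nat \<Rightarrow> complex) \<Rightarrow> nat \<Rightarrow> nat \<Rightarrow> complex"
  where "gram n t = (\<lambda>i j. \<Sum>k<n. cnj (t k i) * t k j)"

definition cogram :: "nat \<Rightarrow> (nat \<Rightarrow> nat \<Rightarrow> complex) \<Rightarrow> nat \<Rightarrow> nat \<Rightarrow> complex"
  where "cogram n s = (\<lambda>i j. \<Sum>k<n. s i k * cnj (s j k))"

definition inverse_matrices :: "nat \<Rightarrow> (nat \<Rightarrow> nat \<Rightarrow> complex) \<Rightarrow> (nat \<Rightarrow> nat \<Rightarrow> complex) \<Rightarrow> bool"
  where "inverse_matrices n t s \<longleftrightarrow> (\<forall>i<n. \<forall>j<n.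
    (\<Sum>k<n. t i k * s k j) = of_bool (i = j) \<and> (\<Sum>k<n. s i k * t k j) = of_bool (i = j))"

lemma complex_mat_mult_eq_one:
  "mat_mult n x y = mat_one n \<longleftrightarrow> (\<forall>i<n. \<forall>j<n. (\<Sum>k<n. x i k * y k j) = of_bool (i = j))"
  by (auto simp: mat_mult_def mat_one_def mat_cut_def fun_eq_iff)

lemma gram_cogram_inverse:
  assumes ts: "inverse_matrices n t s"
  shows "mat_mult n (gram n t) (cogram n s) = mat_one n" "mat_mult n (cogram n s) (gram n t) = mat_one n"
proof -
  define t' s' where "t' = (\<lambda>i j. cnj (t j i))" and "s' = (\<lambda>i j. cnj (s j i))"
  have g: "mat_cut n (gram n t) = mat_mult n t' t" "mat_cut n (cogram n s) = mat_mult n s s'"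
    by (auto simp: mat_cut_def gram_def cogram_def mat_mult_def t'_def s'_def fun_eq_iff)
  have ts1: "mat_mult n t s = mat_one n" "mat_mult n s t = mat_one n"
    using ts by (auto simp: complex_mat_mult_eq_one inverse_matrices_def)
  have "(\<Sum>k<n. cnj (t k i) * cnj (s j k)) = of_bool (i = j)" "(\<Sum>k<n. cnj (s k i) * cnj (t j k)) = of_bool (i = j)"
    if "i < n" "j < n" for i j
  proof -
    have "(\<Sum>k<n. cnj (t k i) * cnj (s j k)) = cnj (\<Sum>k<n. s j k * t k i)" by (simp add: mult.commute)
    also have "\<dots> = of_bool (i = j)" using ts that by (auto simp: inverse_matrices_def)
    finally show "(\<Sum>k<n. cnj (t k i) * cnj (s j k)) = of_bool (i = j)" .
    have "(\<Sum>k<n. cnj (s k i) * cnj (t j k)) = cnj (\<Sum>k<n. t j k * s k i)" by (simp add: mult.commute)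
    also have "\<dots> = of_bool (i = j)" using ts that by (auto simp: inverse_matrices_def)
    finally show "(\<Sum>k<n. cnj (s k i) * cnj (t j k)) = of_bool (i = j)" .
  qed
  then have ts2: "mat_mult n t' s' = mat_one n" "mat_mult n s' t' = mat_one n"
    by (auto simp: complex_mat_mult_eq_one t'_def s'_def)
  have cancel: "mat_mult n t (mat_mult n s x) = mat_cut n x" "mat_mult n s' (mat_mult n t' x) = mat_cut n x" for x
    by (simp_all add: mat_mult_assoc[symmetric] ts1 ts2)
  have "mat_mult n (gram n t) (cogram n s) = mat_mult n (mat_mult n t' t) (mat_mult n s s')"
    unfolding g[symmetric] by simp
  then show "mat_mult n (gram n t) (cogram n s) = mat_one n"
    by (simp add: mat_mult_assoc cancel ts2)
  have "mat_mult n (cogram n s) (gram n t) = mat_mult n (mat_mult n s s') (mat_mult n t' t)"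
    unfolding g[symmetric] by simp
  then show "mat_mult n (cogram n s) (gram n t) = mat_one n"
    by (simp add: mat_mult_assoc cancel ts1)
qed

text \<open>The gram matrix of an invertible matrix is positive definite, hence has an orthonormal
  eigenbasis with positive eigenvalues.\<close>

lemma gram_spectral:
  assumes ts: "inverse_matrices n t s"
  obtains v d where "\<And>m l. m < n \<Longrightarrow> l < n \<Longrightarrow> (\<Sum>i<n. cnj (v m i) * v l i) = of_bool (m = l)"
    "\<And>i j. i < n \<Longrightarrow> j < n \<Longrightarrow> (\<Sum>m<n. v m i * cnj (v m j)) = of_bool (i = j)"
    "\<And>m. m < n \<Longrightarrow> d m > (0::real)"
    "\<And>i j. i < n \<Longrightarrow> j < n \<Longrightarrow> gram n t i j = (\<Sum>m<n. v m i * of_real (d m) * cnj (v m j))"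
proof -
  have herm: "\<forall>i<n. \<forall>j<n. gram n t j i = cnj (gram n t i j)"
    by (simp add: gram_def mult.commute)
  obtain v e where v: "orthonormal n n v"
    and e: "\<And>m. m < n \<Longrightarrow> mat_apply n (gram n t) (v m) = tuple_scale (e m) (v m)"
    and complete: "\<And>i j. i < n \<Longrightarrow> j < n \<Longrightarrow> (\<Sum>m<n. v m i * cnj (v m j)) = of_bool (i = j)"
    and gram: "\<And>i j. i < n \<Longrightarrow> j < n \<Longrightarrow> gram n t i j = (\<Sum>m<n. v m i * e m * cnj (v m j))"
    using spectral_theorem[OF herm] by blast
  define d where "d m = (\<Sum>p<n. (cmod (\<Sum>j<n. t p j * v m j))\<^sup>2)" for m
  have ed: "e m = of_real (d m)" if m: "m < n" for m
  proof -
    have "e m = tuple_inner n (v m) (mat_apply n (gram n t) (v m))"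
      using v m by (simp add: e tuple_inner_scale orthonormal_def)
    also have "\<dots> = (\<Sum>i<n. \<Sum>j<n. \<Sum>p<n. cnj (t p i * v m i) * (t p j * v m j))"
      by (simp add: tuple_inner_def mat_apply_def gram_def sum_distrib_left sum_distrib_right mult_ac)
    also have "\<dots> = (\<Sum>i<n. \<Sum>p<n. \<Sum>j<n. cnj (t p i * v m i) * (t p j * v m j))"
      by (intro sum.cong refl sum.swap)
    also have "\<dots> = (\<Sum>p<n. \<Sum>i<n. \<Sum>j<n. cnj (t p i * v m i) * (t p j * v m j))"
      by (rule sum.swap)
    also have "\<dots> = (\<Sum>p<n. cnj (\<Sum>i<n. t p i * v m i) * (\<Sum>j<n. t p j * v m j))"
      by (simp add: sum_product)
    also have "\<dots> = of_real (d m)"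
      by (simp add: d_def complex_norm_square mult.commute del: of_real_power)
    finally show ?thesis .
  qed
  have "d m > 0" if m: "m < n" for m
  proof (rule ccontr)
    assume "\<not> d m > 0"
    moreover have "d m \<ge> 0" by (simp add: d_def sum_nonneg)
    ultimately have "d m = 0" by simp
    then have zero: "(\<Sum>j<n. t p j * v m j) = 0" if "p < n" for p
      using that by (simp add: d_def sum_nonneg_eq_0_iff)
    have "v m i = 0" if i: "i < n" for i
    proof -
      have "v m i = (\<Sum>j<n. of_bool (i = j) * v m j)" using i by simp
      also have "\<dots> = (\<Sum>j<n. (\<Sum>p<n. s i p * t p j) * v m j)"
        using ts i by (simp add: inverse_matrices_def)
      also have "\<dots> = (\<Sum>p<n. s i p * (\<Sum>j<n. t p j * v m j))"
        unfolding sum_distrib_left sum_distrib_right by (subst sum.swap) (simp add: mult.assoc)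
      also have "\<dots> = 0" using zero by simp
      finally show ?thesis .
    qed
    then have "tuple_inner n (v m) (v m) = 0" by (simp add: tuple_inner_def)
    then show False using v m by (simp add: orthonormal_def)
  qed
  then show ?thesis
    using that[of v d] v complete gram ed by (simp add: orthonormal_def tuple_inner_def)
qed

text \<open>Conjugation by the invertible matrix \<open>t\<close> makes the conjugate \<open>w\<close> of \<open>u\<^sup>\<alpha>\<close> unitary. The
  positive matrix \<open>Q = t\<^sup>*t\<close> and its inverse, written with \<open>s = t\<^sup>-\<^sup>1\<close>, express this in terms of \<open>w\<close>
  alone; up to two normalizing constants they are the Gram matrices of the Haar state.\<close>

definition modular_data ::
    "('a::ring_1, 'i, 'm) cqg_scheme \<Rightarrow> 'i \<Rightarrow> (nat \<Rightarrow> nat \<Rightarrow> complex) \<Rightarrow> (nat \<Rightarrow> nat \<Rightarrow> complex) \<Rightarrow> real \<Rightarrow> real \<Rightarrow> bool"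
  where "modular_data G \<alpha> t s c1 c2 \<longleftrightarrow> (let n = dim_irr G \<alpha>; u = fund G \<alpha>; w = (\<lambda>i j. star G (u i j)) in
    inverse_matrices n t s \<and> c1 > 0 \<and> c2 > 0 \<and>
    (\<forall>i<n. \<forall>j<n. \<forall>k<n. \<forall>l<n.
      haar_functional G (star G (u i j) * u k l) = of_real c1 * cogram n s i k * of_bool (j = l) \<and>
      haar_functional G (u i j * star G (u k l)) = of_real c2 * gram n t j l * of_bool (i = k)) \<and>
    mat_mult n (mat_adj G n w) (mat_mult n (const_mat G n (gram n t)) w) = const_mat G n (gram n t) \<and>
    mat_mult n w (mat_mult n (const_mat G n (cogram n s)) (mat_adj G n w)) = const_mat G n (cogram n s))"

context compact_quantum_group
begin

text \<open>The conjugate of \<open>u\<^sup>\<alpha>\<close> is irreducible, hence equivalent to one of the unitary representatives; \<open>t\<close>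
  is the matrix of such an equivalence.\<close>
lemma conjugate_unitarizable:
  assumes \<alpha>: "\<alpha> \<in> Irr G"
  defines "n \<equiv> dim_irr G \<alpha>" and "w \<equiv> (\<lambda>i j. star G (fund G \<alpha> i j))"
  obtains t s where "inverse_matrices n t s"
    "mat_mult n (mat_adj G n w) (mat_mult n (const_mat G n (gram n t)) w) = const_mat G n (gram n t)"
    "mat_mult n w (mat_mult n (const_mat G n (cogram n s)) (mat_adj G n w)) = const_mat G n (cogram n s)"
proof -
  have "irreducible_corep G n w"
    unfolding n_def w_def by (rule conjugate_irreducible[OF fund_irreducible[OF \<alpha>]])
  from fund_exhaust[OF this] obtain \<beta> where \<beta>: "\<beta> \<in> Irr G"
    and eq: "equivalent_coreps G n w (dim_irr G \<beta>) (fund G \<beta>)" by blast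
  define v where "v = fund G \<beta>"
  from eq have dim: "dim_irr G \<beta> = n" by (simp add: equivalent_coreps_def)
  from eq[unfolded equivalent_coreps_def dim] obtain t s where
    ts: "inverse_matrices n t s" and "intertwiner G n w n v t"
    unfolding inverse_matrices_def intertwiner_def v_def by blast
  then have comm: "mat_mult n (const_mat G n t) w = mat_mult n v (const_mat G n t)"
    by (simp add: intertwiner_iff_commute)
  define T S where "T = const_mat G n t" and "S = const_mat G n s"
  define T' S' v' where "T' = mat_adj G n T" and "S' = mat_adj G n S" and "v' = mat_adj G n v"
  have one: "mat_mult n T S = mat_one n" "mat_mult n S T = mat_one n"
    using ts by (auto simp: T_def S_def const_mat_mult inverse_matrices_def intro!: const_mat_one)
  have one': "mat_mult n S' T' = mat_one n" "mat_mult n T' S' = mat_one n"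
    using arg_cong[OF one(1), of "mat_adj G n"] arg_cong[OF one(2), of "mat_adj G n"]
    by (simp_all add: mat_adj_mult mat_adj_one T'_def S'_def)
  have unit: "mat_mult n v' v = mat_one n" "mat_mult n v v' = mat_one n"
    using fund_unitary[OF \<beta>] by (auto simp: unitary_matrix_iff dim v_def v'_def)
  have cancel: "mat_mult n T (mat_mult n S x) = mat_cut n x" "mat_mult n S (mat_mult n T x) = mat_cut n x"
    "mat_mult n T' (mat_mult n S' x) = mat_cut n x" "mat_mult n S' (mat_mult n T' x) = mat_cut n x"
    "mat_mult n v (mat_mult n v' x) = mat_cut n x" "mat_mult n v' (mat_mult n v x) = mat_cut n x" for x
    by (simp_all add: mat_mult_assoc[symmetric] one one' unit)
  have w: "mat_cut n w = mat_mult n S (mat_mult n v T)"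
    using cancel(2)[of w] comm by (simp add: T_def)
  have w': "mat_adj G n w = mat_mult n T' (mat_mult n v' S')"
    using arg_cong[OF w, of "mat_adj G n"]
    by (simp add: mat_adj_cut mat_adj_mult T'_def v'_def S'_def mat_mult_assoc)
  have gram: "const_mat G n (gram n t) = mat_mult n T' T"
    by (simp add: T'_def T_def const_mat_adj const_mat_mult gram_def)
  have cogram: "const_mat G n (cogram n s) = mat_mult n S S'"
    by (simp add: S'_def S_def const_mat_adj const_mat_mult cogram_def)
  have cuts: "mat_cut n T = T" "mat_cut n S' = S'" by (simp_all add: T_def S'_def)
  show ?thesis
  proof (rule that[OF ts])
    have "mat_mult n (mat_adj G n w) (mat_mult n (const_mat G n (gram n t)) (mat_cut n w)) = const_mat G n (gram n t)"
      unfolding w w' gram by (simp add: mat_mult_assoc cancel cuts)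
    then show "mat_mult n (mat_adj G n w) (mat_mult n (const_mat G n (gram n t)) w) = const_mat G n (gram n t)"
      by simp
    have "mat_mult n (mat_cut n w) (mat_mult n (const_mat G n (cogram n s)) (mat_adj G n w)) = const_mat G n (cogram n s)"
      unfolding w w' cogram by (simp add: mat_mult_assoc cancel cuts)
    then show "mat_mult n w (mat_mult n (const_mat G n (cogram n s)) (mat_adj G n w)) = const_mat G n (cogram n s)"
      by simp
  qed
qed

lemma haar_norm_positive:
  assumes "c * of_real x = (1::complex)" "x \<ge> 0"
  obtains r where "c = of_real r" "r > 0"
proof -
  have "x \<noteq> 0" using assms by auto
  then have "c = of_real (1 / x)" using assms(1) by (simp add: field_simps)
  then show ?thesis using that[of "1 / x"] assms(2) \<open>x \<noteq> 0\<close> by simp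
qed

lemma cogram_trace: "(\<Sum>i<n. cogram n s i i) = of_real (\<Sum>i<n. \<Sum>k<n. (cmod (s i k))\<^sup>2)"
  by (simp add: cogram_def complex_norm_square del: of_real_power)

lemma gram_trace: "(\<Sum>i<n. gram n t i i) = of_real (\<Sum>i<n. \<Sum>k<n. (cmod (t k i))\<^sup>2)"
  by (simp add: gram_def complex_norm_square mult.commute del: of_real_power)

text \<open>By Schur's lemma the Haar state couples only one of the two indices of the matrix elements.
  Invariance of the Haar state shows that the remaining coefficient matrices transform like \<open>Q\<close> and its
  inverse, to which they are therefore proportional, again by Schur's lemma. Taking traces
  shows that the factors are positive.\<close>
theorem modular_data_exists:
  assumes \<alpha>: "\<alpha> \<in> Irr G"
  obtains t s c1 c2 where "modular_data G \<alpha> t s c1 c2"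
proof -
  define n u w where "n = dim_irr G \<alpha>" and "u = fund G \<alpha>" and "w = (\<lambda>i j. star G (u i j))"
  let ?h = "haar_functional G"
  interpret h: Vector_Spaces.linear "scl G" "(*)" ?h by (rule haar_functional(1))
  have n: "n > 0" using dim_irr_pos[OF \<alpha>] by (simp add: n_def)
  have u: "fd_corep G n u" "unitary_matrix G n u" "irreducible_corep G n u"
    using fund_corep fund_unitary fund_irreducible \<alpha> by (simp_all add: n_def u_def)
  have w_irr: "irreducible_corep G n w" unfolding w_def by (rule conjugate_irreducible[OF u(3)])
  obtain t s where ts: "inverse_matrices n t s"
    and Q: "mat_mult n (mat_adj G n w) (mat_mult n (const_mat G n (gram n t)) w) = const_mat G n (gram n t)"
    and P: "mat_mult n w (mat_mult n (const_mat G n (cogram n s)) (mat_adj G n w)) = const_mat G n (cogram n s)"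
    using conjugate_unitarizable[OF \<alpha>] unfolding n_def w_def u_def by blast
  have "\<exists>c. \<forall>j<n. \<forall>l<n. ?h (star G (u i j) * u k l) = c * of_bool (j = l)" if "i < n" "k < n" for i k
    using schur_scalar[OF u(3) haar_orthogonality_left[OF \<alpha> \<alpha>, of i k, folded n_def u_def, OF that]] by metis
  then obtain F where F: "\<And>i j k l. i < n \<Longrightarrow> k < n \<Longrightarrow> j < n \<Longrightarrow> l < n \<Longrightarrow>
      ?h (star G (u i j) * u k l) = F i k * of_bool (j = l)" by metis
  have "\<exists>c. \<forall>i<n. \<forall>k<n. ?h (u i j * star G (u k l)) = c * of_bool (i = k)" if "j < n" "l < n" for j l
    using schur_scalar[OF u(3) haar_orthogonality_right[OF \<alpha> \<alpha>, of j l, folded n_def u_def, OF that]] by metis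
  then obtain H where H: "\<And>i j k l. i < n \<Longrightarrow> k < n \<Longrightarrow> j < n \<Longrightarrow> l < n \<Longrightarrow>
      ?h (u i j * star G (u k l)) = H j l * of_bool (i = k)" by metis
  let ?F = "const_mat G n F" and ?H = "const_mat G n H" and ?w' = "mat_adj G n w"
  let ?Q = "const_mat G n (gram n t)" and ?P = "const_mat G n (cogram n s)"
  have F_inv: "mat_mult n w (mat_mult n ?F ?w') = ?F"
  proof -
    have "mat_cut n (mat_mult n w (mat_mult n ?F ?w')) = mat_cut n ?F"
    proof (rule mat_eqI)
      fix i k assume ik: "i < n" "k < n"
      have "(\<Sum>p<n. \<Sum>q<n. scl G (?h (star G (u p 0) * u q 0)) (star G (u i p) * u k q)) = scl G (?h (star G (u i 0) * u k 0)) 1"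
        using haar_functional_invariant(2)[of "star G (u i 0) * u k 0"]
          comult_map_product[OF conv_bilinear(1)[OF haar_functional(1)] conjugate_corep[OF u(1)] _ _ u(1), of i 0 k 0] ik n
        by simp
      then have "(\<Sum>p<n. \<Sum>q<n. scl G (F p q) (star G (u i p) * u k q)) = scl G (F i k) 1"
        using F ik n by simp
      then show "mat_mult n w (mat_mult n ?F ?w') i k = ?F i k"
        using ik by (simp add: mat_mult_def const_mat_def mat_adj_def mat_cut_def w_def star_star
            sum_distrib_left scl_mult_right[symmetric] scl_mult_left[symmetric])
    qed
    then show ?thesis by simp
  qed
  have H_inv: "mat_mult n ?w' (mat_mult n ?H w) = ?H"
  proof -
    have "mat_cut n (mat_mult n ?w' (mat_mult n ?H w)) = mat_cut n ?H"
    proof (rule mat_eqI)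
      fix j l assume jl: "j < n" "l < n"
      have "(\<Sum>p<n. \<Sum>q<n. scl G (?h (u 0 p * star G (u 0 q))) (u p j * star G (u q l))) = scl G (?h (u 0 j * star G (u 0 l))) 1"
        using haar_functional_invariant(1)[of "u 0 j * star G (u 0 l)"]
          comult_map_product[OF conv_bilinear(2)[OF haar_functional(1)] u(1) _ _ conjugate_corep[OF u(1)], of 0 j 0 l] jl n
        by simp
      then have "(\<Sum>p<n. \<Sum>q<n. scl G (H p q) (u p j * star G (u q l))) = scl G (H j l) 1"
        using H jl n by simp
      then show "mat_mult n ?w' (mat_mult n ?H w) j l = ?H j l"
        using jl by (simp add: mat_mult_def const_mat_def mat_adj_def mat_cut_def w_def star_star
            sum_distrib_left scl_mult_right[symmetric] scl_mult_left[symmetric])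
    qed
    then show ?thesis by simp
  qed
  have "mat_mult n (mat_mult n ?F ?Q) w = mat_mult n w (mat_mult n ?F ?Q)"
  proof -
    have "mat_mult n w (mat_mult n ?F ?Q) = mat_mult n w (mat_mult n ?F (mat_mult n ?w' (mat_mult n ?Q w)))"
      by (simp add: Q)
    also have "\<dots> = mat_mult n (mat_mult n w (mat_mult n ?F ?w')) (mat_mult n ?Q w)"
      by (simp add: mat_mult_assoc)
    finally show ?thesis by (simp add: F_inv mat_mult_assoc)
  qed
  then have "intertwiner G n w n w (\<lambda>i j. \<Sum>k<n. F i k * gram n t k j)"
    by (simp add: intertwiner_iff_commute const_mat_mult)
  then obtain a where a: "\<And>i j. i < n \<Longrightarrow> j < n \<Longrightarrow> (\<Sum>k<n. F i k * gram n t k j) = a * of_bool (i = j)"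
    using schur_scalar[OF w_irr] by blast
  have F_eq: "F i k = a * cogram n s i k" if ik: "i < n" "k < n" for i k
  proof -
    have "F i k = mat_mult n F (mat_mult n (gram n t) (cogram n s)) i k"
      using ik by (simp add: gram_cogram_inverse[OF ts] mat_cut_def)
    also have "\<dots> = mat_mult n (mat_mult n F (gram n t)) (cogram n s) i k"
      by (simp add: mat_mult_assoc)
    also have "\<dots> = (\<Sum>j<n. a * of_bool (i = j) * cogram n s j k)"
      using ik a by (simp add: mat_mult_def)
    also have "\<dots> = a * cogram n s i k"
      using ik by (simp add: mult.assoc sum_distrib_left[symmetric])
    finally show ?thesis .
  qed
  have "mat_mult n (mat_mult n ?P ?H) w = mat_mult n w (mat_mult n ?P ?H)"
  proof -
    have "mat_mult n w (mat_mult n ?P ?H) = mat_mult n w (mat_mult n ?P (mat_mult n ?w' (mat_mult n ?H w)))"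
      by (simp add: H_inv)
    also have "\<dots> = mat_mult n (mat_mult n w (mat_mult n ?P ?w')) (mat_mult n ?H w)"
      by (simp add: mat_mult_assoc)
    finally show ?thesis by (simp add: P mat_mult_assoc)
  qed
  then have "intertwiner G n w n w (\<lambda>i j. \<Sum>k<n. cogram n s i k * H k j)"
    by (simp add: intertwiner_iff_commute const_mat_mult)
  then obtain b where b: "\<And>i j. i < n \<Longrightarrow> j < n \<Longrightarrow> (\<Sum>k<n. cogram n s i k * H k j) = b * of_bool (i = j)"
    using schur_scalar[OF w_irr] by blast
  have H_eq: "H j l = b * gram n t j l" if jl: "j < n" "l < n" for j l
  proof -
    have "H j l = mat_mult n (mat_mult n (gram n t) (cogram n s)) H j l"
      using jl by (simp add: gram_cogram_inverse[OF ts] mat_cut_def)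
    also have "\<dots> = mat_mult n (gram n t) (mat_mult n (cogram n s) H) j l"
      by (simp add: mat_mult_assoc)
    also have "\<dots> = (\<Sum>k<n. gram n t j k * (b * of_bool (k = l)))"
      using jl b by (simp add: mat_mult_def)
    also have "\<dots> = (\<Sum>k<n. b * gram n t j k * of_bool (k = l))"
      by (simp add: mult_ac)
    also have "\<dots> = b * gram n t j l" using jl by simp
    finally show ?thesis .
  qed
  have "(\<Sum>i<n. ?h (star G (u i 0) * u i 0)) = 1"
    using u(2) n by (simp add: unitary_matrix_def h.sum[symmetric] haar_functional_one)
  then have "a * (\<Sum>i<n. cogram n s i i) = 1"
    using F n F_eq by (simp add: sum_distrib_left)
  then have "a * of_real (\<Sum>i<n. \<Sum>k<n. (cmod (s i k))\<^sup>2) = 1" by (simp only: cogram_trace)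
  then obtain c1 where c1: "a = of_real c1" "c1 > 0"
    by (rule haar_norm_positive) (simp add: sum_nonneg)
  have "(\<Sum>j<n. ?h (u 0 j * star G (u 0 j))) = 1"
    using u(2) n by (simp add: unitary_matrix_def h.sum[symmetric] haar_functional_one)
  then have "b * (\<Sum>i<n. gram n t i i) = 1"
    using H n H_eq by (simp add: sum_distrib_left)
  then have "b * of_real (\<Sum>i<n. \<Sum>k<n. (cmod (t k i))\<^sup>2) = 1" by (simp only: gram_trace)
  then obtain c2 where c2: "b = of_real c2" "c2 > 0"
    by (rule haar_norm_positive) (simp add: sum_nonneg)
  have "modular_data G \<alpha> t s c1 c2"
    unfolding modular_data_def Let_def n_def[symmetric] u_def[symmetric] w_def[symmetric]
    using ts c1 c2 F F_eq H H_eq Q P by simp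
  then show ?thesis by (rule that)
qed

lemma modular_dataD:
  assumes "modular_data G \<alpha> t s c1 c2"
  shows "inverse_matrices (dim_irr G \<alpha>) t s" "c1 > 0" "c2 > 0"
    "i < dim_irr G \<alpha> \<Longrightarrow> j < dim_irr G \<alpha> \<Longrightarrow> k < dim_irr G \<alpha> \<Longrightarrow> l < dim_irr G \<alpha> \<Longrightarrow>
      haar_functional G (star G (fund G \<alpha> i j) * fund G \<alpha> k l) = of_real c1 * cogram (dim_irr G \<alpha>) s i k * of_bool (j = l)"
    "i < dim_irr G \<alpha> \<Longrightarrow> j < dim_irr G \<alpha> \<Longrightarrow> k < dim_irr G \<alpha> \<Longrightarrow> l < dim_irr G \<alpha> \<Longrightarrow>
      haar_functional G (fund G \<alpha> i j * star G (fund G \<alpha> k l)) = of_real c2 * gram (dim_irr G \<alpha>) t j l * of_bool (i = k)"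
  using assms by (simp_all add: modular_data_def Let_def)

end

section \<open>Positivity and uniqueness of the Haar state\<close>

lemma sum_swap_nested:
  "(\<Sum>r\<in>I. \<Sum>a\<in>E. \<Sum>j\<in>J a. \<Sum>p\<in>P a. f r a j p) = (\<Sum>a\<in>E. \<Sum>j\<in>J a. \<Sum>p\<in>P a. \<Sum>r\<in>I. f r a j p)"
  by (subst sum.swap, intro sum.cong refl, subst sum.swap, intro sum.cong refl, rule sum.swap)

context compact_quantum_group
begin

lemma modular_family:
  obtains t s c1 c2 where "\<And>\<alpha>. \<alpha> \<in> Irr G \<Longrightarrow> modular_data G \<alpha> (t \<alpha>) (s \<alpha>) (c1 \<alpha>) (c2 \<alpha>)"
proof -
  have "\<exists>x. case x of (t, s, c1, c2) \<Rightarrow> modular_data G \<alpha> t s c1 c2" if \<alpha>: "\<alpha> \<in> Irr G" for \<alpha>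
  proof -
    obtain t s c1 c2 where "modular_data G \<alpha> t s c1 c2" using modular_data_exists[OF \<alpha>] .
    then show ?thesis by (intro exI[of _ "(t, s, c1, c2)"]) simp
  qed
  then obtain X where "\<And>\<alpha>. \<alpha> \<in> Irr G \<Longrightarrow> case X \<alpha> of (t, s, c1, c2) \<Rightarrow> modular_data G \<alpha> t s c1 c2"
    by metis
  then show ?thesis
    by (intro that[of "\<lambda>\<alpha>. fst (X \<alpha>)" "\<lambda>\<alpha>. fst (snd (X \<alpha>))" "\<lambda>\<alpha>. fst (snd (snd (X \<alpha>)))" "\<lambda>\<alpha>. snd (snd (snd (X \<alpha>)))"])
      (simp add: case_prod_unfold)
qed

lemma haar_functional_positive: "haar_functional G (star G a * a) \<in> \<real>\<^sub>\<ge>\<^sub>0"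
proof -
  let ?h = "haar_functional G"
  interpret h: Vector_Spaces.linear "scl G" "(*)" ?h by (rule haar_functional(1))
  obtain I c where I: "finite I" "I \<subseteq> irr_indices G" and a: "a = (\<Sum>r\<in>I. scl G (c r) (fund_entry G r))"
    using fund_expansion by blast
  obtain t s c1 c2 where md: "\<And>\<alpha>. \<alpha> \<in> Irr G \<Longrightarrow> modular_data G \<alpha> (t \<alpha>) (s \<alpha>) (c1 \<alpha>) (c2 \<alpha>)"
    by (rule modular_family) (rule that)
  define E where "E = fst ` I"
  have E: "finite E" "E \<subseteq> Irr G" using I by (auto simp: E_def irr_indices_def)
  \<comment> \<open>the form is a sum of squares of these functionals\<close>
  define \<phi> where "\<phi> = (\<lambda>\<alpha> (j::nat) p (\<beta>, i, k). of_bool (\<beta> = \<alpha>) * of_bool (k = j) * (sqrt (c1 \<alpha>) * cnj (s \<alpha> i p)))"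
  have K: "?h (star G (fund_entry G r) * fund_entry G r') =
      (\<Sum>\<alpha>\<in>E. \<Sum>j<dim_irr G \<alpha>. \<Sum>p<dim_irr G \<alpha>. cnj (\<phi> \<alpha> j p r) * \<phi> \<alpha> j p r')" if "r \<in> I" "r' \<in> I" for r r'
  proof -
    obtain \<beta> i k where r: "r = (\<beta>, i, k)" by (cases r) auto
    obtain \<beta>' i' k' where r': "r' = (\<beta>', i', k')" by (cases r') auto
    have \<beta>: "\<beta> \<in> Irr G" "i < dim_irr G \<beta>" "k < dim_irr G \<beta>" "\<beta>' \<in> Irr G" "i' < dim_irr G \<beta>'" "k' < dim_irr G \<beta>'"
      "\<beta> \<in> E"
      using that I(2) r r' by (auto simp: irr_indices_def E_def image_iff intro!: bexI[of _ r])
    have "(\<Sum>\<alpha>\<in>E. \<Sum>j<dim_irr G \<alpha>. \<Sum>p<dim_irr G \<alpha>. cnj (\<phi> \<alpha> j p r) * \<phi> \<alpha> j p r') =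
        (\<Sum>\<alpha>\<in>E. if \<alpha> = \<beta> then \<Sum>j<dim_irr G \<beta>. \<Sum>p<dim_irr G \<beta>. cnj (\<phi> \<beta> j p r) * \<phi> \<beta> j p r' else 0)"
      by (intro sum.cong) (auto simp: \<phi>_def r)
    also have "\<dots> = (\<Sum>j<dim_irr G \<beta>. \<Sum>p<dim_irr G \<beta>. cnj (\<phi> \<beta> j p r) * \<phi> \<beta> j p r')"
      using E(1) \<beta>(7) by simp
    also have "\<dots> = (\<Sum>j<dim_irr G \<beta>. if j = k then \<Sum>p<dim_irr G \<beta>. cnj (\<phi> \<beta> k p r) * \<phi> \<beta> k p r' else 0)"
      by (intro sum.cong) (auto simp: \<phi>_def r)
    also have "\<dots> = (\<Sum>p<dim_irr G \<beta>. cnj (\<phi> \<beta> k p r) * \<phi> \<beta> k p r')"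
      using \<beta>(3) by simp
    also have "\<dots> = ?h (star G (fund_entry G r) * fund_entry G r')"
    proof (cases "\<beta> = \<beta>'")
      case True
      have sq: "complex_of_real (sqrt (c1 \<beta>)) * complex_of_real (sqrt (c1 \<beta>)) = of_real (c1 \<beta>)"
        using modular_dataD(2)[OF md[OF \<beta>(1)]] by (simp flip: of_real_mult)
      have "(\<Sum>p<dim_irr G \<beta>. cnj (\<phi> \<beta> k p r) * \<phi> \<beta> k p r') =
          (\<Sum>p<dim_irr G \<beta>. of_bool (k = k') * (complex_of_real (sqrt (c1 \<beta>)) * complex_of_real (sqrt (c1 \<beta>)) * (s \<beta> i p * cnj (s \<beta> i' p))))"
        using True by (intro sum.cong) (auto simp: \<phi>_def r r')
      also have "\<dots> = of_real (c1 \<beta>) * cogram (dim_irr G \<beta>) (s \<beta>) i i' * of_bool (k = k')"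
        unfolding sq by (simp add: cogram_def sum_distrib_left sum_distrib_right mult_ac)
      finally show ?thesis
        using True \<beta> modular_dataD(4)[OF md[OF \<beta>(1)], of i k i' k'] by (simp add: r r' fund_entry_def)
    next
      case False
      then show ?thesis
        using \<beta> haar_orthogonal(1)[OF \<beta>(1,4) False \<beta>(2,3,5,6)] by (simp add: \<phi>_def r r' fund_entry_def)
    qed
    finally show ?thesis by simp
  qed
  have "star G a * a = (\<Sum>r\<in>I. \<Sum>r'\<in>I. scl G (c r' * cnj (c r)) (star G (fund_entry G r) * fund_entry G r'))"
    by (simp add: a star_sum star_scl sum_product scl_mult_left[symmetric] scl_mult_right[symmetric])
  then have "?h (star G a * a) = (\<Sum>r\<in>I. \<Sum>r'\<in>I. \<Sum>\<alpha>\<in>E. \<Sum>j<dim_irr G \<alpha>. \<Sum>p<dim_irr G \<alpha>.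
      c r' * cnj (c r) * (cnj (\<phi> \<alpha> j p r) * \<phi> \<alpha> j p r'))"
    using K by (simp add: h.sum h.scale sum_distrib_left)
  also have "\<dots> = (\<Sum>r\<in>I. \<Sum>\<alpha>\<in>E. \<Sum>j<dim_irr G \<alpha>. \<Sum>p<dim_irr G \<alpha>. \<Sum>r'\<in>I.
      c r' * cnj (c r) * (cnj (\<phi> \<alpha> j p r) * \<phi> \<alpha> j p r'))"
    by (intro sum.cong refl sum_swap_nested)
  also have "\<dots> = (\<Sum>\<alpha>\<in>E. \<Sum>j<dim_irr G \<alpha>. \<Sum>p<dim_irr G \<alpha>. \<Sum>r\<in>I. \<Sum>r'\<in>I.
      c r' * cnj (c r) * (cnj (\<phi> \<alpha> j p r) * \<phi> \<alpha> j p r'))"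
    by (rule sum_swap_nested)
  also have "\<dots> = (\<Sum>\<alpha>\<in>E. \<Sum>j<dim_irr G \<alpha>. \<Sum>p<dim_irr G \<alpha>. \<Sum>r\<in>I. \<Sum>r'\<in>I.
      cnj (c r * \<phi> \<alpha> j p r) * (c r' * \<phi> \<alpha> j p r'))"
    by (simp add: mult_ac)
  also have "\<dots> = (\<Sum>\<alpha>\<in>E. \<Sum>j<dim_irr G \<alpha>. \<Sum>p<dim_irr G \<alpha>.
      complex_of_real ((cmod (\<Sum>r\<in>I. c r * \<phi> \<alpha> j p r))\<^sup>2))"
    unfolding sum_product[symmetric] complex_norm_square by (simp add: mult.commute)
  also have "\<dots> = complex_of_real (\<Sum>\<alpha>\<in>E. \<Sum>j<dim_irr G \<alpha>. \<Sum>p<dim_irr G \<alpha>.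
      (cmod (\<Sum>r\<in>I. c r * \<phi> \<alpha> j p r))\<^sup>2)"
    by simp
  also have "\<dots> \<in> \<real>\<^sub>\<ge>\<^sub>0"
    unfolding nonneg_Reals_of_real_iff by (intro sum_nonneg zero_le_power2)
  finally show ?thesis .
qed

lemma haar_state_haar_functional: "haar_state G (haar_functional G)"
  unfolding haar_state_def
  using haar_functional(1) haar_functional_one haar_functional_positive haar_functional_invariant
  by (simp add: comult_map_def)

text \<open>The convolution of two invariant states equals each of them.\<close>
lemma haar_state_unique:
  assumes h: "haar_state G h" and h': "haar_state G h'"
  shows "h = h'"
proof
  fix a
  interpret h: Vector_Spaces.linear "scl G" "(*)" h using h by (simp add: haar_state_def)
  interpret h': Vector_Spaces.linear "scl G" "(*)" h' using h' by (simp add: haar_state_def)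
  have sums: "h' (\<Sum>(x, y)\<leftarrow>xs. scl G (h x) y) = h (\<Sum>(x, y)\<leftarrow>xs. scl G (h' y) x)" for xs
    by (induction xs) (auto simp: h.add h'.add h.zero h'.zero h.scale h'.scale mult.commute)
  have "h a = h' (scl G (h a) 1)" using h' by (simp add: h'.scale haar_state_def)
  also have "\<dots> = h (scl G (h' a) 1)"
    using h h' sums[of "comult G a"] by (simp add: haar_state_def)
  also have "\<dots> = h' a" using h by (simp add: h.scale haar_state_def)
  finally show "h a = h' a" .
qed

lemma haar_eq: "haar G = haar_functional G"
  unfolding haar_def
  by (rule the_equality) (use haar_state_haar_functional haar_state_unique in blast)+

end

section \<open>The modular characters\<close>

lemma poly_interpolation:
  fixes g :: "complex \<Rightarrow> complex"
  assumes "finite S"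
  shows "\<exists>p. \<forall>x\<in>S. poly p x = g x"
  using assms
proof (induction S rule: finite_induct)
  case (insert x S)
  then obtain p where p: "\<forall>y\<in>S. poly p y = g y" by auto
  define q where "q = (\<Prod>y\<in>S. [:- y, 1:])"
  have q0: "poly q y = 0" if "y \<in> S" for y
    using insert.hyps(1) that unfolding q_def poly_prod by (intro prod_zero) (auto intro!: bexI[of _ y])
  have "poly q x \<noteq> 0"
    using insert.hyps by (auto simp: q_def poly_prod)
  then have "\<forall>y\<in>insert x S. poly (p + smult ((g x - poly p x) / poly q x) q) y = g y"
    using p q0 by auto
  then show ?case by blast
qed simp

text \<open>An identity between exponential sums for all natural exponents extends to arbitrary functions
  of the bases, since on finitely many bases every function is a polynomial.\<close>

lemma exponential_sums:
  fixes w :: "'x \<Rightarrow> complex" and w' :: "'y \<Rightarrow> complex"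
  assumes fin: "finite I" "finite J" and eq: "\<And>k. (\<Sum>i\<in>I. w i * z i ^ k) = (\<Sum>j\<in>J. w' j * z' j ^ k)"
  shows "(\<Sum>i\<in>I. w i * g (z i)) = (\<Sum>j\<in>J. w' j * g (z' j))"
proof -
  obtain p where p: "\<forall>x\<in>z ` I \<union> z' ` J. poly p x = g x"
    using poly_interpolation[of "z ` I \<union> z' ` J" g] fin by auto
  have "(\<Sum>i\<in>I. w i * g (z i)) = (\<Sum>i\<in>I. w i * poly p (z i))" using p by (intro sum.cong) auto
  also have "\<dots> = (\<Sum>k\<le>degree p. coeff p k * (\<Sum>i\<in>I. w i * z i ^ k))"
    by (simp add: poly_altdef sum_distrib_left mult_ac) (rule sum.swap)
  also have "\<dots> = (\<Sum>k\<le>degree p. coeff p k * (\<Sum>j\<in>J. w' j * z' j ^ k))"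
    using eq by simp
  also have "\<dots> = (\<Sum>j\<in>J. w' j * poly p (z' j))"
    by (simp add: poly_altdef sum_distrib_left mult_ac) (rule sum.swap)
  also have "\<dots> = (\<Sum>j\<in>J. w' j * g (z' j))" using p by (intro sum.cong) auto
  finally show ?thesis .
qed

definition character :: "('a::ring_1, 'm) star_alg_scheme \<Rightarrow> ('a \<Rightarrow> complex) \<Rightarrow> bool"
  where "character A f \<longleftrightarrow> functional A f \<and> f 1 = 1 \<and> (\<forall>a b. f (a * b) = f a * f b)"

context compact_quantum_group
begin

text \<open>The Gram matrix of the matrix elements is invertible, so that every coefficient of an element in
  the basis can be read off from the Haar state of its products.\<close>
lemma haar_nondegenerate:
  assumes "\<And>b. haar_functional G (b * x) = haar_functional G (b * y)"
  shows "x = y"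
proof -
  let ?h = "haar_functional G"
  interpret h: Vector_Spaces.linear "scl G" "(*)" ?h by (rule haar_functional(1))
  obtain I c where I: "finite I" "I \<subseteq> irr_indices G" and z: "x - y = (\<Sum>r\<in>I. scl G (c r) (fund_entry G r))"
    using fund_expansion by blast
  have hz: "?h (b * (x - y)) = 0" for b using assms by (simp add: right_diff_distrib h.diff)
  have "c r = 0" if r: "r \<in> I" for r
  proof -
    obtain \<gamma> p q where r_eq: "r = (\<gamma>, p, q)" by (cases r) auto
    have \<gamma>: "\<gamma> \<in> Irr G" "p < dim_irr G \<gamma>" "q < dim_irr G \<gamma>" using r I(2) by (auto simp: r_eq irr_indices_def)
    obtain t s c1 c2 where md: "modular_data G \<gamma> t s c1 c2" using modular_data_exists[OF \<gamma>(1)] .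
    let ?n = "dim_irr G \<gamma>"
    define \<phi> where "\<phi> a = (\<Sum>i<?n. gram ?n t p i / of_real c1 * ?h (star G (fund G \<gamma> i q) * a))" for a
    have \<phi>_fund: "\<phi> (fund_entry G r') = of_bool (r' = r)" if r': "r' \<in> irr_indices G" for r'
    proof -
      obtain \<beta> k l where r'_eq: "r' = (\<beta>, k, l)" by (cases r') auto
      have \<beta>: "\<beta> \<in> Irr G" "k < dim_irr G \<beta>" "l < dim_irr G \<beta>" using r' by (auto simp: r'_eq irr_indices_def)
      show ?thesis
      proof (cases "\<beta> = \<gamma>")
        case True
        have "\<phi> (fund_entry G r') = (\<Sum>i<?n. gram ?n t p i * cogram ?n s i k) * of_bool (q = l)"
          using True \<beta> \<gamma> modular_dataD(4)[OF md] modular_dataD(2)[OF md]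
          by (simp add: \<phi>_def r'_eq fund_entry_def sum_distrib_right)
        also have "(\<Sum>i<?n. gram ?n t p i * cogram ?n s i k) = of_bool (p = k)"
          using gram_cogram_inverse(1)[OF modular_dataD(1)[OF md]] True \<beta> \<gamma>
          by (simp add: complex_mat_mult_eq_one)
        finally show ?thesis using True by (auto simp: r_eq r'_eq)
      next
        case False
        then show ?thesis using haar_orthogonal(1)[OF \<gamma>(1) \<beta>(1)] \<gamma> \<beta>
          by (auto simp: \<phi>_def r_eq r'_eq fund_entry_def)
      qed
    qed
    have "\<phi> (x - y) = (\<Sum>r'\<in>I. c r' * \<phi> (fund_entry G r'))"
      unfolding z \<phi>_def
      by (simp add: sum_distrib_left scl_mult_right[symmetric] h.sum h.scale mult_ac) (rule sum.swap)
    also have "\<dots> = (\<Sum>r'\<in>I. if r' = r then c r' else 0)"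
      using \<phi>_fund I(2) by (intro sum.cong) auto
    also have "\<dots> = c r" using r I(1) by simp
    finally have "c r = \<phi> (x - y)" by simp
    also have "\<dots> = 0" by (simp add: \<phi>_def hz)
    finally show ?thesis .
  qed
  then have "x - y = 0" by (simp add: z)
  then show ?thesis by simp
qed

text \<open>The Haar state satisfies \<open>h(ab) = h(b\<sigma>(a))\<close>, and nondegeneracy makes \<open>\<sigma>\<close> multiplicative.
  Composing with the counit gives a character.\<close>

theorem modular_character:
  assumes md: "\<And>\<alpha>. \<alpha> \<in> Irr G \<Longrightarrow> modular_data G \<alpha> (t \<alpha>) (s \<alpha>) (c1 \<alpha>) (c2 \<alpha>)"
  obtains f where "character G f"
    "\<And>\<alpha> i j. \<alpha> \<in> Irr G \<Longrightarrow> i < dim_irr G \<alpha> \<Longrightarrow> j < dim_irr G \<alpha> \<Longrightarrow>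
      f (fund G \<alpha> i j) = of_real (c2 \<alpha> / c1 \<alpha>) *
        (\<Sum>p<dim_irr G \<alpha>. gram (dim_irr G \<alpha>) (t \<alpha>) j p * gram (dim_irr G \<alpha>) (t \<alpha>) p i)"
proof -
  let ?h = "haar_functional G"
  interpret h: Vector_Spaces.linear "scl G" "(*)" ?h by (rule haar_functional(1))
  let ?Q = "\<lambda>\<alpha>. gram (dim_irr G \<alpha>) (t \<alpha>)"
  obtain \<sigma> where \<sigma>: "Vector_Spaces.linear (scl G) (scl G) \<sigma>" and
    \<sigma>_fund: "\<And>\<alpha> i j. \<alpha> \<in> Irr G \<Longrightarrow> i < dim_irr G \<alpha> \<Longrightarrow> j < dim_irr G \<alpha> \<Longrightarrow>
      \<sigma> (fund G \<alpha> i j) = (\<Sum>p<dim_irr G \<alpha>. \<Sum>q<dim_irr G \<alpha>.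
        scl G (of_real (c2 \<alpha> / c1 \<alpha>) * ?Q \<alpha> p i * ?Q \<alpha> j q) (fund G \<alpha> p q))"
    using linear_extension[OF self_vector_space, of "\<lambda>\<alpha> i j. \<Sum>p<dim_irr G \<alpha>. \<Sum>q<dim_irr G \<alpha>.
        scl G (of_real (c2 \<alpha> / c1 \<alpha>) * ?Q \<alpha> p i * ?Q \<alpha> j q) (fund G \<alpha> p q)"] by blast
  interpret \<sigma>: Vector_Spaces.linear "scl G" "scl G" \<sigma> by fact
  have kms_fund: "?h (fund G \<alpha> i j * star G (fund G \<beta> k l)) = ?h (star G (fund G \<beta> k l) * \<sigma> (fund G \<alpha> i j))"
    if \<alpha>: "\<alpha> \<in> Irr G" "i < dim_irr G \<alpha>" "j < dim_irr G \<alpha>" and \<beta>: "\<beta> \<in> Irr G" "k < dim_irr G \<beta>" "l < dim_irr G \<beta>"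
    for \<alpha> i j \<beta> k l
  proof -
    have "?h (star G (fund G \<beta> k l) * \<sigma> (fund G \<alpha> i j)) = (\<Sum>p<dim_irr G \<alpha>. \<Sum>q<dim_irr G \<alpha>.
        of_real (c2 \<alpha> / c1 \<alpha>) * ?Q \<alpha> p i * ?Q \<alpha> j q * ?h (star G (fund G \<beta> k l) * fund G \<alpha> p q))"
      using \<alpha> by (simp add: \<sigma>_fund sum_distrib_left scl_mult_right[symmetric] h.sum h.scale)
    also have "\<dots> = ?h (fund G \<alpha> i j * star G (fund G \<beta> k l))"
    proof (cases "\<alpha> = \<beta>")
      case False
      then show ?thesis using haar_orthogonal[of \<beta> \<alpha>] haar_orthogonal[of \<alpha> \<beta>] \<alpha> \<beta> by simp
    next
      case True
      let ?n = "dim_irr G \<alpha>"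
      note md = md[OF \<alpha>(1)]
      have "(\<Sum>p<?n. \<Sum>q<?n. of_real (c2 \<alpha> / c1 \<alpha>) * ?Q \<alpha> p i * ?Q \<alpha> j q * ?h (star G (fund G \<beta> k l) * fund G \<alpha> p q))
          = (\<Sum>p<?n. \<Sum>q<?n. (of_real (c2 \<alpha>) * (cogram ?n (s \<alpha>) k p * ?Q \<alpha> p i) * ?Q \<alpha> j q) * of_bool (l = q))"
        using True \<alpha> \<beta> modular_dataD(2,4)[OF md] by (intro sum.cong refl) simp
      also have "\<dots> = of_real (c2 \<alpha>) * (\<Sum>p<?n. cogram ?n (s \<alpha>) k p * ?Q \<alpha> p i) * ?Q \<alpha> j l"
        using True \<beta> by (simp add: sum_distrib_left sum_distrib_right)
      also have "(\<Sum>p<?n. cogram ?n (s \<alpha>) k p * ?Q \<alpha> p i) = of_bool (k = i)"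
        using gram_cogram_inverse(2)[OF modular_dataD(1)[OF md]] True \<alpha> \<beta>
        by (simp add: complex_mat_mult_eq_one)
      finally show ?thesis using True \<alpha> \<beta> modular_dataD(5)[OF md, of i j k l] by auto
    qed
    finally show ?thesis by simp
  qed
  have kms_star: "?h (a * star G b) = ?h (star G b * \<sigma> a)" for a b
  proof (rule fund_induct[of "\<lambda>a. ?h (a * star G b) = ?h (star G b * \<sigma> a)"])
    show "subspace {a. ?h (a * star G b) = ?h (star G b * \<sigma> a)}"
      by (auto simp: subspace_def h.zero \<sigma>.zero \<sigma>.add \<sigma>.scale distrib_left distrib_right h.add h.scale
          scl_mult_left[symmetric] scl_mult_right[symmetric])
    fix \<alpha> i j assume \<alpha>: "\<alpha> \<in> Irr G" "i < dim_irr G \<alpha>" "j < dim_irr G \<alpha>"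
    show "?h (fund G \<alpha> i j * star G b) = ?h (star G b * \<sigma> (fund G \<alpha> i j))"
    proof (rule fund_induct[of "\<lambda>b. ?h (fund G \<alpha> i j * star G b) = ?h (star G b * \<sigma> (fund G \<alpha> i j))"])
      show "subspace {b. ?h (fund G \<alpha> i j * star G b) = ?h (star G b * \<sigma> (fund G \<alpha> i j))}"
        by (auto simp: subspace_def h.zero star_zero star_add star_scl distrib_left distrib_right h.add h.scale
            scl_mult_left[symmetric] scl_mult_right[symmetric])
    qed (use kms_fund \<alpha> in blast)
  qed
  have kms: "?h (a * b) = ?h (b * \<sigma> a)" for a b
    using kms_star[of a "star G b"] by (simp add: star_star)
  have \<sigma>_mult: "\<sigma> (a * b) = \<sigma> a * \<sigma> b" for a b
  proof (rule haar_nondegenerate)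
    fix c
    have "?h (c * \<sigma> (a * b)) = ?h (a * (b * c))" by (simp add: kms[symmetric] mult.assoc)
    also have "\<dots> = ?h (b * (c * \<sigma> a))" by (simp add: kms[of a] mult.assoc)
    also have "\<dots> = ?h (c * (\<sigma> a * \<sigma> b))" by (simp add: kms[of b] mult.assoc)
    finally show "?h (c * \<sigma> (a * b)) = ?h (c * (\<sigma> a * \<sigma> b))" .
  qed
  have \<sigma>_one: "\<sigma> 1 = 1"
    by (rule haar_nondegenerate) (simp add: kms[symmetric])
  interpret \<epsilon>: Vector_Spaces.linear "scl G" "(*)" "counit G" by (rule counit_linear)
  show ?thesis
  proof (rule that[of "\<lambda>a. counit G (\<sigma> a)"])
    show "character G (\<lambda>a. counit G (\<sigma> a))"
      unfolding character_def
      by (auto intro!: functionalI simp: \<sigma>.add \<sigma>.scale \<epsilon>.add \<epsilon>.scale \<sigma>_one \<sigma>_mult counit_one counit_mult)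
    fix \<alpha> i j assume \<alpha>: "\<alpha> \<in> Irr G" "i < dim_irr G \<alpha>" "j < dim_irr G \<alpha>"
    have "counit G (\<sigma> (fund G \<alpha> i j)) = (\<Sum>p<dim_irr G \<alpha>. \<Sum>q<dim_irr G \<alpha>.
        of_real (c2 \<alpha> / c1 \<alpha>) * ?Q \<alpha> p i * ?Q \<alpha> j q * of_bool (p = q))"
      using \<alpha> by (simp add: \<sigma>_fund \<epsilon>.sum \<epsilon>.scale counit_corep[OF fund_corep[OF \<alpha>(1)]])
    also have "\<dots> = (\<Sum>p<dim_irr G \<alpha>. of_real (c2 \<alpha> / c1 \<alpha>) * ?Q \<alpha> p i * ?Q \<alpha> j p)"
      by (intro sum.cong refl) (simp del: of_real_divide)
    also have "\<dots> = of_real (c2 \<alpha> / c1 \<alpha>) * (\<Sum>p<dim_irr G \<alpha>. ?Q \<alpha> j p * ?Q \<alpha> p i)"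
      unfolding sum_distrib_left by (simp add: mult_ac)
    finally show "counit G (\<sigma> (fund G \<alpha> i j)) = of_real (c2 \<alpha> / c1 \<alpha>) *
        (\<Sum>p<dim_irr G \<alpha>. ?Q \<alpha> j p * ?Q \<alpha> p i)" .
  qed
qed

lemma character_convolution:
  assumes f: "character G f" and g: "character G g"
  shows "character G (comult_map G (\<lambda>x y. f x * g y))"
proof -
  have fg: "functional G f" "functional G g" using f g by (auto simp: character_def)
  note bil = form_bilinear[OF fg]
  have prod: "(\<Sum>(x, y)\<leftarrow>xs. \<Sum>(x', y')\<leftarrow>ys. (f x * f x') * (g y * g y')) =
      (\<Sum>(x, y)\<leftarrow>xs. f x * g y) * (\<Sum>(x, y)\<leftarrow>ys. f x * g y)" for xs ys
  proof (induction xs)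
    case (Cons z xs)
    obtain x y where z: "z = (x, y)" by force
    have "(\<Sum>(x', y')\<leftarrow>ys. (f x * f x') * (g y * g y')) = f x * g y * (\<Sum>(x', y')\<leftarrow>ys. f x' * g y')"
      by (induction ys) (auto simp: algebra_simps)
    then show ?case using Cons z by (simp add: distrib_right)
  qed simp
  show ?thesis
    unfolding character_def
  proof (intro conjI allI)
    show "functional G (comult_map G (\<lambda>x y. f x * g y))" by (rule comult_map_linear[OF bil])
    show "comult_map G (\<lambda>x y. f x * g y) 1 = 1"
      using f g by (simp add: comult_map_one[OF bil] character_def)
    show "comult_map G (\<lambda>x y. f x * g y) (a * b) = comult_map G (\<lambda>x y. f x * g y) a * comult_map G (\<lambda>x y. f x * g y) b" for a b
      using f g prod[where xs = "comult G a" and ys = "comult G b"]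
      unfolding comult_map_mult[OF bil] by (simp add: comult_map_def character_def)
  qed
qed

text \<open>The values of \<open>\<psi>\<close> on the entries of \<open>u\<^sup>*\<close> form the inverse of the matrix \<open>\<psi>(u)\<close>, which is its
  adjoint by unitarity.\<close>
lemma unitary_character_star:
  assumes \<psi>: "character G \<psi>"
    and unitary: "\<And>\<alpha> i j. \<alpha> \<in> Irr G \<Longrightarrow> i < dim_irr G \<alpha> \<Longrightarrow> j < dim_irr G \<alpha> \<Longrightarrow>
      (\<Sum>k<dim_irr G \<alpha>. \<psi> (fund G \<alpha> i k) * cnj (\<psi> (fund G \<alpha> j k))) = of_bool (i = j)"
  shows "\<psi> (star G a) = cnj (\<psi> a)"
proof (rule fund_induct[of "\<lambda>a. \<psi> (star G a) = cnj (\<psi> a)"])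
  interpret \<psi>: Vector_Spaces.linear "scl G" "(*)" \<psi> using \<psi> by (simp add: character_def)
  show "subspace {a. \<psi> (star G a) = cnj (\<psi> a)}"
    by (auto simp: subspace_def \<psi>.zero star_zero star_add star_scl \<psi>.add \<psi>.scale)
  fix \<alpha> i j assume \<alpha>: "\<alpha> \<in> Irr G" "i < dim_irr G \<alpha>" "j < dim_irr G \<alpha>"
  let ?n = "dim_irr G \<alpha>" and ?u = "fund G \<alpha>"
  have inv: "(\<Sum>k<?n. \<psi> (star G (?u k j)) * \<psi> (?u k l)) = of_bool (j = l)" if "l < ?n" for l
  proof -
    have "(\<Sum>k<?n. star G (?u k j) * ?u k l) = of_bool (j = l)"
      using fund_unitary[OF \<alpha>(1)] \<alpha> that by (simp add: unitary_matrix_def)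
    from arg_cong[OF this, of \<psi>] show ?thesis
      using \<psi> by (simp add: \<psi>.sum character_def of_bool_def \<psi>.zero split: if_splits)
  qed
  have "\<psi> (star G (?u i j)) = (\<Sum>k<?n. \<psi> (star G (?u k j)) * of_bool (k = i))" using \<alpha> by simp
  also have "\<dots> = (\<Sum>k<?n. \<psi> (star G (?u k j)) * (\<Sum>l<?n. \<psi> (?u k l) * cnj (\<psi> (?u i l))))"
    using unitary \<alpha> by simp
  also have "\<dots> = (\<Sum>l<?n. (\<Sum>k<?n. \<psi> (star G (?u k j)) * \<psi> (?u k l)) * cnj (\<psi> (?u i l)))"
    unfolding sum_distrib_left sum_distrib_right by (subst sum.swap) (simp add: mult.assoc)
  also have "\<dots> = cnj (\<psi> (?u i j))" using inv \<alpha> by simp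
  finally show "\<psi> (star G (?u i j)) = cnj (\<psi> (?u i j))" .
qed

text \<open>A positive group-like element of the dual has unitary imaginary powers, which are again
  group-like: natural powers are iterated convolutions of a character, and multiplicativity is an
  identity of exponential sums, which extends from natural exponents to imaginary ones.\<close>

theorem imaginary_powers:
  assumes f: "character G f"
    and orth: "\<And>\<alpha> m l. \<alpha> \<in> Irr G \<Longrightarrow> m < dim_irr G \<alpha> \<Longrightarrow> l < dim_irr G \<alpha> \<Longrightarrow>
      (\<Sum>i<dim_irr G \<alpha>. cnj (v \<alpha> m i) * v \<alpha> l i) = of_bool (m = l)"
    and complete: "\<And>\<alpha> i j. \<alpha> \<in> Irr G \<Longrightarrow> i < dim_irr G \<alpha> \<Longrightarrow> j < dim_irr G \<alpha> \<Longrightarrow>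
      (\<Sum>m<dim_irr G \<alpha>. v \<alpha> m i * cnj (v \<alpha> m j)) = of_bool (i = j)"
    and e: "\<And>\<alpha> m. \<alpha> \<in> Irr G \<Longrightarrow> m < dim_irr G \<alpha> \<Longrightarrow> e \<alpha> m > (0::real)"
    and f_fund: "\<And>\<alpha> i j. \<alpha> \<in> Irr G \<Longrightarrow> i < dim_irr G \<alpha> \<Longrightarrow> j < dim_irr G \<alpha> \<Longrightarrow>
      f (fund G \<alpha> i j) = (\<Sum>m<dim_irr G \<alpha>. v \<alpha> m j * of_real (e \<alpha> m) * cnj (v \<alpha> m i))"
  obtains \<psi> where "character G \<psi>" "\<And>a. \<psi> (star G a) = cnj (\<psi> a)"
    "\<And>\<alpha> i j. \<alpha> \<in> Irr G \<Longrightarrow> i < dim_irr G \<alpha> \<Longrightarrow> j < dim_irr G \<alpha> \<Longrightarrow>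
      \<psi> (fund G \<alpha> i j) = (\<Sum>m<dim_irr G \<alpha>. v \<alpha> m j * cis (\<tau> * ln (e \<alpha> m)) * cnj (v \<alpha> m i))"
proof -
  have power: "\<exists>g. character G g \<and> (\<forall>\<alpha>\<in>Irr G. \<forall>i<dim_irr G \<alpha>. \<forall>j<dim_irr G \<alpha>.
      g (fund G \<alpha> i j) = (\<Sum>m<dim_irr G \<alpha>. v \<alpha> m j * cnj (v \<alpha> m i) * of_real (e \<alpha> m) ^ k))" for k
  proof (induction k)
    case 0
    have "character G (counit G)"
      by (simp add: character_def counit_linear counit_one counit_mult)
    then show ?case
      using complete by (intro exI[of _ "counit G"]) (auto simp: counit_corep[OF fund_corep])
  next
    case (Suc k)
    then obtain g where g: "character G g" and g_fund: "\<And>\<alpha> i j. \<alpha> \<in> Irr G \<Longrightarrow> i < dim_irr G \<alpha> \<Longrightarrow> j < dim_irr G \<alpha> \<Longrightarrow>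
      g (fund G \<alpha> i j) = (\<Sum>m<dim_irr G \<alpha>. v \<alpha> m j * cnj (v \<alpha> m i) * of_real (e \<alpha> m) ^ k)" by blast
    have "comult_map G (\<lambda>x y. f x * g y) (fund G \<alpha> i j) =
        (\<Sum>m<dim_irr G \<alpha>. v \<alpha> m j * cnj (v \<alpha> m i) * of_real (e \<alpha> m) ^ Suc k)"
      if \<alpha>: "\<alpha> \<in> Irr G" "i < dim_irr G \<alpha>" "j < dim_irr G \<alpha>" for \<alpha> i j
    proof -
      let ?n = "dim_irr G \<alpha>"
      let ?x = "\<lambda>m. of_real (e \<alpha> m) * cnj (v \<alpha> m i)" and ?y = "\<lambda>m. v \<alpha> m j * of_real (e \<alpha> m) ^ k"
      have "comult_map G (\<lambda>x y. f x * g y) (fund G \<alpha> i j) = (\<Sum>p<?n. f (fund G \<alpha> i p) * g (fund G \<alpha> p j))"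
        using f g \<alpha> by (intro comult_map_corep[OF form_bilinear] fund_corep) (auto simp: character_def)
      also have "\<dots> = (\<Sum>p<?n. (\<Sum>m<?n. v \<alpha> m p * ?x m) * (\<Sum>m'<?n. cnj (v \<alpha> m' p) * ?y m'))"
        using f_fund g_fund \<alpha> by (intro sum.cong refl arg_cong2[of _ _ _ _ "(*)"]) (simp_all add: mult_ac)
      also have "\<dots> = (\<Sum>p<?n. \<Sum>m<?n. \<Sum>m'<?n. ?x m * ?y m' * (cnj (v \<alpha> m' p) * v \<alpha> m p))"
        by (simp add: sum_product mult_ac)
      also have "\<dots> = (\<Sum>m<?n. \<Sum>p<?n. \<Sum>m'<?n. ?x m * ?y m' * (cnj (v \<alpha> m' p) * v \<alpha> m p))"
        by (rule sum.swap)
      also have "\<dots> = (\<Sum>m<?n. \<Sum>m'<?n. \<Sum>p<?n. ?x m * ?y m' * (cnj (v \<alpha> m' p) * v \<alpha> m p))"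
        by (intro sum.cong refl sum.swap)
      also have "\<dots> = (\<Sum>m<?n. \<Sum>m'<?n. ?x m * ?y m' * of_bool (m' = m))"
        using orth \<alpha> by (simp add: sum_distrib_left[symmetric])
      also have "\<dots> = (\<Sum>m<?n. ?x m * ?y m)"
        by (intro sum.cong refl) simp
      also have "\<dots> = (\<Sum>m<?n. v \<alpha> m j * cnj (v \<alpha> m i) * of_real (e \<alpha> m) ^ Suc k)"
        by (simp add: mult_ac)
      finally show ?thesis .
    qed
    then show ?case using character_convolution[OF f g] by blast
  qed
  have "\<exists>F. \<forall>k. character G (F k) \<and> (\<forall>\<alpha>\<in>Irr G. \<forall>i<dim_irr G \<alpha>. \<forall>j<dim_irr G \<alpha>.
      F k (fund G \<alpha> i j) = (\<Sum>m<dim_irr G \<alpha>. v \<alpha> m j * cnj (v \<alpha> m i) * of_real (e \<alpha> m) ^ k))"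
    by (intro choice allI power)
  then obtain F where F: "\<And>k. character G (F k)" and F_fund: "\<And>k \<alpha> i j. \<alpha> \<in> Irr G \<Longrightarrow> i < dim_irr G \<alpha> \<Longrightarrow> j < dim_irr G \<alpha> \<Longrightarrow>
      F k (fund G \<alpha> i j) = (\<Sum>m<dim_irr G \<alpha>. v \<alpha> m j * cnj (v \<alpha> m i) * of_real (e \<alpha> m) ^ k)"
    by blast
  define g where "g z = cis (\<tau> * ln (cmod z))" for z
  have g_mult: "g (z * z') = g z * g z'" if "z \<noteq> 0" "z' \<noteq> 0" for z z'
    using that by (simp add: g_def norm_mult ln_mult cis_mult distrib_left)
  have g_one: "g 1 = 1" by (simp add: g_def)
  have g_e: "g (of_real (e \<alpha> m)) = cis (\<tau> * ln (e \<alpha> m))" if "\<alpha> \<in> Irr G" "m < dim_irr G \<alpha>" for \<alpha> m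
    using e[OF that] by (simp add: g_def)
  obtain \<psi> where \<psi>: "functional G \<psi>" and \<psi>_fund: "\<And>\<alpha> i j. \<alpha> \<in> Irr G \<Longrightarrow> i < dim_irr G \<alpha> \<Longrightarrow> j < dim_irr G \<alpha> \<Longrightarrow>
      \<psi> (fund G \<alpha> i j) = (\<Sum>m<dim_irr G \<alpha>. v \<alpha> m j * cnj (v \<alpha> m i) * g (of_real (e \<alpha> m)))"
    using linear_extension[OF complex_vector_space, of "\<lambda>\<alpha> i j. \<Sum>m<dim_irr G \<alpha>. v \<alpha> m j * cnj (v \<alpha> m i) * g (of_real (e \<alpha> m))"]
    by blast
  interpret \<psi>: Vector_Spaces.linear "scl G" "(*)" \<psi> by fact
  have expand: "X a = (\<Sum>(r, m)\<in>(SIGMA r:I. {..<dim_irr G (fst r)}).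
      c r * (v (fst r) m (snd (snd r)) * cnj (v (fst r) m (fst (snd r)))) * y (e (fst r) m))"
    if I: "finite I" "I \<subseteq> irr_indices G" and a: "a = (\<Sum>r\<in>I. scl G (c r) (fund_entry G r))"
      and X: "functional G X" and X_fund: "\<And>\<alpha> i j. \<alpha> \<in> Irr G \<Longrightarrow> i < dim_irr G \<alpha> \<Longrightarrow> j < dim_irr G \<alpha> \<Longrightarrow>
        X (fund G \<alpha> i j) = (\<Sum>m<dim_irr G \<alpha>. v \<alpha> m j * cnj (v \<alpha> m i) * y (e \<alpha> m))"
    for I c a X and y :: "real \<Rightarrow> complex"
  proof -
    interpret X: Vector_Spaces.linear "scl G" "(*)" X by fact
    have "X a = (\<Sum>r\<in>I. c r * X (fund_entry G r))" by (simp add: a X.sum X.scale)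
    also have "\<dots> = (\<Sum>r\<in>I. \<Sum>m<dim_irr G (fst r). c r * (v (fst r) m (snd (snd r)) * cnj (v (fst r) m (fst (snd r)))) * y (e (fst r) m))"
      using I(2) by (intro sum.cong) (auto simp: fund_entry_def irr_indices_def X_fund sum_distrib_left mult.assoc)
    finally show ?thesis using I(1) by (simp add: sum.Sigma)
  qed
  have \<psi>_one: "\<psi> 1 = 1"
  proof -
    obtain I c where I: "finite I" "I \<subseteq> irr_indices G" "1 = (\<Sum>r\<in>I. scl G (c r) (fund_entry G r))"
      using fund_expansion by blast
    let ?S = "SIGMA r:I. {..<dim_irr G (fst r)}"
    let ?w = "\<lambda>(r, m). c r * (v (fst r) m (snd (snd r)) * cnj (v (fst r) m (fst (snd r))))"
    let ?z = "\<lambda>(r, m). complex_of_real (e (fst r) m)"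
    have "(\<Sum>x\<in>?S. ?w x * ?z x ^ k) = (\<Sum>x\<in>{()}. 1 * 1 ^ k)" for k
    proof -
      have "functional G (F k)" "F k 1 = 1" using F[of k] by (auto simp: character_def)
      with expand[OF I, of "F k" "\<lambda>x. of_real x ^ k"] F_fund[of _ _ _ k] show ?thesis
        by (simp add: case_prod_unfold)
    qed
    from exponential_sums[OF _ _ this, of g] have "(\<Sum>x\<in>?S. ?w x * g (?z x)) = 1"
      using I(1) by (simp add: g_one)
    moreover have "\<psi> 1 = (\<Sum>x\<in>?S. ?w x * g (?z x))"
      using expand[OF I \<psi>, of "\<lambda>x. g (of_real x)"] \<psi>_fund by (simp add: case_prod_unfold)
    ultimately show ?thesis by simp
  qed
  have \<psi>_mult_fund: "\<psi> (fund G \<alpha> i j * fund G \<beta> k l) = \<psi> (fund G \<alpha> i j) * \<psi> (fund G \<beta> k l)"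
    if \<alpha>: "\<alpha> \<in> Irr G" "i < dim_irr G \<alpha>" "j < dim_irr G \<alpha>" and \<beta>: "\<beta> \<in> Irr G" "k < dim_irr G \<beta>" "l < dim_irr G \<beta>"
    for \<alpha> i j \<beta> k l
  proof -
    obtain I c where I: "finite I" "I \<subseteq> irr_indices G"
      "fund G \<alpha> i j * fund G \<beta> k l = (\<Sum>r\<in>I. scl G (c r) (fund_entry G r))"
      using fund_expansion by blast
    let ?S = "SIGMA r:I. {..<dim_irr G (fst r)}"
    let ?w = "\<lambda>(r, m). c r * (v (fst r) m (snd (snd r)) * cnj (v (fst r) m (fst (snd r))))"
    let ?z = "\<lambda>(r, m). complex_of_real (e (fst r) m)"
    let ?T = "{..<dim_irr G \<alpha>} \<times> {..<dim_irr G \<beta>}"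
    let ?w' = "\<lambda>(m, m'). v \<alpha> m j * cnj (v \<alpha> m i) * (v \<beta> m' l * cnj (v \<beta> m' k))"
    let ?z' = "\<lambda>(m, m'). complex_of_real (e \<alpha> m) * complex_of_real (e \<beta> m')"
    have "(\<Sum>x\<in>?S. ?w x * ?z x ^ p) = (\<Sum>x\<in>?T. ?w' x * ?z' x ^ p)" for p
    proof -
      have "(\<Sum>x\<in>?S. ?w x * ?z x ^ p) = F p (fund G \<alpha> i j * fund G \<beta> k l)"
        using expand[OF I, of "F p" "\<lambda>x. of_real x ^ p"] F_fund[of _ _ _ p] F[of p]
        by (simp add: case_prod_unfold character_def)
      also have "\<dots> = F p (fund G \<alpha> i j) * F p (fund G \<beta> k l)"
        using F[of p] by (simp add: character_def)
      also have "\<dots> = (\<Sum>x\<in>?T. ?w' x * ?z' x ^ p)"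
        using \<alpha> \<beta> by (simp add: F_fund sum_product sum.cartesian_product case_prod_unfold power_mult_distrib mult_ac)
      finally show ?thesis .
    qed
    from exponential_sums[OF _ _ this, of g]
    have "(\<Sum>x\<in>?S. ?w x * g (?z x)) = (\<Sum>x\<in>?T. ?w' x * g (?z' x))" using I(1) by simp
    moreover have "\<psi> (fund G \<alpha> i j * fund G \<beta> k l) = (\<Sum>x\<in>?S. ?w x * g (?z x))"
      using expand[OF I \<psi>, of "\<lambda>x. g (of_real x)"] \<psi>_fund by (simp add: case_prod_unfold)
    moreover have "(\<Sum>x\<in>?T. ?w' x * g (?z' x)) =
        (\<Sum>(m, m')\<in>?T. (v \<alpha> m j * cnj (v \<alpha> m i) * g (of_real (e \<alpha> m))) * (v \<beta> m' l * cnj (v \<beta> m' k) * g (of_real (e \<beta> m'))))"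
    proof (rule sum.cong[OF refl])
      fix x assume "x \<in> ?T"
      then obtain m m' where x: "x = (m, m')" "m < dim_irr G \<alpha>" "m' < dim_irr G \<beta>" by auto
      then have "e \<alpha> m \<noteq> 0" "e \<beta> m' \<noteq> 0" using e[OF \<alpha>(1)] e[OF \<beta>(1)] by (metis less_irrefl)+
      then show "?w' x * g (?z' x) = (case x of (m, m') \<Rightarrow>
          (v \<alpha> m j * cnj (v \<alpha> m i) * g (of_real (e \<alpha> m))) * (v \<beta> m' l * cnj (v \<beta> m' k) * g (of_real (e \<beta> m'))))"
        by (simp add: x g_mult)
    qed
    moreover have "\<dots> = \<psi> (fund G \<alpha> i j) * \<psi> (fund G \<beta> k l)"
      using \<alpha> \<beta> by (simp add: \<psi>_fund sum_product sum.cartesian_product)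
    ultimately show ?thesis by simp
  qed
  have \<psi>_mult: "\<psi> (a * b) = \<psi> a * \<psi> b" for a b
  proof (rule fund_induct[of "\<lambda>a. \<psi> (a * b) = \<psi> a * \<psi> b"])
    show "subspace {a. \<psi> (a * b) = \<psi> a * \<psi> b}"
      by (auto simp: subspace_def \<psi>.zero \<psi>.add \<psi>.scale distrib_right scl_mult_left[symmetric])
    fix \<alpha> i j assume \<alpha>: "\<alpha> \<in> Irr G" "i < dim_irr G \<alpha>" "j < dim_irr G \<alpha>"
    show "\<psi> (fund G \<alpha> i j * b) = \<psi> (fund G \<alpha> i j) * \<psi> b"
    proof (rule fund_induct[of "\<lambda>b. \<psi> (fund G \<alpha> i j * b) = \<psi> (fund G \<alpha> i j) * \<psi> b"])
      show "subspace {b. \<psi> (fund G \<alpha> i j * b) = \<psi> (fund G \<alpha> i j) * \<psi> b}"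
        by (auto simp: subspace_def \<psi>.zero \<psi>.add \<psi>.scale distrib_left scl_mult_right[symmetric])
    qed (use \<psi>_mult_fund \<alpha> in blast)
  qed
  have char: "character G \<psi>" by (simp add: character_def \<psi> \<psi>_one \<psi>_mult)
  have \<psi>_fund': "\<psi> (fund G \<alpha> i j) = (\<Sum>m<dim_irr G \<alpha>. v \<alpha> m j * cis (\<tau> * ln (e \<alpha> m)) * cnj (v \<alpha> m i))"
    if "\<alpha> \<in> Irr G" "i < dim_irr G \<alpha>" "j < dim_irr G \<alpha>" for \<alpha> i j
    using that by (simp add: \<psi>_fund g_e mult_ac)
  have unitary: "(\<Sum>k<dim_irr G \<alpha>. \<psi> (fund G \<alpha> i k) * cnj (\<psi> (fund G \<alpha> j k))) = of_bool (i = j)"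
    if \<alpha>: "\<alpha> \<in> Irr G" "i < dim_irr G \<alpha>" "j < dim_irr G \<alpha>" for \<alpha> i j
  proof -
    let ?n = "dim_irr G \<alpha>" and ?c = "\<lambda>m. cis (\<tau> * ln (e \<alpha> m))"
    have "(\<Sum>k<?n. \<psi> (fund G \<alpha> i k) * cnj (\<psi> (fund G \<alpha> j k))) =
        (\<Sum>k<?n. \<Sum>m<?n. \<Sum>m'<?n. ?c m * cnj (v \<alpha> m i) * (cnj (?c m') * v \<alpha> m' j) * (cnj (v \<alpha> m' k) * v \<alpha> m k))"
      using \<alpha> by (simp add: \<psi>_fund' sum_product mult_ac)
    also have "\<dots> = (\<Sum>m<?n. \<Sum>k<?n. \<Sum>m'<?n. ?c m * cnj (v \<alpha> m i) * (cnj (?c m') * v \<alpha> m' j) * (cnj (v \<alpha> m' k) * v \<alpha> m k))"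
      by (rule sum.swap)
    also have "\<dots> = (\<Sum>m<?n. \<Sum>m'<?n. \<Sum>k<?n. ?c m * cnj (v \<alpha> m i) * (cnj (?c m') * v \<alpha> m' j) * (cnj (v \<alpha> m' k) * v \<alpha> m k))"
      by (intro sum.cong refl sum.swap)
    also have "\<dots> = (\<Sum>m<?n. \<Sum>m'<?n. ?c m * cnj (v \<alpha> m i) * (cnj (?c m') * v \<alpha> m' j) * of_bool (m' = m))"
      using orth \<alpha> by (simp add: sum_distrib_left[symmetric])
    also have "\<dots> = (\<Sum>m<?n. ?c m * cnj (v \<alpha> m i) * (cnj (?c m) * v \<alpha> m j))"
      by (intro sum.cong refl) (simp del: complex_cnj_mult cis_cnj)
    also have "\<dots> = (\<Sum>m<?n. v \<alpha> m j * cnj (v \<alpha> m i) * (?c m * cnj (?c m)))"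
      by (simp only: mult_ac)
    also have "\<dots> = (\<Sum>m<?n. v \<alpha> m j * cnj (v \<alpha> m i))"
      by (simp add: complex_norm_square[symmetric])
    also have "\<dots> = of_bool (j = i)" using complete \<alpha> by blast
    finally show ?thesis by (simp add: eq_commute)
  qed
  show ?thesis
    using that[OF char] unitary_character_star[OF char unitary] \<psi>_fund' by blast
qed

end

context compact_quantum_group
begin

text \<open>If the dual is not unimodular, some modular eigenvalue \<open>e\<close> differs from 1, and the characters of
  the imaginary powers with exponents tending to 0 converge to the counit without ever reaching it.\<close>

theorem kac_criterion:
  assumes isolated: "\<And>\<psi>. (\<And>n. character G (\<psi> n)) \<Longrightarrow> (\<And>n a. \<psi> n (star G a) = cnj (\<psi> n a)) \<Longrightarrow>
      (\<And>\<alpha> i j. \<alpha> \<in> Irr G \<Longrightarrow> i < dim_irr G \<alpha> \<Longrightarrow> j < dim_irr G \<alpha> \<Longrightarrow>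
        (\<lambda>n::nat. \<psi> n (fund G \<alpha> i j)) \<longlonglongrightarrow> of_bool (i = j)) \<Longrightarrow> \<exists>n. \<forall>a. \<psi> n a = counit G a"
    and \<alpha>: "\<alpha> \<in> Irr G"
  shows "unitary_matrix G (dim_irr G \<alpha>) (\<lambda>i j. star G (fund G \<alpha> i j))"
proof -
  obtain t s c1 c2 where md: "\<And>\<alpha>. \<alpha> \<in> Irr G \<Longrightarrow> modular_data G \<alpha> (t \<alpha>) (s \<alpha>) (c1 \<alpha>) (c2 \<alpha>)"
    by (rule modular_family) (rule that)
  have "\<exists>v d. (\<forall>m<dim_irr G \<alpha>. \<forall>l<dim_irr G \<alpha>. (\<Sum>i<dim_irr G \<alpha>. cnj (v m i) * v l i) = of_bool (m = l)) \<and>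
      (\<forall>i<dim_irr G \<alpha>. \<forall>j<dim_irr G \<alpha>. (\<Sum>m<dim_irr G \<alpha>. v m i * cnj (v m j)) = of_bool (i = j)) \<and>
      (\<forall>m<dim_irr G \<alpha>. d m > (0::real)) \<and>
      (\<forall>i<dim_irr G \<alpha>. \<forall>j<dim_irr G \<alpha>. gram (dim_irr G \<alpha>) (t \<alpha>) i j = (\<Sum>m<dim_irr G \<alpha>. v m i * of_real (d m) * cnj (v m j)))"
    if "\<alpha> \<in> Irr G" for \<alpha>
    by (rule gram_spectral[OF modular_dataD(1)[OF md[OF that]]]) blast
  then have "\<forall>\<alpha>\<in>Irr G. \<exists>vd. (\<forall>m<dim_irr G \<alpha>. \<forall>l<dim_irr G \<alpha>. (\<Sum>i<dim_irr G \<alpha>. cnj (fst vd m i) * fst vd l i) = of_bool (m = l)) \<and>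
      (\<forall>i<dim_irr G \<alpha>. \<forall>j<dim_irr G \<alpha>. (\<Sum>m<dim_irr G \<alpha>. fst vd m i * cnj (fst vd m j)) = of_bool (i = j)) \<and>
      (\<forall>m<dim_irr G \<alpha>. snd vd m > (0::real)) \<and>
      (\<forall>i<dim_irr G \<alpha>. \<forall>j<dim_irr G \<alpha>. gram (dim_irr G \<alpha>) (t \<alpha>) i j = (\<Sum>m<dim_irr G \<alpha>. fst vd m i * of_real (snd vd m) * cnj (fst vd m j)))"
    by simp
  from bchoice[OF this] obtain vd where vd: "\<forall>\<alpha>\<in>Irr G. (\<forall>m<dim_irr G \<alpha>. \<forall>l<dim_irr G \<alpha>. (\<Sum>i<dim_irr G \<alpha>. cnj (fst (vd \<alpha>) m i) * fst (vd \<alpha>) l i) = of_bool (m = l)) \<and>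
      (\<forall>i<dim_irr G \<alpha>. \<forall>j<dim_irr G \<alpha>. (\<Sum>m<dim_irr G \<alpha>. fst (vd \<alpha>) m i * cnj (fst (vd \<alpha>) m j)) = of_bool (i = j)) \<and>
      (\<forall>m<dim_irr G \<alpha>. snd (vd \<alpha>) m > (0::real)) \<and>
      (\<forall>i<dim_irr G \<alpha>. \<forall>j<dim_irr G \<alpha>. gram (dim_irr G \<alpha>) (t \<alpha>) i j = (\<Sum>m<dim_irr G \<alpha>. fst (vd \<alpha>) m i * of_real (snd (vd \<alpha>) m) * cnj (fst (vd \<alpha>) m j)))"
    by blast
  define v d where "v = (\<lambda>\<alpha>. fst (vd \<alpha>))" and "d = (\<lambda>\<alpha>. snd (vd \<alpha>))"
  have orth: "\<And>\<alpha> m l. \<alpha> \<in> Irr G \<Longrightarrow> m < dim_irr G \<alpha> \<Longrightarrow> l < dim_irr G \<alpha> \<Longrightarrow>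
      (\<Sum>i<dim_irr G \<alpha>. cnj (v \<alpha> m i) * v \<alpha> l i) = of_bool (m = l)"
    and complete: "\<And>\<alpha> i j. \<alpha> \<in> Irr G \<Longrightarrow> i < dim_irr G \<alpha> \<Longrightarrow> j < dim_irr G \<alpha> \<Longrightarrow>
      (\<Sum>m<dim_irr G \<alpha>. v \<alpha> m i * cnj (v \<alpha> m j)) = of_bool (i = j)"
    and d: "\<And>\<alpha> m. \<alpha> \<in> Irr G \<Longrightarrow> m < dim_irr G \<alpha> \<Longrightarrow> d \<alpha> m > 0"
    and gram: "\<And>\<alpha> i j. \<alpha> \<in> Irr G \<Longrightarrow> i < dim_irr G \<alpha> \<Longrightarrow> j < dim_irr G \<alpha> \<Longrightarrow>
      gram (dim_irr G \<alpha>) (t \<alpha>) i j = (\<Sum>m<dim_irr G \<alpha>. v \<alpha> m i * of_real (d \<alpha> m) * cnj (v \<alpha> m j))"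
    unfolding v_def d_def using vd by blast+
  define e where "e = (\<lambda>\<alpha> m. c2 \<alpha> / c1 \<alpha> * (d \<alpha> m)\<^sup>2)"
  have e: "e \<alpha> m > 0" if "\<alpha> \<in> Irr G" "m < dim_irr G \<alpha>" for \<alpha> m
    using d[OF that] modular_dataD(2,3)[OF md[OF that(1)]] by (simp add: e_def)
  obtain f where f: "character G f" and f_gram: "\<And>\<alpha> i j. \<alpha> \<in> Irr G \<Longrightarrow> i < dim_irr G \<alpha> \<Longrightarrow> j < dim_irr G \<alpha> \<Longrightarrow>
      f (fund G \<alpha> i j) = of_real (c2 \<alpha> / c1 \<alpha>) *
        (\<Sum>p<dim_irr G \<alpha>. gram (dim_irr G \<alpha>) (t \<alpha>) j p * gram (dim_irr G \<alpha>) (t \<alpha>) p i)"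
    using modular_character[OF md] by blast
  have f_fund: "f (fund G \<alpha> i j) = (\<Sum>m<dim_irr G \<alpha>. v \<alpha> m j * of_real (e \<alpha> m) * cnj (v \<alpha> m i))"
    if \<alpha>: "\<alpha> \<in> Irr G" "i < dim_irr G \<alpha>" "j < dim_irr G \<alpha>" for \<alpha> i j
  proof -
    let ?n = "dim_irr G \<alpha>" and ?v = "v \<alpha>" and ?d = "\<lambda>m. complex_of_real (d \<alpha> m)"
    let ?x = "\<lambda>m. ?v m j * ?d m" and ?y = "\<lambda>m. ?d m * cnj (?v m i)"
    have "(\<Sum>p<?n. gram ?n (t \<alpha>) j p * gram ?n (t \<alpha>) p i) = (\<Sum>p<?n. (\<Sum>m<?n. ?x m * cnj (?v m p)) * (\<Sum>l<?n. ?v l p * ?y l))"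
      using \<alpha> by (intro sum.cong refl) (simp add: gram mult.assoc)
    also have "\<dots> = (\<Sum>p<?n. \<Sum>m<?n. \<Sum>l<?n. ?x m * ?y l * (cnj (?v m p) * ?v l p))"
      unfolding sum_product by (simp add: mult_ac)
    also have "\<dots> = (\<Sum>m<?n. \<Sum>p<?n. \<Sum>l<?n. ?x m * ?y l * (cnj (?v m p) * ?v l p))"
      by (rule sum.swap)
    also have "\<dots> = (\<Sum>m<?n. \<Sum>l<?n. \<Sum>p<?n. ?x m * ?y l * (cnj (?v m p) * ?v l p))"
      by (intro sum.cong refl sum.swap)
    also have "\<dots> = (\<Sum>m<?n. \<Sum>l<?n. ?x m * ?y l * of_bool (m = l))"
      using orth \<alpha> by (simp add: sum_distrib_left[symmetric])
    also have "\<dots> = (\<Sum>m<?n. ?x m * ?y m)" by (intro sum.cong refl) simp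
    finally show ?thesis
      using \<alpha> by (simp add: f_gram sum_distrib_left e_def power2_eq_square mult_ac)
  qed
  have e_one: "e \<beta> m = 1" if \<beta>: "\<beta> \<in> Irr G" "m < dim_irr G \<beta>" for \<beta> m
  proof (rule ccontr)
    assume "e \<beta> m \<noteq> 1"
    then have ln: "ln (e \<beta> m) \<noteq> 0" using e[OF \<beta>] by simp
    \<comment> \<open>the phase at \<open>e \<beta> m\<close> becomes \<open>1 / (n + 1)\<close>, which is never a multiple of \<open>2\<pi>\<close>\<close>
    define \<tau> where "\<tau> n = inverse (real (Suc n)) / ln (e \<beta> m)" for n
    have "\<exists>\<psi>. character G \<psi> \<and> (\<forall>a. \<psi> (star G a) = cnj (\<psi> a)) \<and> (\<forall>\<alpha>\<in>Irr G. \<forall>i<dim_irr G \<alpha>. \<forall>j<dim_irr G \<alpha>.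
        \<psi> (fund G \<alpha> i j) = (\<Sum>m<dim_irr G \<alpha>. v \<alpha> m j * cis (\<tau> n * ln (e \<alpha> m)) * cnj (v \<alpha> m i)))" for n
      by (rule imaginary_powers[OF f orth complete e f_fund, of "\<tau> n"]) blast+
    then have "\<exists>\<psi>. \<forall>n. character G (\<psi> n) \<and> (\<forall>a. \<psi> n (star G a) = cnj (\<psi> n a)) \<and> (\<forall>\<alpha>\<in>Irr G. \<forall>i<dim_irr G \<alpha>. \<forall>j<dim_irr G \<alpha>.
        \<psi> n (fund G \<alpha> i j) = (\<Sum>m<dim_irr G \<alpha>. v \<alpha> m j * cis (\<tau> n * ln (e \<alpha> m)) * cnj (v \<alpha> m i)))"
      by (intro choice allI)
    then obtain \<psi> where \<psi>: "\<And>n. character G (\<psi> n)" "\<And>n a. \<psi> n (star G a) = cnj (\<psi> n a)"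
      and \<psi>_fund: "\<And>n \<alpha> i j. \<alpha> \<in> Irr G \<Longrightarrow> i < dim_irr G \<alpha> \<Longrightarrow> j < dim_irr G \<alpha> \<Longrightarrow>
        \<psi> n (fund G \<alpha> i j) = (\<Sum>m<dim_irr G \<alpha>. v \<alpha> m j * cis (\<tau> n * ln (e \<alpha> m)) * cnj (v \<alpha> m i))"
      by blast
    have \<tau>: "\<tau> \<longlonglongrightarrow> 0"
      unfolding \<tau>_def using tendsto_divide[OF LIMSEQ_inverse_real_of_nat tendsto_const ln] by simp
    have lim: "(\<lambda>n. \<psi> n (fund G \<alpha> i j)) \<longlonglongrightarrow> of_bool (i = j)"
      if \<alpha>: "\<alpha> \<in> Irr G" "i < dim_irr G \<alpha>" "j < dim_irr G \<alpha>" for \<alpha> i j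
    proof -
      have cis0: "(\<lambda>n. cis (\<tau> n * x)) \<longlonglongrightarrow> cis (0 * x)" for x
        unfolding cis_conv_exp by (intro tendsto_intros \<tau>)
      have "(\<lambda>n. \<Sum>m<dim_irr G \<alpha>. v \<alpha> m j * cis (\<tau> n * ln (e \<alpha> m)) * cnj (v \<alpha> m i)) \<longlonglongrightarrow>
          (\<Sum>m<dim_irr G \<alpha>. v \<alpha> m j * cis (0 * ln (e \<alpha> m)) * cnj (v \<alpha> m i))"
        by (intro tendsto_sum tendsto_mult cis0 tendsto_const)
      also have "(\<Sum>m<dim_irr G \<alpha>. v \<alpha> m j * cis (0 * ln (e \<alpha> m)) * cnj (v \<alpha> m i)) = of_bool (j = i)"
        using complete \<alpha> by simp
      finally show ?thesis using \<alpha> by (simp add: \<psi>_fund eq_commute)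
    qed
    obtain n where n: "\<And>a. \<psi> n a = counit G a" using isolated[OF \<psi> lim] by blast
    let ?n = "dim_irr G \<beta>" and ?v = "v \<beta>" and ?c = "\<lambda>m. cis (\<tau> n * ln (e \<beta> m))"
    have delta: "(\<Sum>l<?n. ?v l j * ?c l * cnj (?v l i)) = of_bool (i = j)" if "i < ?n" "j < ?n" for i j
      using \<psi>_fund[OF \<beta>(1) that, of n] n counit_corep[OF fund_corep[OF \<beta>(1)] that] by simp
    have "(\<Sum>j<?n. \<Sum>i<?n. cnj (?v m j) * ?v m i * (\<Sum>l<?n. ?v l j * ?c l * cnj (?v l i))) =
        (\<Sum>j<?n. \<Sum>i<?n. cnj (?v m j) * ?v m i * of_bool (i = j))"
      using delta by (intro sum.cong refl) simp
    also have "\<dots> = (\<Sum>j<?n. cnj (?v m j) * ?v m j)" by (intro sum.cong refl) simp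
    also have "\<dots> = 1" using orth[OF \<beta>(1) \<beta>(2) \<beta>(2)] by simp
    finally have one: "(\<Sum>j<?n. \<Sum>i<?n. cnj (?v m j) * ?v m i * (\<Sum>l<?n. ?v l j * ?c l * cnj (?v l i))) = 1" .
    have "(\<Sum>j<?n. \<Sum>i<?n. cnj (?v m j) * ?v m i * (\<Sum>l<?n. ?v l j * ?c l * cnj (?v l i))) =
        (\<Sum>j<?n. \<Sum>i<?n. \<Sum>l<?n. ?c l * ((cnj (?v m j) * ?v l j) * (cnj (?v l i) * ?v m i)))"
      by (simp add: sum_distrib_left mult_ac)
    also have "\<dots> = (\<Sum>j<?n. \<Sum>l<?n. \<Sum>i<?n. ?c l * ((cnj (?v m j) * ?v l j) * (cnj (?v l i) * ?v m i)))"
      by (intro sum.cong refl sum.swap)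
    also have "\<dots> = (\<Sum>l<?n. \<Sum>j<?n. \<Sum>i<?n. ?c l * ((cnj (?v m j) * ?v l j) * (cnj (?v l i) * ?v m i)))"
      by (rule sum.swap)
    also have "\<dots> = (\<Sum>l<?n. ?c l * ((\<Sum>j<?n. cnj (?v m j) * ?v l j) * (\<Sum>i<?n. cnj (?v l i) * ?v m i)))"
      unfolding sum_product by (simp only: sum_distrib_left)
    also have "\<dots> = (\<Sum>l<?n. ?c l * (of_bool (m = l) * of_bool (l = m)))"
      using orth \<beta> by simp
    also have "\<dots> = (\<Sum>l<?n. ?c l * of_bool (m = l))" by (intro sum.cong refl) auto
    also have "\<dots> = ?c m" using \<beta>(2) by simp
    finally have "cis (\<tau> n * ln (e \<beta> m)) = 1" using one by simp
    then have "sin (inverse (real (Suc n))) = 0" using ln by (simp add: \<tau>_def complex_eq_iff)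
    moreover have "inverse (real (Suc n)) \<le> 1" by (simp add: field_simps)
    then have "sin (inverse (real (Suc n))) > 0"
      using pi_gt3 by (intro sin_gt_zero) auto
    ultimately show False by simp
  qed
  let ?n = "dim_irr G \<alpha>"
  define \<kappa> where "\<kappa> = sqrt (c1 \<alpha> / c2 \<alpha>)"
  have c: "c1 \<alpha> > 0" "c2 \<alpha> > 0" using modular_dataD(2,3)[OF md[OF \<alpha>]] by auto
  then have \<kappa>: "\<kappa> > 0" by (simp add: \<kappa>_def)
  have "d \<alpha> m = \<kappa>" if "m < ?n" for m
  proof -
    have "(d \<alpha> m)\<^sup>2 = c1 \<alpha> / c2 \<alpha>" using e_one[OF \<alpha> that] c by (simp add: e_def field_simps)
    then show ?thesis using d[OF \<alpha> that] by (simp add: \<kappa>_def real_sqrt_unique)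
  qed
  then have g: "gram ?n (t \<alpha>) i j = of_real \<kappa> * of_bool (i = j)" if "i < ?n" "j < ?n" for i j
    using complete[OF \<alpha> that] by (simp add: gram[OF \<alpha> that] mult_ac sum_distrib_left[symmetric])
  have p: "cogram ?n (s \<alpha>) i j = of_real (1 / \<kappa>) * of_bool (i = j)" if ij: "i < ?n" "j < ?n" for i j
  proof -
    have "(\<Sum>k<?n. gram ?n (t \<alpha>) i k * cogram ?n (s \<alpha>) k j) = of_bool (i = j)"
      using gram_cogram_inverse(1)[OF modular_dataD(1)[OF md[OF \<alpha>]]] ij by (simp add: complex_mat_mult_eq_one)
    moreover have "(\<Sum>k<?n. gram ?n (t \<alpha>) i k * cogram ?n (s \<alpha>) k j) = of_real \<kappa> * cogram ?n (s \<alpha>) i j"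
      using g ij by (simp add: mult.assoc sum_distrib_left[symmetric])
    ultimately show ?thesis using \<kappa> by (simp add: field_simps)
  qed
  let ?w = "\<lambda>i j. star G (fund G \<alpha> i j)"
  have const: "mat_mult ?n (const_mat G ?n x) y = (\<lambda>i j. scl G z (mat_cut ?n y i j))"
    if x: "\<And>i j. i < ?n \<Longrightarrow> j < ?n \<Longrightarrow> x i j = z * of_bool (i = j)" for x y z
  proof (intro ext)
    fix i j show "mat_mult ?n (const_mat G ?n x) y i j = scl G z (mat_cut ?n y i j)"
    proof (cases "i < ?n \<and> j < ?n")
      case True
      have "mat_mult ?n (const_mat G ?n x) y i j = (\<Sum>k<?n. scl G (x i k) (y k j))"
        using True by (simp add: const_mult_entry)
      also have "\<dots> = (\<Sum>k<?n. if k = i then scl G z (y i j) else 0)"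
        using True x by (intro sum.cong refl) auto
      finally show ?thesis using True by (simp add: mat_cut_def)
    next
      case False
      then show ?thesis by (auto simp: mat_mult_def mat_cut_def)
    qed
  qed
  have mult_scl: "mat_mult ?n x (\<lambda>i j. scl G z (y i j)) = (\<lambda>i j. scl G z (mat_mult ?n x y i j))" for x y z
    by (auto simp: mat_mult_def fun_eq_iff scl_mult_right[symmetric] scale_sum_right)
  have scl_cancel: "x = mat_one ?n"
    if "(\<lambda>i j. scl G z (x i j)) = const_mat G ?n y" "z \<noteq> 0" "mat_cut ?n x = x"
      "\<And>i j. i < ?n \<Longrightarrow> j < ?n \<Longrightarrow> y i j = z * of_bool (i = j)" for x y z
  proof -
    have "mat_cut ?n x = mat_cut ?n (\<lambda>i j. of_bool (i = j))"
    proof (rule mat_eqI)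
      fix i j assume ij: "i < ?n" "j < ?n"
      have "scl G z (x i j) = scl G (y i j) 1"
        using fun_cong[OF fun_cong[OF that(1), of i], of j] ij by (simp add: const_mat_def mat_cut_def)
      also have "\<dots> = scl G z (of_bool (i = j))" using that(4) ij by simp
      finally show "x i j = of_bool (i = j)" using that(2) by (simp add: scale_left_imp_eq)
    qed
    then show ?thesis using that(3) by (simp add: mat_one_def)
  qed
  note data = md[OF \<alpha>, unfolded modular_data_def Let_def]
  have "mat_mult ?n (mat_adj G ?n ?w) ?w = mat_one ?n"
  proof (rule scl_cancel[of "of_real \<kappa>" _ "gram ?n (t \<alpha>)"])
    have "mat_mult ?n (mat_adj G ?n ?w) (mat_mult ?n (const_mat G ?n (gram ?n (t \<alpha>))) ?w) = const_mat G ?n (gram ?n (t \<alpha>))"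
      using data by blast
    then show "(\<lambda>i j. scl G (of_real \<kappa>) (mat_mult ?n (mat_adj G ?n ?w) ?w i j)) = const_mat G ?n (gram ?n (t \<alpha>))"
      by (simp add: const[OF g] mult_scl)
  qed (use \<kappa> g in auto)
  moreover have "mat_mult ?n ?w (mat_adj G ?n ?w) = mat_one ?n"
  proof (rule scl_cancel[of "of_real (1 / \<kappa>)" _ "cogram ?n (s \<alpha>)"])
    have "mat_mult ?n ?w (mat_mult ?n (const_mat G ?n (cogram ?n (s \<alpha>))) (mat_adj G ?n ?w)) = const_mat G ?n (cogram ?n (s \<alpha>))"
      using data by blast
    then show "(\<lambda>i j. scl G (of_real (1 / \<kappa>)) (mat_mult ?n ?w (mat_adj G ?n ?w) i j)) = const_mat G ?n (cogram ?n (s \<alpha>))"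
      by (simp only: const[OF p] mult_scl mat_mult_cut)
  qed (use \<kappa> p in auto)
  ultimately show ?thesis by (simp add: unitary_matrix_iff)
qed

end

section \<open>Operators on closed subspaces of the sequence space\<close>

lemma cinner_add_right: "cinner x (y + z) = cinner x y + cinner x z"
  by (subst (1 2 3) cinner_commute) (simp add: cinner_add_left)

lemma cinner_scaleC_right: "cinner x (c *\<^sub>C y) = c * cinner x y"
  by (subst (1 2) cinner_commute) (simp add: cinner_scaleC_left)

lemma cinner_zero [simp]: "cinner 0 x = 0" "cinner x 0 = 0"
  by (simp_all add: cinner_def)

lemma cinner_sum_left: "cinner (\<Sum>i\<in>S. f i) y = (\<Sum>i\<in>S. cinner (f i) y)"
  by (induction S rule: infinite_finite_induct) (simp_all add: cinner_add_left)

lemma cinner_sum_right: "cinner y (\<Sum>i\<in>S. f i) = (\<Sum>i\<in>S. cinner y (f i))"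
  by (induction S rule: infinite_finite_induct) (simp_all add: cinner_add_right)

lemma cinner_self_norm: "cinner x x = of_real ((norm x)\<^sup>2)"
  by (simp add: cinner_self norm_ell2_square)

lemma cinner_diff_left: "cinner (x - y) z = cinner x z - cinner y z"
  using cinner_add_left[of "x - y" y z] by simp

lemma norm_scaleC: "norm (c *\<^sub>C x) = cmod c * norm x"
proof -
  have "(norm (c *\<^sub>C x))\<^sup>2 = Re (cinner (c *\<^sub>C x) (c *\<^sub>C x))" by (simp add: cinner_self_norm)
  also have "\<dots> = Re (of_real ((cmod c)\<^sup>2) * cinner x x)"
    by (simp add: cinner_scaleC_left cinner_scaleC_right complex_norm_square mult_ac del: of_real_power)
  also have "\<dots> = (cmod c * norm x)\<^sup>2" by (simp add: cinner_self_norm power_mult_distrib)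
  finally show ?thesis by simp
qed

lemma cinner_eq_inner: "cinner x y = Complex (inner x y) (inner (\<i> *\<^sub>C x) y)"
  by (simp add: inner_ell2_def cinner_scaleC_left complex_eq_iff)

lemma bounded_linear_scaleC: "bounded_linear (\<lambda>x. c *\<^sub>C x)"
proof (rule bounded_linear_intro[where K = "cmod c"])
  show "c *\<^sub>C (r *\<^sub>R x) = r *\<^sub>R (c *\<^sub>C x)" for r x
    by (simp add: scaleR_ell2_def mult.commute)
qed (simp_all add: ell2.scale_right_distrib norm_scaleC mult.commute)

lemma tendsto_cinner:
  assumes "(f \<longlongrightarrow> x) F" "(g \<longlongrightarrow> y) F"
  shows "((\<lambda>n. cinner (f n) (g n)) \<longlongrightarrow> cinner x y) F"
  unfolding cinner_eq_inner
  by (intro tendsto_Complex tendsto_inner assms bounded_linear.tendsto[OF bounded_linear_scaleC])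

lemma hilbert_subspaceD:
  assumes "hilbert_subspace K"
  shows "ell2.subspace K" "closed K" "0 \<in> K"
    "\<And>x y. x \<in> K \<Longrightarrow> y \<in> K \<Longrightarrow> x + y \<in> K" "\<And>c x. x \<in> K \<Longrightarrow> c *\<^sub>C x \<in> K"
    "\<And>x y. x \<in> K \<Longrightarrow> y \<in> K \<Longrightarrow> x - y \<in> K" "\<And>S f. (\<And>i. i \<in> S \<Longrightarrow> f i \<in> K) \<Longrightarrow> sum f S \<in> K"
  using assms unfolding hilbert_subspace_def
  by (auto simp: ell2.subspace_0 ell2.subspace_add ell2.subspace_scale ell2.subspace_diff ell2.subspace_sum)

lemma bounded_opD:
  assumes "bounded_op K T"
  shows "x \<in> K \<Longrightarrow> T x \<in> K" "x \<in> K \<Longrightarrow> y \<in> K \<Longrightarrow> T (x + y) = T x + T y" "x \<in> K \<Longrightarrow> T (c *\<^sub>C x) = c *\<^sub>C T x"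
  using assms by (auto simp: bounded_op_def)

lemma bounded_op_sum:
  assumes T: "bounded_op K T" and K: "hilbert_subspace K" and f: "\<And>i. i \<in> S \<Longrightarrow> f i \<in> K"
  shows "T (\<Sum>i\<in>S. f i) = (\<Sum>i\<in>S. T (f i))"
proof -
  have "T 0 = 0" using bounded_opD(3)[OF T hilbert_subspaceD(3)[OF K], of 0] by simp
  then show ?thesis
    using f
  proof (induction S rule: infinite_finite_induct)
    case (insert x F)
    have "T (f x + sum f F) = T (f x) + T (sum f F)"
      using insert.prems by (intro bounded_opD(2)[OF T] hilbert_subspaceD(7)[OF K]) auto
    then show ?case using insert by simp
  qed simp_all
qed

lemma bounded_op_diff:
  assumes T: "bounded_op K T" and K: "hilbert_subspace K" and x: "x \<in> K" "y \<in> K"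
  shows "T (x - y) = T x - T y"
  using bounded_opD(2)[OF T hilbert_subspaceD(6)[OF K x] x(2)] by (simp add: algebra_simps)

lemma star_linear_mapD:
  assumes "star_linear_map A K \<pi>"
  shows "bounded_op K (\<pi> a)" "x \<in> K \<Longrightarrow> \<pi> (a + b) x = \<pi> a x + \<pi> b x" "x \<in> K \<Longrightarrow> \<pi> (scl A c a) x = c *\<^sub>C \<pi> a x"
    "x \<in> K \<Longrightarrow> \<pi> 1 x = x" "x \<in> K \<Longrightarrow> y \<in> K \<Longrightarrow> cinner (\<pi> a x) y = cinner x (\<pi> (star A a) y)"
    "x \<in> K \<Longrightarrow> \<pi> a x \<in> K"
  using assms by (auto simp: star_linear_map_def bounded_op_def)

lemma (in star_algebra) star_linear_map_linear:
  assumes "star_linear_map A K \<pi>" "x \<in> K"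
  shows "Vector_Spaces.linear (scl A) (*\<^sub>C) (\<lambda>a. \<pi> a x)"
  using star_linear_mapD[OF assms(1)] assms(2)
  by (intro linear_intro ell2.vector_space_axioms) auto

section \<open>Norm bounds for representations\<close>

definition op_norm :: "ell2 set \<Rightarrow> (ell2 \<Rightarrow> ell2) \<Rightarrow> real"
  where "op_norm K T = (SUP x\<in>{x \<in> K. norm x \<le> 1}. norm (T x))"

lemma op_norm_bdd:
  assumes "bounded_op K T"
  shows "bdd_above ((\<lambda>x. norm (T x)) ` {x \<in> K. norm x \<le> 1})"
proof -
  obtain B where B: "\<forall>x\<in>K. norm (T x) \<le> B * norm x" using assms unfolding bounded_op_def by blast
  show ?thesis
  proof (rule bdd_aboveI2)
    fix z assume z: "z \<in> {x \<in> K. norm x \<le> 1}"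
    have "norm (T z) \<le> B * norm z" using B z by auto
    also have "\<dots> \<le> \<bar>B\<bar> * 1" using z by (intro mult_mono) auto
    finally show "norm (T z) \<le> \<bar>B\<bar>" by simp
  qed
qed

lemma op_norm_bound:
  assumes K: "hilbert_subspace K" and T: "bounded_op K T" and x: "x \<in> K"
  shows "norm (T x) \<le> op_norm K T * norm x"
proof (cases "x = 0")
  case True
  then show ?thesis using bounded_opD(3)[OF T x, of 0] by simp
next
  case False
  define y where "y = of_real (1 / norm x) *\<^sub>C x"
  have y: "y \<in> K" "norm y = 1"
    using False hilbert_subspaceD(5)[OF K x] by (simp_all add: y_def norm_scaleC norm_divide)
  have "norm (T y) \<le> op_norm K T"
    unfolding op_norm_def using y op_norm_bdd[OF T] by (intro cSUP_upper) auto
  moreover have "T y = of_real (1 / norm x) *\<^sub>C T x"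
    unfolding y_def by (rule bounded_opD(3)[OF T x])
  ultimately have "norm (T x) / norm x \<le> op_norm K T" by (simp add: norm_scaleC norm_divide)
  then show ?thesis using False by (simp add: field_simps)
qed

lemma op_norm_least:
  assumes K: "hilbert_subspace K" and "B \<ge> 0" and "\<And>x. x \<in> K \<Longrightarrow> norm (T x) \<le> B * norm x"
  shows "op_norm K T \<le> B"
  unfolding op_norm_def
proof (rule cSUP_least)
  show "{x \<in> K. norm x \<le> 1} \<noteq> {}" using hilbert_subspaceD(3)[OF K] by (auto intro!: exI[of _ 0])
  fix x assume x: "x \<in> {x \<in> K. norm x \<le> 1}"
  then have "norm (T x) \<le> B * norm x" using assms(3) by auto
  also have "\<dots> \<le> B" using x assms(2) by (simp add: mult_left_le)
  finally show "norm (T x) \<le> B" .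
qed

lemma op_norm_nonneg:
  assumes K: "hilbert_subspace K" and T: "bounded_op K T"
  shows "op_norm K T \<ge> 0"
proof -
  have "0 \<le> norm (T 0)" by simp
  also have "\<dots> \<le> op_norm K T"
    unfolding op_norm_def using hilbert_subspaceD(3)[OF K] op_norm_bdd[OF T] by (intro cSUP_upper) auto
  finally show ?thesis .
qed

lemma norm_sq_eq_inner: "(norm x)\<^sup>2 = Re (cinner x x)" for x :: ell2
  by (simp add: cinner_self_norm)

lemma Re_cinner_le: "Re (cinner x y) \<le> norm x * norm y"
  using norm_cauchy_schwarz[of x y] by (simp add: inner_ell2_def)

text \<open>The operator norm satisfies the C*-identity; such seminorms are the ones that define the norm of
  the envelope.\<close>
lemma star_rep_cstar_seminorm:
  assumes A: "star_algebra A" and K: "hilbert_subspace K" and \<pi>: "star_rep A K \<pi>"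
  shows "cstar_seminorm A (\<lambda>a. op_norm K (\<pi> a))"
proof -
  interpret star_algebra A by fact
  have slm: "star_linear_map A K \<pi>" using \<pi> by (simp add: star_rep_def)
  have mult: "\<pi> (a * b) x = \<pi> a (\<pi> b x)" if "x \<in> K" for a b x
    using \<pi> that by (simp add: star_rep_def)
  note D = star_linear_mapD[OF slm]
  let ?p = "\<lambda>a. op_norm K (\<pi> a)"
  have bound: "norm (\<pi> a x) \<le> ?p a * norm x" if "x \<in> K" for a x
    using op_norm_bound[OF K D(1) that] .
  have nonneg: "?p a \<ge> 0" for a using op_norm_nonneg[OF K D(1)] .
  have add: "?p (a + b) \<le> ?p a + ?p b" for a b
  proof (rule op_norm_least[OF K])
    fix x assume x: "x \<in> K"
    have "norm (\<pi> (a + b) x) \<le> norm (\<pi> a x) + norm (\<pi> b x)" by (simp add: D(2)[OF x] norm_triangle_ineq)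
    also have "\<dots> \<le> (?p a + ?p b) * norm x" using bound[OF x, of a] bound[OF x, of b] by (simp add: distrib_right)
    finally show "norm (\<pi> (a + b) x) \<le> (?p a + ?p b) * norm x" .
  qed (simp add: nonneg)
  have scl_le: "?p (scl A c a) \<le> cmod c * ?p a" for c a
  proof (rule op_norm_least[OF K])
    fix x assume x: "x \<in> K"
    show "norm (\<pi> (scl A c a) x) \<le> cmod c * ?p a * norm x"
      using mult_left_mono[OF bound[OF x, of a], of "cmod c"] by (simp add: D(3)[OF x] norm_scaleC mult.assoc)
  qed (simp add: nonneg)
  have scl: "?p (scl A c a) = cmod c * ?p a" for c a
  proof (cases "c = 0")
    case True
    then show ?thesis using scl_le[of 0 a] nonneg[of "scl A c a"] by simp
  next
    case False
    have "?p (scl A (1 / c) (scl A c a)) \<le> cmod (1 / c) * ?p (scl A c a)" by (rule scl_le)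
    then have "cmod c * ?p a \<le> ?p (scl A c a)" using False by (simp add: field_simps norm_divide)
    with scl_le[of c a] show ?thesis by simp
  qed
  have mult_le: "?p (a * b) \<le> ?p a * ?p b" for a b
  proof (rule op_norm_least[OF K])
    fix x assume x: "x \<in> K"
    have "norm (\<pi> (a * b) x) \<le> ?p a * norm (\<pi> b x)"
      using bound[OF D(6)[OF x], of a b] by (simp add: mult[OF x])
    also have "\<dots> \<le> ?p a * (?p b * norm x)" by (intro mult_left_mono bound x nonneg)
    finally show "norm (\<pi> (a * b) x) \<le> ?p a * ?p b * norm x" by (simp add: mult.assoc)
  qed (simp add: nonneg)
  have le_star: "?p a \<le> sqrt (?p (star A a * a))" for a
  proof (rule op_norm_least[OF K])
    fix x assume x: "x \<in> K"
    have "(norm (\<pi> a x))\<^sup>2 = Re (cinner x (\<pi> (star A a * a) x))"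
      by (simp add: norm_sq_eq_inner D(5)[OF x D(6)[OF x]] mult[OF x])
    also have "\<dots> \<le> norm x * norm (\<pi> (star A a * a) x)" by (rule Re_cinner_le)
    also have "\<dots> \<le> norm x * (?p (star A a * a) * norm x)" by (intro mult_left_mono bound x) simp
    also have "\<dots> = (sqrt (?p (star A a * a)) * norm x)\<^sup>2"
      using nonneg[of "star A a * a"] by (simp add: power2_eq_square)
    finally show "norm (\<pi> a x) \<le> sqrt (?p (star A a * a)) * norm x"
      by (rule power2_le_imp_le) (simp add: nonneg)
  qed (simp add: nonneg)
  have sq: "(?p a)\<^sup>2 \<le> ?p (star A a * a)" for a
    using power_mono[OF le_star[of a] nonneg, of 2] nonneg[of "star A a * a"] by simp
  have star_le: "?p (star A a) \<le> ?p a" for a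
  proof -
    have "(?p (star A a))\<^sup>2 \<le> ?p a * ?p (star A a)"
      using sq[of "star A a"] mult_le[of a "star A a"] by (simp add: star_star)
    then show ?thesis using nonneg[of "star A a"] nonneg[of a]
      by (cases "?p (star A a) = 0") (auto simp: power2_eq_square)
  qed
  have "?p (star A a * a) \<le> (?p a)\<^sup>2" for a
  proof -
    have "?p (star A a * a) \<le> ?p (star A a) * ?p a" by (rule mult_le)
    also have "\<dots> \<le> ?p a * ?p a" by (intro mult_right_mono star_le nonneg)
    finally show ?thesis by (simp add: power2_eq_square)
  qed
  with sq have "?p (star A a * a) = (?p a)\<^sup>2" for a by (intro antisym)
  with add scl mult_le show ?thesis unfolding cstar_seminorm_def by blast
qed

context cstar_algebra
begin

lemma norm_star: "norm (star A a) = norm a"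
proof -
  have le: "norm b \<le> norm (star A b)" for b
  proof (cases "b = 0")
    case False
    have "norm b * norm b \<le> norm (star A b) * norm b"
      using cstar_identity[of b] norm_mult_ineq[of "star A b" b] by (simp add: power2_eq_square)
    then show ?thesis using False by simp
  qed simp
  show ?thesis using le[of a] le[of "star A a"] by (simp add: star_star)
qed

lemma bounded_linear_star: "bounded_linear (star A)"
proof (rule bounded_linear_intro[where K = 1])
  show "star A (r *\<^sub>R a) = r *\<^sub>R star A a" for r a
    by (simp add: scl_of_real[symmetric] star_scl)
qed (simp_all add: star_add norm_star)

lemma star_power: "star A a = a \<Longrightarrow> star A (a ^ n) = a ^ n"
  by (induction n) (simp_all add: star_one star_mult power_commutes)

text \<open>The binomial series with exponent \<open>1/2\<close>, whose coefficients are bounded by 1; Vandermonde's identity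
  computes its square.\<close>
lemma selfadjoint_square_root:
  assumes a: "star A a = a" "norm a < 1"
  obtains y where "star A y = y" "y * y = 1 - a"
proof -
  define g :: "nat \<Rightarrow> real" where "g n = ((1/2) gchoose n) * (-1) ^ n" for n
  have g: "\<bar>g n\<bar> \<le> 1" for n
  proof (induction n)
    case (Suc n)
    have "(1/2 :: real) gchoose Suc n = ((1/2) gchoose n) * ((1/2 - real n) / real (Suc n))"
      using gbinomial_mult_1[of "1/2 :: real" n] by (simp add: field_simps)
    then have "\<bar>g (Suc n)\<bar> = \<bar>g n\<bar> * (\<bar>1/2 - real n\<bar> / real (Suc n))"
      by (simp add: g_def abs_mult)
    also have "\<dots> \<le> 1 * 1" using Suc by (intro mult_mono) (auto simp: field_simps)
    finally show ?case by simp
  qed (simp add: g_def)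
  have summable: "summable (\<lambda>n. norm (g n *\<^sub>R a ^ n))"
  proof (rule summable_comparison_test'[of "\<lambda>n. norm a ^ n"])
    show "summable (\<lambda>n. norm a ^ n)" using a(2) by (simp add: summable_geometric)
    fix n
    have "\<bar>g n\<bar> * norm (a ^ n) \<le> 1 * norm a ^ n" using g by (intro mult_mono norm_power_ineq) auto
    then show "norm (norm (g n *\<^sub>R a ^ n)) \<le> norm a ^ n" by simp
  qed
  define y where "y = (\<Sum>n. g n *\<^sub>R a ^ n)"
  have conv: "(\<Sum>i\<le>n. g i * g (n - i)) = (-1) ^ n * of_nat (1 choose n)" for n
  proof -
    have "(\<Sum>i\<le>n. g i * g (n - i)) = (\<Sum>i\<in>{0..n}. (-1) ^ n * (((1/2) gchoose i) * ((1/2) gchoose (n - i))))"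
      unfolding g_def atMost_atLeast0 by (intro sum.cong refl) (simp add: power_add[symmetric] mult_ac)
    also have "\<dots> = (-1) ^ n * ((1/2 + 1/2 :: real) gchoose n)"
      by (simp add: sum_distrib_left[symmetric] gbinomial_Vandermonde)
    also have "(1/2 + 1/2 :: real) gchoose n = of_nat (1 choose n)"
      by (simp add: binomial_gbinomial)
    finally show ?thesis .
  qed
  have "(\<lambda>n. \<Sum>i\<le>n. (g i *\<^sub>R a ^ i) * (g (n - i) *\<^sub>R a ^ (n - i))) sums (y * y)"
    unfolding y_def by (rule Cauchy_product_sums[OF summable summable])
  moreover have "(\<Sum>i\<le>n. (g i *\<^sub>R a ^ i) * (g (n - i) *\<^sub>R a ^ (n - i))) = ((-1) ^ n * of_nat (1 choose n)) *\<^sub>R a ^ n" for n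
  proof -
    have "(\<Sum>i\<le>n. (g i *\<^sub>R a ^ i) * (g (n - i) *\<^sub>R a ^ (n - i))) = (\<Sum>i\<le>n. (g i * g (n - i)) *\<^sub>R a ^ n)"
      by (intro sum.cong refl) (simp add: power_add[symmetric])
    then show ?thesis by (simp add: scaleR_left.sum[symmetric] conv)
  qed
  moreover have "(\<lambda>n. ((-1) ^ n * of_nat (1 choose n) :: real) *\<^sub>R a ^ n) sums (\<Sum>n\<in>{0, 1}. ((-1) ^ n * of_nat (1 choose n) :: real) *\<^sub>R a ^ n)"
  proof (rule sums_finite)
    fix n :: nat assume "n \<notin> {0, 1}"
    then have "n > 1" by auto
    then show "((-1) ^ n * of_nat (1 choose n) :: real) *\<^sub>R a ^ n = 0" by (simp add: binomial_eq_0)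
  qed simp
  ultimately have "y * y = 1 - a" by (simp add: sums_iff)
  moreover have "star A y = y"
  proof -
    have "star A y = (\<Sum>n. star A (g n *\<^sub>R a ^ n))"
      unfolding y_def by (rule bounded_linear.suminf[OF bounded_linear_star summable_norm_cancel[OF summable]])
    also have "\<dots> = y"
      by (simp add: y_def bounded_linear.linear[OF bounded_linear_star, THEN linear_scale] star_power[OF a(1)])
    finally show ?thesis .
  qed
  ultimately show ?thesis using that by blast
qed

text \<open>Scale \<open>c\<close>, which stands for \<open>b\<^sup>*b\<close> or \<open>bb\<^sup>*\<close>, to norm below 1. Then \<open>1 - c\<close> is the square of a selfadjoint
  element, so its image is a positive operator and the image of \<open>c\<close> is bounded by the identity. Only
  squares have to be preserved for this, so that the argument serves representations of the algebra and
  of its opposite alike.\<close>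
lemma jordan_contractive:
  assumes \<pi>: "star_linear_map A K \<pi>"
    and square: "\<And>y x. x \<in> K \<Longrightarrow> \<pi> (y * y) x = \<pi> y (\<pi> y x)"
    and c: "star A c = c" "norm c = (norm b)\<^sup>2" and cb: "\<pi> c x = \<pi> (star A b) (\<pi> b x)" and x: "x \<in> K"
  shows "norm (\<pi> b x) \<le> norm b * norm x"
proof -
  note D = star_linear_mapD[OF \<pi>]
  have le: "norm (\<pi> b x) \<le> r * norm x" if r: "r > norm b" for r
  proof -
    have r0: "r > 0" using r norm_ge_zero[of b] by linarith
    define a where "a = scl A (of_real (1 / r\<^sup>2)) c"
    have "norm a < 1"
    proof -
      have "(norm b)\<^sup>2 < r\<^sup>2" using r by (simp add: power_strict_mono)
      then show ?thesis using r0 by (simp add: a_def norm_scl c(2) norm_divide norm_power)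
    qed
    moreover have "star A a = a" by (simp add: a_def star_scl c(1))
    ultimately obtain y where y: "star A y = y" "y * y = 1 - a" using selfadjoint_square_root by blast
    have "\<pi> a x = x - \<pi> y (\<pi> y x)"
      using D(2)[OF x, of "1 - a" a] D(4)[OF x] square[OF x, of y] y(2) by (simp add: algebra_simps)
    moreover have "cinner (\<pi> y (\<pi> y x)) x = of_real ((norm (\<pi> y x))\<^sup>2)"
      using D(5)[OF D(6)[OF x] x, of y y] y(1) by (simp add: cinner_self_norm)
    ultimately have "Re (cinner (\<pi> a x) x) \<le> (norm x)\<^sup>2"
      by (simp add: cinner_diff_left cinner_self_norm)
    moreover have "\<pi> a x = of_real (1 / r\<^sup>2) *\<^sub>C \<pi> c x" unfolding a_def by (rule D(3)[OF x])
    moreover have "cinner (\<pi> c x) x = of_real ((norm (\<pi> b x))\<^sup>2)"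
      using D(5)[OF D(6)[OF x] x, of "star A b" b] cb by (simp add: star_star cinner_self_norm)
    ultimately have "(norm (\<pi> b x))\<^sup>2 / r\<^sup>2 \<le> (norm x)\<^sup>2"
      by (simp add: cinner_scaleC_left del: of_real_power of_real_divide)
    then have "(norm (\<pi> b x))\<^sup>2 \<le> (r * norm x)\<^sup>2" using r0 by (simp add: field_simps power_mult_distrib)
    then show ?thesis by (rule power2_le_imp_le) (use r0 in simp)
  qed
  show ?thesis
  proof (cases "x = 0")
    case True
    then show ?thesis using le[of "norm b + 1"] by simp
  next
    case False
    have "norm (\<pi> b x) / norm x \<le> norm b"
    proof (rule dense_ge)
      fix r assume "norm b < r"
      then show "norm (\<pi> b x) / norm x \<le> r" using le[of r] False by (simp add: field_simps)
    qed
    then show ?thesis using False by (simp add: field_simps)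
  qed
qed

lemma star_rep_contractive:
  assumes \<pi>: "star_rep A K \<pi>" and x: "x \<in> K"
  shows "norm (\<pi> b x) \<le> norm b * norm x"
proof (rule jordan_contractive[where c = "star A b * b"])
  show "star A (star A b * b) = star A b * b" by (simp add: star_mult star_star)
  show "norm (star A b * b) = (norm b)\<^sup>2" by (rule cstar_identity)
qed (use \<pi> x in \<open>auto simp: star_rep_def\<close>)

lemma op_star_rep_contractive:
  assumes \<pi>: "op_star_rep A K \<pi>" and x: "x \<in> K"
  shows "norm (\<pi> b x) \<le> norm b * norm x"
proof (rule jordan_contractive[where c = "b * star A b"])
  show "star A (b * star A b) = b * star A b" by (simp add: star_mult star_star)
  show "norm (b * star A b) = (norm b)\<^sup>2" using cstar_identity[of "star A b"] by (simp add: star_star norm_star)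
qed (use \<pi> x in \<open>auto simp: op_star_rep_def\<close>)

end

section \<open>Extending maps from the polynomial algebra to its envelope\<close>

context universal_envelope
begin

lemma embed_simps: "\<iota> (a + b) = \<iota> a + \<iota> b" "\<iota> (scl G c a) = scl A c (\<iota> a)" "\<iota> (a - b) = \<iota> a - \<iota> b" "\<iota> 0 = 0"
proof -
  interpret i: Vector_Spaces.linear "scl G" "scl A" \<iota> by (rule embed_linear)
  show "\<iota> (a + b) = \<iota> a + \<iota> b" "\<iota> (scl G c a) = scl A c (\<iota> a)" "\<iota> (a - b) = \<iota> a - \<iota> b" "\<iota> 0 = 0"
    by (simp_all add: i.add i.scale i.diff i.zero)
qed

lemma embed_approx: "\<exists>s :: nat \<Rightarrow> 'a. (\<lambda>n. \<iota> (s n)) \<longlonglongrightarrow> a"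
proof -
  have "a \<in> closure (range \<iota>)" using embed_dense by simp
  then obtain t where t: "\<And>n. t n \<in> range \<iota>" "t \<longlonglongrightarrow> a" unfolding closure_sequential by blast
  then have "\<exists>s. \<forall>n. t n = \<iota> (s n)" by (intro choice) blast
  then obtain s where "t = (\<lambda>n. \<iota> (s n))" by (auto simp: fun_eq_iff)
  with t(2) show ?thesis by auto
qed

text \<open>The norm of the envelope dominates every C*-seminorm of the polynomial algebra.\<close>
lemma star_rep_bound:
  assumes "hilbert_subspace K" "star_rep G K \<pi>" "x \<in> K"
  shows "norm (\<pi> a x) \<le> norm (\<iota> a) * norm x"
proof -
  have "norm (\<pi> a x) \<le> op_norm K (\<pi> a) * norm x"
    using assms by (intro op_norm_bound) (auto simp: star_rep_def star_linear_map_def)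
  also have "op_norm K (\<pi> a) \<le> norm (\<iota> a)"
    by (rule embed_norm_greatest[OF star_rep_cstar_seminorm[OF pol.star_algebra_axioms assms(1,2)]])
  finally show ?thesis by (simp add: mult_right_mono)
qed

lemma extend_bounded:
  fixes f :: "'a \<Rightarrow> 'b::banach"
  assumes diff: "\<And>a b. f (a - b) = f a - f b" and bound: "\<And>a. norm (f a) \<le> C * norm (\<iota> a)"
  shows "\<exists>g. \<forall>s c. (\<lambda>n::nat. \<iota> (s n)) \<longlonglongrightarrow> c \<longrightarrow> (\<lambda>n. f (s n)) \<longlonglongrightarrow> g c"
proof -
  have Cnn: "norm (f a) \<le> \<bar>C\<bar> * norm (\<iota> a)" for a
    using bound[of a] by (meson abs_ge_self mult_right_mono norm_ge_zero order_trans)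
  have cauchy: "Cauchy (\<lambda>n. f (s n))" if "(\<lambda>n::nat. \<iota> (s n)) \<longlonglongrightarrow> c" for s c
  proof (rule CauchyI)
    fix e :: real assume e: "e > 0"
    have "Cauchy (\<lambda>n. \<iota> (s n))" using that by (rule LIMSEQ_imp_Cauchy)
    then obtain M where M: "\<forall>m\<ge>M. \<forall>n\<ge>M. norm (\<iota> (s m) - \<iota> (s n)) < e / (\<bar>C\<bar> + 1)"
      using CauchyD[of "\<lambda>n. \<iota> (s n)" "e / (\<bar>C\<bar> + 1)"] e by auto
    have "norm (f (s m) - f (s n)) < e" if "m \<ge> M" "n \<ge> M" for m n
    proof -
      have "norm (f (s m) - f (s n)) \<le> \<bar>C\<bar> * norm (\<iota> (s m) - \<iota> (s n))"
        using Cnn[of "s m - s n"] by (simp add: diff embed_simps)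
      also have "\<dots> \<le> (\<bar>C\<bar> + 1) * norm (\<iota> (s m) - \<iota> (s n))" by (intro mult_right_mono) auto
      also have "\<dots> < (\<bar>C\<bar> + 1) * (e / (\<bar>C\<bar> + 1))" using M that by (intro mult_strict_left_mono) auto
      finally show ?thesis by simp
    qed
    then show "\<exists>M. \<forall>m\<ge>M. \<forall>n\<ge>M. norm (f (s m) - f (s n)) < e" by blast
  qed
  have "\<exists>l. \<forall>s. (\<lambda>n::nat. \<iota> (s n)) \<longlonglongrightarrow> c \<longrightarrow> (\<lambda>n. f (s n)) \<longlonglongrightarrow> l" for c
  proof -
    obtain s0 where s0: "(\<lambda>n::nat. \<iota> (s0 n)) \<longlonglongrightarrow> c" using embed_approx by blast
    obtain l where l: "(\<lambda>n. f (s0 n)) \<longlonglongrightarrow> l"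
      using cauchy[OF s0] Cauchy_convergent_iff convergent_def by blast
    have "(\<lambda>n. f (s n)) \<longlonglongrightarrow> l" if s: "(\<lambda>n::nat. \<iota> (s n)) \<longlonglongrightarrow> c" for s
    proof -
      have "(\<lambda>n. \<iota> (s n) - \<iota> (s0 n)) \<longlonglongrightarrow> c - c" by (intro tendsto_diff s s0)
      then have lim0: "(\<lambda>n. \<bar>C\<bar> * norm (\<iota> (s n) - \<iota> (s0 n))) \<longlonglongrightarrow> 0"
        by (intro tendsto_mult_right_zero tendsto_norm_zero) simp
      have "(\<lambda>n. f (s n) - f (s0 n)) \<longlonglongrightarrow> 0"
      proof (rule Lim_null_comparison[OF _ lim0])
        show "\<forall>\<^sub>F n in sequentially. norm (f (s n) - f (s0 n)) \<le> \<bar>C\<bar> * norm (\<iota> (s n) - \<iota> (s0 n))"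
          using Cnn[of "s _ - s0 _"] by (simp add: diff embed_simps)
      qed
      from tendsto_add[OF this l] show ?thesis by simp
    qed
    then show ?thesis by blast
  qed
  then show ?thesis by metis
qed

text \<open>A representation of the polynomial algebra extends to the envelope by continuity.\<close>

lemma star_rep_extension:
  assumes K: "hilbert_subspace K" and \<pi>: "star_rep G K \<pi>"
  obtains L where "star_rep A K L" "\<And>a x. x \<in> K \<Longrightarrow> L (\<iota> a) x = \<pi> a x"
proof -
  have slm: "star_linear_map G K \<pi>" and mult: "\<And>a b x. x \<in> K \<Longrightarrow> \<pi> (a * b) x = \<pi> a (\<pi> b x)"
    using \<pi> by (auto simp: star_rep_def)
  note D = star_linear_mapD[OF slm]
  have bound: "norm (\<pi> a x) \<le> norm (\<iota> a) * norm x" if "x \<in> K" for a x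
    by (rule star_rep_bound[OF K \<pi> that])
  have "\<exists>g. \<forall>s c. (\<lambda>n::nat. \<iota> (s n)) \<longlonglongrightarrow> c \<longrightarrow> (\<lambda>n. \<pi> (s n) x) \<longlonglongrightarrow> g c" if x: "x \<in> K" for x
  proof (rule extend_bounded[where C = "norm x"])
    show "\<pi> (a - b) x = \<pi> a x - \<pi> b x" for a b
      using D(2)[OF x, of "a - b" b] by (simp add: algebra_simps)
    show "norm (\<pi> a x) \<le> norm x * norm (\<iota> a)" for a using bound[OF x, of a] by (simp add: mult.commute)
  qed
  then obtain g where g: "\<And>x s c. x \<in> K \<Longrightarrow> (\<lambda>n::nat. \<iota> (s n)) \<longlonglongrightarrow> c \<Longrightarrow> (\<lambda>n. \<pi> (s n) x) \<longlonglongrightarrow> g x c"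
    by metis
  define L where "L = (\<lambda>c x. g x c)"
  have lim: "(\<lambda>n. \<pi> (s n) x) \<longlonglongrightarrow> L c x" if "x \<in> K" "(\<lambda>n::nat. \<iota> (s n)) \<longlonglongrightarrow> c" for x s c
    unfolding L_def using g that by blast
  have L_\<iota>: "L (\<iota> a) x = \<pi> a x" if "x \<in> K" for a x
    using lim[OF that, of "\<lambda>_. a" "\<iota> a"] by (simp add: LIMSEQ_const_iff)
  have L_K: "L c x \<in> K" if x: "x \<in> K" for c x
  proof -
    obtain s where s: "(\<lambda>n::nat. \<iota> (s n)) \<longlonglongrightarrow> c" using embed_approx by blast
    show ?thesis
      using closed_sequentially[OF hilbert_subspaceD(2)[OF K] _ lim[OF x s]] D(6)[OF x] by blast
  qed
  have L_bound: "norm (L c x) \<le> norm c * norm x" if x: "x \<in> K" for c x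
  proof -
    obtain s where s: "(\<lambda>n::nat. \<iota> (s n)) \<longlonglongrightarrow> c" using embed_approx by blast
    show ?thesis
      by (rule LIMSEQ_le[OF tendsto_norm[OF lim[OF x s]] tendsto_mult[OF tendsto_norm[OF s] tendsto_const]])
        (use bound[OF x] in blast)
  qed
  have bnd: "bounded_op K (L c)" for c
  proof -
    obtain s where s: "(\<lambda>n::nat. \<iota> (s n)) \<longlonglongrightarrow> c" using embed_approx by blast
    have "L c (x + y) = L c x + L c y" if xy: "x \<in> K" "y \<in> K" for x y
    proof (rule LIMSEQ_unique[OF lim[OF hilbert_subspaceD(4)[OF K xy] s]])
      show "(\<lambda>n. \<pi> (s n) (x + y)) \<longlonglongrightarrow> L c x + L c y"
        using tendsto_add[OF lim[OF xy(1) s] lim[OF xy(2) s]] bounded_opD(2)[OF D(1) xy] by simp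
    qed
    moreover have "L c (z *\<^sub>C x) = z *\<^sub>C L c x" if x: "x \<in> K" for z x
    proof (rule LIMSEQ_unique[OF lim[OF hilbert_subspaceD(5)[OF K x] s]])
      show "(\<lambda>n. \<pi> (s n) (z *\<^sub>C x)) \<longlonglongrightarrow> z *\<^sub>C L c x"
        using bounded_linear.tendsto[OF bounded_linear_scaleC lim[OF x s]] bounded_opD(3)[OF D(1) x] by simp
    qed
    ultimately show ?thesis using L_K L_bound unfolding bounded_op_def by blast
  qed
  have add: "L (a + b) x = L a x + L b x" if x: "x \<in> K" for a b x
  proof -
    obtain s t where s: "(\<lambda>n::nat. \<iota> (s n)) \<longlonglongrightarrow> a" and t: "(\<lambda>n::nat. \<iota> (t n)) \<longlonglongrightarrow> b" using embed_approx by metis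
    have "(\<lambda>n. \<iota> (s n + t n)) \<longlonglongrightarrow> a + b" using tendsto_add[OF s t] by (simp add: embed_simps)
    from LIMSEQ_unique[OF lim[OF x this]] tendsto_add[OF lim[OF x s] lim[OF x t]]
    show ?thesis by (simp add: D(2)[OF x])
  qed
  have bounded_linear_scl: "bounded_linear (\<lambda>a. scl A z a)" for z
  proof (rule bounded_linear_intro[where K = "cmod z"])
    show "scl A z (r *\<^sub>R a) = r *\<^sub>R scl A z a" for r a
      by (simp add: env.scl_of_real[symmetric] mult.commute)
  qed (simp_all add: env.scale_right_distrib env.norm_scl mult.commute)
  have scale: "L (scl A z a) x = z *\<^sub>C L a x" if x: "x \<in> K" for z a x
  proof -
    obtain s where s: "(\<lambda>n::nat. \<iota> (s n)) \<longlonglongrightarrow> a" using embed_approx by blast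
    have "(\<lambda>n. \<iota> (scl G z (s n))) \<longlonglongrightarrow> scl A z a"
      using bounded_linear.tendsto[OF bounded_linear_scl s] by (simp add: embed_simps)
    from LIMSEQ_unique[OF lim[OF x this]] bounded_linear.tendsto[OF bounded_linear_scaleC lim[OF x s], of z]
    show ?thesis by (simp add: D(3)[OF x])
  qed
  have one: "L 1 x = x" if x: "x \<in> K" for x
    using L_\<iota>[OF x, of 1] D(4)[OF x] by (simp add: embed_one)
  have adj: "cinner (L a x) y = cinner x (L (star A a) y)" if x: "x \<in> K" and y: "y \<in> K" for a x y
  proof -
    obtain s where s: "(\<lambda>n::nat. \<iota> (s n)) \<longlonglongrightarrow> a" using embed_approx by blast
    have "(\<lambda>n. \<iota> (star G (s n))) \<longlonglongrightarrow> star A a"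
      using bounded_linear.tendsto[OF env.bounded_linear_star s] by (simp add: embed_star)
    from tendsto_cinner[OF tendsto_const lim[OF y this], of x]
    have "(\<lambda>n. cinner (\<pi> (s n) x) y) \<longlonglongrightarrow> cinner x (L (star A a) y)"
      by (simp add: D(5)[OF x y])
    from LIMSEQ_unique[OF this tendsto_cinner[OF lim[OF x s] tendsto_const]] show ?thesis by simp
  qed
  have L_mult: "L (a * b) x = L a (L b x)" if x: "x \<in> K" for a b x
  proof -
    obtain s t where s: "(\<lambda>n::nat. \<iota> (s n)) \<longlonglongrightarrow> a" and t: "(\<lambda>n::nat. \<iota> (t n)) \<longlonglongrightarrow> b" using embed_approx by metis
    have st: "(\<lambda>n. \<iota> (s n * t n)) \<longlonglongrightarrow> a * b" using tendsto_mult[OF s t] by (simp add: embed_mult)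
    have zero: "(\<lambda>n. norm (\<iota> (s n)) * norm (\<pi> (t n) x - L b x)) \<longlonglongrightarrow> 0"
    proof -
      have "(\<lambda>n. \<pi> (t n) x - L b x) \<longlonglongrightarrow> L b x - L b x" by (intro tendsto_diff lim x t tendsto_const)
      then have "(\<lambda>n. norm (\<pi> (t n) x - L b x)) \<longlonglongrightarrow> 0" by (intro tendsto_norm_zero) simp
      from tendsto_mult[OF tendsto_norm[OF s] this] show ?thesis by simp
    qed
    have "(\<lambda>n. \<pi> (s n) (\<pi> (t n) x) - \<pi> (s n) (L b x)) \<longlonglongrightarrow> 0"
    proof (rule Lim_null_comparison[OF _ zero])
      have "norm (\<pi> (s n) (\<pi> (t n) x) - \<pi> (s n) (L b x)) \<le> norm (\<iota> (s n)) * norm (\<pi> (t n) x - L b x)" for n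
        using bound[OF hilbert_subspaceD(6)[OF K D(6)[OF x] L_K[OF x]], of "s n" "t n" b]
          bounded_op_diff[OF D(1) K D(6)[OF x] L_K[OF x], of "s n" "t n" b] by simp
      then show "\<forall>\<^sub>F n in sequentially. norm (\<pi> (s n) (\<pi> (t n) x) - \<pi> (s n) (L b x)) \<le> norm (\<iota> (s n)) * norm (\<pi> (t n) x - L b x)"
        by simp
    qed
    from tendsto_add[OF this lim[OF L_K[OF x, of b] s]]
    have "(\<lambda>n. \<pi> (s n * t n) x) \<longlonglongrightarrow> L a (L b x)" by (simp add: mult[OF x])
    from LIMSEQ_unique[OF lim[OF x st] this] show ?thesis .
  qed
  have "star_rep A K L"
    unfolding star_rep_def star_linear_map_def using bnd add scale one adj L_mult by blast
  then show ?thesis using that L_\<iota> by blast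
qed

end

section \<open>Hilbert sums of sequences of subspaces\<close>

text \<open>The pairing of naturals splits the sequence space into a Hilbert sum of countably many copies of
  itself; a sequence of subspaces is summed along these copies.\<close>
definition ell2_component :: "nat \<Rightarrow> ell2 \<Rightarrow> ell2"
  where "ell2_component n x = Abs_ell2 (\<lambda>m. coord x (prod_encode (n, m)))"

definition ell2_assemble :: "(nat \<Rightarrow> ell2) \<Rightarrow> ell2"
  where "ell2_assemble z = Abs_ell2 (\<lambda>k. coord (z (fst (prod_decode k))) (snd (prod_decode k)))"

definition direct_sum :: "(nat \<Rightarrow> ell2 set) \<Rightarrow> ell2 set"
  where "direct_sum K = {x. \<forall>n. ell2_component n x \<in> K n}"

lemma coord_component: "coord (ell2_component n x) m = coord x (prod_encode (n, m))"
proof -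
  have "inj (\<lambda>m. prod_encode (n, m))" by (auto simp: inj_on_def)
  from summable_reindex[OF summable_coord[of x] this]
  have "summable (\<lambda>m. (cmod (coord x (prod_encode (n, m))))\<^sup>2)" by (simp add: comp_def)
  then show ?thesis by (simp add: ell2_component_def Abs_ell2_inverse)
qed

lemma component_simps:
  "ell2_component n (x + y) = ell2_component n x + ell2_component n y"
  "ell2_component n (x - y) = ell2_component n x - ell2_component n y"
  "ell2_component n (c *\<^sub>C x) = c *\<^sub>C ell2_component n x" "ell2_component n 0 = 0"
  by (auto intro!: ell2_eqI simp: coord_component)

lemma component_eqI: "(\<And>n. ell2_component n x = ell2_component n y) \<Longrightarrow> x = y"
proof (rule ell2_eqI)
  fix k assume *: "\<And>n. ell2_component n x = ell2_component n y"
  obtain n m where "k = prod_encode (n, m)" by (metis prod_decode_inverse surj_pair)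
  then show "coord x k = coord y k" using *[of n] by (metis coord_component)
qed

lemma cinner_has_sum: "((\<lambda>k. cnj (coord x k) * coord y k) has_sum cinner x y) UNIV"
proof (rule norm_summable_imp_has_sum)
  show "summable (\<lambda>k. norm (cnj (coord x k) * coord y k))"
  proof (rule summable_comparison_test')
    show "summable (\<lambda>k. (cmod (coord x k))\<^sup>2 + (cmod (coord y k))\<^sup>2)"
      by (intro summable_add summable_coord)
    fix k
    have "0 \<le> (cmod (coord x k) - cmod (coord y k))\<^sup>2" by simp
    then have "2 * (cmod (coord x k) * cmod (coord y k)) \<le> (cmod (coord x k))\<^sup>2 + (cmod (coord y k))\<^sup>2"
      by (simp add: power2_diff)
    moreover have "0 \<le> cmod (coord x k) * cmod (coord y k)" by simp
    ultimately have "cmod (coord x k) * cmod (coord y k) \<le> (cmod (coord x k))\<^sup>2 + (cmod (coord y k))\<^sup>2"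
      by linarith
    then show "norm (norm (cnj (coord x k) * coord y k)) \<le> (cmod (coord x k))\<^sup>2 + (cmod (coord y k))\<^sup>2"
      by (simp add: norm_mult)
  qed
  show "(\<lambda>k. cnj (coord x k) * coord y k) sums cinner x y"
    unfolding cinner_def by (rule summable_sums[OF summable_cinner])
qed

lemma bij_prod_encode_UNIV: "bij_betw prod_encode (Sigma UNIV (\<lambda>_. UNIV)) UNIV"
  using bij_prod_encode by simp

lemma cinner_components: "((\<lambda>n. cinner (ell2_component n x) (ell2_component n y)) has_sum cinner x y) UNIV"
proof (rule has_sum_SigmaD)
  show "((\<lambda>p. cnj (coord x (prod_encode p)) * coord y (prod_encode p)) has_sum cinner x y) (Sigma UNIV (\<lambda>_. UNIV))"
    using has_sum_reindex_bij_betw[OF bij_prod_encode_UNIV, of "\<lambda>k. cnj (coord x k) * coord y k" "cinner x y"]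
      cinner_has_sum by blast
  show "((\<lambda>m. cnj (coord x (prod_encode (n, m))) * coord y (prod_encode (n, m))) has_sum
      cinner (ell2_component n x) (ell2_component n y)) UNIV" for n
    using cinner_has_sum[of "ell2_component n x" "ell2_component n y"] by (simp add: coord_component)
qed

lemma norm_components: "(\<lambda>n. (norm (ell2_component n x))\<^sup>2) sums (norm x)\<^sup>2"
proof -
  have "(\<lambda>n. cinner (ell2_component n x) (ell2_component n x)) sums cinner x x"
    by (rule has_sum_imp_sums[OF cinner_components])
  then have "(\<lambda>n. complex_of_real ((norm (ell2_component n x))\<^sup>2)) sums of_real ((norm x)\<^sup>2)"
    by (simp only: cinner_self_norm)
  then show ?thesis by (simp only: sums_of_real_iff)
qed

lemma norm_component_le: "norm (ell2_component n x) \<le> norm x"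
proof (rule power2_le_imp_le)
  have "(\<Sum>k\<in>{n}. (norm (ell2_component k x))\<^sup>2) \<le> (\<Sum>k. (norm (ell2_component k x))\<^sup>2)"
    using norm_components by (intro sum_le_suminf) (auto simp: sums_iff)
  then show "(norm (ell2_component n x))\<^sup>2 \<le> (norm x)\<^sup>2"
    using norm_components[of x] by (simp add: sums_iff)
qed simp

lemma component_assemble:
  assumes "summable (\<lambda>n. (norm (z n))\<^sup>2)"
  shows "ell2_component n (ell2_assemble z) = z n"
proof -
  have "((\<lambda>m. (cmod (coord (z n) m))\<^sup>2) has_sum (norm (z n))\<^sup>2) UNIV" for n
    using summable_coord[of "z n"]
    by (intro norm_summable_imp_has_sum) (auto simp: norm_ell2_square intro: summable_sums)
  moreover have "(\<lambda>n. (norm (z n))\<^sup>2) summable_on UNIV"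
    using assms by (simp add: summable_on_UNIV_nonneg_real_iff)
  ultimately have "(\<lambda>(n, m). (cmod (coord (z n) m))\<^sup>2) summable_on (Sigma UNIV (\<lambda>_. UNIV))"
    by (intro summable_on_SigmaI[where g = "\<lambda>n. (norm (z n))\<^sup>2"]) auto
  then have "(\<lambda>k. (case prod_decode k of (n, m) \<Rightarrow> (cmod (coord (z n) m))\<^sup>2)) summable_on UNIV"
    using summable_on_reindex_bij_betw[of prod_decode UNIV UNIV "\<lambda>(n, m). (cmod (coord (z n) m))\<^sup>2"] bij_prod_decode
    by simp
  then have "summable (\<lambda>k. (cmod (coord (z (fst (prod_decode k))) (snd (prod_decode k))))\<^sup>2)"
    by (intro summable_on_imp_summable) (simp add: case_prod_unfold)
  then show ?thesis
    by (intro ell2_eqI) (simp add: coord_component ell2_assemble_def Abs_ell2_inverse)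
qed

lemma bounded_linear_component: "bounded_linear (ell2_component n)"
proof (rule bounded_linear_intro[where K = 1])
  show "ell2_component n (r *\<^sub>R x) = r *\<^sub>R ell2_component n x" for r x
    by (simp add: scaleR_ell2_def component_simps)
qed (simp_all add: component_simps norm_component_le)

lemma hilbert_subspace_direct_sum:
  assumes "\<And>n. hilbert_subspace (K n)"
  shows "hilbert_subspace (direct_sum K)"
proof -
  note K = hilbert_subspaceD[OF assms]
  have "closed (ell2_component n -` K n)" for n
    using bounded_linear.continuous_on[OF bounded_linear_component continuous_on_id, of UNIV n] K(2)
    by (intro closed_vimage) (simp_all add: continuous_on_eq_continuous_within id_def)
  moreover have "direct_sum K = (\<Inter>n. ell2_component n -` K n)" by (auto simp: direct_sum_def)
  ultimately have "closed (direct_sum K)" by auto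
  then show ?thesis
    unfolding hilbert_subspace_def ell2.subspace_def
    by (auto simp: direct_sum_def component_simps K(3) intro: K(4,5))
qed

definition ell2_single :: "nat \<Rightarrow> ell2 \<Rightarrow> ell2"
  where "ell2_single n z = ell2_assemble (\<lambda>k. if k = n then z else 0)"

lemma single_sums: "(\<lambda>k. (norm (if k = n then z else (0::ell2)))\<^sup>2) sums (norm z)\<^sup>2"
  using sums_single[of n "\<lambda>_. (norm z)\<^sup>2"] by (simp add: if_distrib[of norm] if_distrib[of "\<lambda>x. x\<^sup>2"] cong: if_cong)

lemma component_single: "ell2_component k (ell2_single n z) = (if k = n then z else 0)"
  unfolding ell2_single_def using single_sums by (subst component_assemble) (auto simp: sums_iff)

lemma norm_single: "norm (ell2_single n z) = norm z"
proof -
  have "(\<lambda>k. (norm (if k = n then z else (0::ell2)))\<^sup>2) sums (norm (ell2_single n z))\<^sup>2"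
    using norm_components[of "ell2_single n z"] by (simp add: component_single)
  from sums_unique2[OF this single_sums] show ?thesis by simp
qed

lemma single_diff: "ell2_single n x - ell2_single n y = ell2_single n (x - y)"
  by (rule component_eqI) (simp add: component_simps component_single)

lemma single_scaleC: "c *\<^sub>C ell2_single n x = ell2_single n (c *\<^sub>C x)"
  by (rule component_eqI) (simp add: component_simps component_single)

text \<open>The norm of the envelope bounds the images of an element under all members of the sequence
  uniformly, so that the summands combine to a bounded operator.\<close>
lemma (in universal_envelope) star_rep_direct_sum:
  assumes K: "\<And>n. hilbert_subspace (K n)" and \<Phi>: "\<And>n. star_rep G (K n) (\<Phi> n)"
  obtains D where "star_rep G (direct_sum K) D"
    "\<And>a x n. x \<in> direct_sum K \<Longrightarrow> ell2_component n (D a x) = \<Phi> n a (ell2_component n x)"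
proof -
  define D where "D a x = ell2_assemble (\<lambda>n. \<Phi> n a (ell2_component n x))" for a x
  have slm: "star_linear_map G (K n) (\<Phi> n)" and mult: "\<And>a b x. x \<in> K n \<Longrightarrow> \<Phi> n (a * b) x = \<Phi> n a (\<Phi> n b x)" for n
    using \<Phi>[of n] by (auto simp: star_rep_def)
  note S = star_linear_mapD[OF slm]
  have mem: "ell2_component n x \<in> K n" if "x \<in> direct_sum K" for x n
    using that by (simp add: direct_sum_def)
  have bound: "(norm (\<Phi> n a (ell2_component n x)))\<^sup>2 \<le> (norm (\<iota> a))\<^sup>2 * (norm (ell2_component n x))\<^sup>2"
    if "x \<in> direct_sum K" for n a x
  proof -
    have "norm (\<Phi> n a (ell2_component n x)) \<le> norm (\<iota> a) * norm (ell2_component n x)"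
      by (rule star_rep_bound[OF K \<Phi> mem[OF that]])
    from power_mono[OF this norm_ge_zero, of 2] show ?thesis by (simp add: power_mult_distrib)
  qed
  have summable: "summable (\<lambda>n. (norm (\<Phi> n a (ell2_component n x)))\<^sup>2)" if "x \<in> direct_sum K" for a x
  proof (rule summable_comparison_test')
    show "summable (\<lambda>n. (norm (\<iota> a))\<^sup>2 * (norm (ell2_component n x))\<^sup>2)"
      using norm_components[of x] by (intro summable_mult) (simp add: sums_iff)
  qed (use bound[OF that] in simp)
  have comp: "ell2_component n (D a x) = \<Phi> n a (ell2_component n x)" if "x \<in> direct_sum K" for a x n
    unfolding D_def by (rule component_assemble[OF summable[OF that]])
  have D_mem: "D a x \<in> direct_sum K" if "x \<in> direct_sum K" for a x
    using S(6)[OF mem[OF that]] by (simp add: direct_sum_def comp[OF that])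
  note DS = hilbert_subspaceD[OF hilbert_subspace_direct_sum[OF K]]
  have D_bound: "norm (D a x) \<le> norm (\<iota> a) * norm x" if x: "x \<in> direct_sum K" for a x
  proof (rule power2_le_imp_le)
    have "(norm (D a x))\<^sup>2 = (\<Sum>n. (norm (\<Phi> n a (ell2_component n x)))\<^sup>2)"
      using norm_components[of "D a x"] by (simp add: comp[OF x] sums_iff)
    also have "\<dots> \<le> (\<Sum>n. (norm (\<iota> a))\<^sup>2 * (norm (ell2_component n x))\<^sup>2)"
      using norm_components[of x] by (intro suminf_le bound x summable summable_mult) (simp add: sums_iff)
    also have "\<dots> = (norm (\<iota> a) * norm x)\<^sup>2"
      using norm_components[of x] by (simp add: suminf_mult sums_iff power_mult_distrib)
    finally show "(norm (D a x))\<^sup>2 \<le> (norm (\<iota> a) * norm x)\<^sup>2" .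
  qed simp
  have "star_rep G (direct_sum K) D"
    unfolding star_rep_def star_linear_map_def bounded_op_def
  proof (intro conjI allI ballI)
    fix a b x y c assume x: "x \<in> direct_sum K" and y: "y \<in> direct_sum K"
    show "D a x \<in> direct_sum K" by (rule D_mem[OF x])
    show "D a (x + y) = D a x + D a y"
      by (rule component_eqI) (simp add: comp x y DS(4) component_simps bounded_opD(2)[OF S(1)] mem)
    show "D (a + b) x = D a x + D b x"
      by (rule component_eqI) (simp add: comp x component_simps S(2)[OF mem[OF x]])
    show "D (scl G c a) x = c *\<^sub>C D a x"
      by (rule component_eqI) (simp add: comp x component_simps S(3)[OF mem[OF x]])
    show "D 1 x = x"
      by (rule component_eqI) (simp add: comp x S(4)[OF mem[OF x]])
    show "D (a * b) x = D a (D b x)"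
      by (rule component_eqI) (simp add: comp x D_mem mult[OF mem[OF x]])
    show "cinner (D a x) y = cinner x (D (star G a) y)"
    proof (rule has_sum_unique[OF cinner_components])
      show "((\<lambda>n. cinner (ell2_component n (D a x)) (ell2_component n y)) has_sum cinner x (D (star G a) y)) UNIV"
        using cinner_components[of x "D (star G a) y"] by (simp add: comp x y S(5)[OF mem[OF x] mem[OF y]])
    qed
  next
    fix a c x assume x: "x \<in> direct_sum K"
    show "D a (c *\<^sub>C x) = c *\<^sub>C D a x"
      by (rule component_eqI) (simp add: comp x DS(5) component_simps bounded_opD(3)[OF S(1)] mem)
  next
    fix a show "\<exists>B. \<forall>x\<in>direct_sum K. norm (D a x) \<le> B * norm x" using D_bound by blast
  qed
  then show ?thesis using that comp by blast
qed

section \<open>Representations of the polynomial algebra and corepresentations of the dual\<close>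

lemma bounded_op_add: "bounded_op K T \<Longrightarrow> bounded_op K T' \<Longrightarrow> hilbert_subspace K \<Longrightarrow> bounded_op K (\<lambda>x. T x + T' x)"
proof -
  assume T: "bounded_op K T" "bounded_op K T'" and K: "hilbert_subspace K"
  obtain B B' where B: "\<forall>x\<in>K. norm (T x) \<le> B * norm x" "\<forall>x\<in>K. norm (T' x) \<le> B' * norm x"
    using T unfolding bounded_op_def by blast
  have "\<forall>x\<in>K. norm (T x + T' x) \<le> (B + B') * norm x"
    using B by (auto simp: distrib_right intro: order_trans[OF norm_triangle_ineq add_mono])
  moreover have "\<forall>x\<in>K. T x + T' x \<in> K" using bounded_opD(1)[OF T(1)] bounded_opD(1)[OF T(2)] hilbert_subspaceD(4)[OF K] by blast
  ultimately show ?thesis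
    unfolding bounded_op_def
    using bounded_opD(2,3)[OF T(1)] bounded_opD(2,3)[OF T(2)] by (auto simp: ell2.scale_right_distrib)
qed

lemma bounded_op_zero: "hilbert_subspace K \<Longrightarrow> bounded_op K (\<lambda>x. 0)"
  using hilbert_subspaceD(3) unfolding bounded_op_def by (auto intro!: exI[of _ 0])

lemma bounded_op_scale: "bounded_op K T \<Longrightarrow> hilbert_subspace K \<Longrightarrow> bounded_op K (\<lambda>x. c *\<^sub>C T x)"
proof -
  assume T: "bounded_op K T" and K: "hilbert_subspace K"
  obtain B where B: "\<forall>x\<in>K. norm (T x) \<le> B * norm x"
    using T unfolding bounded_op_def by blast
  have "\<forall>x\<in>K. norm (c *\<^sub>C T x) \<le> (cmod c * B) * norm x"
    using B by (auto simp: norm_scaleC mult.assoc intro: mult_left_mono)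
  then have "\<exists>B. \<forall>x\<in>K. norm (c *\<^sub>C T x) \<le> B * norm x" by blast
  then show ?thesis
    unfolding bounded_op_def
    using bounded_opD[OF T] hilbert_subspaceD(5)[OF K] by (simp add: ell2.scale_right_distrib mult.commute)
qed

lemma bounded_op_comp: "bounded_op K T \<Longrightarrow> bounded_op K T' \<Longrightarrow> bounded_op K (\<lambda>x. T (T' x))"
proof -
  assume T: "bounded_op K T" "bounded_op K T'"
  obtain B B' where B: "\<forall>x\<in>K. norm (T x) \<le> B * norm x" "\<forall>x\<in>K. norm (T' x) \<le> B' * norm x"
    using T unfolding bounded_op_def by blast
  have "norm (T (T' x)) \<le> (\<bar>B\<bar> * B') * norm x" if x: "x \<in> K" for x
  proof -
    have "norm (T (T' x)) \<le> B * norm (T' x)" using B(1) bounded_opD(1)[OF T(2) x] by blast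
    also have "\<dots> \<le> \<bar>B\<bar> * norm (T' x)" by (intro mult_right_mono) auto
    also have "\<dots> \<le> \<bar>B\<bar> * (B' * norm x)" using B(2) x by (intro mult_left_mono) auto
    finally show ?thesis by (simp add: mult.assoc)
  qed
  then show ?thesis
    unfolding bounded_op_def using bounded_opD[OF T(1)] bounded_opD[OF T(2)] by auto
qed

context compact_quantum_group
begin

text \<open>The coproduct of the dual is fixed by \<open>w\<^sub>2\<^sub>3w\<^sub>1\<^sub>3\<close>, which reverses the order of the factors.\<close>
lemma dual_comult_eval:
  assumes f: "Vector_Spaces.linear (scl G) (*\<^sub>C) f"
    and V: "\<And>\<gamma> p q. \<gamma> \<in> Irr G \<Longrightarrow> p < dim_irr G \<gamma> \<Longrightarrow> q < dim_irr G \<gamma> \<Longrightarrow> V \<gamma> p q \<xi> = f (fund G \<gamma> p q)"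
  shows "dual_comult G V (\<alpha>, i, k) (\<beta>, j, l) \<xi> = f (fund G \<beta> j l * fund G \<alpha> i k)"
proof -
  interpret f: Vector_Spaces.linear "scl G" "(*\<^sub>C)" f by fact
  let ?B = "fund_entry G ` irr_indices G" and ?w = "fund G \<beta> j l * fund G \<alpha> i k"
  have unit: "dual_comult_unit G r (\<alpha>, i, k) (\<beta>, j, l) = representation ?B ?w (fund_entry G r)" for r
    by (cases r) (simp add: dual_comult_unit_def fund_entry_def[symmetric], simp add: fund_entry_def)
  let ?I = "{r \<in> irr_indices G. representation ?B ?w (fund_entry G r) \<noteq> 0}"
  have image: "{b. representation ?B ?w b \<noteq> 0} = fund_entry G ` ?I"
    using representation_ne_zero[of ?B ?w] by auto
  have inj: "inj_on (fund_entry G) ?I" by (rule inj_on_subset[OF inj_fund_entry]) auto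
  have "f ?w = f (\<Sum>b | representation ?B ?w b \<noteq> 0. scl G (representation ?B ?w b) b)"
    using sum_nonzero_representation_eq[OF independent_fund_entries, of ?w] fund_span_UNIV by simp
  also have "\<dots> = (\<Sum>r\<in>?I. representation ?B ?w (fund_entry G r) *\<^sub>C f (fund_entry G r))"
    unfolding image by (simp add: sum.reindex[OF inj] f.sum f.scale)
  also have "\<dots> = (\<Sum>(\<gamma>, p, q)\<in>?I. representation ?B ?w (fund_entry G (\<gamma>, p, q)) *\<^sub>C V \<gamma> p q \<xi>)"
    by (intro sum.cong refl) (auto simp: irr_indices_def V fund_entry_def)
  also have "\<dots> = dual_comult G V (\<alpha>, i, k) (\<beta>, j, l) \<xi>"
    by (simp add: dual_comult_def unit)
  finally show ?thesis by simp
qed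

lemma star_rep_dual_corep:
  assumes K: "hilbert_subspace K" and \<Phi>: "star_rep G K \<Phi>"
  shows "dual_corep G K (\<lambda>\<alpha> i j. \<Phi> (fund G \<alpha> i j))"
proof -
  have slm: "star_linear_map G K \<Phi>" and mult: "\<And>a b x. x \<in> K \<Longrightarrow> \<Phi> (a * b) x = \<Phi> a (\<Phi> b x)"
    using \<Phi> by (auto simp: star_rep_def)
  note S = star_linear_mapD[OF slm]
  have lin: "Vector_Spaces.linear (scl G) (*\<^sub>C) (\<lambda>a. \<Phi> a x)" if "x \<in> K" for x
    by (rule star_linear_map_linear[OF slm that])
  have sum: "\<Phi> (\<Sum>i\<in>I. f i) x = (\<Sum>i\<in>I. \<Phi> (f i) x)" if "x \<in> K" for f x and I :: "nat set"
  proof -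
    interpret l: Vector_Spaces.linear "scl G" "(*\<^sub>C)" "\<lambda>a. \<Phi> a x" by (rule lin[OF that])
    show ?thesis by (rule l.sum)
  qed
  have bool: "\<Phi> (of_bool b) x = (if b then x else 0)" if "x \<in> K" for b x
  proof -
    interpret l: Vector_Spaces.linear "scl G" "(*\<^sub>C)" "\<lambda>a. \<Phi> a x" by (rule lin[OF that])
    show ?thesis using S(4)[OF that] l.zero by auto
  qed
  show ?thesis
    unfolding dual_corep_def
  proof (intro conjI ballI allI impI K)
    fix \<alpha> assume \<alpha>: "\<alpha> \<in> Irr G"
    let ?n = "dim_irr G \<alpha>" and ?u = "fund G \<alpha>"
    have uu: "(\<Sum>k<?n. star G (?u k i) * ?u k j) = of_bool (i = j)" "(\<Sum>k<?n. ?u i k * star G (?u j k)) = of_bool (i = j)"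
      if "i < ?n" "j < ?n" for i j
      using fund_unitary[OF \<alpha>] that by (simp_all add: unitary_matrix_def)
    show "bounded_op K (\<Phi> (fund G \<alpha> i j))" for i j by (rule S(1))
    fix x assume x: "\<forall>j<?n. x j \<in> K"
    have xj: "x j \<in> K" if "j \<in> {..<?n}" for j using x that by simp
    have inK: "(\<Sum>j<?n. \<Phi> (?u i j) (x j)) \<in> K" for i using S(6) x by (intro hilbert_subspaceD(7)[OF K]) auto
    have "complex_of_real (\<Sum>i<?n. (norm (\<Sum>j<?n. \<Phi> (?u i j) (x j)))\<^sup>2) =
        (\<Sum>i<?n. \<Sum>j<?n. \<Sum>l<?n. cinner (\<Phi> (?u i j) (x j)) (\<Phi> (?u i l) (x l)))"
      by (simp add: cinner_self_norm[symmetric] cinner_sum_left cinner_sum_right del: of_real_power)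
        (rule sum.cong[OF refl], rule sum.swap)
    also have "\<dots> = (\<Sum>i<?n. \<Sum>j<?n. \<Sum>l<?n. cinner (x j) (\<Phi> (star G (?u i j) * ?u i l) (x l)))"
      using x by (intro sum.cong refl) (simp add: S(5)[OF _ S(6)] mult)
    also have "\<dots> = (\<Sum>j<?n. \<Sum>i<?n. \<Sum>l<?n. cinner (x j) (\<Phi> (star G (?u i j) * ?u i l) (x l)))"
      by (rule sum.swap)
    also have "\<dots> = (\<Sum>j<?n. \<Sum>l<?n. \<Sum>i<?n. cinner (x j) (\<Phi> (star G (?u i j) * ?u i l) (x l)))"
      by (intro sum.cong refl sum.swap)
    also have "\<dots> = (\<Sum>j<?n. \<Sum>l<?n. cinner (x j) (\<Phi> (\<Sum>i<?n. star G (?u i j) * ?u i l) (x l)))"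
      using x by (intro sum.cong refl) (simp add: sum cinner_sum_right)
    also have "\<dots> = (\<Sum>j<?n. \<Sum>l<?n. if l = j then cinner (x j) (x j) else 0)"
      using x by (intro sum.cong refl) (auto simp: uu bool)
    also have "\<dots> = (\<Sum>j<?n. cinner (x j) (x j))" by (intro sum.cong refl) simp
    also have "\<dots> = complex_of_real (\<Sum>j<?n. (norm (x j))\<^sup>2)"
      by (simp add: cinner_self_norm)
    finally show "(\<Sum>i<?n. (norm (\<Sum>j<?n. \<Phi> (?u i j) (x j)))\<^sup>2) = (\<Sum>j<?n. (norm (x j))\<^sup>2)"
      by (simp only: of_real_eq_iff)
    \<comment> \<open>the adjoint matrix provides a preimage\<close>
    define z where "z j = (\<Sum>i<?n. \<Phi> (star G (?u i j)) (x i))" for j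
    have "z j \<in> K" for j unfolding z_def using S(6) x by (intro hilbert_subspaceD(7)[OF K]) auto
    moreover have "(\<Sum>j<?n. \<Phi> (?u i j) (z j)) = x i" if i: "i < ?n" for i
    proof -
      have "(\<Sum>j<?n. \<Phi> (?u i j) (z j)) = (\<Sum>j<?n. \<Sum>k<?n. \<Phi> (?u i j * star G (?u k j)) (x k))"
        unfolding z_def using x S(6) by (intro sum.cong refl) (subst bounded_op_sum[OF S(1) K], auto simp: mult)
      also have "\<dots> = (\<Sum>k<?n. \<Phi> (\<Sum>j<?n. ?u i j * star G (?u k j)) (x k))"
        using x by (subst sum.swap) (simp add: sum)
      also have "\<dots> = (\<Sum>k<?n. if k = i then x i else 0)"
        using x i by (intro sum.cong refl) (auto simp: uu bool)
      finally show ?thesis using i by simp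
    qed
    ultimately show "\<exists>z. (\<forall>j<?n. z j \<in> K) \<and> (\<forall>i<?n. (\<Sum>j<?n. \<Phi> (?u i j) (z j)) = x i)" by blast
  next
    fix \<alpha> \<beta> i k j l \<xi> assume "\<alpha> \<in> Irr G" "\<beta> \<in> Irr G" "\<xi> \<in> K"
    then show "dual_comult G (\<lambda>\<alpha> i j. \<Phi> (fund G \<alpha> i j)) (\<alpha>, i, k) (\<beta>, j, l) \<xi> = \<Phi> (fund G \<beta> j l) (\<Phi> (fund G \<alpha> i k) \<xi>)"
      by (subst dual_comult_eval[OF lin[OF \<open>\<xi> \<in> K\<close>]]) (auto simp: mult)
  qed
qed

text \<open>The values of \<open>\<Phi>\<close> are prescribed on the basis of matrix elements. The corepresentation identity
  gives multiplicativity, and polarization of the isometry property gives compatibility with the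
  involution.\<close>
lemma dual_corep_star_rep:
  assumes V: "dual_corep G K V"
  obtains \<Phi> where "star_rep G K \<Phi>" "\<And>\<alpha> i j. \<alpha> \<in> Irr G \<Longrightarrow> i < dim_irr G \<alpha> \<Longrightarrow> j < dim_irr G \<alpha> \<Longrightarrow> \<Phi> (fund G \<alpha> i j) = V \<alpha> i j"
proof -
  have K: "hilbert_subspace K" using V by (simp add: dual_corep_def)
  note KD = hilbert_subspaceD[OF K]
  have "\<forall>x. \<exists>f. Vector_Spaces.linear (scl G) (*\<^sub>C) f \<and> (\<forall>\<alpha>\<in>Irr G. \<forall>i<dim_irr G \<alpha>. \<forall>j<dim_irr G \<alpha>. f (fund G \<alpha> i j) = V \<alpha> i j x)"
    by (intro allI linear_extension ell2.vector_space_axioms)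
  from choice[OF this] obtain F where F: "\<And>x. Vector_Spaces.linear (scl G) (*\<^sub>C) (F x)"
    and F_fund: "\<And>x \<alpha> i j. \<alpha> \<in> Irr G \<Longrightarrow> i < dim_irr G \<alpha> \<Longrightarrow> j < dim_irr G \<alpha> \<Longrightarrow> F x (fund G \<alpha> i j) = V \<alpha> i j x"
    by blast
  define \<Phi> where "\<Phi> a x = F x a" for a x
  have \<Phi>_fund: "\<Phi> (fund G \<alpha> i j) = V \<alpha> i j" if "\<alpha> \<in> Irr G" "i < dim_irr G \<alpha>" "j < dim_irr G \<alpha>" for \<alpha> i j
    using that by (auto simp: \<Phi>_def F_fund)
  have lin: "Vector_Spaces.linear (scl G) (*\<^sub>C) (\<lambda>a. \<Phi> a x)" for x using F by (simp add: \<Phi>_def)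
  have add: "\<Phi> (a + b) x = \<Phi> a x + \<Phi> b x" and scale: "\<Phi> (scl G c a) x = c *\<^sub>C \<Phi> a x" and zero: "\<Phi> 0 x = 0"
    and sum: "\<Phi> (\<Sum>i\<in>I. f i) x = (\<Sum>i\<in>I. \<Phi> (f i) x)" for a b c x f and I :: "nat set"
  proof -
    interpret l: Vector_Spaces.linear "scl G" "(*\<^sub>C)" "\<lambda>a. \<Phi> a x" by (rule lin)
    show "\<Phi> (a + b) x = \<Phi> a x + \<Phi> b x" "\<Phi> (scl G c a) x = c *\<^sub>C \<Phi> a x" "\<Phi> 0 x = 0"
      "\<Phi> (\<Sum>i\<in>I. f i) x = (\<Sum>i\<in>I. \<Phi> (f i) x)"
      by (rule l.add l.scale l.zero l.sum)+
  qed
  have bnd: "bounded_op K (\<Phi> a)" for a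
  proof (rule fund_induct[of "\<lambda>a. bounded_op K (\<Phi> a)"])
    have "\<Phi> (a + b) = (\<lambda>x. \<Phi> a x + \<Phi> b x)" "\<Phi> (scl G c a) = (\<lambda>x. c *\<^sub>C \<Phi> a x)" "\<Phi> 0 = (\<lambda>x. 0)" for a b c
      by (auto simp: add scale zero)
    then show "subspace {a. bounded_op K (\<Phi> a)}"
      using K by (auto simp: subspace_def bounded_op_zero bounded_op_add bounded_op_scale)
    show "bounded_op K (\<Phi> (fund G \<alpha> i j))" if "\<alpha> \<in> Irr G" "i < dim_irr G \<alpha>" "j < dim_irr G \<alpha>" for \<alpha> i j
      using V that by (simp add: \<Phi>_fund dual_corep_def)
  qed
  note bndD = bounded_opD[OF bnd]
  have mult_fund: "\<Phi> (fund G \<beta> j l * fund G \<alpha> i k) x = \<Phi> (fund G \<beta> j l) (\<Phi> (fund G \<alpha> i k) x)"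
    if "\<beta> \<in> Irr G" "j < dim_irr G \<beta>" "l < dim_irr G \<beta>" "\<alpha> \<in> Irr G" "i < dim_irr G \<alpha>" "k < dim_irr G \<alpha>" "x \<in> K"
    for \<alpha> \<beta> i j k l x
  proof -
    have "dual_comult G V (\<alpha>, i, k) (\<beta>, j, l) x = V \<beta> j l (V \<alpha> i k x)"
      using V that unfolding dual_corep_def by blast
    moreover have "dual_comult G V (\<alpha>, i, k) (\<beta>, j, l) x = \<Phi> (fund G \<beta> j l * fund G \<alpha> i k) x"
      by (rule dual_comult_eval[OF lin]) (simp add: \<Phi>_fund)
    ultimately show ?thesis using that by (simp add: \<Phi>_fund)
  qed
  have mult: "\<Phi> (a * b) x = \<Phi> a (\<Phi> b x)" if x: "x \<in> K" for a b x
  proof (rule fund_induct[of "\<lambda>a. \<Phi> (a * b) x = \<Phi> a (\<Phi> b x)"])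
    show "subspace {a. \<Phi> (a * b) x = \<Phi> a (\<Phi> b x)}"
      by (auto simp: subspace_def zero add scale distrib_right scl_mult_left[symmetric])
    fix \<beta> j l assume \<beta>: "\<beta> \<in> Irr G" "j < dim_irr G \<beta>" "l < dim_irr G \<beta>"
    show "\<Phi> (fund G \<beta> j l * b) x = \<Phi> (fund G \<beta> j l) (\<Phi> b x)"
    proof (rule fund_induct[of "\<lambda>b. \<Phi> (fund G \<beta> j l * b) x = \<Phi> (fund G \<beta> j l) (\<Phi> b x)"])
      have "\<Phi> a 0 = 0" for a using bndD(3)[OF KD(3), of a 0] by simp
      then show "subspace {b. \<Phi> (fund G \<beta> j l * b) x = \<Phi> (fund G \<beta> j l) (\<Phi> b x)}"
        using x by (auto simp: subspace_def zero add scale distrib_left scl_mult_right[symmetric] bndD)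
    qed (use mult_fund \<beta> x in blast)
  qed
  have iso: "(\<Sum>i<dim_irr G \<alpha>. (norm (\<Sum>j<dim_irr G \<alpha>. \<Phi> (fund G \<alpha> i j) (x j)))\<^sup>2) = (\<Sum>j<dim_irr G \<alpha>. (norm (x j))\<^sup>2)"
    if "\<alpha> \<in> Irr G" "\<And>j. j < dim_irr G \<alpha> \<Longrightarrow> x j \<in> K" for \<alpha> x
  proof -
    have "(\<Sum>i<dim_irr G \<alpha>. (norm (\<Sum>j<dim_irr G \<alpha>. V \<alpha> i j (x j)))\<^sup>2) = (\<Sum>j<dim_irr G \<alpha>. (norm (x j))\<^sup>2)"
      using V that unfolding dual_corep_def by blast
    then show ?thesis using that(1) by (simp add: \<Phi>_fund)
  qed
  \<comment> \<open>an isometric idempotent is the identity\<close>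
  have one: "\<Phi> 1 x = x" if x: "x \<in> K" for x
  proof -
    have "norm (\<Phi> 1 y) = norm y" if "y \<in> K" for y
      using iso[OF trivial_irr(1), of "\<lambda>_. y"] that trivial_irr by simp
    from this[OF KD(6)[OF bndD(1)[OF x] x], of 1]
    have "norm (\<Phi> 1 x - x) = norm (\<Phi> 1 (\<Phi> 1 x) - \<Phi> 1 x)"
      by (simp add: bounded_op_diff[OF bnd K bndD(1)[OF x] x])
    also have "\<dots> = 0" using mult[OF x, of 1 1] by simp
    finally show ?thesis by simp
  qed
  have polar: "(\<Sum>i<dim_irr G \<alpha>. cinner (\<Sum>j<dim_irr G \<alpha>. \<Phi> (fund G \<alpha> i j) (x j)) (\<Sum>j<dim_irr G \<alpha>. \<Phi> (fund G \<alpha> i j) (y j))) =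
      (\<Sum>j<dim_irr G \<alpha>. cinner (x j) (y j))"
    if \<alpha>: "\<alpha> \<in> Irr G" and x: "\<And>j. j < dim_irr G \<alpha> \<Longrightarrow> x j \<in> K" and y: "\<And>j. j < dim_irr G \<alpha> \<Longrightarrow> y j \<in> K" for \<alpha> x y
  proof -
    let ?n = "dim_irr G \<alpha>" and ?T = "\<lambda>x i. \<Sum>j<dim_irr G \<alpha>. \<Phi> (fund G \<alpha> i j) (x j)"
    have real_polar: "(\<Sum>i<?n. inner (?T x i) (?T y i)) = (\<Sum>j<?n. inner (x j) (y j))"
      if x: "\<And>j. j < ?n \<Longrightarrow> x j \<in> K" and y: "\<And>j. j < ?n \<Longrightarrow> y j \<in> K" for x y
    proof -
      have T_add: "?T (\<lambda>j. x j + y j) i = ?T x i + ?T y i" for i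
        using x y by (simp add: bndD(2) sum.distrib)
      have pol: "inner a b = ((norm (a + b))\<^sup>2 - (norm a)\<^sup>2 - (norm b)\<^sup>2) / 2" for a b :: ell2
        by (simp add: power2_norm_eq_inner inner_add_left inner_add_right inner_commute)
      have "(\<Sum>i<?n. inner (?T x i) (?T y i)) =
          ((\<Sum>i<?n. (norm (?T (\<lambda>j. x j + y j) i))\<^sup>2) - (\<Sum>i<?n. (norm (?T x i))\<^sup>2) - (\<Sum>i<?n. (norm (?T y i))\<^sup>2)) / 2"
        unfolding T_add by (simp add: pol sum_subtractf sum_divide_distrib[symmetric])
      also have "\<dots> = ((\<Sum>j<?n. (norm (x j + y j))\<^sup>2) - (\<Sum>j<?n. (norm (x j))\<^sup>2) - (\<Sum>j<?n. (norm (y j))\<^sup>2)) / 2"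
        using iso[OF \<alpha>, of "\<lambda>j. x j + y j"] iso[OF \<alpha>, of x] iso[OF \<alpha>, of y] x y KD(4) by simp
      also have "\<dots> = (\<Sum>j<?n. inner (x j) (y j))"
        by (simp add: pol sum_subtractf sum_divide_distrib[symmetric])
      finally show ?thesis .
    qed
    have T_scale: "?T (\<lambda>j. \<i> *\<^sub>C x j) i = \<i> *\<^sub>C ?T x i" for i
      using x by (simp add: bndD(3) ell2.scale_sum_right)
    have "(\<Sum>i<?n. cinner (?T x i) (?T y i)) =
        Complex (\<Sum>i<?n. inner (?T x i) (?T y i)) (\<Sum>i<?n. inner (\<i> *\<^sub>C ?T x i) (?T y i))"
      by (simp add: cinner_eq_inner complex_eq_iff)
    also have "\<dots> = Complex (\<Sum>j<?n. inner (x j) (y j)) (\<Sum>j<?n. inner (\<i> *\<^sub>C x j) (y j))"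
      using real_polar[OF x y] real_polar[of "\<lambda>j. \<i> *\<^sub>C x j" y] x y KD(5) unfolding T_scale by simp
    also have "\<dots> = (\<Sum>j<?n. cinner (x j) (y j))"
      by (simp add: cinner_eq_inner complex_eq_iff)
    finally show ?thesis .
  qed
  have adj: "cinner (\<Phi> a x) y = cinner x (\<Phi> (star G a) y)" if x: "x \<in> K" and y: "y \<in> K" for a x y
  proof (rule fund_induct[of "\<lambda>a. cinner (\<Phi> a x) y = cinner x (\<Phi> (star G a) y)"])
    show "subspace {a. cinner (\<Phi> a x) y = cinner x (\<Phi> (star G a) y)}"
      by (auto simp: subspace_def zero add scale star_zero star_add star_scl cinner_add_left cinner_add_right
          cinner_scaleC_left cinner_scaleC_right)
    fix \<alpha> k j assume \<alpha>: "\<alpha> \<in> Irr G" "k < dim_irr G \<alpha>" "j < dim_irr G \<alpha>"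
    let ?n = "dim_irr G \<alpha>" and ?u = "fund G \<alpha>"
    define x' where "x' = (\<lambda>p. if p = j then x else 0)"
    define y' where "y' = (\<lambda>l. \<Phi> (star G (?u k l)) y)"
    have x'K: "x' p \<in> K" for p using x KD(3) by (simp add: x'_def)
    have y'K: "y' p \<in> K" for p using bndD(1)[OF y] by (simp add: y'_def)
    have Tx: "(\<Sum>p<?n. \<Phi> (?u i p) (x' p)) = \<Phi> (?u i j) x" for i
    proof -
      have "(\<Sum>p<?n. \<Phi> (?u i p) (x' p)) = (\<Sum>p<?n. if p = j then \<Phi> (?u i j) x else 0)"
        using bndD(3)[OF KD(3), of _ 0] by (intro sum.cong refl) (auto simp: x'_def)
      then show ?thesis using \<alpha> by simp
    qed
    have Ty: "(\<Sum>p<?n. \<Phi> (?u i p) (y' p)) = (if i = k then y else 0)" if i: "i < ?n" for i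
    proof -
      have "(\<Sum>p<?n. \<Phi> (?u i p) (y' p)) = \<Phi> (\<Sum>p<?n. ?u i p * star G (?u k p)) y"
        by (simp add: y'_def sum mult[OF y])
      also have "\<dots> = \<Phi> (of_bool (i = k)) y"
        using fund_unitary[OF \<alpha>(1)] i \<alpha> by (simp add: unitary_matrix_def)
      finally show ?thesis using one[OF y] zero by auto
    qed
    have "cinner (\<Phi> (?u k j) x) y = (\<Sum>i<?n. if i = k then cinner (\<Phi> (?u k j) x) y else 0)" using \<alpha> by simp
    also have "\<dots> = (\<Sum>i<?n. cinner (\<Sum>p<?n. \<Phi> (?u i p) (x' p)) (\<Sum>p<?n. \<Phi> (?u i p) (y' p)))"
      by (intro sum.cong refl) (auto simp: Tx Ty)
    also have "\<dots> = (\<Sum>p<?n. cinner (x' p) (y' p))" by (rule polar[OF \<alpha>(1) x'K y'K])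
    also have "\<dots> = (\<Sum>p<?n. if p = j then cinner x (y' j) else 0)"
      by (intro sum.cong refl) (auto simp: x'_def)
    also have "\<dots> = cinner x (\<Phi> (star G (?u k j)) y)" using \<alpha> by (simp add: y'_def)
    finally show "cinner (\<Phi> (?u k j) x) y = cinner x (\<Phi> (star G (?u k j)) y)" .
  qed
  have "star_rep G K \<Phi>"
    unfolding star_rep_def star_linear_map_def using bnd add scale one adj mult by blast
  then show ?thesis using that \<Phi>_fund by blast
qed

end

section \<open>Almost invariant vectors\<close>

context compact_quantum_group
begin

lemma H_tensor_norm_eq:
  assumes \<alpha>: "\<alpha> \<in> Irr G" and md: "modular_data G \<alpha> t s c1 c2"
  defines "n \<equiv> dim_irr G \<alpha>"
  shows "H_tensor_norm G \<alpha> \<zeta> = sqrt (c1 * (\<Sum>l<n. \<Sum>p<n. (norm (\<Sum>r<n. cnj (s r p) *\<^sub>C \<zeta> r l))\<^sup>2))"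
proof -
  have "(\<Sum>r<n. \<Sum>l<n. \<Sum>r'<n. \<Sum>l'<n. haar G (star G (fund G \<alpha> r l) * fund G \<alpha> r' l') * cinner (\<zeta> r l) (\<zeta> r' l')) =
      (\<Sum>r<n. \<Sum>l<n. \<Sum>r'<n. \<Sum>l'<n. (of_real c1 * cogram n s r r' * cinner (\<zeta> r l) (\<zeta> r' l')) * of_bool (l = l'))"
    unfolding haar_eq n_def by (intro sum.cong refl) (simp add: modular_dataD(4)[OF md])
  also have "\<dots> = (\<Sum>r<n. \<Sum>l<n. \<Sum>r'<n. of_real c1 * cogram n s r r' * cinner (\<zeta> r l) (\<zeta> r' l))"
    by (intro sum.cong refl) simp
  also have "\<dots> = (\<Sum>l<n. \<Sum>r<n. \<Sum>r'<n. of_real c1 * cogram n s r r' * cinner (\<zeta> r l) (\<zeta> r' l))"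
    by (rule sum.swap)
  also have "\<dots> = (\<Sum>l<n. of_real c1 * (\<Sum>p<n. cinner (\<Sum>r<n. cnj (s r p) *\<^sub>C \<zeta> r l) (\<Sum>r<n. cnj (s r p) *\<^sub>C \<zeta> r l)))"
  proof (rule sum.cong[OF refl])
    fix l
    have "(\<Sum>p<n. cinner (\<Sum>r<n. cnj (s r p) *\<^sub>C \<zeta> r l) (\<Sum>r<n. cnj (s r p) *\<^sub>C \<zeta> r l)) =
        (\<Sum>p<n. \<Sum>r<n. \<Sum>r'<n. s r p * cnj (s r' p) * cinner (\<zeta> r l) (\<zeta> r' l))"
      unfolding cinner_sum_left unfolding cinner_sum_right
      by (simp add: cinner_scaleC_left cinner_scaleC_right mult_ac)
    also have "\<dots> = (\<Sum>r<n. \<Sum>p<n. \<Sum>r'<n. s r p * cnj (s r' p) * cinner (\<zeta> r l) (\<zeta> r' l))"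
      by (rule sum.swap)
    also have "\<dots> = (\<Sum>r<n. \<Sum>r'<n. \<Sum>p<n. s r p * cnj (s r' p) * cinner (\<zeta> r l) (\<zeta> r' l))"
      by (rule sum.cong[OF refl], rule sum.swap)
    finally show "(\<Sum>r<n. \<Sum>r'<n. of_real c1 * cogram n s r r' * cinner (\<zeta> r l) (\<zeta> r' l)) =
        of_real c1 * (\<Sum>p<n. cinner (\<Sum>r<n. cnj (s r p) *\<^sub>C \<zeta> r l) (\<Sum>r<n. cnj (s r p) *\<^sub>C \<zeta> r l))"
      by (simp add: cogram_def sum_distrib_left sum_distrib_right mult_ac)
  qed
  also have "\<dots> = of_real (c1 * (\<Sum>l<n. \<Sum>p<n. (norm (\<Sum>r<n. cnj (s r p) *\<^sub>C \<zeta> r l))\<^sup>2))"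
    by (simp add: cinner_self_norm sum_distrib_left)
  finally show ?thesis unfolding H_tensor_norm_def n_def by simp
qed

lemma L2_norm_eq:
  assumes \<alpha>: "\<alpha> \<in> Irr G" and md: "modular_data G \<alpha> t s c1 c2"
  defines "n \<equiv> dim_irr G \<alpha>"
  shows "L2_norm G (H_elem G \<alpha> c) = sqrt (c1 * (\<Sum>l<n. \<Sum>p<n. (cmod (\<Sum>r<n. cnj (s r p) * c r l))\<^sup>2))"
proof -
  let ?h = "haar_functional G" and ?u = "fund G \<alpha>"
  interpret h: Vector_Spaces.linear "scl G" "(*)" ?h by (rule haar_functional(1))
  have "haar G (star G (H_elem G \<alpha> c) * H_elem G \<alpha> c) =
      (\<Sum>r<n. \<Sum>l<n. \<Sum>r'<n. \<Sum>l'<n. cnj (c r l) * c r' l' * ?h (star G (?u r l) * ?u r' l'))"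
    unfolding haar_eq H_elem_def n_def star_sum star_scl sum_distrib_right
    unfolding sum_distrib_left
    by (simp add: scl_mult_left[symmetric] scl_mult_right[symmetric] h.sum h.scale mult_ac)
  also have "\<dots> = (\<Sum>r<n. \<Sum>l<n. \<Sum>r'<n. \<Sum>l'<n. (of_real c1 * cogram n s r r' * (cnj (c r l) * c r' l')) * of_bool (l = l'))"
    unfolding n_def by (intro sum.cong refl) (simp add: modular_dataD(4)[OF md])
  also have "\<dots> = (\<Sum>r<n. \<Sum>l<n. \<Sum>r'<n. of_real c1 * cogram n s r r' * (cnj (c r l) * c r' l))"
    by (intro sum.cong refl) simp
  also have "\<dots> = (\<Sum>l<n. \<Sum>r<n. \<Sum>r'<n. of_real c1 * cogram n s r r' * (cnj (c r l) * c r' l))"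
    by (rule sum.swap)
  also have "\<dots> = (\<Sum>l<n. of_real c1 * (\<Sum>p<n. cnj (\<Sum>r<n. cnj (s r p) * c r l) * (\<Sum>r<n. cnj (s r p) * c r l)))"
  proof (rule sum.cong[OF refl])
    fix l
    have "(\<Sum>p<n. cnj (\<Sum>r<n. cnj (s r p) * c r l) * (\<Sum>r<n. cnj (s r p) * c r l)) =
        (\<Sum>p<n. \<Sum>r<n. \<Sum>r'<n. s r p * cnj (s r' p) * (cnj (c r l) * c r' l))"
      unfolding cnj_sum sum_product by (simp add: mult_ac)
    also have "\<dots> = (\<Sum>r<n. \<Sum>p<n. \<Sum>r'<n. s r p * cnj (s r' p) * (cnj (c r l) * c r' l))"
      by (rule sum.swap)
    also have "\<dots> = (\<Sum>r<n. \<Sum>r'<n. \<Sum>p<n. s r p * cnj (s r' p) * (cnj (c r l) * c r' l))"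
      by (rule sum.cong[OF refl], rule sum.swap)
    finally show "(\<Sum>r<n. \<Sum>r'<n. of_real c1 * cogram n s r r' * (cnj (c r l) * c r' l)) =
        of_real c1 * (\<Sum>p<n. cnj (\<Sum>r<n. cnj (s r p) * c r l) * (\<Sum>r<n. cnj (s r p) * c r l))"
      by (simp add: cogram_def sum_distrib_left sum_distrib_right mult_ac)
  qed
  also have "\<dots> = of_real (c1 * (\<Sum>l<n. \<Sum>p<n. (cmod (\<Sum>r<n. cnj (s r p) * c r l))\<^sup>2))"
    unfolding of_real_mult of_real_sum complex_norm_square by (simp add: sum_distrib_left mult.commute)
  finally show ?thesis unfolding L2_norm_def by simp
qed

text \<open>The matrix of inner products of \<open>H\<^sup>\<alpha>\<close> acts on the row index only, while \<open>V\<close> acts on the column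
  index. Hence the modular matrix cancels, and displacement is controlled entrywise.\<close>

lemma displacement_bound:
  assumes \<alpha>: "\<alpha> \<in> Irr G" and \<kappa>: "\<kappa> \<ge> 0"
    and small: "\<And>l j. l < dim_irr G \<alpha> \<Longrightarrow> j < dim_irr G \<alpha> \<Longrightarrow>
      norm (V \<alpha> l j \<xi> - of_bool (l = j) *\<^sub>C \<xi>) \<le> \<kappa> * norm \<xi>"
    and \<delta>: "real (dim_irr G \<alpha>) * \<kappa> < \<delta>" and \<xi>: "\<xi> \<noteq> 0" and c: "H_elem G \<alpha> c \<noteq> 0"
  shows "H_tensor_norm G \<alpha> (displacement G V \<alpha> c \<xi>) < \<delta> * L2_norm G (H_elem G \<alpha> c) * norm \<xi>"
proof -
  let ?n = "dim_irr G \<alpha>"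
  obtain t s c1 c2 where md: "modular_data G \<alpha> t s c1 c2" using modular_data_exists[OF \<alpha>] .
  define c' where "c' = (\<lambda>p j. \<Sum>r<?n. cnj (s r p) * c r j)"
  define w where "w = (\<lambda>l j. V \<alpha> l j \<xi> - of_bool (l = j) *\<^sub>C \<xi>)"
  have disp: "displacement G V \<alpha> c \<xi> r l = (\<Sum>j<?n. c r j *\<^sub>C w l j)" if l: "l < ?n" for r l
  proof -
    have "(\<Sum>j<?n. c r j *\<^sub>C (of_bool (l = j) *\<^sub>C \<xi>)) = (\<Sum>j<?n. if j = l then c r l *\<^sub>C \<xi> else 0)"
      by (intro sum.cong refl) auto
    then show ?thesis
      using l by (simp add: displacement_def w_def ell2.scale_right_diff_distrib sum_subtractf)
  qed
  have trans: "(\<Sum>r<?n. cnj (s r p) *\<^sub>C displacement G V \<alpha> c \<xi> r l) = (\<Sum>j<?n. c' p j *\<^sub>C w l j)" if l: "l < ?n" for p l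
  proof -
    have "(\<Sum>r<?n. cnj (s r p) *\<^sub>C displacement G V \<alpha> c \<xi> r l) = (\<Sum>r<?n. \<Sum>j<?n. (cnj (s r p) * c r j) *\<^sub>C w l j)"
      using l by (simp add: disp ell2.scale_sum_right)
    also have "\<dots> = (\<Sum>j<?n. \<Sum>r<?n. (cnj (s r p) * c r j) *\<^sub>C w l j)" by (rule sum.swap)
    finally show ?thesis by (simp add: c'_def ell2.scale_sum_left)
  qed
  define X where "X = (\<Sum>l<?n. \<Sum>p<?n. (cmod (c' p l))\<^sup>2)"
  have bound: "(norm (\<Sum>j<?n. c' p j *\<^sub>C w l j))\<^sup>2 \<le> real ?n * (\<kappa> * norm \<xi>)\<^sup>2 * (\<Sum>j<?n. (cmod (c' p j))\<^sup>2)"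
    if l: "l < ?n" for p l
  proof -
    have "norm (\<Sum>j<?n. c' p j *\<^sub>C w l j) \<le> (\<Sum>j<?n. cmod (c' p j) * norm (w l j))"
      by (rule order_trans[OF norm_sum]) (simp add: norm_scaleC)
    also have "\<dots> \<le> (\<Sum>j<?n. cmod (c' p j) * (\<kappa> * norm \<xi>))"
      using small[OF l] by (intro sum_mono mult_left_mono) (auto simp: w_def)
    also have "\<dots> = (\<kappa> * norm \<xi>) * (\<Sum>j<?n. cmod (c' p j))"
      by (simp add: sum_distrib_left mult.commute)
    finally have "(norm (\<Sum>j<?n. c' p j *\<^sub>C w l j))\<^sup>2 \<le> ((\<kappa> * norm \<xi>) * (\<Sum>j<?n. cmod (c' p j)))\<^sup>2"
      by (intro power_mono) auto
    also have "\<dots> = (\<kappa> * norm \<xi>)\<^sup>2 * (\<Sum>j<?n. cmod (c' p j))\<^sup>2" by (simp add: power_mult_distrib)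
    also have "\<dots> \<le> (\<kappa> * norm \<xi>)\<^sup>2 * ((\<Sum>j<?n. (cmod (c' p j))\<^sup>2) * real (card {..<?n}))"
      by (intro mult_left_mono sum_squared_le_sum_of_squares) auto
    finally show ?thesis by (simp add: mult_ac)
  qed
  have "(\<Sum>l<?n. \<Sum>p<?n. (norm (\<Sum>j<?n. c' p j *\<^sub>C w l j))\<^sup>2) \<le>
      (\<Sum>l<?n. \<Sum>p<?n. real ?n * (\<kappa> * norm \<xi>)\<^sup>2 * (\<Sum>j<?n. (cmod (c' p j))\<^sup>2))"
    by (intro sum_mono bound) simp
  also have "\<dots> = real ?n * real ?n * (\<kappa> * norm \<xi>)\<^sup>2 * X"
    unfolding X_def by (subst (2) sum.swap) (simp add: sum_distrib_left mult_ac)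
  finally have le: "(\<Sum>l<?n. \<Sum>p<?n. (norm (\<Sum>j<?n. c' p j *\<^sub>C w l j))\<^sup>2) \<le> (real ?n * \<kappa> * norm \<xi>)\<^sup>2 * X"
    by (simp add: power2_eq_square mult_ac)
  have "H_tensor_norm G \<alpha> (displacement G V \<alpha> c \<xi>) = sqrt (c1 * (\<Sum>l<?n. \<Sum>p<?n. (norm (\<Sum>j<?n. c' p j *\<^sub>C w l j))\<^sup>2))"
    unfolding H_tensor_norm_eq[OF \<alpha> md] using trans by simp
  also have "\<dots> \<le> sqrt (c1 * ((real ?n * \<kappa> * norm \<xi>)\<^sup>2 * X))"
    using le modular_dataD(2)[OF md] by (intro real_sqrt_le_mono mult_left_mono) auto
  also have "\<dots> = real ?n * \<kappa> * norm \<xi> * sqrt (c1 * X)"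
    using \<kappa> by (simp add: real_sqrt_mult)
  also have "sqrt (c1 * X) = L2_norm G (H_elem G \<alpha> c)"
    unfolding L2_norm_eq[OF \<alpha> md] X_def c'_def ..
  finally have H_le: "H_tensor_norm G \<alpha> (displacement G V \<alpha> c \<xi>) \<le> real ?n * \<kappa> * norm \<xi> * L2_norm G (H_elem G \<alpha> c)" .
  have "X > 0"
  proof (rule ccontr)
    assume "\<not> X > 0"
    moreover have "X \<ge> 0" unfolding X_def by (intro sum_nonneg) auto
    ultimately have "X = 0" by simp
    then have zero: "c' p l = 0" if "p < ?n" "l < ?n" for p l
      using that unfolding X_def by (simp add: sum_nonneg_eq_0_iff sum_nonneg)
    have "c k l = 0" if k: "k < ?n" "l < ?n" for k l
    proof -
      have "0 = (\<Sum>p<?n. cnj (t p k) * c' p l)" using zero k by simp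
      also have "\<dots> = (\<Sum>p<?n. \<Sum>r<?n. cnj (s r p * t p k) * c r l)"
        by (simp add: c'_def sum_distrib_left mult_ac)
      also have "\<dots> = (\<Sum>r<?n. cnj (\<Sum>p<?n. s r p * t p k) * c r l)"
        by (subst sum.swap) (simp add: sum_distrib_right)
      also have "\<dots> = (\<Sum>r<?n. of_bool (r = k) * c r l)"
        using modular_dataD(1)[OF md] k unfolding inverse_matrices_def by (intro sum.cong refl) auto
      finally show ?thesis using k by simp
    qed
    then have "H_elem G \<alpha> c = 0" unfolding H_elem_def by (intro sum.neutral ballI) auto
    with c show False by simp
  qed
  then have "L2_norm G (H_elem G \<alpha> c) > 0"
    unfolding L2_norm_eq[OF \<alpha> md] using modular_dataD(2)[OF md] by (simp add: X_def c'_def)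
  then have "real ?n * \<kappa> * (L2_norm G (H_elem G \<alpha> c) * norm \<xi>) < \<delta> * (L2_norm G (H_elem G \<alpha> c) * norm \<xi>)"
    using \<delta> \<xi> by (intro mult_strict_right_mono) auto
  with H_le show ?thesis by (simp add: mult_ac)
qed

text \<open>Test the definition on \<open>u\<^sub>0\<^sub>j\<close>. The displacement has components in row 0 only, so that the weight of
  this row occurs on both sides of the estimate and cancels.\<close>
lemma almost_invariant_entries:
  assumes \<alpha>: "\<alpha> \<in> Irr G" "\<alpha> \<in> E" and inv: "almost_invariant G V E \<delta> \<xi>"
    and lj: "l < dim_irr G \<alpha>" "j < dim_irr G \<alpha>"
  shows "norm (V \<alpha> l j \<xi> - of_bool (l = j) *\<^sub>C \<xi>) < \<delta> * norm \<xi>"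
proof -
  let ?n = "dim_irr G \<alpha>"
  obtain t s c1 c2 where md: "modular_data G \<alpha> t s c1 c2" using modular_data_exists[OF \<alpha>(1)] .
  have n: "0 < ?n" using dim_irr_pos[OF \<alpha>(1)] .
  define c where "c = (\<lambda>r q. of_bool (r = (0::nat) \<and> q = j) :: complex)"
  define w where "w = (\<lambda>l. V \<alpha> l j \<xi> - of_bool (l = j) *\<^sub>C \<xi>)"
  define q where "q = (\<Sum>p<?n. (cmod (s 0 p))\<^sup>2)"
  have elem: "H_elem G \<alpha> c = fund G \<alpha> 0 j"
  proof -
    have "H_elem G \<alpha> c = (\<Sum>r<?n. \<Sum>l<?n. if r = 0 then (if l = j then fund G \<alpha> 0 j else 0) else 0)"
      unfolding H_elem_def by (intro sum.cong refl) (auto simp: c_def)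
    also have "\<dots> = (\<Sum>r<?n. if r = 0 then fund G \<alpha> 0 j else 0)"
      using lj by (intro sum.cong refl) auto
    finally show ?thesis using n by simp
  qed
  have "fund G \<alpha> 0 j \<noteq> 0"
  proof
    assume "fund G \<alpha> 0 j = 0"
    then have "(\<Sum>r\<in>{(\<alpha>, 0, j)}. scl G 1 (fund_entry G r)) = 0" by (simp add: fund_entry_def)
    from fund_entries_independent[OF _ _ this, of "(\<alpha>, 0, j)"] \<alpha> n lj show False
      by (simp add: irr_indices_def)
  qed
  then have ineq: "H_tensor_norm G \<alpha> (displacement G V \<alpha> c \<xi>) < \<delta> * L2_norm G (H_elem G \<alpha> c) * norm \<xi>"
    using inv \<alpha> elem unfolding almost_invariant_def by metis
  have disp: "displacement G V \<alpha> c \<xi> r k = (if r = 0 then w k else 0)" for r k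
  proof -
    have "(\<Sum>q<?n. c r q *\<^sub>C V \<alpha> k q \<xi>) = (\<Sum>q<?n. if q = j then of_bool (r = 0) *\<^sub>C V \<alpha> k j \<xi> else 0)"
      by (intro sum.cong refl) (auto simp: c_def)
    also have "\<dots> = of_bool (r = 0) *\<^sub>C V \<alpha> k j \<xi>" using lj by simp
    finally show ?thesis by (auto simp: displacement_def w_def c_def)
  qed
  have "(\<Sum>r<?n. cnj (s r p) *\<^sub>C displacement G V \<alpha> c \<xi> r k) = cnj (s 0 p) *\<^sub>C w k" for p k
  proof -
    have "(\<Sum>r<?n. cnj (s r p) *\<^sub>C displacement G V \<alpha> c \<xi> r k) = (\<Sum>r<?n. if r = 0 then cnj (s 0 p) *\<^sub>C w k else 0)"
      by (intro sum.cong refl) (auto simp: disp)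
    then show ?thesis using n by simp
  qed
  then have H: "H_tensor_norm G \<alpha> (displacement G V \<alpha> c \<xi>) = sqrt (c1 * (\<Sum>k<?n. (norm (w k))\<^sup>2 * q))"
    unfolding H_tensor_norm_eq[OF \<alpha>(1) md] by (simp add: norm_scaleC power_mult_distrib q_def sum_distrib_left mult.commute)
  have "(\<Sum>r<?n. cnj (s r p) * c r k) = of_bool (k = j) * cnj (s 0 p)" for p k
  proof -
    have "(\<Sum>r<?n. cnj (s r p) * c r k) = (\<Sum>r<?n. if r = 0 then of_bool (k = j) * cnj (s 0 p) else 0)"
      by (intro sum.cong refl) (auto simp: c_def)
    then show ?thesis using n by simp
  qed
  then have "(\<Sum>k<?n. \<Sum>p<?n. (cmod (\<Sum>r<?n. cnj (s r p) * c r k))\<^sup>2) = (\<Sum>k<?n. if k = j then q else 0)"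
    by (intro sum.cong refl) (auto simp: q_def)
  then have L: "L2_norm G (H_elem G \<alpha> c) = sqrt (c1 * q)"
    unfolding L2_norm_eq[OF \<alpha>(1) md] using lj by simp
  have q0: "q \<ge> 0" by (simp add: q_def sum_nonneg)
  have c1: "c1 > 0" by (rule modular_dataD(2)[OF md])
  have "(norm (w l))\<^sup>2 \<le> (\<Sum>k<?n. (norm (w k))\<^sup>2)" using lj by (intro member_le_sum) auto
  then have "c1 * ((norm (w l))\<^sup>2 * q) \<le> c1 * (\<Sum>k<?n. (norm (w k))\<^sup>2 * q)"
    unfolding sum_distrib_right[symmetric] using c1 q0 by (intro mult_left_mono mult_right_mono) auto
  then have "sqrt (c1 * q * (norm (w l))\<^sup>2) \<le> H_tensor_norm G \<alpha> (displacement G V \<alpha> c \<xi>)"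
    unfolding H by (intro real_sqrt_le_mono) (simp add: mult_ac)
  then have "sqrt (c1 * q) * norm (w l) < sqrt (c1 * q) * (\<delta> * norm \<xi>)"
    using ineq unfolding L real_sqrt_mult by (simp add: mult_ac)
  then show ?thesis
    using c1 q0 by (auto simp: w_def mult_less_cancel_left)
qed

lemma invariant_vector_iff:
  "invariant_vector G V \<xi> \<longleftrightarrow> (\<forall>\<alpha>\<in>Irr G. \<forall>l<dim_irr G \<alpha>. \<forall>j<dim_irr G \<alpha>. V \<alpha> l j \<xi> = of_bool (l = j) *\<^sub>C \<xi>)"
proof
  assume inv: "invariant_vector G V \<xi>"
  show "\<forall>\<alpha>\<in>Irr G. \<forall>l<dim_irr G \<alpha>. \<forall>j<dim_irr G \<alpha>. V \<alpha> l j \<xi> = of_bool (l = j) *\<^sub>C \<xi>"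
  proof (intro ballI allI impI)
    fix \<alpha> l j assume *: "\<alpha> \<in> Irr G" "l < dim_irr G \<alpha>" "j < dim_irr G \<alpha>"
    have "displacement G V \<alpha> (\<lambda>r q. of_bool (q = j)) \<xi> 0 l = 0"
      using inv * dim_irr_pos[OF *(1)] unfolding invariant_vector_def by blast
    moreover have "(\<Sum>q<dim_irr G \<alpha>. of_bool (q = j) *\<^sub>C V \<alpha> l q \<xi>) = (\<Sum>q<dim_irr G \<alpha>. if q = j then V \<alpha> l j \<xi> else 0)"
      by (intro sum.cong refl) auto
    ultimately show "V \<alpha> l j \<xi> = of_bool (l = j) *\<^sub>C \<xi>" using * by (simp add: displacement_def)
  qed
next
  assume inv: "\<forall>\<alpha>\<in>Irr G. \<forall>l<dim_irr G \<alpha>. \<forall>j<dim_irr G \<alpha>. V \<alpha> l j \<xi> = of_bool (l = j) *\<^sub>C \<xi>"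
  show "invariant_vector G V \<xi>"
    unfolding invariant_vector_def
  proof (intro ballI allI impI)
    fix \<alpha> c r l assume *: "\<alpha> \<in> Irr G" "r < dim_irr G \<alpha>" "l < dim_irr G \<alpha>"
    have "(\<Sum>j<dim_irr G \<alpha>. c r j *\<^sub>C V \<alpha> l j \<xi>) = (\<Sum>j<dim_irr G \<alpha>. if j = l then c r l *\<^sub>C \<xi> else 0)"
      using inv * by (intro sum.cong refl) auto
    then show "displacement G V \<alpha> c \<xi> r l = 0" using * by (simp add: displacement_def)
  qed
qed

end

section \<open>Sequences of representations\<close>

locale cqg_envelope = compact_quantum_group G + universal_envelope G A \<iota>
  for G :: "('a::ring_1, 'i, 'm) cqg_scheme"
    and A :: "('c::{real_normed_algebra_1, banach}, 'l) star_alg_scheme"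
    and \<iota> :: "'a \<Rightarrow> 'c"

context cqg_envelope
begin

lemma counit_sum:
  assumes slm: "star_linear_map G K \<Phi>" and x: "x \<in> K"
    and fund: "\<And>\<alpha> i j. \<alpha> \<in> Irr G \<Longrightarrow> i < dim_irr G \<alpha> \<Longrightarrow> j < dim_irr G \<alpha> \<Longrightarrow> \<Phi> (fund G \<alpha> i j) x = of_bool (i = j) *\<^sub>C x"
  shows "\<Phi> a x = counit G a *\<^sub>C x"
proof (rule linear_eq_on_fund[OF star_linear_map_linear[OF slm x]])
  interpret \<epsilon>: Vector_Spaces.linear "scl G" "(*)" "counit G" by (rule counit_linear)
  show "Vector_Spaces.linear (scl G) (*\<^sub>C) (\<lambda>a. counit G a *\<^sub>C x)"
    by (rule linear_intro[OF ell2.vector_space_axioms]) (simp_all add: \<epsilon>.add \<epsilon>.scale ell2.scale_left_distrib)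
qed (simp add: fund counit_corep[OF fund_corep])

text \<open>Property (T) applied to the Hilbert sum of a sequence of representations: vectors that become
  asymptotically invariant along the sequence force an invariant vector in one of its members.\<close>

theorem property_T_sequences:
  assumes T: "dual_property_T G"
    and K: "\<And>n. hilbert_subspace (K n)" and \<Phi>: "\<And>n. star_rep G (K n) (\<Phi> n)"
    and \<xi>: "\<And>n. \<xi> n \<in> K n" "\<And>n. norm (\<xi> n) = 1"
    and lim: "\<And>\<alpha> i j. \<alpha> \<in> Irr G \<Longrightarrow> i < dim_irr G \<alpha> \<Longrightarrow> j < dim_irr G \<alpha> \<Longrightarrow>
      (\<lambda>n::nat. norm (\<Phi> n (fund G \<alpha> i j) (\<xi> n) - of_bool (i = j) *\<^sub>C \<xi> n)) \<longlonglongrightarrow> 0"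
  shows "\<exists>n. \<exists>\<zeta>\<in>K n. \<zeta> \<noteq> 0 \<and> (\<forall>a. \<Phi> n a \<zeta> = counit G a *\<^sub>C \<zeta>)"
proof -
  obtain D where D: "star_rep G (direct_sum K) D"
    and comp: "\<And>a x n. x \<in> direct_sum K \<Longrightarrow> ell2_component n (D a x) = \<Phi> n a (ell2_component n x)"
    using star_rep_direct_sum[where K = K and \<Phi> = \<Phi>, OF K \<Phi>] by blast
  have slm: "star_linear_map G (K n) (\<Phi> n)" for n using \<Phi>[of n] by (simp add: star_rep_def)
  have zero: "\<Phi> n a 0 = 0" for n a
    using bounded_opD(3)[OF star_linear_mapD(1)[OF slm] hilbert_subspaceD(3)[OF K], of n a 0] by simp
  define V where "V = (\<lambda>\<alpha> i j. D (fund G \<alpha> i j))"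
  have corep: "dual_corep G (direct_sum K) V"
    unfolding V_def by (rule star_rep_dual_corep[OF hilbert_subspace_direct_sum[OF K] D])
  have single_in: "ell2_single n x \<in> direct_sum K" if "x \<in> K n" for n x
    using that hilbert_subspaceD(3)[OF K] by (simp add: direct_sum_def component_single)
  have D_single: "D a (ell2_single n x) = ell2_single n (\<Phi> n a x)" if "x \<in> K n" for a n x
    by (rule component_eqI) (simp add: comp single_in[OF that] component_single zero)
  have "has_almost_invariant_vectors G (direct_sum K) V"
    unfolding has_almost_invariant_vectors_def
  proof (intro allI impI)
    fix E \<delta> assume "finite E \<and> E \<subseteq> Irr G \<and> \<delta> > (0::real)"
    then have E: "finite E" "E \<subseteq> Irr G" and \<delta>: "\<delta> > 0" by auto
    define N where "N = (\<Sum>\<alpha>\<in>E. real (dim_irr G \<alpha>))"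
    have N: "N \<ge> 0" by (simp add: N_def sum_nonneg)
    define \<kappa> where "\<kappa> = \<delta> / (N + 1)"
    have \<kappa>: "\<kappa> > 0" using \<delta> N by (simp add: \<kappa>_def)
    have N\<kappa>: "real (dim_irr G \<alpha>) * \<kappa> < \<delta>" if "\<alpha> \<in> E" for \<alpha>
    proof -
      have "real (dim_irr G \<alpha>) \<le> N" unfolding N_def using that E by (intro member_le_sum) auto
      then have "real (dim_irr G \<alpha>) * \<kappa> \<le> N * \<kappa>" using \<kappa> by (intro mult_right_mono) auto
      also have "\<dots> < (N + 1) * \<kappa>" using \<kappa> by simp
      also have "\<dots> = \<delta>" using N by (simp add: \<kappa>_def)
      finally show ?thesis .
    qed
    have "\<forall>\<^sub>F n in sequentially. \<forall>\<alpha>\<in>E. \<forall>i\<in>{..<dim_irr G \<alpha>}. \<forall>j\<in>{..<dim_irr G \<alpha>}.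
        norm (\<Phi> n (fund G \<alpha> i j) (\<xi> n) - of_bool (i = j) *\<^sub>C \<xi> n) < \<kappa>"
      using E \<kappa> by (intro eventually_ball_finite ballI order_tendstoD(2)[OF lim]) auto
    then obtain n where n: "\<And>\<alpha> i j. \<alpha> \<in> E \<Longrightarrow> i < dim_irr G \<alpha> \<Longrightarrow> j < dim_irr G \<alpha> \<Longrightarrow>
        norm (\<Phi> n (fund G \<alpha> i j) (\<xi> n) - of_bool (i = j) *\<^sub>C \<xi> n) < \<kappa>"
      by (force simp: eventually_sequentially)
    let ?x = "ell2_single n (\<xi> n)"
    have x: "norm ?x = 1" using \<xi>(2) by (simp add: norm_single)
    have "almost_invariant G V E \<delta> ?x"
      unfolding almost_invariant_def
    proof (intro ballI allI impI)
      fix \<alpha> c assume \<alpha>: "\<alpha> \<in> E" and c: "H_elem G \<alpha> c \<noteq> 0"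
      show "H_tensor_norm G \<alpha> (displacement G V \<alpha> c ?x) < \<delta> * L2_norm G (H_elem G \<alpha> c) * norm ?x"
      proof (rule displacement_bound[where \<kappa> = \<kappa>])
        fix l j assume lj: "l < dim_irr G \<alpha>" "j < dim_irr G \<alpha>"
        have "V \<alpha> l j ?x - of_bool (l = j) *\<^sub>C ?x = ell2_single n (\<Phi> n (fund G \<alpha> l j) (\<xi> n) - of_bool (l = j) *\<^sub>C \<xi> n)"
          unfolding V_def D_single[OF \<xi>(1)] single_scaleC single_diff ..
        then show "norm (V \<alpha> l j ?x - of_bool (l = j) *\<^sub>C ?x) \<le> \<kappa> * norm ?x"
          using n[OF \<alpha> lj] x by (simp add: norm_single)
      qed (use \<alpha> E c \<kappa> N\<kappa> x in auto)
    qed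
    then show "\<exists>x\<in>direct_sum K. almost_invariant G V E \<delta> x" using single_in[OF \<xi>(1)] by blast
  qed
  with T corep obtain x where x: "x \<in> direct_sum K" "x \<noteq> 0" and inv: "invariant_vector G V x"
    unfolding dual_property_T_def by blast
  obtain n where n: "ell2_component n x \<noteq> 0"
  proof -
    have "\<not> (\<forall>n. ell2_component n x = ell2_component n 0)" using component_eqI x(2) by blast
    then show ?thesis using that by (auto simp: component_simps)
  qed
  let ?\<zeta> = "ell2_component n x"
  have \<zeta>: "?\<zeta> \<in> K n" using x(1) by (simp add: direct_sum_def)
  have "\<Phi> n a ?\<zeta> = counit G a *\<^sub>C ?\<zeta>" for a
  proof (rule counit_sum[OF slm \<zeta>])
    fix \<alpha> i j assume "\<alpha> \<in> Irr G" "i < dim_irr G \<alpha>" "j < dim_irr G \<alpha>"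
    then have "D (fund G \<alpha> i j) x = of_bool (i = j) *\<^sub>C x"
      using inv unfolding invariant_vector_iff V_def by blast
    from arg_cong[OF this, of "ell2_component n"]
    show "\<Phi> n (fund G \<alpha> i j) ?\<zeta> = of_bool (i = j) *\<^sub>C ?\<zeta>"
      by (simp only: comp[OF x(1)] component_simps)
  qed
  with \<zeta> n show ?thesis by blast
qed

lemma unit_vector_exists: "\<exists>e :: ell2. norm e = 1"
proof -
  define x where "x = Abs_ell2 (\<lambda>k. of_bool (k = (0::nat)))"
  have "(\<lambda>k. (cmod (of_bool (k = (0::nat))))\<^sup>2) sums (\<Sum>k\<in>{0::nat}. (cmod (of_bool (k = (0::nat))))\<^sup>2)"
    by (rule sums_finite) auto
  then have "coord x 0 = 1" by (simp add: x_def Abs_ell2_inverse sums_iff)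
  then have "x \<noteq> 0" by auto
  then show ?thesis by (intro exI[of _ "sgn x"]) (simp add: norm_sgn)
qed

lemma hilbert_subspace_UNIV: "hilbert_subspace UNIV"
  by (simp add: hilbert_subspace_def ell2.subspace_UNIV)

lemma character_star_rep:
  assumes \<psi>: "character G \<psi>" and star: "\<And>a. \<psi> (star G a) = cnj (\<psi> a)"
  shows "star_rep G UNIV (\<lambda>a x. \<psi> a *\<^sub>C x)"
proof -
  interpret \<psi>: Vector_Spaces.linear "scl G" "(*)" \<psi> using \<psi> by (simp add: character_def)
  have "bounded_op UNIV (\<lambda>x. \<psi> a *\<^sub>C x)" for a
    by (auto simp: bounded_op_def ell2.scale_right_distrib norm_scaleC mult.commute intro!: exI[of _ "cmod (\<psi> a)"])
  then show ?thesis
    using \<psi> by (auto simp: star_rep_def star_linear_map_def \<psi>.add \<psi>.scale ell2.scale_left_distrib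
        cinner_scaleC_left cinner_scaleC_right star character_def)
qed

text \<open>A discrete quantum group with property (T) is unimodular: distinct characters close to the
  counit would form almost invariant, but not invariant, one-dimensional pieces.\<close>

theorem property_T_kac:
  assumes T: "dual_property_T G" and \<alpha>: "\<alpha> \<in> Irr G"
  shows "unitary_matrix G (dim_irr G \<alpha>) (\<lambda>i j. star G (fund G \<alpha> i j))"
proof (rule kac_criterion[OF _ \<alpha>])
  fix \<psi> :: "nat \<Rightarrow> 'a \<Rightarrow> complex"
  assume \<psi>: "\<And>n. character G (\<psi> n)" "\<And>n a. \<psi> n (star G a) = cnj (\<psi> n a)"
    and lim: "\<And>\<alpha> i j. \<alpha> \<in> Irr G \<Longrightarrow> i < dim_irr G \<alpha> \<Longrightarrow> j < dim_irr G \<alpha> \<Longrightarrow>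
        (\<lambda>n. \<psi> n (fund G \<alpha> i j)) \<longlonglongrightarrow> of_bool (i = j)"
  obtain e :: ell2 where e: "norm e = 1" using unit_vector_exists by blast
  have "\<exists>n. \<exists>\<zeta>\<in>UNIV. \<zeta> \<noteq> 0 \<and> (\<forall>a. \<psi> n a *\<^sub>C \<zeta> = counit G a *\<^sub>C \<zeta>)"
  proof (rule property_T_sequences[OF T, where \<xi> = "\<lambda>_. e"])
    fix \<alpha> i j assume *: "\<alpha> \<in> Irr G" "i < dim_irr G \<alpha>" "j < dim_irr G \<alpha>"
    have "norm (\<psi> n (fund G \<alpha> i j) *\<^sub>C e - of_bool (i = j) *\<^sub>C e) = norm (\<psi> n (fund G \<alpha> i j) - of_bool (i = j))" for n
      using norm_scaleC[of "\<psi> n (fund G \<alpha> i j) - of_bool (i = j)" e] e by (simp add: ell2.scale_left_diff_distrib)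
    moreover have "(\<lambda>n. norm (\<psi> n (fund G \<alpha> i j) - of_bool (i = j))) \<longlonglongrightarrow> 0"
      using tendsto_norm_zero[OF LIM_zero[OF lim[OF *]]] .
    ultimately show "(\<lambda>n. norm (\<psi> n (fund G \<alpha> i j) *\<^sub>C e - of_bool (i = j) *\<^sub>C e)) \<longlonglongrightarrow> 0" by simp
  qed (use e character_star_rep[OF \<psi>] hilbert_subspace_UNIV in auto)
  then show "\<exists>n. \<forall>a. \<psi> n a = counit G a" by (auto simp: ell2.scale_right_imp_eq)
qed

section \<open>The adjoint representation of a bimodule\<close>

lemma antipode_fund:
  "\<alpha> \<in> Irr G \<Longrightarrow> i < dim_irr G \<alpha> \<Longrightarrow> j < dim_irr G \<alpha> \<Longrightarrow> antipode G (fund G \<alpha> i j) = star G (fund G \<alpha> j i)"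
  by (rule antipode_unitary[OF fund_corep fund_unitary])

lemma antipode_one: "antipode G 1 = 1"
  using antipode_fund[OF trivial_irr(1), of 0 0] trivial_irr by (simp add: star_one)

text \<open>Matrix elements of products of unitary corepresentations have an explicit right inverse matrix.\<close>
lemma antipode_mult: "antipode G (a * b) = antipode G b * antipode G a"
proof -
  interpret S: Vector_Spaces.linear "scl G" "scl G" "antipode G" by (rule antipode_linear)
  have fund: "antipode G (fund G \<alpha> i j * fund G \<beta> k l) = antipode G (fund G \<beta> k l) * antipode G (fund G \<alpha> i j)"
    if \<alpha>: "\<alpha> \<in> Irr G" "i < dim_irr G \<alpha>" "j < dim_irr G \<alpha>" and \<beta>: "\<beta> \<in> Irr G" "k < dim_irr G \<beta>" "l < dim_irr G \<beta>"
    for \<alpha> \<beta> i j k l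
  proof -
    let ?n = "dim_irr G \<alpha>" and ?m = "dim_irr G \<beta>" and ?u = "fund G \<alpha>" and ?v = "fund G \<beta>"
    let ?I = "{..<?n} \<times> {..<?m}"
    let ?z = "\<lambda>p q. ?u (fst p) (fst q) * ?v (snd p) (snd q)"
    let ?y = "\<lambda>p q. star G (?v (snd q) (snd p)) * star G (?u (fst q) (fst p))"
    have "antipode G (?z (i, k) (j, l)) = ?y (i, k) (j, l)"
    proof (rule antipode_inverse[where I = ?I and z = ?z and y = ?y])
      fix B :: "'a \<Rightarrow> 'a \<Rightarrow> 'a" and p q assume B: "bilinear_map G (scl G) B" and pq: "p \<in> ?I" "q \<in> ?I"
      show "comult_map G B (?z p q) = (\<Sum>r\<in>?I. B (?z p r) (?z r q))"
        using pq comult_map_product[OF B fund_corep[OF \<alpha>(1)] _ _ fund_corep[OF \<beta>(1)], of "fst p" "fst q" "snd p" "snd q"]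
        by (auto simp: sum.cartesian_product case_prod_unfold)
    next
      fix p q assume pq: "p \<in> ?I" "q \<in> ?I"
      show "counit G (?z p q) = of_bool (p = q)"
        using pq by (auto simp: counit_mult counit_corep[OF fund_corep[OF \<alpha>(1)]] counit_corep[OF fund_corep[OF \<beta>(1)]])
      have "(\<Sum>r\<in>?I. ?z p r * ?y r q) = (\<Sum>a<?n. \<Sum>b<?m. ?u (fst p) a * (?v (snd p) b * star G (?v (snd q) b)) * star G (?u (fst q) a))"
        by (simp add: sum.cartesian_product case_prod_unfold mult.assoc)
      also have "\<dots> = (\<Sum>a<?n. ?u (fst p) a * (\<Sum>b<?m. ?v (snd p) b * star G (?v (snd q) b)) * star G (?u (fst q) a))"
        by (simp add: sum_distrib_left sum_distrib_right)
      also have "\<dots> = (\<Sum>a<?n. ?u (fst p) a * of_bool (snd p = snd q) * star G (?u (fst q) a))"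
        using pq fund_unitary[OF \<beta>(1)] by (intro sum.cong refl) (auto simp: unitary_matrix_def)
      also have "\<dots> = (if snd p = snd q then (\<Sum>a<?n. ?u (fst p) a * star G (?u (fst q) a)) else 0)"
        by simp
      also have "\<dots> = of_bool (p = q)"
        using pq fund_unitary[OF \<alpha>(1)] by (auto simp: unitary_matrix_def prod_eq_iff)
      finally show "(\<Sum>r\<in>?I. ?z p r * ?y r q) = of_bool (p = q)" .
    qed (use \<alpha> \<beta> in auto)
    then show ?thesis using \<alpha> \<beta> by (simp add: antipode_fund)
  qed
  show ?thesis
  proof (rule fund_induct[of "\<lambda>a. antipode G (a * b) = antipode G b * antipode G a"])
    show "subspace {a. antipode G (a * b) = antipode G b * antipode G a}"
      by (auto simp: subspace_def S.zero S.add S.scale distrib_left distrib_right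
          scl_mult_left[symmetric] scl_mult_right[symmetric])
    fix \<alpha> i j assume \<alpha>: "\<alpha> \<in> Irr G" "i < dim_irr G \<alpha>" "j < dim_irr G \<alpha>"
    show "antipode G (fund G \<alpha> i j * b) = antipode G b * antipode G (fund G \<alpha> i j)"
    proof (rule fund_induct[of "\<lambda>b. antipode G (fund G \<alpha> i j * b) = antipode G b * antipode G (fund G \<alpha> i j)"])
      show "subspace {b. antipode G (fund G \<alpha> i j * b) = antipode G b * antipode G (fund G \<alpha> i j)}"
        by (auto simp: subspace_def S.zero S.add S.scale distrib_left distrib_right
            scl_mult_left[symmetric] scl_mult_right[symmetric])
    qed (use fund \<alpha> in blast)
  qed
qed

text \<open>In the unimodular case the conjugate of \<open>u\<^sup>\<alpha>\<close> is unitary, which determines the antipode on its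
  entries as well.\<close>
lemma antipode_star:
  assumes kac: "\<And>\<alpha>. \<alpha> \<in> Irr G \<Longrightarrow> unitary_matrix G (dim_irr G \<alpha>) (\<lambda>i j. star G (fund G \<alpha> i j))"
  shows "antipode G (star G a) = star G (antipode G a)"
proof (rule fund_induct[of "\<lambda>a. antipode G (star G a) = star G (antipode G a)"])
  interpret S: Vector_Spaces.linear "scl G" "scl G" "antipode G" by (rule antipode_linear)
  show "subspace {a. antipode G (star G a) = star G (antipode G a)}"
    by (auto simp: subspace_def S.zero S.add S.scale star_zero star_add star_scl)
  fix \<alpha> i j assume \<alpha>: "\<alpha> \<in> Irr G" "i < dim_irr G \<alpha>" "j < dim_irr G \<alpha>"
  show "antipode G (star G (fund G \<alpha> i j)) = star G (antipode G (fund G \<alpha> i j))"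
    using antipode_unitary[OF conjugate_corep[OF fund_corep[OF \<alpha>(1)]] kac[OF \<alpha>(1)] \<alpha>(2,3)] \<alpha>
    by (simp add: antipode_fund star_star)
qed

lemma bounded_op_sum_list:
  assumes K: "hilbert_subspace K" and T: "\<And>p. bounded_op K (T p)"
  shows "bounded_op K (\<lambda>x. \<Sum>p\<leftarrow>ps. T p x)"
proof (induction ps)
  case Nil
  then show ?case using bounded_op_zero[OF K] by simp
next
  case (Cons p ps)
  then show ?case using bounded_op_add[OF T _ K, of "\<lambda>x. \<Sum>p\<leftarrow>ps. T p x" p] by simp
qed

lemma bounded_op_of_sum_list:
  assumes K: "hilbert_subspace K" and T: "bounded_op K T" and f: "\<And>p. f p \<in> K"
  shows "T (\<Sum>p\<leftarrow>ps. f p) = (\<Sum>p\<leftarrow>ps. T (f p))"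
proof (induction ps)
  case Nil
  then show ?case using bounded_opD(3)[OF T hilbert_subspaceD(3)[OF K], of 0] by simp
next
  case (Cons p ps)
  have "(\<Sum>p\<leftarrow>ps. f p) \<in> K"
    by (induction ps) (auto intro: hilbert_subspaceD(3,4)[OF K] f)
  then show ?case using Cons bounded_opD(2)[OF T f] by simp
qed

lemma cinner_sum_list: "cinner (\<Sum>p\<leftarrow>ps. f p) y = (\<Sum>p\<leftarrow>ps. cinner (f p) y)"
  "cinner y (\<Sum>p\<leftarrow>ps. f p) = (\<Sum>p\<leftarrow>ps. cinner y (f p))"
  by (induction ps) (auto simp: cinner_add_left cinner_add_right)

lemma dense_equal:
  assumes f: "continuous_on UNIV f" and g: "continuous_on UNIV g" and eq: "\<And>a. f (\<iota> a) = g (\<iota> a)"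
  shows "f c = (g c :: 'x::t2_space)"
proof -
  obtain s where s: "(\<lambda>n::nat. \<iota> (s n)) \<longlonglongrightarrow> c" using embed_approx by blast
  have "(\<lambda>n. f (\<iota> (s n))) \<longlonglongrightarrow> f c" "(\<lambda>n. g (\<iota> (s n))) \<longlonglongrightarrow> g c"
    using f g s by (auto intro: continuous_on_tendsto_compose)
  then show ?thesis using LIMSEQ_unique eq by auto
qed

lemma continuous_rep:
  assumes \<pi>: "star_linear_map A K \<pi>" and x: "x \<in> K" and bound: "\<And>a. norm (\<pi> a x) \<le> norm a * norm x"
  shows "continuous_on UNIV (\<lambda>a. \<pi> a x)"
proof -
  interpret l: Vector_Spaces.linear "scl A" "(*\<^sub>C)" "\<lambda>a. \<pi> a x" by (rule env.star_linear_map_linear[OF \<pi> x])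
  have "\<pi> (r *\<^sub>R a) x = r *\<^sub>R \<pi> a x" for r a
    unfolding env.scl_of_real[symmetric] by (simp add: l.scale scaleR_ell2_def)
  then have "bounded_linear (\<lambda>a. \<pi> a x)"
    using bound by (auto intro!: bounded_linear_intro[where K = "norm x"] simp: l.add)
  then show ?thesis by (rule linear_continuous_on)
qed

text \<open>The action \<open>x \<mapsto> a\<^sub>1 x S(a\<^sub>2)\<close> of the polynomial algebra on a bimodule.\<close>
definition adjoint_rep :: "('c \<Rightarrow> ell2 \<Rightarrow> ell2) \<Rightarrow> ('c \<Rightarrow> ell2 \<Rightarrow> ell2) \<Rightarrow> 'a \<Rightarrow> ell2 \<Rightarrow> ell2"
  where "adjoint_rep L R a x = comult_map G (\<lambda>y z. L (\<iota> y) (R (\<iota> (antipode G z)) x)) a"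

context
  fixes K :: "ell2 set" and L R :: "'c \<Rightarrow> ell2 \<Rightarrow> ell2"
  assumes bimodule: "hilbert_bimodule A K L R"
begin

lemma bimodule_facts:
  shows K: "hilbert_subspace K" and L_slm: "star_linear_map A K L" and R_slm: "star_linear_map A K R"
    and L_rep: "star_rep A K L" and R_rep: "op_star_rep A K R"
    and L_mult: "\<And>a b x. x \<in> K \<Longrightarrow> L (a * b) x = L a (L b x)" and R_mult: "\<And>a b x. x \<in> K \<Longrightarrow> R (a * b) x = R b (R a x)"
    and LR: "\<And>a b x. x \<in> K \<Longrightarrow> L a (R b x) = R b (L a x)"
  using bimodule by (auto simp: hilbert_bimodule_def star_rep_def op_star_rep_def)

lemmas LD = star_linear_mapD[OF L_slm]
lemmas RD = star_linear_mapD[OF R_slm]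

lemma adjoint_bilinear:
  assumes x: "x \<in> K"
  shows "bilinear_map G (*\<^sub>C) (\<lambda>y z. L (\<iota> y) (R (\<iota> (antipode G z)) x))"
proof -
  interpret S: Vector_Spaces.linear "scl G" "scl G" "antipode G" by (rule antipode_linear)
  show ?thesis
    by (rule bilinear_mapI[OF ell2.vector_space_axioms])
      (simp_all add: embed_simps S.add S.scale LD(2,3) RD(2,3)[OF x] RD(6)[OF x] bounded_opD(2,3)[OF LD(1)])
qed

lemma adjoint_rep_fund:
  assumes x: "x \<in> K" and \<alpha>: "\<alpha> \<in> Irr G" "i < dim_irr G \<alpha>" "j < dim_irr G \<alpha>"
  shows "adjoint_rep L R (fund G \<alpha> i j) x =
    (\<Sum>k<dim_irr G \<alpha>. L (\<iota> (fund G \<alpha> i k)) (R (\<iota> (star G (fund G \<alpha> j k))) x))"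
  unfolding adjoint_rep_def comult_map_corep[OF adjoint_bilinear[OF x] fund_corep[OF \<alpha>(1)] \<alpha>(2,3)]
  using \<alpha> by (intro sum.cong refl) (simp add: antipode_fund)

text \<open>The antipode must commute with the involution for the adjoint action to preserve involutions;
  this is where unimodularity enters.\<close>

lemma adjoint_star_rep:
  assumes kac: "\<And>\<alpha>. \<alpha> \<in> Irr G \<Longrightarrow> unitary_matrix G (dim_irr G \<alpha>) (\<lambda>i j. star G (fund G \<alpha> i j))"
  shows "star_rep G K (adjoint_rep L R)"
proof -
  let ?\<Phi> = "adjoint_rep L R" and ?S = "antipode G"
  let ?T = "\<lambda>p x. L (\<iota> (fst p)) (R (\<iota> (?S (snd p))) x)"
  have \<Phi>: "?\<Phi> a = (\<lambda>x. \<Sum>p\<leftarrow>comult G a. ?T p x)" for a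
    by (simp add: adjoint_rep_def comult_map_def case_prod_unfold fun_eq_iff)
  have T: "bounded_op K (?T p)" for p by (rule bounded_op_comp[OF LD(1) RD(1)])
  have bnd: "bounded_op K (?\<Phi> a)" for a unfolding \<Phi> by (intro bounded_op_sum_list K T)
  have add: "?\<Phi> (a + b) x = ?\<Phi> a x + ?\<Phi> b x" and scale: "?\<Phi> (scl G c a) x = c *\<^sub>C ?\<Phi> a x" if x: "x \<in> K" for a b c x
  proof -
    interpret l: Vector_Spaces.linear "scl G" "(*\<^sub>C)" "comult_map G (\<lambda>y z. L (\<iota> y) (R (\<iota> (?S z)) x))"
      by (rule comult_map_linear[OF adjoint_bilinear[OF x]])
    show "?\<Phi> (a + b) x = ?\<Phi> a x + ?\<Phi> b x" "?\<Phi> (scl G c a) x = c *\<^sub>C ?\<Phi> a x"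
      by (simp_all add: adjoint_rep_def l.add l.scale)
  qed
  have one: "?\<Phi> 1 x = x" if x: "x \<in> K" for x
    unfolding adjoint_rep_def comult_map_one[OF adjoint_bilinear[OF x]]
    using x by (simp add: antipode_one embed_one LD(4) RD(4))
  have mult: "?\<Phi> (a * b) x = ?\<Phi> a (?\<Phi> b x)" if x: "x \<in> K" for a b x
  proof -
    have summand: "L (\<iota> (y * y')) (R (\<iota> (?S (z * z'))) x) = ?T (y, z) (?T (y', z') x)" for y y' z z'
      using x by (simp add: antipode_mult embed_mult L_mult R_mult RD(6) LD(6) LR)
    have "?\<Phi> (a * b) x = (\<Sum>p\<leftarrow>comult G a. \<Sum>q\<leftarrow>comult G b. ?T p (?T q x))"
      unfolding adjoint_rep_def comult_map_mult[OF adjoint_bilinear[OF x]] using summand by (simp add: case_prod_unfold)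
    also have "\<dots> = (\<Sum>p\<leftarrow>comult G a. ?T p (\<Sum>q\<leftarrow>comult G b. ?T q x))"
      using bounded_op_of_sum_list[OF K T, of "\<lambda>q. ?T q x"] bounded_opD(1)[OF T x] by simp
    finally show ?thesis by (simp add: \<Phi>)
  qed
  have adj: "cinner (?\<Phi> a x) w = cinner x (?\<Phi> (star G a) w)" if x: "x \<in> K" and w: "w \<in> K" for a x w
  proof -
    have summand: "cinner (?T p x) w = cinner x (?T (star G (fst p), star G (snd p)) w)" for p
    proof -
      have "cinner (?T p x) w = cinner x (R (star A (\<iota> (?S (snd p)))) (L (star A (\<iota> (fst p))) w))"
        using x w by (simp add: LD(5,6) RD(5,6))
      then show ?thesis using w by (simp add: LR antipode_star[OF kac] embed_star)
    qed
    have "?\<Phi> (star G a) w = (\<Sum>p\<leftarrow>comult G a. ?T (star G (fst p), star G (snd p)) w)"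
      unfolding adjoint_rep_def comult_map_star[OF adjoint_bilinear[OF w]] by (simp add: case_prod_unfold)
    then show ?thesis by (simp add: \<Phi> cinner_sum_list summand)
  qed
  show ?thesis
    unfolding star_rep_def star_linear_map_def using bnd add scale one adj mult by blast
qed

text \<open>Unitarity writes the trivial action as \<open>u\<^sub>i\<^sub>k\<close> applied to \<open>u\<^sub>j\<^sub>k\<^sup>* x\<close>, whereas the adjoint action applies it to
  \<open>x u\<^sub>j\<^sub>k\<^sup>*\<close>.\<close>
lemma adjoint_displacement:
  assumes x: "x \<in> K" and \<alpha>: "\<alpha> \<in> Irr G" "i < dim_irr G \<alpha>" "j < dim_irr G \<alpha>"
  shows "norm (adjoint_rep L R (fund G \<alpha> i j) x - of_bool (i = j) *\<^sub>C x) \<le>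
    (\<Sum>k<dim_irr G \<alpha>. norm (\<iota> (fund G \<alpha> i k)) * norm (L (\<iota> (star G (fund G \<alpha> j k))) x - R (\<iota> (star G (fund G \<alpha> j k))) x))"
proof -
  let ?n = "dim_irr G \<alpha>" and ?u = "fund G \<alpha>"
  let ?b = "\<lambda>k. \<iota> (star G (?u j k))"
  interpret l: Vector_Spaces.linear "scl A" "(*\<^sub>C)" "\<lambda>a. L a x" by (rule env.star_linear_map_linear[OF L_slm x])
  interpret i: Vector_Spaces.linear "scl G" "scl A" \<iota> by (rule embed_linear)
  have "(\<Sum>k<?n. L (\<iota> (?u i k)) (L (?b k) x)) = L (\<iota> (\<Sum>k<?n. ?u i k * star G (?u j k))) x"
    by (simp add: i.sum l.sum embed_mult L_mult[OF x])
  also have "\<dots> = of_bool (i = j) *\<^sub>C x"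
    using fund_unitary[OF \<alpha>(1)] \<alpha> LD(4)[OF x] by (auto simp: unitary_matrix_def embed_one embed_simps l.zero)
  finally have "adjoint_rep L R (?u i j) x - of_bool (i = j) *\<^sub>C x =
      (\<Sum>k<?n. L (\<iota> (?u i k)) (R (?b k) x) - L (\<iota> (?u i k)) (L (?b k) x))"
    by (simp add: adjoint_rep_fund[OF x \<alpha>] sum_subtractf)
  also have "\<dots> = (\<Sum>k<?n. L (\<iota> (?u i k)) (R (?b k) x - L (?b k) x))"
    by (simp add: bounded_op_diff[OF LD(1) K RD(6)[OF x] LD(6)[OF x]])
  also have "norm \<dots> \<le> (\<Sum>k<?n. norm (L (\<iota> (?u i k)) (R (?b k) x - L (?b k) x)))" by (rule norm_sum)
  also have "\<dots> \<le> (\<Sum>k<?n. norm (\<iota> (?u i k)) * norm (R (?b k) x - L (?b k) x))"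
    by (intro sum_mono env.star_rep_contractive[OF L_rep] hilbert_subspaceD(6)[OF K] RD(6) LD(6) x)
  finally show ?thesis by (simp add: norm_minus_commute)
qed

text \<open>Acting from the right on \<open>a\<^sub>1 x S(a\<^sub>2) = \<epsilon>(a) x\<close> by the entries of the same corepresentation cancels the
  antipode.\<close>
lemma adjoint_invariant_central:
  assumes x: "x \<in> K" and inv: "\<And>a. adjoint_rep L R a x = counit G a *\<^sub>C x"
  shows "L c x = R c x"
proof -
  interpret l: Vector_Spaces.linear "scl A" "(*\<^sub>C)" "\<lambda>a. L a x" by (rule env.star_linear_map_linear[OF L_slm x])
  interpret r: Vector_Spaces.linear "scl A" "(*\<^sub>C)" "\<lambda>a. R a x" by (rule env.star_linear_map_linear[OF R_slm x])
  interpret i: Vector_Spaces.linear "scl G" "scl A" \<iota> by (rule embed_linear)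
  have fund: "L (\<iota> (fund G \<alpha> i m)) x = R (\<iota> (fund G \<alpha> i m)) x"
    if \<alpha>: "\<alpha> \<in> Irr G" "i < dim_irr G \<alpha>" "m < dim_irr G \<alpha>" for \<alpha> i m
  proof -
    let ?n = "dim_irr G \<alpha>" and ?u = "fund G \<alpha>"
    have R0: "R c 0 = 0" for c using bounded_opD(3)[OF RD(1) x, of c 0] by simp
    have "R (\<iota> (?u i m)) x = (\<Sum>j<?n. if j = i then R (\<iota> (?u i m)) x else 0)" using \<alpha> by simp
    also have "\<dots> = (\<Sum>j<?n. R (\<iota> (?u j m)) (adjoint_rep L R (?u i j) x))"
      using \<alpha> R0 by (intro sum.cong refl) (auto simp: inv counit_corep[OF fund_corep[OF \<alpha>(1)]])
    also have "\<dots> = (\<Sum>j<?n. \<Sum>k<?n. L (\<iota> (?u i k)) (R (\<iota> (star G (?u j k) * ?u j m)) x))"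
      using \<alpha> x by (intro sum.cong refl)
        (simp add: adjoint_rep_fund bounded_op_sum[OF RD(1) K] LD(6) RD(6) LR[symmetric] embed_mult R_mult)
    also have "\<dots> = (\<Sum>k<?n. L (\<iota> (?u i k)) (R (\<iota> (\<Sum>j<?n. star G (?u j k) * ?u j m)) x))"
      using x by (subst sum.swap) (simp add: i.sum r.sum bounded_op_sum[OF LD(1) K] RD(6))
    also have "\<dots> = (\<Sum>k<?n. if k = m then L (\<iota> (?u i m)) x else 0)"
    proof (rule sum.cong[OF refl])
      fix k assume "k \<in> {..<?n}"
      then have "(\<Sum>j<?n. star G (?u j k) * ?u j m) = of_bool (k = m)"
        using fund_unitary[OF \<alpha>(1)] \<alpha> by (simp add: unitary_matrix_def)
      then show "L (\<iota> (?u i k)) (R (\<iota> (\<Sum>j<?n. star G (?u j k) * ?u j m)) x) = (if k = m then L (\<iota> (?u i m)) x else 0)"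
        using RD(4)[OF x] bounded_opD(3)[OF LD(1) x, of _ 0] by (auto simp: embed_one embed_simps r.zero)
    qed
    finally show ?thesis using \<alpha> by simp
  qed
  have pol: "L (\<iota> a) x = R (\<iota> a) x" for a
  proof (rule fund_induct[of "\<lambda>a. L (\<iota> a) x = R (\<iota> a) x"])
    show "subspace {a. L (\<iota> a) x = R (\<iota> a) x}"
      by (auto simp: subspace_def embed_simps l.zero r.zero l.add r.add l.scale r.scale)
  qed (rule fund)
  show ?thesis
    by (rule dense_equal[OF continuous_rep[OF L_slm x env.star_rep_contractive[OF L_rep x]]
          continuous_rep[OF R_slm x env.op_star_rep_contractive[OF R_rep x]] pol])
qed

end

section \<open>The equivalence of the two properties\<close>

text \<open>A character that respects the involution is a one-dimensional representation, and as such extends to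
  the envelope.\<close>
lemma counit_extension:
  obtains \<tau> where "\<And>a. \<tau> (\<iota> a) = counit G a" "functional A \<tau>" "\<tau> 1 = 1"
    "\<And>a b. \<tau> (a * b) = \<tau> a * \<tau> b" "\<And>a. \<tau> (star A a) = cnj (\<tau> a)" "\<And>a. cmod (\<tau> a) \<le> norm a"
proof -
  have "character G (counit G)" by (simp add: character_def counit_linear counit_one counit_mult)
  from character_star_rep[OF this counit_star]
  obtain L where L: "star_rep A UNIV L" and L\<iota>: "\<And>a x. L (\<iota> a) x = counit G a *\<^sub>C x"
    using star_rep_extension[OF hilbert_subspace_UNIV] by (metis UNIV_I)
  have slm: "star_linear_map A UNIV L" and mult: "L (a * b) x = L a (L b x)" for a b x
    using L by (auto simp: star_rep_def)
  note D = star_linear_mapD[OF slm, simplified]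
  obtain e :: ell2 where e: "norm e = 1" using unit_vector_exists by blast
  then have ee: "cinner e e = 1" by (simp add: cinner_self_norm)
  define \<tau> where "\<tau> a = cinner e (L a e)" for a
  have cont: "continuous_on UNIV (\<lambda>a. L a e)"
    by (rule continuous_rep[OF slm]) (auto intro: env.star_rep_contractive[OF L])
  have cont_\<tau>: "continuous_on UNIV (\<lambda>a. \<tau> a *\<^sub>C e)"
  proof -
    have c2: "continuous_on UNIV \<tau>"
      unfolding \<tau>_def continuous_on_def
      using cont by (auto simp: continuous_on_def intro!: tendsto_cinner)
    have "bounded_linear (\<lambda>z. z *\<^sub>C e)"
      by (rule bounded_linear_intro[where K = "norm e"])
        (simp_all add: ell2.scale_left_distrib norm_scaleC scaleR_ell2_def scaleR_conv_of_real)
    from bounded_linear.continuous_on[OF this c2] show ?thesis .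
  qed
  have L_e: "L a e = \<tau> a *\<^sub>C e" for a
    by (rule dense_equal[OF cont cont_\<tau>]) (simp add: \<tau>_def L\<iota> cinner_scaleC_right ee)
  have e_eq: "z = w" if "z *\<^sub>C e = w *\<^sub>C e" for z w
    using arg_cong[OF that, of "cinner e"] by (simp add: cinner_scaleC_right ee)
  show ?thesis
  proof (rule that[of \<tau>])
    show "\<tau> (\<iota> a) = counit G a" for a by (simp add: \<tau>_def L\<iota> cinner_scaleC_right ee)
    show "functional A \<tau>"
      by (rule env.functionalI) (simp_all add: \<tau>_def D(2,3) cinner_add_right cinner_scaleC_right)
    show "\<tau> 1 = 1" by (simp add: \<tau>_def D(4) ee)
    show "\<tau> (a * b) = \<tau> a * \<tau> b" for a b
    proof (rule e_eq)
      have "L (a * b) e = L a (\<tau> b *\<^sub>C e)" unfolding mult by (simp only: L_e[of b])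
      also have "\<dots> = \<tau> b *\<^sub>C L a e" by (rule bounded_opD(3)[OF D(1)]) simp
      finally show "\<tau> (a * b) *\<^sub>C e = (\<tau> a * \<tau> b) *\<^sub>C e" by (simp add: L_e mult.commute)
    qed
    show "\<tau> (star A a) = cnj (\<tau> a)" for a
      unfolding \<tau>_def by (subst D(5)[symmetric]) (rule cinner_commute)
    show "cmod (\<tau> a) \<le> norm a" for a
      using env.star_rep_contractive[OF L, of e a] e by (simp add: L_e norm_scaleC)
  qed
qed

lemma tracial_state_exists: "\<exists>\<tau>. tracial_state A \<tau>"
proof -
  obtain \<tau> where \<tau>: "functional A \<tau>" "\<tau> 1 = 1" "\<And>a b. \<tau> (a * b) = \<tau> a * \<tau> b" "\<And>a. \<tau> (star A a) = cnj (\<tau> a)"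
    by (rule counit_extension) (rule that)
  have "\<tau> (star A a * a) \<in> \<real>\<^sub>\<ge>\<^sub>0" for a
  proof -
    have "\<tau> (star A a * a) = of_real ((cmod (\<tau> a))\<^sup>2)"
      unfolding complex_norm_square by (simp add: \<tau>(3,4) mult.commute)
    then show ?thesis by (simp only: nonneg_Reals_of_real_iff) simp
  qed
  then show ?thesis using \<tau> by (auto simp: tracial_state_def mult.commute)
qed

text \<open>For each point of a countable dense set of the envelope and each scale, choose an element of the
  polynomial algebra nearby if there is one.\<close>
lemma dense_sequence:
  assumes "separable_space (euclidean :: 'c topology)"
  obtains b :: "nat \<Rightarrow> 'a" where "\<And>a e. e > 0 \<Longrightarrow> \<exists>p. norm (\<iota> a - \<iota> (b p)) < e"
proof -
  obtain C :: "'c set" where C: "countable C" "closure C = UNIV"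
    using assms by (auto simp: separable_space_def euclidean_closure_of)
  have "C \<noteq> {}" using C(2) by auto
  define d where "d = from_nat_into C"
  have d: "range d = C" unfolding d_def by (rule range_from_nat_into[OF \<open>C \<noteq> {}\<close> C(1)])
  have "\<exists>a. norm (\<iota> a - d m) < inverse (real (Suc k)) \<or> (\<forall>a. norm (\<iota> a - d m) \<ge> inverse (real (Suc k)))" for m k
    by (meson not_le)
  then obtain b' where b': "\<And>m k. norm (\<iota> (b' m k) - d m) < inverse (real (Suc k)) \<or> (\<forall>a. norm (\<iota> a - d m) \<ge> inverse (real (Suc k)))"
    by metis
  define b where "b p = b' (fst (prod_decode p)) (snd (prod_decode p))" for p
  have "\<exists>p. norm (\<iota> a - \<iota> (b p)) < e" if e: "e > 0" for a e
  proof -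
    obtain k where k: "inverse (real (Suc k)) < e / 2" using reals_Archimedean[of "e / 2"] e by auto
    have "\<iota> a \<in> closure C" using C(2) by simp
    then obtain y where "y \<in> C" "dist y (\<iota> a) < inverse (real (Suc k))"
      unfolding closure_approachable by (metis inverse_positive_iff_positive of_nat_0_less_iff zero_less_Suc)
    then obtain m where m: "dist (d m) (\<iota> a) < inverse (real (Suc k))" using d by (metis imageE)
    then have "norm (\<iota> a - d m) < inverse (real (Suc k))" by (simp add: dist_norm norm_minus_commute)
    moreover from this have "norm (\<iota> (b' m k) - d m) < inverse (real (Suc k))" using b'[of m k] by (meson not_le)
    ultimately have "norm (\<iota> a - \<iota> (b' m k)) < e"
      using k norm_triangle_ineq4[of "\<iota> a - d m" "\<iota> (b' m k) - d m"] by simp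
    then show ?thesis by (intro exI[of _ "prod_encode (m, k)"]) (simp add: b_def)
  qed
  then show ?thesis using that by blast
qed

text \<open>If all candidates for the finite set and the constant fail, then so do the first terms of a dense
  sequence with constants tending to 0. The resulting bimodules have asymptotically central unit
  vectors, and property (T) applies to their adjoint representations.\<close>
theorem property_T_imp_bekka:
  assumes T: "dual_property_T G" and sep: "separable_space (euclidean :: 'c topology)"
  shows "bekka_property_T A"
proof -
  obtain b :: "nat \<Rightarrow> 'a" where b: "\<And>a e. e > 0 \<Longrightarrow> \<exists>p. norm (\<iota> a - \<iota> (b p)) < e"
    using dense_sequence[OF sep] by blast
  have kac: "unitary_matrix G (dim_irr G \<alpha>) (\<lambda>i j. star G (fund G \<alpha> i j))" if "\<alpha> \<in> Irr G" for \<alpha>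
    by (rule property_T_kac[OF T that])
  have "\<exists>F c. finite F \<and> c > 0 \<and> (\<forall>K L R. hilbert_bimodule A K L R \<longrightarrow>
        (\<exists>\<xi>\<in>K. norm \<xi> = 1 \<and> (\<forall>a\<in>F. norm (L a \<xi> - R a \<xi>) < c)) \<longrightarrow>
        (\<exists>\<xi>'\<in>K. \<xi>' \<noteq> 0 \<and> (\<forall>a. L a \<xi>' = R a \<xi>')))"
  proof (rule ccontr)
    assume neg: "\<not> ?thesis"
    have "\<exists>X. case X of (K, L, R, \<xi>) \<Rightarrow> hilbert_bimodule A K L R \<and> \<xi> \<in> K \<and> norm \<xi> = 1 \<and>
        (\<forall>p\<le>n. norm (L (\<iota> (b p)) \<xi> - R (\<iota> (b p)) \<xi>) < inverse (real (Suc n))) \<and>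
        \<not> (\<exists>\<xi>'\<in>K. \<xi>' \<noteq> 0 \<and> (\<forall>a. L a \<xi>' = R a \<xi>'))" for n
    proof -
      let ?F = "(\<lambda>p. \<iota> (b p)) ` {..n}" and ?c = "inverse (real (Suc n))"
      have fin: "finite ?F" "?c > 0" by simp_all
      show ?thesis (is ?G)
      proof (rule ccontr)
        assume no: "\<not> ?G"
        have all: "\<forall>K L R. hilbert_bimodule A K L R \<longrightarrow> (\<exists>\<xi>\<in>K. norm \<xi> = 1 \<and> (\<forall>a\<in>?F. norm (L a \<xi> - R a \<xi>) < ?c)) \<longrightarrow>
          (\<exists>\<xi>'\<in>K. \<xi>' \<noteq> 0 \<and> (\<forall>a. L a \<xi>' = R a \<xi>'))"
        proof (intro allI impI)
          fix K L R
          assume bim: "hilbert_bimodule A K L R" and "\<exists>\<xi>\<in>K. norm \<xi> = 1 \<and> (\<forall>a\<in>?F. norm (L a \<xi> - R a \<xi>) < ?c)"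
          then obtain \<xi> where \<xi>: "\<xi> \<in> K" "norm \<xi> = 1" "\<And>a. a \<in> ?F \<Longrightarrow> norm (L a \<xi> - R a \<xi>) < ?c" by blast
          have small: "\<forall>p\<le>n. norm (L (\<iota> (b p)) \<xi> - R (\<iota> (b p)) \<xi>) < ?c"
            by (intro allI impI \<xi>(3)) (simp add: image_iff, blast)
          show "\<exists>\<xi>'\<in>K. \<xi>' \<noteq> 0 \<and> (\<forall>a. L a \<xi>' = R a \<xi>')"
          proof (rule ccontr)
            assume "\<not> (\<exists>\<xi>'\<in>K. \<xi>' \<noteq> 0 \<and> (\<forall>a. L a \<xi>' = R a \<xi>'))"
            then have ?G
              by (intro exI[of _ "(K, L, R, \<xi>)"], unfold prod.case, intro conjI bim \<xi>(1,2) small)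
            with no show False by (rule notE)
          qed
        qed
        show False
          by (rule notE[OF neg], rule exI[of _ ?F], rule exI[of _ ?c]) (intro conjI fin all)
      qed
    qed
    from choice[OF allI[OF this]] obtain X where X: "\<forall>n. case X n of (K, L, R, \<xi>) \<Rightarrow> hilbert_bimodule A K L R \<and> \<xi> \<in> K \<and> norm \<xi> = 1 \<and>
        (\<forall>p\<le>n. norm (L (\<iota> (b p)) \<xi> - R (\<iota> (b p)) \<xi>) < inverse (real (Suc n))) \<and>
        \<not> (\<exists>\<xi>'\<in>K. \<xi>' \<noteq> 0 \<and> (\<forall>a. L a \<xi>' = R a \<xi>'))"
      by (rule exE) (rule that)
    define K L R \<xi> where "K n = fst (X n)" and "L n = fst (snd (X n))" and "R n = fst (snd (snd (X n)))"
      and "\<xi> n = snd (snd (snd (X n)))" for n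
    have bim: "hilbert_bimodule A (K n) (L n) (R n)" and \<xi>: "\<xi> n \<in> K n" "norm (\<xi> n) = 1"
      and small: "p \<le> n \<Longrightarrow> norm (L n (\<iota> (b p)) (\<xi> n) - R n (\<iota> (b p)) (\<xi> n)) < inverse (real (Suc n))"
      and no_central: "\<not> (\<exists>\<xi>'\<in>K n. \<xi>' \<noteq> 0 \<and> (\<forall>a. L n a \<xi>' = R n a \<xi>'))" for n p
      using X[rule_format, of n] by (auto simp: K_def L_def R_def \<xi>_def case_prod_unfold)
    have central_lim: "(\<lambda>n. norm (L n (\<iota> c) (\<xi> n) - R n (\<iota> c) (\<xi> n))) \<longlonglongrightarrow> 0" for c
    proof (rule LIMSEQ_I)
      fix e :: real assume e: "e > 0"
      obtain p where p: "norm (\<iota> c - \<iota> (b p)) < e / 3" using b[of "e / 3" c] e by auto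
      obtain m where m: "inverse (real (Suc m)) < e / 3" using reals_Archimedean[of "e / 3"] e by auto
      have "norm (norm (L n (\<iota> c) (\<xi> n) - R n (\<iota> c) (\<xi> n)) - 0) < e" if n: "n \<ge> max p m" for n
      proof -
        note facts = bimodule_facts[OF bim[of n]]
        interpret l: Vector_Spaces.linear "scl A" "(*\<^sub>C)" "\<lambda>a. L n a (\<xi> n)"
          by (rule env.star_linear_map_linear[OF facts(2) \<xi>(1)])
        interpret r: Vector_Spaces.linear "scl A" "(*\<^sub>C)" "\<lambda>a. R n a (\<xi> n)"
          by (rule env.star_linear_map_linear[OF facts(3) \<xi>(1)])
        have l: "norm (L n (\<iota> c - \<iota> (b p)) (\<xi> n)) < e / 3"
          using env.star_rep_contractive[OF facts(4) \<xi>(1), of "\<iota> c - \<iota> (b p)"] p \<xi>(2)[of n] by simp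
        have r: "norm (R n (\<iota> c - \<iota> (b p)) (\<xi> n)) < e / 3"
          using env.op_star_rep_contractive[OF facts(5) \<xi>(1), of "\<iota> c - \<iota> (b p)"] p \<xi>(2)[of n] by simp
        have le: "inverse (real (Suc n)) \<le> inverse (real (Suc m))" using n by (intro le_imp_inverse_le) auto
        then have mid: "norm (L n (\<iota> (b p)) (\<xi> n) - R n (\<iota> (b p)) (\<xi> n)) < e / 3"
          using small[of p n] m n le by linarith
        have "L n (\<iota> c) (\<xi> n) - R n (\<iota> c) (\<xi> n) =
            (L n (\<iota> c - \<iota> (b p)) (\<xi> n) + (L n (\<iota> (b p)) (\<xi> n) - R n (\<iota> (b p)) (\<xi> n))) - R n (\<iota> c - \<iota> (b p)) (\<xi> n)"
          by (simp add: l.diff r.diff)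
        also have "norm \<dots> \<le> norm (L n (\<iota> c - \<iota> (b p)) (\<xi> n)) + norm (L n (\<iota> (b p)) (\<xi> n) - R n (\<iota> (b p)) (\<xi> n))
            + norm (R n (\<iota> c - \<iota> (b p)) (\<xi> n))"
          by (rule order_trans[OF norm_triangle_ineq4 add_right_mono[OF norm_triangle_ineq]])
        finally show ?thesis using l r mid by simp
      qed
      then show "\<exists>no. \<forall>n\<ge>no. norm (norm (L n (\<iota> c) (\<xi> n) - R n (\<iota> c) (\<xi> n)) - 0) < e" by blast
    qed
    have "\<exists>n. \<exists>\<zeta>\<in>K n. \<zeta> \<noteq> 0 \<and> (\<forall>a. adjoint_rep (L n) (R n) a \<zeta> = counit G a *\<^sub>C \<zeta>)"
    proof (rule property_T_sequences[OF T, where \<xi> = \<xi>])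
      show "hilbert_subspace (K n)" for n by (rule bimodule_facts(1)[OF bim])
      show "star_rep G (K n) (adjoint_rep (L n) (R n))" for n by (rule adjoint_star_rep[OF bim kac])
      show "\<xi> n \<in> K n" "norm (\<xi> n) = 1" for n by (rule \<xi>)+
      fix \<alpha> i j assume \<alpha>: "\<alpha> \<in> Irr G" "i < dim_irr G \<alpha>" "j < dim_irr G \<alpha>"
      let ?B = "\<lambda>n. \<Sum>k<dim_irr G \<alpha>. norm (\<iota> (fund G \<alpha> i k)) *
          norm (L n (\<iota> (star G (fund G \<alpha> j k))) (\<xi> n) - R n (\<iota> (star G (fund G \<alpha> j k))) (\<xi> n))"
      have "?B \<longlonglongrightarrow> (\<Sum>k<dim_irr G \<alpha>. norm (\<iota> (fund G \<alpha> i k)) * 0)"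
        by (intro tendsto_sum tendsto_mult tendsto_const central_lim)
      then have "?B \<longlonglongrightarrow> 0" by simp
      then show "(\<lambda>n. norm (adjoint_rep (L n) (R n) (fund G \<alpha> i j) (\<xi> n) - of_bool (i = j) *\<^sub>C \<xi> n)) \<longlonglongrightarrow> 0"
        by (rule Lim_null_comparison[rotated]) (use adjoint_displacement[OF bim \<xi>(1) \<alpha>] in simp)
    qed
    then obtain n \<zeta> where \<zeta>: "\<zeta> \<in> K n" "\<zeta> \<noteq> 0" "\<And>a. adjoint_rep (L n) (R n) a \<zeta> = counit G a *\<^sub>C \<zeta>" by blast
    have "L n a \<zeta> = R n a \<zeta>" for a by (rule adjoint_invariant_central[OF bim \<zeta>(1,3)])
    with \<zeta> no_central show False by blast
  qed
  then show ?thesis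
    unfolding bekka_property_T_def using env.cstar_algebra_axioms tracial_state_exists by blast
qed

lemma almost_invariant_mono:
  assumes "almost_invariant G V E \<delta> \<xi>" "E' \<subseteq> E" "\<delta> \<le> \<delta>'" 
    and nn: "\<And>\<alpha>. \<alpha> \<in> E' \<Longrightarrow> \<alpha> \<in> Irr G"
  shows "almost_invariant G V E' \<delta>' \<xi>"
  unfolding almost_invariant_def
proof (intro ballI allI impI)
  fix \<alpha> c assume \<alpha>: "\<alpha> \<in> E'" and c: "H_elem G \<alpha> c \<noteq> 0"
  obtain t s c1 c2 where md: "modular_data G \<alpha> t s c1 c2" using modular_data_exists[OF nn[OF \<alpha>]] .
  have "L2_norm G (H_elem G \<alpha> c) \<ge> 0"
    unfolding L2_norm_eq[OF nn[OF \<alpha>] md] using modular_dataD(2)[OF md] by (simp add: sum_nonneg)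
  then have "\<delta> * L2_norm G (H_elem G \<alpha> c) * norm \<xi> \<le> \<delta>' * L2_norm G (H_elem G \<alpha> c) * norm \<xi>"
    using assms(3) by (intro mult_right_mono) auto
  moreover have "H_tensor_norm G \<alpha> (displacement G V \<alpha> c \<xi>) < \<delta> * L2_norm G (H_elem G \<alpha> c) * norm \<xi>"
    using assms(1,2) \<alpha> c unfolding almost_invariant_def by blast
  ultimately show "H_tensor_norm G \<alpha> (displacement G V \<alpha> c \<xi>) < \<delta>' * L2_norm G (H_elem G \<alpha> c) * norm \<xi>" by linarith
qed

text \<open>Every element is a finite linear combination of matrix elements.\<close>
lemma almost_invariant_element:
  assumes slm: "star_linear_map G K \<Phi>"
    and \<Phi>: "\<And>\<alpha> i j. \<alpha> \<in> Irr G \<Longrightarrow> i < dim_irr G \<alpha> \<Longrightarrow> j < dim_irr G \<alpha> \<Longrightarrow> \<Phi> (fund G \<alpha> i j) = V \<alpha> i j"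
    and \<eta>: "\<eta> > 0"
  shows "\<exists>E \<delta>. finite E \<and> E \<subseteq> Irr G \<and> \<delta> > 0 \<and> (\<forall>\<xi>\<in>K. almost_invariant G V E \<delta> \<xi> \<longrightarrow>
    norm (\<Phi> a \<xi> - counit G a *\<^sub>C \<xi>) \<le> \<eta> * norm \<xi>)"
proof -
  interpret \<epsilon>: Vector_Spaces.linear "scl G" "(*)" "counit G" by (rule counit_linear)
  obtain I c where I: "finite I" "I \<subseteq> irr_indices G" and a: "a = (\<Sum>r\<in>I. scl G (c r) (fund_entry G r))"
    using fund_expansion by blast
  define N where "N = (\<Sum>r\<in>I. cmod (c r))"
  have N: "N \<ge> 0" by (simp add: N_def sum_nonneg)
  define \<delta> where "\<delta> = \<eta> / (N + 1)"
  have \<delta>: "\<delta> > 0" using \<eta> N by (simp add: \<delta>_def)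
  have "norm (\<Phi> a \<xi> - counit G a *\<^sub>C \<xi>) \<le> \<eta> * norm \<xi>"
    if \<xi>: "\<xi> \<in> K" and inv: "almost_invariant G V (fst ` I) \<delta> \<xi>" for \<xi>
  proof -
    interpret l: Vector_Spaces.linear "scl G" "(*\<^sub>C)" "\<lambda>a. \<Phi> a \<xi>" by (rule star_linear_map_linear[OF slm \<xi>])
    have entry: "norm (\<Phi> (fund_entry G r) \<xi> - counit G (fund_entry G r) *\<^sub>C \<xi>) \<le> \<delta> * norm \<xi>" if r: "r \<in> I" for r
    proof -
      obtain \<alpha> i j where r_eq: "r = (\<alpha>, i, j)" by (cases r) auto
      have \<alpha>: "\<alpha> \<in> Irr G" "i < dim_irr G \<alpha>" "j < dim_irr G \<alpha>" "\<alpha> \<in> fst ` I"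
        using r I(2) by (auto simp: r_eq irr_indices_def image_iff intro!: bexI[of _ r])
      show ?thesis
        using almost_invariant_entries[OF \<alpha>(1,4) inv \<alpha>(2,3)] \<alpha>
        by (simp add: r_eq fund_entry_def \<Phi> counit_corep[OF fund_corep])
    qed
    have "\<Phi> a \<xi> - counit G a *\<^sub>C \<xi> = (\<Sum>r\<in>I. c r *\<^sub>C (\<Phi> (fund_entry G r) \<xi> - counit G (fund_entry G r) *\<^sub>C \<xi>))"
      by (simp add: a l.sum l.scale \<epsilon>.sum \<epsilon>.scale ell2.scale_right_diff_distrib sum_subtractf ell2.scale_sum_left)
    also have "norm \<dots> \<le> (\<Sum>r\<in>I. cmod (c r) * norm (\<Phi> (fund_entry G r) \<xi> - counit G (fund_entry G r) *\<^sub>C \<xi>))"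
      by (rule order_trans[OF norm_sum]) (simp add: norm_scaleC)
    also have "\<dots> \<le> (\<Sum>r\<in>I. cmod (c r) * (\<delta> * norm \<xi>))"
      by (intro sum_mono mult_left_mono entry) auto
    also have "\<dots> = N * \<delta> * norm \<xi>" by (simp add: N_def sum_distrib_right mult.assoc)
    also have "\<dots> \<le> (N + 1) * \<delta> * norm \<xi>" using \<delta> by (intro mult_right_mono) auto
    also have "(N + 1) * \<delta> = \<eta>" using N by (simp add: \<delta>_def)
    finally show ?thesis .
  qed
  moreover have "finite (fst ` I)" "fst ` I \<subseteq> Irr G" using I by (auto simp: irr_indices_def)
  ultimately show ?thesis using \<delta> by blast
qed

text \<open>The envelope acts from the left by the extension of the corepresentation and from the right through
  the counit.\<close>
theorem bekka_imp_property_T: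
  assumes B: "bekka_property_T A"
  shows "dual_property_T G"
  unfolding dual_property_T_def
proof (intro allI impI)
  fix K V assume V: "dual_corep G K V" and ai: "has_almost_invariant_vectors G K V"
  have K: "hilbert_subspace K" using V by (simp add: dual_corep_def)
  obtain F c where F: "finite F" "c > 0" and bekka: "\<And>K L R. hilbert_bimodule A K L R \<Longrightarrow>
        \<exists>\<xi>\<in>K. norm \<xi> = 1 \<and> (\<forall>a\<in>F. norm (L a \<xi> - R a \<xi>) < c) \<Longrightarrow>
        \<exists>\<xi>'\<in>K. \<xi>' \<noteq> 0 \<and> (\<forall>a. L a \<xi>' = R a \<xi>')"
    using B unfolding bekka_property_T_def by blast
  obtain \<Phi> where \<Phi>: "star_rep G K \<Phi>" and \<Phi>_fund: "\<And>\<alpha> i j. \<alpha> \<in> Irr G \<Longrightarrow> i < dim_irr G \<alpha> \<Longrightarrow> j < dim_irr G \<alpha> \<Longrightarrow> \<Phi> (fund G \<alpha> i j) = V \<alpha> i j"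
    using dual_corep_star_rep[OF V] by blast
  have slm: "star_linear_map G K \<Phi>" using \<Phi> by (simp add: star_rep_def)
  obtain L where L: "star_rep A K L" and L\<iota>: "\<And>a x. x \<in> K \<Longrightarrow> L (\<iota> a) x = \<Phi> a x"
    using star_rep_extension[OF K \<Phi>] by blast
  have L_slm: "star_linear_map A K L" using L by (simp add: star_rep_def)
  note LD = star_linear_mapD[OF L_slm]
  obtain \<tau> where \<tau>: "\<And>a. \<tau> (\<iota> a) = counit G a" "functional A \<tau>" "\<tau> 1 = 1"
    "\<And>a b. \<tau> (a * b) = \<tau> a * \<tau> b" "\<And>a. \<tau> (star A a) = cnj (\<tau> a)" "\<And>a. cmod (\<tau> a) \<le> norm a"
    by (rule counit_extension) (rule that)
  interpret \<tau>: Vector_Spaces.linear "scl A" "(*)" \<tau> by (rule \<tau>(2))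
  define R where "R = (\<lambda>a x. \<tau> a *\<^sub>C x)"
  have "bounded_op K (R a)" for a
    using hilbert_subspaceD(5)[OF K]
    by (auto simp: R_def bounded_op_def ell2.scale_right_distrib norm_scaleC mult.commute intro!: exI[of _ "cmod (\<tau> a)"])
  then have R: "op_star_rep A K R"
    by (auto simp: op_star_rep_def star_linear_map_def R_def \<tau>.add \<tau>.scale \<tau>(3,4,5) ell2.scale_left_distrib
        cinner_scaleC_left cinner_scaleC_right mult.commute)
  have bim: "hilbert_bimodule A K L R"
    unfolding hilbert_bimodule_def using K L R bounded_opD(3)[OF LD(1)] by (auto simp: R_def)
  have elem: "\<exists>E \<delta>. finite E \<and> E \<subseteq> Irr G \<and> \<delta> > 0 \<and> (\<forall>\<xi>\<in>K. almost_invariant G V E \<delta> \<xi> \<longrightarrow>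
      norm (L a \<xi> - R a \<xi>) \<le> (3 * c / 4) * norm \<xi>)" for a
  proof -
    obtain s where "(\<lambda>n::nat. \<iota> (s n)) \<longlonglongrightarrow> a" using embed_approx by blast
    then have "\<forall>\<^sub>F n in sequentially. dist (\<iota> (s n)) a < c / 4" using F(2) by (intro tendstoD) auto
    then obtain n where "dist (\<iota> (s n)) a < c / 4" using eventually_happens'[OF sequentially_bot] by blast
    then obtain p where p: "norm (a - \<iota> p) < c / 4" by (metis dist_norm dist_commute)
    obtain E \<delta> where E: "finite E" "E \<subseteq> Irr G" "\<delta> > 0" and
      near: "\<And>\<xi>. \<xi> \<in> K \<Longrightarrow> almost_invariant G V E \<delta> \<xi> \<Longrightarrow> norm (\<Phi> p \<xi> - counit G p *\<^sub>C \<xi>) \<le> (c / 4) * norm \<xi>"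
      using almost_invariant_element[OF slm \<Phi>_fund, of "c / 4" p] F(2) by auto
    have "norm (L a \<xi> - R a \<xi>) \<le> (3 * c / 4) * norm \<xi>" if \<xi>: "\<xi> \<in> K" "almost_invariant G V E \<delta> \<xi>" for \<xi>
    proof -
      interpret l: Vector_Spaces.linear "scl A" "(*\<^sub>C)" "\<lambda>a. L a \<xi>" by (rule env.star_linear_map_linear[OF L_slm \<xi>(1)])
      have "norm (L (a - \<iota> p) \<xi>) \<le> norm (a - \<iota> p) * norm \<xi>" by (rule env.star_rep_contractive[OF L \<xi>(1)])
      also have "\<dots> \<le> (c / 4) * norm \<xi>" using p by (intro mult_right_mono) auto
      finally have 1: "norm (L (a - \<iota> p) \<xi>) \<le> (c / 4) * norm \<xi>" .
      have "norm (R (a - \<iota> p) \<xi>) \<le> norm (a - \<iota> p) * norm \<xi>"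
        unfolding R_def norm_scaleC by (intro mult_right_mono \<tau>(6)) auto
      also have "\<dots> \<le> (c / 4) * norm \<xi>" using p by (intro mult_right_mono) auto
      finally have 2: "norm (R (a - \<iota> p) \<xi>) \<le> (c / 4) * norm \<xi>" .
      have "L a \<xi> - R a \<xi> = (L (a - \<iota> p) \<xi> + (\<Phi> p \<xi> - counit G p *\<^sub>C \<xi>)) - R (a - \<iota> p) \<xi>"
        by (simp add: l.diff L\<iota>[OF \<xi>(1)] R_def \<tau>.diff \<tau>(1) ell2.scale_left_diff_distrib)
      also have "norm \<dots> \<le> norm (L (a - \<iota> p) \<xi>) + norm (\<Phi> p \<xi> - counit G p *\<^sub>C \<xi>) + norm (R (a - \<iota> p) \<xi>)"
        by (rule order_trans[OF norm_triangle_ineq4 add_right_mono[OF norm_triangle_ineq]])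
      finally show ?thesis using 1 2 near[OF \<xi>] by (simp add: field_simps)
    qed
    with E show ?thesis by blast
  qed
  have "\<exists>E \<delta>. finite E \<and> E \<subseteq> Irr G \<and> \<delta> > 0 \<and> (\<forall>\<xi>\<in>K. almost_invariant G V E \<delta> \<xi> \<longrightarrow>
      (\<forall>a\<in>F'. norm (L a \<xi> - R a \<xi>) \<le> (3 * c / 4) * norm \<xi>))" if "finite F'" for F'
    using that
  proof (induction F' rule: finite_induct)
    case empty
    show ?case by (intro exI[of _ "{}"] exI[of _ 1]) auto
  next
    case (insert a F')
    obtain E \<delta> where 1: "finite E" "E \<subseteq> Irr G" "\<delta> > 0" "\<And>\<xi>. \<xi> \<in> K \<Longrightarrow> almost_invariant G V E \<delta> \<xi> \<Longrightarrow>
        \<forall>a\<in>F'. norm (L a \<xi> - R a \<xi>) \<le> (3 * c / 4) * norm \<xi>"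
      using insert.IH by blast
    obtain E' \<delta>' where 2: "finite E'" "E' \<subseteq> Irr G" "\<delta>' > 0" "\<And>\<xi>. \<xi> \<in> K \<Longrightarrow> almost_invariant G V E' \<delta>' \<xi> \<Longrightarrow>
        norm (L a \<xi> - R a \<xi>) \<le> (3 * c / 4) * norm \<xi>"
      using elem[of a] by blast
    have "almost_invariant G V E \<delta> \<xi>" "almost_invariant G V E' \<delta>' \<xi>"
      if "almost_invariant G V (E \<union> E') (min \<delta> \<delta>') \<xi>" for \<xi>
      using 1(2) 2(2) by (auto intro: almost_invariant_mono[OF that])
    then show ?case using 1 2 by (intro exI[of _ "E \<union> E'"] exI[of _ "min \<delta> \<delta>'"]) auto
  qed
  from this[OF F(1)] obtain E \<delta> where E: "finite E" "E \<subseteq> Irr G" "\<delta> > 0" and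
    near: "\<And>\<xi>. \<xi> \<in> K \<Longrightarrow> almost_invariant G V E \<delta> \<xi> \<Longrightarrow> \<forall>a\<in>F. norm (L a \<xi> - R a \<xi>) \<le> (3 * c / 4) * norm \<xi>"
    by blast
  \<comment> \<open>the trivial class is added so that the strict inequality excludes the zero vector\<close>
  obtain \<xi> where \<xi>: "\<xi> \<in> K" and inv: "almost_invariant G V (insert (trivial_irr G) E) \<delta> \<xi>"
    using ai[unfolded has_almost_invariant_vectors_def] E trivial_irr(1)
    by (meson finite_insert insert_subset)
  have "\<xi> \<noteq> 0"
    using almost_invariant_entries[OF trivial_irr(1) insertI1 inv, of 0 0] trivial_irr(2) by auto
  define \<zeta> where "\<zeta> = of_real (1 / norm \<xi>) *\<^sub>C \<xi>"
  have \<zeta>: "\<zeta> \<in> K" "norm \<zeta> = 1"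
    using \<open>\<xi> \<noteq> 0\<close> hilbert_subspaceD(5)[OF K \<xi>] by (simp_all add: \<zeta>_def norm_scaleC norm_divide)
  have "norm (L a \<zeta> - R a \<zeta>) < c" if a: "a \<in> F" for a
  proof -
    have "almost_invariant G V E \<delta> \<xi>" using E(2) by (intro almost_invariant_mono[OF inv]) auto
    then have le: "norm (L a \<xi> - R a \<xi>) \<le> (3 * c / 4) * norm \<xi>" using near[OF \<xi>] a by blast
    have "L a \<zeta> - R a \<zeta> = of_real (1 / norm \<xi>) *\<^sub>C (L a \<xi> - R a \<xi>)"
      unfolding \<zeta>_def bounded_opD(3)[OF LD(1) \<xi>] R_def
      by (simp add: ell2.scale_right_diff_distrib mult.commute)
    then have "norm (L a \<zeta> - R a \<zeta>) = norm (L a \<xi> - R a \<xi>) / norm \<xi>" by (simp add: norm_scaleC norm_divide)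
    also have "\<dots> \<le> 3 * c / 4" using le \<open>\<xi> \<noteq> 0\<close> by (simp add: field_simps)
    finally show ?thesis using F(2) by simp
  qed
  then obtain \<xi>' where \<xi>': "\<xi>' \<in> K" "\<xi>' \<noteq> 0" "\<And>a. L a \<xi>' = R a \<xi>'"
    using bekka[OF bim] \<zeta> by blast
  have "invariant_vector G V \<xi>'"
    unfolding invariant_vector_iff
  proof (intro ballI allI impI)
    fix \<alpha> l j assume \<alpha>: "\<alpha> \<in> Irr G" "l < dim_irr G \<alpha>" "j < dim_irr G \<alpha>"
    have "V \<alpha> l j \<xi>' = L (\<iota> (fund G \<alpha> l j)) \<xi>'" by (simp add: L\<iota>[OF \<xi>'(1)] \<Phi>_fund \<alpha>)
    also have "\<dots> = of_bool (l = j) *\<^sub>C \<xi>'"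
      using \<alpha> by (simp add: \<xi>'(3) R_def \<tau>(1) counit_corep[OF fund_corep])
    finally show "V \<alpha> l j \<xi>' = of_bool (l = j) *\<^sub>C \<xi>'" .
  qed
  with \<xi>' show "\<exists>\<xi>\<in>K. \<xi> \<noteq> 0 \<and> invariant_vector G V \<xi>" by blast
qed

end

theorem theorem5p2:
  fixes G :: "('a::ring_1, 'i) cqg"
    and A :: "'c::{real_normed_algebra_1, banach} star_alg"
    and \<iota> :: "'a \<Rightarrow> 'c"
  assumes "compact_quantum_group G"
    and "universal_envelope G A \<iota>"
    and "separable_space (euclidean :: 'c topology)"
  shows "dual_property_T G \<longleftrightarrow> bekka_property_T A"
proof -
  interpret cqg_envelope G A \<iota>
    using assms(1,2) by (simp add: cqg_envelope_def)
  show ?thesis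
    using property_T_imp_bekka[OF _ assms(3)] bekka_imp_property_T by blast
qed

end
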